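(* Let $m>0$, let $V:\mathbb R^4\to\mathbb C^{4\times4}$ be self-adjoint with continuous entries satisfying $|V(x)|\lesssim\langle x\rangle^{-\delta}$ for some $\delta>\frac52$, and let $\mathcal H=D_m+V$. If the thresholds $\pm m$ are regular points of the spectrum of $\mathcal H$, then $$\big\|e^{-it\mathcal H}P_{ac}(\mathcal H)\langle\mathcal H\rangle^{-4-}\big\|_{L^1\to L^\infty}\lesssim1.$$
   Context: Notation: $\langle x\rangle=(1+|x|^2)^{1/2}$; $a-$ means $a-\epsilon$ for an arbitrarily small but fixed $\epsilon>0$ (so $\langle\mathcal H\rangle^{-4-}$ is $\langle\mathcal H\rangle^{-4-\epsilon}$, defined by functional calculus with $\langle\mathcal H\rangle=(1+\mathcal H^2)^{1/2}$); $A\lesssim B$ means $A\le CB$ with $C$ independent of $t\in\mathbb R$ (it may depend on $V,m,\epsilon$); $|V(x)|\lesssim\langle x\rangle^{-\delta}$ means this holds for every entry of $V$. All function spaces consist of $\mathbb C^4$-valued functions on $\mathbb R^4$. The free Dirac operator is $D_m=-i\sum_{k=1}^4\alpha_k\partial_{x_k}+m\beta$, where $\beta=\begin{pmatrix}I_2&0\\0&-I_2\end{pmatrix}$, $\alpha_j=\begin{pmatrix}0&\sigma_j\\\sigma_j&0\end{pmatrix}$ for $j=1,2,3$, $\alpha_4=i\begin{pmatrix}0&I_2\\-I_2&0\end{pmatrix}$, with $\sigma_1=\begin{pmatrix}0&-i\\i&0\end{pmatrix}$, $\sigma_2=\begin{pmatrix}0&1\\1&0\end{pmatrix}$, $\sigma_3=\begin{pmatrix}1&0\\0&-1\end{pmatrix}$.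 $P_{ac}(\mathcal H)$ is the projection onto the absolutely continuous subspace of $L^2$ associated to the self-adjoint operator $\mathcal H$. Factorization of $V$: by the spectral theorem $V=B^*\Lambda B$ with $B(x)$ unitary and $\Lambda=\mathrm{diag}(\lambda_1,\dots,\lambda_4)$ real; put $v=|\Lambda|^{1/2}B$ and $U=\mathrm{diag}(\mathrm{sign}\,\lambda_1,\dots,\mathrm{sign}\,\lambda_4)$ (with $\mathrm{sign}(0)=1$, so $U^2=I$); then $V=v^*Uv$. Thresholds: let $I_+=\frac12(I+\beta)$ and $I_-=\frac12(I-\beta)$. For $s\in\{+,-\}$ let $\mathcal G_0^{(s)}=(D_m+s\,m)(-\Delta)^{-1}$, the integral operator with kernel $\frac{i\alpha\cdot(x-y)}{2\pi^2|x-y|^4}+s\frac{m I_s}{2\pi^2|x-y|^2}$, and let $T_0^{(s)}=U+v\mathcal G_0^{(s)}v^*$ on $L^2(\mathbb R^4)$. The threshold $s\,m$ is a regular point of the spectrum of $\mathcal H$ if $T_0^{(s)}$ is invertible on $L^2(\mathbb R^4)$. *)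

theory Defs
  imports "HOL-Analysis.Analysis" "HOL-Probability.Essential_Supremum"
begin

section \<open>The Hilbert space of square-integrable spinor fields\<close>

type_synonym spinor_field = "real^4 \<Rightarrow> complex^4"

definition square_integrable :: "spinor_field \<Rightarrow> bool" where
  "square_integrable f \<longleftrightarrow>
     f \<in> borel_measurable lborel \<and> integrable lborel (\<lambda>x. (norm (f x))\<^sup>2)"

definition hdot :: "complex^4 \<Rightarrow> complex^4 \<Rightarrow> complex" where
  "hdot a b = (\<Sum>j\<in>UNIV. a $ j * cnj (b $ j))"

lemma Re_hdot: "Re (hdot a b) = inner a b"
  by (simp add: hdot_def inner_vec_def inner_complex_def)

lemma hdot_add_left: "hdot (a + b) c = hdot a c + hdot b c"
  by (simp add: hdot_def algebra_simps sum.distrib)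

lemma hdot_commute: "hdot b a = cnj (hdot a b)"
  by (simp add: hdot_def mult.commute)

lemma norm_hdot_le: "norm (hdot a b) \<le> 4 * ((norm a)\<^sup>2 + (norm b)\<^sup>2)"
proof -
  have "norm (a $ j * cnj (b $ j)) \<le> (norm a)\<^sup>2 + (norm b)\<^sup>2" for j
  proof -
    have "norm (a $ j * cnj (b $ j)) = norm (a $ j) * norm (b $ j)"
      by (simp add: norm_mult)
    also have "\<dots> \<le> norm a * norm b"
      by (intro mult_mono Finite_Cartesian_Product.norm_nth_le) auto
    also have "\<dots> \<le> (norm a)\<^sup>2 + (norm b)\<^sup>2"
    proof -
      have "norm a * norm b \<ge> 0"
        by simp
      then show ?thesis
        using sum_squares_bound[of "norm a" "norm b"] by linarith
    qed
    finally show ?thesis .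
  qed
  then have "norm (hdot a b) \<le> (\<Sum>j\<in>(UNIV::4 set). (norm a)\<^sup>2 + (norm b)\<^sup>2)"
    unfolding hdot_def by (intro sum_norm_le) auto
  then show ?thesis by simp
qed

lemma integrable_hdot:
  assumes "square_integrable f" "square_integrable g"
  shows "integrable lborel (\<lambda>x. hdot (f x) (g x))"
proof (rule Bochner_Integration.integrable_bound)
  show "integrable lborel (\<lambda>x. 4 * ((norm (f x))\<^sup>2 + (norm (g x))\<^sup>2))"
    using assms by (auto simp: square_integrable_def)
  have [measurable]: "f \<in> borel_measurable borel" "g \<in> borel_measurable borel"
    using assms by (auto simp: square_integrable_def)
  have nth: "(\<lambda>v::complex^4. v $ j) \<in> borel_measurable borel" for j
    by (intro borel_measurable_continuous_onI continuous_intros)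
  have cnj_nth: "(\<lambda>v::complex^4. cnj (v $ j)) \<in> borel_measurable borel" for j
    by (intro borel_measurable_continuous_onI continuous_intros)
  have "(\<lambda>x. f x $ j) \<in> borel_measurable borel" "(\<lambda>x. cnj (g x $ j)) \<in> borel_measurable borel" for j
    by (rule measurable_compose[OF _ nth] measurable_compose[OF _ cnj_nth], simp)+
  then show "(\<lambda>x. hdot (f x) (g x)) \<in> borel_measurable lborel"
    unfolding hdot_def measurable_lborel1
    by (intro borel_measurable_sum borel_measurable_times) simp_all
  show "AE x in lborel. norm (hdot (f x) (g x))
      \<le> norm (4 * ((norm (f x))\<^sup>2 + (norm (g x))\<^sup>2))"
    using norm_hdot_le by simp
qed

lemma square_integrable_zero: "square_integrable (\<lambda>x. 0)"
  by (simp add: square_integrable_def)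

lemma square_integrable_add:
  assumes "square_integrable f" "square_integrable g"
  shows "square_integrable (\<lambda>x. f x + g x)"
proof -
  have [measurable]: "f \<in> borel_measurable borel" "g \<in> borel_measurable borel"
    using assms by (auto simp: square_integrable_def)
  have "integrable lborel (\<lambda>x. (norm (f x + g x))\<^sup>2)"
  proof (rule Bochner_Integration.integrable_bound)
    show "integrable lborel (\<lambda>x. 2 * ((norm (f x))\<^sup>2 + (norm (g x))\<^sup>2))"
      using assms by (auto simp: square_integrable_def)
    have "(norm (a + b))\<^sup>2 \<le> 2 * ((norm a)\<^sup>2 + (norm b)\<^sup>2)" for a b :: "complex^4"
    proof -
      have "(norm (a + b))\<^sup>2 \<le> (norm a + norm b)\<^sup>2"
        by (simp add: norm_triangle_ineq power_mono)
      also have "\<dots> \<le> 2 * ((norm a)\<^sup>2 + (norm b)\<^sup>2)"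
        using sum_squares_bound[of "norm a" "norm b"] by (simp add: power2_sum)
      finally show ?thesis .
    qed
    then show "AE x in lborel. norm ((norm (f x + g x))\<^sup>2)
        \<le> norm (2 * ((norm (f x))\<^sup>2 + (norm (g x))\<^sup>2))"
      by simp
  qed simp
  then show ?thesis by (simp add: square_integrable_def)
qed

lemma norm_vector_smult: "norm (c *s (a::complex^4)) = norm c * norm a"
  by (simp add: norm_vec_def L2_set_def norm_mult power_mult_distrib
      sum_distrib_left[symmetric] real_sqrt_mult)

lemma square_integrable_smult:
  assumes "square_integrable f"
  shows "square_integrable (\<lambda>x. c *s f x)"
proof -
  have "(\<lambda>v::complex^4. c *s v) \<in> borel_measurable borel"
    unfolding vector_scalar_mult_def
    by (intro borel_measurable_continuous_onI continuous_intros)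
  then have "(\<lambda>x. c *s f x) \<in> borel_measurable borel"
    using measurable_compose[of f] assms by (auto simp: square_integrable_def)
  then show ?thesis
    using assms by (simp add: square_integrable_def norm_vector_smult power_mult_distrib)
qed

quotient_type L2 = spinor_field / partial:
  "\<lambda>f g. square_integrable f \<and> square_integrable g \<and> (AE x in lborel. f x = g x)"
  by (rule part_equivpI) (auto simp: symp_def transp_def intro: square_integrable_zero)

lift_definition scaleC :: "complex \<Rightarrow> L2 \<Rightarrow> L2" is "\<lambda>c f x. c *s f x"
  by (auto intro: square_integrable_smult)

lift_definition cinner :: "L2 \<Rightarrow> L2 \<Rightarrow> complex" is
  "\<lambda>f g. integral\<^sup>L lborel (\<lambda>x. hdot (f x) (g x))"
proof -
  fix f f' g g' :: spinor_field
  assume *: "square_integrable f \<and> square_integrable f' \<and> (AE x in lborel. f x = f' x)"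
    "square_integrable g \<and> square_integrable g' \<and> (AE x in lborel. g x = g' x)"
  have int: "integrable lborel (\<lambda>x. hdot (f x) (g x))" "integrable lborel (\<lambda>x. hdot (f' x) (g' x))"
    by (rule integrable_hdot, use * in blast, use * in blast)+
  have "AE x in lborel. f x = f' x" "AE x in lborel. g x = g' x"
    using * by blast+
  then have "AE x in lborel. hdot (f x) (g x) = hdot (f' x) (g' x)"
    by eventually_elim simp
  then show "integral\<^sup>L lborel (\<lambda>x. hdot (f x) (g x)) = integral\<^sup>L lborel (\<lambda>x. hdot (f' x) (g' x))"
    by (intro integral_cong_AE int[THEN borel_measurable_integrable])
qed

instantiation L2 :: real_inner
begin

lift_definition zero_L2 :: L2 is "\<lambda>x. 0"
  by (simp add: square_integrable_zero)

lift_definition plus_L2 :: "L2 \<Rightarrow> L2 \<Rightarrow> L2" is "\<lambda>f g x. f x + g x"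
  by (auto intro: square_integrable_add)

definition uminus_L2 :: "L2 \<Rightarrow> L2" where "- u = scaleC (- 1) u"
definition minus_L2 :: "L2 \<Rightarrow> L2 \<Rightarrow> L2" where "u - v = u + - (v::L2)"
definition scaleR_L2 :: "real \<Rightarrow> L2 \<Rightarrow> L2" where "r *\<^sub>R u = scaleC (complex_of_real r) u"
definition inner_L2 :: "L2 \<Rightarrow> L2 \<Rightarrow> real" where "inner u v = Re (cinner u v)"
definition norm_L2 :: "L2 \<Rightarrow> real" where "norm u = sqrt (inner u (u::L2))"
definition sgn_L2 :: "L2 \<Rightarrow> L2" where "sgn u = inverse (norm u) *\<^sub>R (u::L2)"
definition dist_L2 :: "L2 \<Rightarrow> L2 \<Rightarrow> real" where "dist u v = norm (u - (v::L2))"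
definition uniformity_L2 :: "(L2 \<times> L2) filter" where
  "uniformity_L2 = (INF e\<in>{0<..}. principal {(u, v). dist u v < e})"
definition open_L2 :: "L2 set \<Rightarrow> bool" where
  "open_L2 S \<longleftrightarrow> (\<forall>u\<in>S. \<forall>\<^sub>F (u', v) in uniformity. u' = u \<longrightarrow> v \<in> S)"

instance
proof
  fix u v w :: L2 and a b r :: real
  show "u + v + w = u + (v + w)"
    by transfer (auto simp: add.assoc intro: square_integrable_add)
  show "u + v = v + u"
    by transfer (auto simp: add.commute intro: square_integrable_add)
  show "0 + u = u"
    by transfer auto
  show "- u + u = 0"
    unfolding uminus_L2_def
    by transfer (auto simp: vec_eq_iff intro: square_integrable_add square_integrable_smult
        square_integrable_zero)
  show "u - v = u + - v" by (simp add: minus_L2_def)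
  show "a *\<^sub>R (u + v) = a *\<^sub>R u + a *\<^sub>R v"
    unfolding scaleR_L2_def
    by transfer (auto simp: vec_eq_iff algebra_simps
        intro: square_integrable_add square_integrable_smult)
  show "(a + b) *\<^sub>R u = a *\<^sub>R u + b *\<^sub>R u"
    unfolding scaleR_L2_def
    by transfer (auto simp: vec_eq_iff algebra_simps
        intro: square_integrable_add square_integrable_smult)
  show "a *\<^sub>R b *\<^sub>R u = (a * b) *\<^sub>R u"
    unfolding scaleR_L2_def
    by transfer (auto simp: vec_eq_iff algebra_simps
        intro: square_integrable_add square_integrable_smult)
  show "1 *\<^sub>R u = u"
    unfolding scaleR_L2_def
    by transfer (auto simp: vec_eq_iff)
  show "sgn u = inverse (norm u) *\<^sub>R u" by (simp add: sgn_L2_def)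
  show "dist u v = norm (u - v)" by (simp add: dist_L2_def)
  show "uniformity = (INF e\<in>{0<..}. principal {(x, y::L2). dist x y < e})"
    by (simp add: uniformity_L2_def)
  show "open S = (\<forall>x\<in>S. \<forall>\<^sub>F (x', y) in uniformity. x' = x \<longrightarrow> y \<in> S)" for S :: "L2 set"
    by (simp add: open_L2_def)
  show "inner u v = inner v u"
    unfolding inner_L2_def
  proof transfer
    fix f g :: spinor_field
    have "integral\<^sup>L lborel (\<lambda>x. hdot (f x) (g x)) = cnj (integral\<^sup>L lborel (\<lambda>x. hdot (g x) (f x)))"
      unfolding Bochner_Integration.integral_cnj[symmetric]
      by (intro Bochner_Integration.integral_cong refl hdot_commute)
    then show "Re (integral\<^sup>L lborel (\<lambda>x. hdot (f x) (g x)))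
        = Re (integral\<^sup>L lborel (\<lambda>x. hdot (g x) (f x)))"
      by simp
  qed
  show "inner (u + v) w = inner u w + inner v w"
    unfolding inner_L2_def
    by transfer (simp add: hdot_add_left integrable_hdot)
  show "inner (r *\<^sub>R u) v = r * inner u v"
    unfolding inner_L2_def scaleR_L2_def
  proof transfer
    fix r :: real and f g :: spinor_field
    have "hdot (complex_of_real r *s f x) (g x) = complex_of_real r * hdot (f x) (g x)" for x
      by (simp add: hdot_def sum_distrib_left mult.assoc)
    then show "Re (integral\<^sup>L lborel (\<lambda>x. hdot (complex_of_real r *s f x) (g x)))
        = r * Re (integral\<^sup>L lborel (\<lambda>x. hdot (f x) (g x)))"
      by simp
  qed
  have eq: "Re (integral\<^sup>L lborel (\<lambda>x. hdot (f x) (f x))) = integral\<^sup>L lborel (\<lambda>x. (norm (f x))\<^sup>2)"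
    if "square_integrable f" for f
    using Bochner_Integration.integral_Re[OF integrable_hdot[OF that that]]
    by (simp add: Re_hdot power2_norm_eq_inner)
  show "0 \<le> inner u u"
    unfolding inner_L2_def
    by transfer (simp add: eq)
  show "inner u u = 0 \<longleftrightarrow> u = 0"
    unfolding inner_L2_def
  proof transfer
    fix f :: spinor_field
    assume "square_integrable f \<and> square_integrable f \<and> (AE x in lborel. f x = f x)"
    then have f: "square_integrable f" by simp
    then show "Re (integral\<^sup>L lborel (\<lambda>x. hdot (f x) (f x))) = 0 \<longleftrightarrow>
       square_integrable f \<and> square_integrable (\<lambda>x. 0) \<and> (AE x in lborel. f x = 0)"
      by (simp add: eq square_integrable_zero)
        (subst integral_nonneg_eq_0_iff_AE, auto simp: square_integrable_def)
  qed
  show "norm u = sqrt (inner u u)" by (simp add: norm_L2_def)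
qed

end

text \<open>The class of \<open>f\<close>, and \<open>0\<close> if \<open>f\<close> is not square integrable.\<close>

definition mk_L2 :: "spinor_field \<Rightarrow> L2" where
  "mk_L2 f = (if square_integrable f then abs_L2 f else 0)"

definition mult_L2 :: "(real^4 \<Rightarrow> complex^4^4) \<Rightarrow> L2 \<Rightarrow> L2" where
  "mult_L2 M u = mk_L2 (\<lambda>x. M x *v rep_L2 u x)"

definition bounded_clinear :: "(L2 \<Rightarrow> L2) \<Rightarrow> bool" where
  "bounded_clinear T \<longleftrightarrow> bounded_linear T \<and> (\<forall>c u. T (scaleC c u) = scaleC c (T u))"

definition invertible_L2 :: "(L2 \<Rightarrow> L2) \<Rightarrow> bool" where
  "invertible_L2 T \<longleftrightarrow>
     bounded_clinear T \<and> (\<exists>S. bounded_clinear S \<and> S \<circ> T = id \<and> T \<circ> S = id)"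

definition L1_norm :: "L2 \<Rightarrow> ennreal" where
  "L1_norm u = (\<integral>\<^sup>+x. ennreal (norm (rep_L2 u x)) \<partial>lborel)"

definition Linf_norm :: "L2 \<Rightarrow> ennreal" where
  "Linf_norm u = esssup lborel (\<lambda>x. ennreal (norm (rep_L2 u x)))"

text \<open>The operators are a priori defined on \<open>L\<^sup>2\<close>; their norm from \<open>L\<^sup>1\<close> to \<open>L\<^sup>\<infinity>\<close>
  is taken over the dense subspace \<open>L\<^sup>1 \<inter> L\<^sup>2\<close> of \<open>L\<^sup>1\<close>.\<close>

definition L1_Linf_opnorm :: "(L2 \<Rightarrow> L2) \<Rightarrow> ennreal" where
  "L1_Linf_opnorm T = (SUP u\<in>{u. L1_norm u \<le> 1}. Linf_norm (T u))"


section \<open>Spectral theory of self-adjoint operators on the Hilbert space\<close>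

text \<open>An unbounded operator is represented by its graph, so that its domain is \<open>Domain H\<close>.\<close>

type_synonym L2_operator = "(L2 \<times> L2) set"

definition projection_valued_measure :: "(real set \<Rightarrow> L2 \<Rightarrow> L2) \<Rightarrow> bool" where
  "projection_valued_measure E \<longleftrightarrow>
     (\<forall>A\<in>sets borel. bounded_clinear (E A)
        \<and> (\<forall>u. E A (E A u) = E A u) \<and> (\<forall>u v. cinner (E A u) v = cinner u (E A v)))
   \<and> E UNIV = id
   \<and> (\<forall>A :: nat \<Rightarrow> real set. range A \<subseteq> sets borel \<longrightarrow> disjoint_family A \<longrightarrow>
        (\<forall>u. (\<lambda>n. E (A n) u) sums E (\<Union>n. A n) u))"

definition scalar_measure :: "(real set \<Rightarrow> L2 \<Rightarrow> L2) \<Rightarrow> L2 \<Rightarrow> real measure" where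
  "scalar_measure E u =
     measure_of UNIV (sets borel) (\<lambda>A. ennreal (Re (cinner (E A u) u)))"

text \<open>\<open>H = \<integral> \<lambda> dE(\<lambda>)\<close>; by polarization the quadratic forms determine the operator.\<close>

definition spectral_resolution :: "L2_operator \<Rightarrow> (real set \<Rightarrow> L2 \<Rightarrow> L2) \<Rightarrow> bool" where
  "spectral_resolution H E \<longleftrightarrow>
     projection_valued_measure E
   \<and> Domain H = {u. (\<integral>\<^sup>+r. ennreal (r\<^sup>2) \<partial>scalar_measure E u) < \<infinity>}
   \<and> (\<forall>(u, w)\<in>H. cinner w u
        = complex_of_real (integral\<^sup>L (scalar_measure E u) (\<lambda>r. r)))"

text \<open>For self-adjoint \<open>H\<close> the spectral theorem determines \<open>spectral_family H\<close> uniquely on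
  Borel sets, the only sets on which its values are used.\<close>

definition spectral_family :: "L2_operator \<Rightarrow> real set \<Rightarrow> L2 \<Rightarrow> L2" where
  "spectral_family H = (SOME E. spectral_resolution H E)"

abbreviation spectral_measure_at :: "L2_operator \<Rightarrow> L2 \<Rightarrow> real measure" where
  "spectral_measure_at H \<equiv> scalar_measure (spectral_family H)"

text \<open>\<open>g(H) = \<integral> g(\<lambda>) dE(\<lambda>)\<close> for bounded Borel functions \<open>g\<close>.\<close>

definition functional_calculus :: "(real \<Rightarrow> complex) \<Rightarrow> L2_operator \<Rightarrow> L2 \<Rightarrow> L2" where
  "functional_calculus g H =
     (THE T. bounded_clinear T \<and> (\<forall>u. cinner (T u) u = integral\<^sup>L (spectral_measure_at H u) g))"

definition ac_subspace :: "L2_operator \<Rightarrow> L2 set" where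
  "ac_subspace H = {u. absolutely_continuous lborel (spectral_measure_at H u)}"

definition P_ac :: "L2_operator \<Rightarrow> L2 \<Rightarrow> L2" where
  "P_ac H = (THE P. \<forall>u. P u \<in> ac_subspace H \<and> (\<forall>w\<in>ac_subspace H. cinner (u - P u) w = 0))"


section \<open>The Dirac operator\<close>

definition japanese_bracket :: "'a::real_normed_vector \<Rightarrow> real" where
  "japanese_bracket x = sqrt (1 + (norm x)\<^sup>2)"

definition adjoint_matrix :: "complex^'n^'m \<Rightarrow> complex^'m^'n" where
  "adjoint_matrix A = (\<chi> i j. cnj (A $ j $ i))"

definition diag_matrix :: "('n \<Rightarrow> complex) \<Rightarrow> complex^'n^'n" where
  "diag_matrix d = (\<chi> i j. if i = j then d i else 0)"

definition block_matrix ::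
  "complex^2^2 \<Rightarrow> complex^2^2 \<Rightarrow> complex^2^2 \<Rightarrow> complex^2^2 \<Rightarrow> complex^4^4" where
  "block_matrix A B C D = vector
     [vector [A$1$1, A$1$2, B$1$1, B$1$2],
      vector [A$2$1, A$2$2, B$2$1, B$2$2],
      vector [C$1$1, C$1$2, D$1$1, D$1$2],
      vector [C$2$1, C$2$2, D$2$1, D$2$2]]"

text \<open>The Pauli matrices in the numbering used here: \<open>pauli 1\<close> is the imaginary one.\<close>

definition pauli :: "4 \<Rightarrow> complex^2^2" where
  "pauli k =
     (if k = 1 then vector [vector [0, - \<i>], vector [\<i>, 0]]
      else if k = 2 then vector [vector [0, 1], vector [1, 0]]
      else vector [vector [1, 0], vector [0, - 1]])"

definition dirac_beta :: "complex^4^4" where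
  "dirac_beta = block_matrix (mat 1) 0 0 (- mat 1)"

definition dirac_alpha :: "4 \<Rightarrow> complex^4^4" where
  "dirac_alpha k =
     (if k = 4 then block_matrix 0 (mat \<i>) (- mat \<i>) 0
      else block_matrix 0 (pauli k) (pauli k) 0)"

text \<open>First-order Sobolev space via weak derivatives, tested against \<open>C\<^sub>c\<^sup>\<infinity>(\<real>\<^sup>4)\<close>.\<close>

definition partial_deriv :: "4 \<Rightarrow> (real^4 \<Rightarrow> real) \<Rightarrow> real^4 \<Rightarrow> real" where
  "partial_deriv k \<phi> x = frechet_derivative \<phi> (at x) (axis k 1)"

primrec C_k :: "nat \<Rightarrow> (real^4 \<Rightarrow> real) \<Rightarrow> bool" where
  "C_k 0 \<phi> \<longleftrightarrow> continuous_on UNIV \<phi>"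
| "C_k (Suc n) \<phi> \<longleftrightarrow> (\<forall>x. \<phi> differentiable (at x)) \<and> (\<forall>k. C_k n (partial_deriv k \<phi>))"

definition test_function :: "(real^4 \<Rightarrow> real) \<Rightarrow> bool" where
  "test_function \<phi> \<longleftrightarrow> (\<forall>n. C_k n \<phi>) \<and> compact (closure {x. \<phi> x \<noteq> 0})"

definition weak_partial_deriv :: "4 \<Rightarrow> L2 \<Rightarrow> L2 \<Rightarrow> bool" where
  "weak_partial_deriv k u g \<longleftrightarrow>
     (\<forall>\<phi>. test_function \<phi> \<longrightarrow>
        integral\<^sup>L lborel (\<lambda>x. partial_deriv k \<phi> x *\<^sub>R rep_L2 u x)
        = - integral\<^sup>L lborel (\<lambda>x. \<phi> x *\<^sub>R rep_L2 g x))"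

text \<open>The free operator \<open>D\<^sub>m = - i \<Sum>\<^sub>k \<alpha>\<^sub>k \<partial>\<^sub>k + m \<beta>\<close> with domain \<open>H\<^sup>1(\<real>\<^sup>4; \<complex>\<^sup>4)\<close>;
  \<open>g k\<close> is the weak derivative \<open>\<partial>\<^sub>k u\<close>.\<close>

definition free_dirac :: "real \<Rightarrow> L2_operator" where
  "free_dirac m = {(u, w). \<exists>g. (\<forall>k. weak_partial_deriv k u (g k)) \<and>
     w = scaleC (- \<i>) (\<Sum>k\<in>UNIV. mult_L2 (\<lambda>x. dirac_alpha k) (g k))
         + scaleC (complex_of_real m) (mult_L2 (\<lambda>x. dirac_beta) u)}"

definition perturbed_dirac :: "real \<Rightarrow> (real^4 \<Rightarrow> complex^4^4) \<Rightarrow> L2_operator" where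
  "perturbed_dirac m V = {(u, w + mult_L2 V u) |u w. (u, w) \<in> free_dirac m}"


section \<open>Threshold regularity\<close>

definition measurable_diagonalization ::
  "(real^4 \<Rightarrow> complex^4^4) \<Rightarrow> (real^4 \<Rightarrow> complex^4^4) \<Rightarrow> (real^4 \<Rightarrow> real^4) \<Rightarrow> bool" where
  "measurable_diagonalization V B ev \<longleftrightarrow>
     B \<in> borel_measurable borel \<and> ev \<in> borel_measurable borel \<and>
     (\<forall>x. B x ** adjoint_matrix (B x) = mat 1 \<and> adjoint_matrix (B x) ** B x = mat 1 \<and>
          V x = adjoint_matrix (B x) ** diag_matrix (\<lambda>j. complex_of_real (ev x $ j)) ** B x)"

definition factor_v ::
  "(real^4 \<Rightarrow> complex^4^4) \<Rightarrow> (real^4 \<Rightarrow> real^4) \<Rightarrow> real^4 \<Rightarrow> complex^4^4" where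
  "factor_v B ev x = diag_matrix (\<lambda>j. complex_of_real (sqrt \<bar>ev x $ j\<bar>)) ** B x"

text \<open>Unlike the library's \<open>sgn\<close>, the sign of \<open>0\<close> is \<open>1\<close> here, so that \<open>U\<^sup>2 = I\<close>.\<close>

definition factor_U :: "(real^4 \<Rightarrow> real^4) \<Rightarrow> real^4 \<Rightarrow> complex^4^4" where
  "factor_U ev x = diag_matrix (\<lambda>j. if ev x $ j < 0 then - 1 else 1)"

text \<open>\<open>s \<in> {1, -1}\<close> encodes the sign of the threshold \<open>s m\<close>; \<open>half_projection s\<close> is \<open>I\<^sub>s\<close>.
  Scalar multiples of matrices are written as products with \<open>mat c\<close>.\<close>

definition half_projection :: "real \<Rightarrow> complex^4^4" where
  "half_projection s = (1/2) *\<^sub>R (mat 1 + s *\<^sub>R dirac_beta)"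

definition threshold_kernel :: "real \<Rightarrow> real \<Rightarrow> real^4 \<Rightarrow> real^4 \<Rightarrow> complex^4^4" where
  "threshold_kernel m s x y =
     (1 / (2 * pi\<^sup>2 * norm (x - y) ^ 4)) *\<^sub>R
       (mat \<i> ** (\<Sum>k\<in>UNIV. ((x - y) $ k) *\<^sub>R dirac_alpha k))
     + (s * m / (2 * pi\<^sup>2 * (norm (x - y))\<^sup>2)) *\<^sub>R half_projection s"

definition threshold_operator ::
  "real \<Rightarrow> real \<Rightarrow> (real^4 \<Rightarrow> complex^4^4) \<Rightarrow> (real^4 \<Rightarrow> real^4) \<Rightarrow> L2 \<Rightarrow> L2" where
  "threshold_operator m s B ev u = mk_L2 (\<lambda>x.
     factor_U ev x *v rep_L2 u x
     + factor_v B ev x *v integral\<^sup>L lborel (\<lambda>y.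
         threshold_kernel m s x y *v (adjoint_matrix (factor_v B ev y) *v rep_L2 u y)))"

text \<open>Measurable diagonalizations of a continuous \<open>V\<close> always exist, and any two of them give
  threshold operators that are conjugate by a unitary multiplication operator; so the property
  does not depend on the choice.\<close>

definition regular_threshold :: "real \<Rightarrow> (real^4 \<Rightarrow> complex^4^4) \<Rightarrow> real \<Rightarrow> bool" where
  "regular_threshold m V s \<longleftrightarrow>
     (\<exists>B ev. measurable_diagonalization V B ev \<and> invertible_L2 (threshold_operator m s B ev))"

end

theory Submission
  imports Defs "HOL-Probability.Helly_Selection"
begin

text \<open>Since no decay in time is claimed, boundedness of the propagator and of the spectral projection on \<open>L\<^sup>2\<close>, together with
  enough smoothing by the weight, is all that matters.  The exponent \<open>4\<close> is the dimension: it is what passing from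
  \<open>L\<^sup>1\<close> to \<open>L\<^sup>2\<close> and from \<open>L\<^sup>2\<close> to \<open>L\<^sup>\<infinity>\<close> costs, each step losing half the dimension in powers of the spectral parameter, and
  the \<open>\<epsilon>\<close> makes a dyadic sum converge.

  In detail, let \<open>E\<^sub>k\<close> be the spectral projection of \<open>H\<close> for \<open>2\<^sup>k \<le> \<langle>H\<rangle> < 2\<^sup>k\<^sup>+\<^sup>1\<close>.  The Bernstein inequality
  \<open>\<parallel>E\<^sub>k u\<parallel>\<^sub>\<infinity> \<le> C 4\<^sup>k \<parallel>E\<^sub>k u\<parallel>\<^sub>2\<close> (\<open>shell_bernstein\<close>) implies its dual \<open>\<parallel>E\<^sub>k u\<parallel>\<^sub>2 \<le> C 4\<^sup>k \<parallel>u\<parallel>\<^sub>1\<close> (\<open>shell_dual_bernstein\<close>).  All three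
  factors of the operator commute with \<open>E\<^sub>k\<close>, the first two are bounded on \<open>L\<^sup>2\<close>, and the weight is at most \<open>2\<^sup>-\<^sup>k\<^sup>(\<^sup>4\<^sup>+\<^sup>\<epsilon>\<^sup>)\<close> on the
  range of \<open>E\<^sub>k\<close>.  So the piece of the operator in the \<open>k\<close>-th shell has norm at most a constant times \<open>16\<^sup>k 2\<^sup>-\<^sup>k\<^sup>(\<^sup>4\<^sup>+\<^sup>\<epsilon>\<^sup>) = 2\<^sup>-\<^sup>\<epsilon>\<^sup>k\<close> from
  \<open>L\<^sup>1\<close> to \<open>L\<^sup>\<infinity>\<close>, which is summable (\<open>weighted_bound\<close>).

  The Bernstein inequality rests on the fundamental solution of the massless Dirac operator.  Cut off at
  distance \<open>1/L\<close>, it represents \<open>u\<close> through \<open>H u\<close> and \<open>u\<close> itself by a kernel of size \<open>|x|\<^sup>-\<^sup>3\<close> on the ball of radius \<open>1/L\<close>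
  (\<open>H_pointwise_bound\<close>), a bounded potential being a harmless lower order term.  Three applications produce a square
  integrable iterated kernel, whose norm scales like \<open>L\<^sup>2\<close>; for \<open>u\<close> in the range of \<open>E\<^sub>k\<close> and \<open>L = 2\<^sup>k\<^sup>+\<^sup>2\<close> the fields
  \<open>H\<^sup>i u\<close> are of size \<open>L\<^sup>i \<parallel>u\<parallel>\<close> (\<open>bernstein\<close>, \<open>window_action\<close>).

  For the functional calculus to have a meaning, \<open>H\<close> must possess a spectral resolution.  It is symmetric and
  closed, and elliptic regularity (\<open>dirac_elliptic_regularity\<close>) gives \<open>H \<plusminus> \<i>\<close> full range, so that its Cayley transform is
  unitary.  The spectral measures of a unitary operator come from Herglotz's theorem on positive definite
  sequences (\<open>moment_measure\<close>), and the spectral theorem for \<open>H\<close> follows (\<open>spectral_resolution_exists\<close>).  Operators are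
  handled through their quadratic forms: \<open>T = g(H)\<close> means \<open>\<langle>T u, u\<rangle> = \<integral> g d\<mu>\<^sub>u\<close> for the spectral measures \<open>\<mu>\<^sub>u\<close>.\<close>

section \<open>The complex Hilbert space structure\<close>

lemma square_integrable_rep [simp]: "square_integrable (rep_L2 u)"
  using Quotient3_rep_reflp[OF Quotient3_L2, of u] by simp

lemma rep_abs_L2_AE: "square_integrable f \<Longrightarrow> AE x in lborel. rep_L2 (abs_L2 f) x = f x"
  using rep_abs_rsp_left[OF Quotient3_L2, of f f] by simp

lemma L2_eqI: "AE x in lborel. rep_L2 u x = rep_L2 v x \<Longrightarrow> u = v"
  using Quotient3_rel_rep[OF Quotient3_L2, of u v] by simp

lemma rep_mk_L2_AE: "square_integrable f \<Longrightarrow> AE x in lborel. rep_L2 (mk_L2 f) x = f x"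
  by (simp add: mk_L2_def rep_abs_L2_AE)

lemma borel_measurable_rep [measurable]: "rep_L2 u \<in> borel_measurable borel"
  using square_integrable_rep[of u] by (simp add: square_integrable_def)

lemma borel_measurable_vec_nth [measurable]: "(\<lambda>v::complex^4. v $ j) \<in> borel_measurable borel"
  by (intro borel_measurable_continuous_onI continuous_intros)

lemma integrable_norm_rep_sq: "integrable lborel (\<lambda>x. (norm (rep_L2 u x))\<^sup>2)"
  using square_integrable_rep[of u] by (simp add: square_integrable_def)

lemma rep_zero_AE: "AE x in lborel. rep_L2 0 x = 0"
  unfolding zero_L2_def by (rule rep_abs_L2_AE[OF square_integrable_zero])

lemma rep_add_AE: "AE x in lborel. rep_L2 (u + v) x = rep_L2 u x + rep_L2 v x"
  using rep_abs_L2_AE[OF square_integrable_add[of "rep_L2 u" "rep_L2 v"]]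
  by (simp add: plus_L2_def map_fun_def)

lemma rep_scaleC_AE: "AE x in lborel. rep_L2 (scaleC c u) x = c *s rep_L2 u x"
  using rep_abs_L2_AE[OF square_integrable_smult[of "rep_L2 u" c]]
  by (simp add: scaleC_def map_fun_def)

lemma rep_uminus_AE: "AE x in lborel. rep_L2 (- u) x = - rep_L2 u x"
  using rep_scaleC_AE[of "-1" u] unfolding uminus_L2_def by (auto simp: vec_eq_iff)

lemma rep_diff_AE: "AE x in lborel. rep_L2 (u - v) x = rep_L2 u x - rep_L2 v x"
  using rep_add_AE[of u "- v"] rep_uminus_AE[of v] by eventually_elim simp

lemma rep_scaleR_AE: "AE x in lborel. rep_L2 (r *\<^sub>R u) x = r *\<^sub>R rep_L2 u x"
  using rep_scaleC_AE[of "complex_of_real r" u] unfolding scaleR_L2_def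
  by eventually_elim (simp add: vec_eq_iff scaleR_conv_of_real[where 'a=complex])

lemma rep_sum_AE: "finite I \<Longrightarrow> AE x in lborel. rep_L2 (\<Sum>i\<in>I. f i) x = (\<Sum>i\<in>I. rep_L2 (f i) x)"
proof (induction I rule: finite_induct)
  case empty then show ?case using rep_zero_AE by simp
next
  case (insert i I)
  show ?case using insert.IH rep_add_AE[of "f i" "\<Sum>i\<in>I. f i"]
    by eventually_elim (simp add: insert.hyps)
qed

lemma borel_measurable_hdot [measurable]:
  assumes [measurable]: "f \<in> borel_measurable M" "g \<in> borel_measurable M"
  shows "(\<lambda>x. hdot (f x) (g x)) \<in> borel_measurable M"
proof -
  have cnj_nth: "(\<lambda>v::complex^4. cnj (v $ j)) \<in> borel_measurable borel" for j
    by (intro borel_measurable_continuous_onI continuous_intros)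
  have [measurable]: "(\<lambda>x. f x $ j) \<in> borel_measurable M" "(\<lambda>x. cnj (g x $ j)) \<in> borel_measurable M" for j
    by (rule measurable_compose[OF assms(1) borel_measurable_vec_nth]
        measurable_compose[OF assms(2) cnj_nth])+
  show ?thesis unfolding hdot_def by measurable
qed

lemma cinner_rep: "cinner u v = integral\<^sup>L lborel (\<lambda>x. hdot (rep_L2 u x) (rep_L2 v x))"
  by (simp add: cinner_def map_fun_def)

lemma hdot_smult_left: "hdot (c *s a) b = c * hdot a b"
  by (simp add: hdot_def sum_distrib_left mult.assoc)

lemma hdot_self: "hdot a a = of_real ((norm a)\<^sup>2)"
proof -
  have "Im (hdot a a) = 0" by (metis Reals_cnj_iff complex_is_Real_iff hdot_commute)
  then show ?thesis by (simp add: complex_eq_iff Re_hdot power2_norm_eq_inner)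
qed

lemma norm_hdot_le_mult: "norm (hdot a b) \<le> norm a * norm b"
proof (cases "hdot a b = 0")
  case False
  define c where "c = cnj (hdot a b) / of_real (norm (hdot a b))"
  have c: "norm c = 1" using False by (simp add: c_def norm_divide)
  have "of_real (norm (hdot a b)) = c * hdot a b"
    using False complex_norm_square[of "hdot a b"]
    by (simp add: c_def mult.commute power2_eq_square field_simps)
  then have "norm (hdot a b) = Re (hdot (c *s a) b)"
    by (metis Re_complex_of_real hdot_smult_left)
  also have "\<dots> \<le> norm (c *s a) * norm b" by (simp add: Re_hdot norm_cauchy_schwarz)
  finally show ?thesis by (simp add: norm_vector_smult c)
qed simp

lemma cinner_commute: "cinner v u = cnj (cinner u v)"
  unfolding cinner_rep Bochner_Integration.integral_cnj[symmetric]
  by (rule Bochner_Integration.integral_cong[OF refl hdot_commute])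

lemma cinner_add_left: "cinner (u + v) w = cinner u w + cinner v w"
proof -
  have "cinner (u + v) w = integral\<^sup>L lborel (\<lambda>x. hdot (rep_L2 u x) (rep_L2 w x) + hdot (rep_L2 v x) (rep_L2 w x))"
    unfolding cinner_rep
    by (rule integral_cong_AE)
      (use rep_add_AE[of u v] in \<open>auto simp: hdot_add_left elim: eventually_mono\<close>)
  then show ?thesis by (simp add: cinner_rep integrable_hdot)
qed

lemma cinner_scaleC_left: "cinner (scaleC c u) w = c * cinner u w"
proof -
  have "cinner (scaleC c u) w = integral\<^sup>L lborel (\<lambda>x. c * hdot (rep_L2 u x) (rep_L2 w x))"
    unfolding cinner_rep
    by (rule integral_cong_AE)
      (use rep_scaleC_AE[of c u] in \<open>auto simp: hdot_smult_left elim: eventually_mono\<close>)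
  then show ?thesis by (simp add: cinner_rep)
qed

lemma cinner_add_right: "cinner w (u + v) = cinner w u + cinner w v"
  unfolding cinner_commute[of w] by (simp add: cinner_add_left)

lemma cinner_scaleC_right: "cinner w (scaleC c u) = cnj c * cinner w u"
  unfolding cinner_commute[of w] by (simp add: cinner_scaleC_left)

lemma scaleC_add_right: "scaleC c (u + v) = scaleC c u + scaleC c v"
proof (rule L2_eqI)
  show "AE x in lborel. rep_L2 (scaleC c (u + v)) x = rep_L2 (scaleC c u + scaleC c v) x"
    using rep_scaleC_AE[of c "u+v"] rep_scaleC_AE[of c u] rep_scaleC_AE[of c v] rep_add_AE[of u v]
      rep_add_AE[of "scaleC c u" "scaleC c v"]
    by eventually_elim (simp add: vector_add_ldistrib)
qed

lemma scaleC_add_left: "scaleC (c + d) u = scaleC c u + scaleC d u"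
proof (rule L2_eqI)
  show "AE x in lborel. rep_L2 (scaleC (c + d) u) x = rep_L2 (scaleC c u + scaleC d u) x"
    using rep_scaleC_AE[of "c+d" "u"] rep_scaleC_AE[of c u] rep_scaleC_AE[of d u]
      rep_add_AE[of "scaleC c u" "scaleC d u"]
    by eventually_elim (simp add: vector_sadd_rdistrib)
qed

lemma scaleC_scaleC [simp]: "scaleC c (scaleC d u) = scaleC (c * d) u"
proof (rule L2_eqI)
  show "AE x in lborel. rep_L2 (scaleC c (scaleC d u)) x = rep_L2 (scaleC (c * d) u) x"
    using rep_scaleC_AE[of "c" "scaleC d u"] rep_scaleC_AE[of d u] rep_scaleC_AE[of "c*d" u]
    by eventually_elim (simp add: vector_smult_assoc)
qed

lemma scaleR_scaleC: "r *\<^sub>R u = scaleC (of_real r) u"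
  by (simp add: scaleR_L2_def)

lemma scaleC_one [simp]: "scaleC 1 u = u"
  using scaleR_scaleC[of 1 u] by simp

lemma scaleC_minus1: "scaleC (-1) u = - u"
  by (simp add: uminus_L2_def)

lemma scaleC_minus_left: "scaleC (- c) u = - scaleC c u"
  using scaleC_scaleC[of "-1" c u] by (simp add: scaleC_minus1 del: scaleC_scaleC)

lemma scaleC_minus_right: "scaleC c (- u) = - scaleC c u"
  using scaleC_scaleC[of c "-1" u] by (simp add: scaleC_minus1 scaleC_minus_left del: scaleC_scaleC)

lemma scaleC_diff_right: "scaleC c (u - v) = scaleC c u - scaleC c v"
  using scaleC_add_right[of c u "- v"] by (simp add: scaleC_minus_right)

lemma scaleC_zero_right [simp]: "scaleC c 0 = 0"
  using scaleC_add_right[of c 0 0] by simp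

lemma scaleC_sum: "scaleC c (\<Sum>i\<in>I. f i) = (\<Sum>i\<in>I. scaleC c (f i))"
  by (induction I rule: infinite_finite_induct) (auto simp: scaleC_add_right)

lemma cinner_zero_left [simp]: "cinner 0 v = 0"
  using cinner_scaleC_left[of 0 0 v] by simp

lemma cinner_zero_right [simp]: "cinner v 0 = 0"
  using cinner_scaleC_right[of v 0 0] by simp

lemma cinner_minus_left [simp]: "cinner (- u) v = - cinner u v"
  using cinner_scaleC_left[of "-1" u v] by (simp add: scaleC_minus1)

lemma cinner_minus_right [simp]: "cinner u (- v) = - cinner u v"
  using cinner_scaleC_right[of u "-1" v] by (simp add: scaleC_minus1)

lemma cinner_diff_left: "cinner (u - v) w = cinner u w - cinner v w"
  using cinner_add_left[of u "- v" w] by simp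

lemma cinner_diff_right: "cinner w (u - v) = cinner w u - cinner w v"
  using cinner_add_right[of w u "- v"] by simp

lemma cinner_scaleR_left: "cinner (r *\<^sub>R u) v = of_real r * cinner u v"
  by (simp add: scaleR_scaleC cinner_scaleC_left)

lemma cinner_scaleR_right: "cinner u (r *\<^sub>R v) = of_real r * cinner u v"
  by (simp add: scaleR_scaleC cinner_scaleC_right)

lemma cinner_sum_left: "cinner (\<Sum>i\<in>I. f i) v = (\<Sum>i\<in>I. cinner (f i) v)"
  by (induction I rule: infinite_finite_induct) (auto simp: cinner_add_left)

lemma cinner_sum_right: "cinner v (\<Sum>i\<in>I. f i) = (\<Sum>i\<in>I. cinner v (f i))"
  by (induction I rule: infinite_finite_induct) (auto simp: cinner_add_right)

lemma Re_cinner: "Re (cinner u v) = inner u v"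
  by (simp add: inner_L2_def)

lemma Im_cinner: "Im (cinner u v) = inner u (scaleC \<i> v)"
  by (simp flip: Re_cinner add: cinner_scaleC_right)

lemma cinner_self: "cinner u u = of_real ((norm u)\<^sup>2)"
proof -
  have "Im (cinner u u) = 0" by (metis Reals_cnj_iff complex_is_Real_iff cinner_commute)
  then show ?thesis by (simp add: complex_eq_iff Re_cinner power2_norm_eq_inner)
qed

lemma norm_scaleC: "norm (scaleC c u) = norm c * norm u"
proof -
  have "complex_of_real ((norm (scaleC c u))\<^sup>2) = (c * cnj c) * of_real ((norm u)\<^sup>2)"
    by (simp add: cinner_self[symmetric] cinner_scaleC_left cinner_scaleC_right del: of_real_power)
  also have "\<dots> = of_real ((norm c * norm u)\<^sup>2)"
    by (simp add: power_mult_distrib flip: complex_norm_square)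
  finally have "(norm (scaleC c u))\<^sup>2 = (norm c * norm u)\<^sup>2" by (simp only: of_real_eq_iff)
  then show ?thesis by (simp add: power2_eq_iff_nonneg)
qed

lemma norm_cinner_le: "norm (cinner u v) \<le> norm u * norm v"
proof (cases "cinner u v = 0")
  case False
  define c where "c = cnj (cinner u v) / of_real (norm (cinner u v))"
  have c: "norm c = 1" using False by (simp add: c_def norm_divide)
  have "of_real (norm (cinner u v)) = c * cinner u v"
    using False complex_norm_square[of "cinner u v"]
    by (simp add: c_def mult.commute power2_eq_square field_simps)
  then have "norm (cinner u v) = Re (cinner (scaleC c u) v)"
    by (metis Re_complex_of_real cinner_scaleC_left)
  also have "\<dots> \<le> norm (scaleC c u) * norm v" by (simp add: Re_cinner norm_cauchy_schwarz)
  finally show ?thesis by (simp add: norm_scaleC c)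
qed simp

text \<open>An element of a Hilbert space is determined by its inner products; operators defined through forms are
  shown to be linear in this way.\<close>

lemma cinner_eqI: "(\<And>v. cinner u v = cinner w v) \<Longrightarrow> u = w"
  using cinner_diff_left[of u w "u - w"] cinner_self[of "u - w"] by simp

lemma bounded_linear_cinner_left: "bounded_linear (\<lambda>u. cinner u v)"
  by (rule bounded_linear_intro[where K="norm v"])
    (auto simp: cinner_add_left cinner_scaleR_left scaleR_conv_of_real norm_cinner_le)

lemma bounded_linear_cinner_right: "bounded_linear (\<lambda>v. cinner u v)"
  by (rule bounded_linear_intro[where K="norm u"])
    (use norm_cinner_le[of u] in \<open>auto simp: cinner_add_right cinner_scaleR_right scaleR_conv_of_real mult.commute\<close>)

lemmas tendsto_cinner_left = bounded_linear.tendsto[OF bounded_linear_cinner_left]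
lemmas tendsto_cinner_right = bounded_linear.tendsto[OF bounded_linear_cinner_right]

lemma norm_L2_sq: "(norm u)\<^sup>2 = integral\<^sup>L lborel (\<lambda>x. (norm (rep_L2 u x))\<^sup>2)"
proof -
  have "complex_of_real ((norm u)\<^sup>2) = integral\<^sup>L lborel (\<lambda>x. complex_of_real ((norm (rep_L2 u x))\<^sup>2))"
    by (simp only: cinner_self[symmetric] cinner_rep hdot_self)
  then show ?thesis by (simp only: integral_complex_of_real of_real_eq_iff)
qed

lemma nn_integral_norm_rep: "(\<integral>\<^sup>+x. ennreal ((norm (rep_L2 u x))\<^sup>2) \<partial>lborel) = ennreal ((norm u)\<^sup>2)"
  by (simp add: norm_L2_sq nn_integral_eq_integral integrable_norm_rep_sq)

lemma nn_integral_norm_diff: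
  "(\<integral>\<^sup>+x. ennreal ((norm (rep_L2 u x - rep_L2 v x))\<^sup>2) \<partial>lborel) = ennreal ((norm (u - v))\<^sup>2)"
  unfolding nn_integral_norm_rep[symmetric]
  by (rule nn_integral_cong_AE) (use rep_diff_AE[of u v] in \<open>auto elim: eventually_mono\<close>)

lemma square_integrableI:
  assumes "f \<in> borel_measurable borel" "(\<integral>\<^sup>+x. ennreal ((norm (f x))\<^sup>2) \<partial>lborel) < \<infinity>"
  shows "square_integrable f"
  using assms unfolding square_integrable_def by (auto intro!: integrableI_bounded)

lemma norm_mk_L2:
  assumes "square_integrable f"
  shows "ennreal ((norm (mk_L2 f))\<^sup>2) = (\<integral>\<^sup>+x. ennreal ((norm (f x))\<^sup>2) \<partial>lborel)"
  unfolding nn_integral_norm_rep[symmetric]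
  by (rule nn_integral_cong_AE) (use rep_mk_L2_AE[OF assms] in \<open>auto elim: eventually_mono\<close>)

section \<open>Completeness, orthogonal projection and representation of forms\<close>

text \<open>Along a subsequence with \<open>\<parallel>d k\<parallel>\<^sup>2 \<le> 4\<^sup>-\<^sup>k\<close> for the increments \<open>d k\<close>, the sum of
  \<open>2\<^sup>k |d k|\<^sup>2\<close> is integrable, so that almost everywhere \<open>|d k| \<le> C 2\<^sup>-\<^sup>k\<^sup>/\<^sup>2\<close> and the representatives
  converge; Fatou's lemma then identifies the pointwise limit as the limit in norm.\<close>

lemma L2_fast_Cauchy_convergent:
  fixes u :: "nat \<Rightarrow> L2"
  assumes C: "Cauchy u" and d: "\<And>k. (norm (u (Suc k) - u k))\<^sup>2 \<le> (1/4) ^ k"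
  shows "convergent u"
proof -
  define D where "D k x = norm (rep_L2 (u (Suc k)) x - rep_L2 (u k) x)" for k x
  have [measurable]: "D k \<in> borel_measurable borel" for k unfolding D_def by measurable
  have "(\<integral>\<^sup>+x. (\<Sum>k. ennreal (2^k * (D k x)\<^sup>2)) \<partial>lborel) = (\<Sum>k. \<integral>\<^sup>+x. ennreal (2^k * (D k x)\<^sup>2) \<partial>lborel)"
    by (rule nn_integral_suminf) measurable
  also have "\<dots> = (\<Sum>k. ennreal (2^k * (norm (u (Suc k) - u k))\<^sup>2))"
    by (intro suminf_cong)
      (simp add: ennreal_mult nn_integral_cmult D_def nn_integral_norm_diff)
  also have "\<dots> \<le> (\<Sum>k. ennreal ((1/2)^k))"
  proof (intro suminf_le ennreal_leI)
    fix k show "2^k * (norm (u (Suc k) - u k))\<^sup>2 \<le> (1/2)^k"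
      using mult_left_mono[OF d[of k], of "2^k"] by (simp add: flip: power_mult_distrib)
  qed auto
  also have "\<dots> < \<infinity>"
    by (subst suminf_ennreal2) (simp_all add: summable_geometric)
  finally have "AE x in lborel. (\<Sum>k. ennreal (2^k * (D k x)\<^sup>2)) \<noteq> \<infinity>"
    by (intro nn_integral_noteq_infinite) auto
  then have conv: "AE x in lborel. convergent (\<lambda>k. rep_L2 (u k) x)"
  proof eventually_elim
    case (elim x)
    then have "summable (\<lambda>k. 2^k * (D k x)\<^sup>2)"
      by (intro summable_suminf_not_top) auto
    then obtain B where B: "\<And>k. norm (2^k * (D k x)\<^sup>2) \<le> B"
      using convergent_imp_Bseq[OF convergentI[OF summable_LIMSEQ_zero]] unfolding Bseq_def by blast
    have Dk: "D k x \<le> sqrt B * (1 / sqrt 2)^k" for k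
    proof -
      have "(D k x)\<^sup>2 \<le> B * (1/2)^k" using B[of k] by (simp add: field_simps)
      then have "sqrt ((D k x)\<^sup>2) \<le> sqrt (B * (1/2)^k)" by (rule real_sqrt_le_mono)
      then show ?thesis
        by (simp add: D_def real_sqrt_mult real_sqrt_power real_sqrt_divide)
    qed
    have "summable (\<lambda>k. sqrt B * (1 / sqrt 2)^k)"
      by (intro summable_mult summable_geometric) simp
    then have "summable (\<lambda>k. rep_L2 (u (Suc k)) x - rep_L2 (u k) x)"
      by (rule summable_comparison_test') (use Dk in \<open>simp add: D_def\<close>)
    then have "convergent (\<lambda>n. \<Sum>k<n. rep_L2 (u (Suc k)) x - rep_L2 (u k) x)"
      by (simp add: summable_iff_convergent)
    then have "convergent (\<lambda>n. (rep_L2 (u n) x - rep_L2 (u 0) x) + rep_L2 (u 0) x)"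
      by (intro convergent_add convergent_const) (simp add: sum_lessThan_telescope[where f="\<lambda>k. rep_L2 (u k) x"])
    then show ?case by simp
  qed
  define f where "f x = lim (\<lambda>k. rep_L2 (u k) x)" for x
  have [measurable]: "f \<in> borel_measurable borel"
    unfolding f_def by measurable
  have lim: "AE x in lborel. (\<lambda>k. rep_L2 (u k) x) \<longlonglongrightarrow> f x"
    using conv by eventually_elim (simp add: f_def convergent_LIMSEQ_iff)
  have fatou: "(\<integral>\<^sup>+x. ennreal ((norm (f x - rep_L2 (u n) x))\<^sup>2) \<partial>lborel) \<le> ennreal (e\<^sup>2)"
    if e: "e \<ge> 0" and n: "\<And>m. m \<ge> n \<Longrightarrow> norm (u m - u n) \<le> e" for n e
  proof -
    have "(\<integral>\<^sup>+x. ennreal ((norm (f x - rep_L2 (u n) x))\<^sup>2) \<partial>lborel)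
       = (\<integral>\<^sup>+x. liminf (\<lambda>m. ennreal ((norm (rep_L2 (u m) x - rep_L2 (u n) x))\<^sup>2)) \<partial>lborel)"
    proof (rule nn_integral_cong_AE)
      show "AE x in lborel. ennreal ((norm (f x - rep_L2 (u n) x))\<^sup>2)
        = liminf (\<lambda>m. ennreal ((norm (rep_L2 (u m) x - rep_L2 (u n) x))\<^sup>2))"
        using lim
      proof eventually_elim
        case (elim x)
        have "(\<lambda>m. ennreal ((norm (rep_L2 (u m) x - rep_L2 (u n) x))\<^sup>2)) \<longlonglongrightarrow> ennreal ((norm (f x - rep_L2 (u n) x))\<^sup>2)"
          by (intro tendsto_ennrealI tendsto_intros elim)
        from lim_imp_Liminf[OF _ this] show ?case by simp
      qed
    qed
    also have "\<dots> \<le> liminf (\<lambda>m. \<integral>\<^sup>+x. ennreal ((norm (rep_L2 (u m) x - rep_L2 (u n) x))\<^sup>2) \<partial>lborel)"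
      by (rule nn_integral_liminf) measurable
    also have "\<dots> = liminf (\<lambda>m. ennreal ((norm (u m - u n))\<^sup>2))"
      by (simp add: nn_integral_norm_diff)
    also have "\<dots> \<le> limsup (\<lambda>m. ennreal ((norm (u m - u n))\<^sup>2))"
      by (simp add: Liminf_le_Limsup)
    also have "\<dots> \<le> ennreal (e\<^sup>2)"
      by (rule Limsup_bounded) (use n in \<open>auto simp: eventually_sequentially intro!: exI[of _ n] ennreal_leI power_mono\<close>)
    finally show ?thesis .
  qed
  obtain n0 where n0: "\<And>m. m \<ge> n0 \<Longrightarrow> norm (u m - u n0) < 1"
    using C unfolding Cauchy_altdef2 dist_norm by (meson zero_less_one)
  have "square_integrable (\<lambda>x. f x - rep_L2 (u n0) x)"
    by (rule square_integrableI, measurable)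
      (use fatou[of 1 n0] n0 in \<open>auto intro: less_imp_le intro!: le_less_trans[OF _ ennreal_one_less_top]\<close>)
  from square_integrable_add[OF this square_integrable_rep[of "u n0"]]
  have f: "square_integrable f" by simp
  have "u \<longlonglongrightarrow> mk_L2 f"
  proof (rule LIMSEQ_I)
    fix r :: real assume r: "r > 0"
    obtain n1 where n1: "\<And>m n. m \<ge> n1 \<Longrightarrow> n \<ge> n1 \<Longrightarrow> norm (u m - u n) < r/2"
      using C r unfolding Cauchy_def dist_norm by (meson half_gt_zero)
    show "\<exists>no. \<forall>n\<ge>no. norm (u n - mk_L2 f) < r"
    proof (intro exI[of _ n1] allI impI)
      fix n assume n: "n \<ge> n1"
      have "ennreal ((norm (mk_L2 f - u n))\<^sup>2) = (\<integral>\<^sup>+x. ennreal ((norm (f x - rep_L2 (u n) x))\<^sup>2) \<partial>lborel)"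
        unfolding nn_integral_norm_diff[symmetric]
        by (rule nn_integral_cong_AE) (use rep_mk_L2_AE[OF f] in \<open>auto elim: eventually_mono\<close>)
      also have "\<dots> \<le> ennreal ((r/2)\<^sup>2)"
        by (rule fatou) (use r n n1 in \<open>auto intro!: less_imp_le\<close>)
      finally have "(norm (mk_L2 f - u n))\<^sup>2 \<le> (r/2)\<^sup>2" by (simp add: ennreal_le_iff)
      then have "norm (mk_L2 f - u n) \<le> r/2" using r by (simp add: power2_le_iff_abs_le)
      then show "norm (u n - mk_L2 f) < r" using r by (simp add: norm_minus_commute)
    qed
  qed
  then show ?thesis by (auto simp: convergent_def)
qed

text \<open>Every Cauchy sequence has a subsequence whose increments decay like \<open>2\<^sup>-\<^sup>k\<close>, and converges along with it.\<close>

instance L2 :: complete_space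
proof
  fix u :: "nat \<Rightarrow> L2" assume C: "Cauchy u"
  have "\<forall>k. \<exists>N. \<forall>m\<ge>N. \<forall>n\<ge>N. norm (u m - u n) < (1/2)^k"
    using C unfolding Cauchy_def dist_norm by (metis half_gt_zero_iff zero_less_one zero_less_power)
  then obtain N where N: "\<And>k m n. m \<ge> N k \<Longrightarrow> n \<ge> N k \<Longrightarrow> norm (u m - u n) < (1/2)^k" by metis
  define s where "s k = (\<Sum>i\<le>k. N i) + k" for k
  have "N i \<le> s i" for i
    using member_le_sum[of i "{..i}" N] unfolding s_def by auto
  moreover have s: "strict_mono s"
    unfolding strict_mono_Suc_iff s_def by simp
  moreover have "s i \<le> s (Suc i)" for i using s by (simp add: strict_mono_less_eq)
  ultimately have d: "norm (u (s (Suc k)) - u (s k)) \<le> (1/2)^k" for k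
    by (meson N le_trans less_imp_le)
  have "convergent (u \<circ> s)"
  proof (rule L2_fast_Cauchy_convergent)
    show "Cauchy (u \<circ> s)" by (rule Cauchy_subseq_Cauchy[OF C s])
    show "(norm ((u \<circ> s) (Suc k) - (u \<circ> s) k))\<^sup>2 \<le> (1/4)^k" for k
    proof -
      have "((1/2::real)^k)\<^sup>2 = (1/4)^k" by (simp add: power2_eq_square flip: power_mult_distrib)
      then show ?thesis using power_mono[OF d[of k], of 2] by simp
    qed
  qed
  then obtain l where "(u \<circ> s) \<longlonglongrightarrow> l" by (auto simp: convergent_def)
  then have "u \<longlonglongrightarrow> l" by (rule Cauchy_converges_subseq[OF C s])
  then show "convergent u" by (auto simp: convergent_def)
qed

text \<open>A minimizing sequence for the distance from \<open>x\<close> to \<open>S\<close> is Cauchy by the parallelogram identity, and at its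
  limit the first variation of the distance vanishes.\<close>

lemma orthogonal_projection_exists:
  fixes S :: "'a::{real_inner,complete_space} set"
  assumes S: "closed S" "subspace S"
  shows "\<exists>p\<in>S. \<forall>s\<in>S. inner (x - p) s = 0"
proof -
  define d where "d = Inf ((\<lambda>s. norm (x - s)) ` S)"
  have ne: "S \<noteq> {}" using S(2) subspace_0 by blast
  have bdd: "bdd_below ((\<lambda>s. norm (x - s)) ` S)" by (rule bdd_belowI[of _ 0]) auto
  have dle: "d \<le> norm (x - s)" if "s \<in> S" for s
    unfolding d_def by (rule cInf_lower[OF _ bdd]) (use that in auto)
  have d0: "d \<ge> 0" unfolding d_def by (rule cInf_greatest) (use ne in auto)
  have "\<exists>s\<in>S. norm (x - s) < d + inverse (Suc n)" for n
    using cInf_lessD[of "(\<lambda>s. norm (x - s)) ` S" "d + inverse (Suc n)"] ne unfolding d_def[symmetric] by auto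
  then obtain s where s: "\<And>n. s n \<in> S" "\<And>n. norm (x - s n) < d + inverse (Suc n)" by metis
  have par: "(norm (s m - s n))\<^sup>2 \<le> 2 * (norm (x - s m))\<^sup>2 + 2 * (norm (x - s n))\<^sup>2 - 4 * d\<^sup>2" for m n
  proof -
    have "(1/2) *\<^sub>R (s m + s n) \<in> S" using s(1) S(2) by (simp add: subspace_add subspace_scale)
    from dle[OF this] d0 have "d\<^sup>2 \<le> (norm (x - (1/2) *\<^sub>R (s m + s n)))\<^sup>2" by (simp add: power_mono)
    moreover have "(norm (s m - s n))\<^sup>2 + 4 * (norm (x - (1/2) *\<^sub>R (s m + s n)))\<^sup>2
        = 2 * (norm (x - s m))\<^sup>2 + 2 * (norm (x - s n))\<^sup>2"
      unfolding power2_norm_eq_inner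
      by (simp add: inner_diff_left inner_diff_right inner_add_left inner_add_right inner_commute algebra_simps)
    ultimately show ?thesis by linarith
  qed
  have sq: "(\<lambda>n. (d + inverse (real (Suc n)))\<^sup>2) \<longlonglongrightarrow> (d + 0)\<^sup>2"
    by (intro tendsto_intros LIMSEQ_inverse_real_of_nat)
  have "Cauchy s"
  proof (rule metric_CauchyI)
    fix e :: real assume e: "e > 0"
    have "eventually (\<lambda>n. (d + inverse (real (Suc n)))\<^sup>2 < d\<^sup>2 + e\<^sup>2/4) sequentially"
      using order_tendstoD(2)[OF sq, of "d\<^sup>2 + e\<^sup>2/4"] e by simp
    then obtain M where M: "\<And>n. n \<ge> M \<Longrightarrow> (d + inverse (real (Suc n)))\<^sup>2 < d\<^sup>2 + e\<^sup>2/4"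
      unfolding eventually_sequentially by blast
    have b: "(norm (x - s n))\<^sup>2 < d\<^sup>2 + e\<^sup>2/4" if "n \<ge> M" for n
      using M[OF that] s(2)[of n] by (smt (verit) norm_ge_zero power_mono)
    show "\<exists>M. \<forall>m\<ge>M. \<forall>n\<ge>M. dist (s m) (s n) < e"
    proof (intro exI[of _ M] allI impI)
      fix m n assume "m \<ge> M" "n \<ge> M"
      then have "(norm (s m - s n))\<^sup>2 < e\<^sup>2" using par[of m n] b[of m] b[of n] by linarith
      then show "dist (s m) (s n) < e" using e unfolding dist_norm by (simp add: power2_less_imp_less)
    qed
  qed
  then obtain p where p: "s \<longlonglongrightarrow> p" using Cauchy_convergent convergent_def by blast
  have pS: "p \<in> S" using closed_sequentially[OF S(1)] s(1) p by blast
  have "norm (x - p) \<le> d"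
  proof (rule tendsto_le[OF sequentially_bot])
    show "(\<lambda>n. norm (x - s n)) \<longlonglongrightarrow> norm (x - p)" by (intro tendsto_intros p)
    show "(\<lambda>n. d + inverse (real (Suc n))) \<longlonglongrightarrow> d" using tendsto_add[OF tendsto_const LIMSEQ_inverse_real_of_nat] by simp
    show "\<forall>\<^sub>F n in sequentially. norm (x - s n) \<le> d + inverse (real (Suc n))"
      using s(2) by (intro always_eventually allI less_imp_le)
  qed
  then have pd: "norm (x - p) \<le> norm (x - s)" if "s \<in> S" for s using dle[OF that] by linarith
  have "inner (x - p) t = 0" if t: "t \<in> S" for t
  proof (cases "t = 0")
    case False
    \<comment> \<open>the step length that minimizes the distance from \<open>x\<close> along the line \<open>p + \<real> t\<close>\<close>
    define a where "a = inner (x - p) t / inner t t"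
    have "p + a *\<^sub>R t \<in> S" using pS t S(2) by (simp add: subspace_add subspace_scale)
    from pd[OF this] have "(norm (x - p))\<^sup>2 \<le> (norm (x - p - a *\<^sub>R t))\<^sup>2"
      by (simp add: power_mono algebra_simps)
    also have "\<dots> = (norm (x - p))\<^sup>2 - 2 * a * inner (x - p) t + a\<^sup>2 * inner t t"
      unfolding power2_norm_eq_inner[of "x - p - a *\<^sub>R t"] power2_norm_eq_inner[of "x - p"]
      by (simp add: inner_diff_left inner_diff_right inner_commute power2_eq_square algebra_simps)
    also have "\<dots> = (norm (x - p))\<^sup>2 - (inner (x - p) t)\<^sup>2 / inner t t"
      using False by (simp add: a_def power2_eq_square field_simps)
    finally have "(inner (x - p) t)\<^sup>2 / inner t t \<le> 0" by linarith
    moreover have "inner t t > 0" using False by simp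
    ultimately have "(inner (x - p) t)\<^sup>2 \<le> 0" by (meson divide_pos_pos not_less)
    then show ?thesis by simp
  qed simp
  then show ?thesis using pS by blast
qed

text \<open>The representing vector is a multiple of the component of any vector outside the kernel that is orthogonal to
  the kernel.\<close>

lemma Riesz_representation:
  fixes f :: "'a::{real_inner,complete_space} \<Rightarrow> real"
  assumes f: "bounded_linear f"
  shows "\<exists>w. \<forall>v. f v = inner w v"
proof (cases "\<forall>v. f v = 0")
  case True then show ?thesis by (intro exI[of _ 0]) simp
next
  case False
  then obtain x where x: "f x \<noteq> 0" by blast
  interpret bounded_linear f by fact
  define S where "S = {v. f v = 0}"
  have "closed S" unfolding S_def
    by (intro closed_Collect_eq linear_continuous_on f continuous_intros)
  moreover have "subspace S" unfolding S_def subspace_def by (simp add: add scaleR zero)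
  ultimately obtain p where p: "f p = 0" "\<And>s. f s = 0 \<Longrightarrow> inner (x - p) s = 0"
    using orthogonal_projection_exists[of S x] unfolding S_def by blast
  define z where "z = x - p"
  have fz: "f z \<noteq> 0" using x p(1) by (simp add: z_def diff)
  then have zz: "inner z z \<noteq> 0" using zero by auto
  show ?thesis
  proof (intro exI[of _ "(f z / inner z z) *\<^sub>R z"] allI)
    fix v
    have "f (v - (f v / f z) *\<^sub>R z) = 0" using fz by (simp add: diff scaleR)
    from p(2)[OF this] have "inner z v = (f v / f z) * inner z z"
      by (simp add: z_def[symmetric] inner_diff_right)
    then show "f v = inner ((f z / inner z z) *\<^sub>R z) v" using fz zz by simp
  qed
qed

section \<open>Bounded complex-linear operators\<close>

lemma bounded_clinearD:
  assumes "bounded_clinear T"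
  shows "bounded_linear T" "T (u + v) = T u + T v" "T (u - v) = T u - T v" "T 0 = 0" "T (- u) = - T u"
    "T (scaleC c u) = scaleC c (T u)" "T (r *\<^sub>R u) = r *\<^sub>R T u"
proof -
  show b: "bounded_linear T" using assms by (simp add: bounded_clinear_def)
  interpret bounded_linear T by (rule b)
  show "T (u + v) = T u + T v" "T (u - v) = T u - T v" "T 0 = 0" "T (- u) = - T u" "T (r *\<^sub>R u) = r *\<^sub>R T u"
    by (simp_all add: add diff zero scaleR linear_neg[OF bounded_linear.linear[OF b]])
  show "T (scaleC c u) = scaleC c (T u)" using assms by (simp add: bounded_clinear_def)
qed

lemma bounded_clinearI:
  assumes "\<And>u v. T (u + v) = T u + T v" "\<And>c u. T (scaleC c u) = scaleC c (T u)" "\<And>u. norm (T u) \<le> K * norm u"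
  shows "bounded_clinear T"
  unfolding bounded_clinear_def
  by (intro conjI bounded_linear_intro[where K=K])
    (use assms in \<open>auto simp: scaleR_scaleC mult.commute\<close>)

lemma bounded_clinear_scaleC: "bounded_clinear (scaleC c)"
  by (rule bounded_clinearI[where K="norm c"]) (auto simp: scaleC_add_right norm_scaleC mult.commute)

lemma bounded_clinear_id: "bounded_clinear id"
  by (rule bounded_clinearI[where K=1]) auto

lemma bounded_clinear_compose:
  "bounded_clinear S \<Longrightarrow> bounded_clinear T \<Longrightarrow> bounded_clinear (\<lambda>u. S (T u))"
  unfolding bounded_clinear_def by (auto intro: bounded_linear_compose)

lemma bounded_clinear_add:
  "bounded_clinear S \<Longrightarrow> bounded_clinear T \<Longrightarrow> bounded_clinear (\<lambda>u. S u + T u)"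
  unfolding bounded_clinear_def by (auto intro: bounded_linear_add simp: scaleC_add_right)

text \<open>The quadratic form of an operator on a complex space determines the operator.  Throughout, operators are built
  from and compared by their quadratic forms, which are integrals against positive measures.\<close>

lemma polarization:
  assumes T: "bounded_clinear T"
  shows "4 * cinner (T u) v = cinner (T (u + v)) (u + v) - cinner (T (u - v)) (u - v)
     + \<i> * cinner (T (u + scaleC \<i> v)) (u + scaleC \<i> v)
     - \<i> * cinner (T (u - scaleC \<i> v)) (u - scaleC \<i> v)"
  by (simp add: bounded_clinearD[OF T] cinner_add_left cinner_add_right cinner_diff_left cinner_diff_right
      cinner_scaleC_left cinner_scaleC_right algebra_simps)

lemma operator_eq_of_form_eq:
  assumes "bounded_clinear S" "bounded_clinear T" "\<And>u. cinner (S u) u = cinner (T u) u"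
  shows "S = T"
proof (rule ext, rule cinner_eqI)
  fix u v
  have "4 * cinner (S u) v = 4 * cinner (T u) v"
    unfolding polarization[OF assms(1)] polarization[OF assms(2)] assms(3) ..
  then show "cinner (S u) v = cinner (T u) v" by simp
qed

text \<open>The constant \<open>2\<close> is the price of passing from the quadratic form to the sesquilinear form
  by polarization for an operator that need not be self-adjoint.\<close>

lemma norm_le_of_form_le:
  assumes T: "bounded_clinear T" and C: "\<And>u. norm (cinner (T u) u) \<le> C * (norm u)\<^sup>2"
  shows "norm (T u) \<le> 2 * C * norm u"
proof -
  have unit: "norm (cinner (T u) v) \<le> 2 * C" if "norm u = 1" "norm v = 1" for u v
  proof -
    have par: "(norm (u + w))\<^sup>2 + (norm (u - w))\<^sup>2 = 2 * (norm u)\<^sup>2 + 2 * (norm w)\<^sup>2" for w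
      unfolding power2_norm_eq_inner
      by (simp add: inner_diff_left inner_diff_right inner_add_left inner_add_right inner_commute algebra_simps)
    let ?q = "\<lambda>w. cinner (T w) w"
    have "4 * norm (cinner (T u) v) = norm (4 * cinner (T u) v)" by (simp add: norm_mult)
    also have "\<dots> \<le> norm (?q (u + v)) + norm (?q (u - v)) + norm (?q (u + scaleC \<i> v)) + norm (?q (u - scaleC \<i> v))"
      unfolding polarization[OF T]
      using norm_triangle_ineq4[of "?q (u + v)" "?q (u - v)"]
        norm_triangle_ineq[of "?q (u + v) - ?q (u - v)" "\<i> * ?q (u + scaleC \<i> v)"]
        norm_triangle_ineq4[of "?q (u + v) - ?q (u - v) + \<i> * ?q (u + scaleC \<i> v)" "\<i> * ?q (u - scaleC \<i> v)"]
      by (simp add: norm_mult)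
    also have "\<dots> \<le> C * (norm (u + v))\<^sup>2 + C * (norm (u - v))\<^sup>2 + C * (norm (u + scaleC \<i> v))\<^sup>2 + C * (norm (u - scaleC \<i> v))\<^sup>2"
      by (intro add_mono C)
    also have "\<dots> = C * ((norm (u + v))\<^sup>2 + (norm (u - v))\<^sup>2) + C * ((norm (u + scaleC \<i> v))\<^sup>2 + (norm (u - scaleC \<i> v))\<^sup>2)"
      by (simp add: algebra_simps)
    also have "\<dots> = 8 * C" unfolding par using that by (simp add: norm_scaleC)
    finally show ?thesis by simp
  qed
  show ?thesis
  proof (cases "u = 0 \<or> T u = 0")
    case True then show ?thesis
      using order_trans[OF norm_ge_zero C[of u]] by (auto simp: bounded_clinearD[OF T] zero_le_mult_iff)
  next
    case False
    let ?a = "inverse (norm u) *\<^sub>R u" and ?b = "inverse (norm (T u)) *\<^sub>R T u"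
    have "norm (cinner (T ?a) ?b) \<le> 2 * C"
      by (rule unit) (use False in auto)
    also have "cinner (T ?a) ?b = of_real (norm (T u) / norm u)"
      using False by (simp add: bounded_clinearD[OF T] cinner_scaleR_left cinner_scaleR_right cinner_self field_simps power2_eq_square)
    finally show ?thesis using False by (simp add: norm_divide field_simps)
  qed
qed

text \<open>The real Riesz representation of \<open>Re (B u \<cdot>)\<close> suffices, since \<open>B u (\<i> v) = - \<i> B u v\<close> recovers the imaginary part.\<close>

lemma operator_of_sesquilinear_form:
  assumes add1: "\<And>u v w. B (u + v) w = B u w + B v w" and sc1: "\<And>c u w. B (scaleC c u) w = c * B u w"
    and add2: "\<And>u v w. B u (v + w) = B u v + B u w" and sc2: "\<And>c u w. B u (scaleC c w) = cnj c * B u w"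
    and bd: "\<And>u v. norm (B u v) \<le> K * norm u * norm v"
  shows "\<exists>T. bounded_clinear T \<and> (\<forall>u v. cinner (T u) v = B u v)"
proof -
  have "\<exists>w. \<forall>v. Re (B u v) = inner w v" for u
  proof (rule Riesz_representation, rule bounded_linear_intro[where K="K * norm u"])
    show "Re (B u (x + y)) = Re (B u x) + Re (B u y)" for x y by (simp add: add2)
    show "Re (B u (r *\<^sub>R x)) = r *\<^sub>R Re (B u x)" for r x by (simp add: sc2 scaleR_scaleC)
    show "norm (Re (B u x)) \<le> norm x * (K * norm u)" for x
      using bd[of u x] abs_Re_le_cmod[of "B u x"] by (simp add: mult_ac)
  qed
  then obtain T where T: "\<And>u v. Re (B u v) = inner (T u) v" by metis
  have c: "cinner (T u) v = B u v" for u v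
    by (simp add: complex_eq_iff Re_cinner Im_cinner flip: T) (simp add: sc2)
  have "bounded_clinear T"
  proof (rule bounded_clinearI[where K=K])
    show "T (u + v) = T u + T v" for u v by (rule cinner_eqI) (simp add: c add1 cinner_add_left)
    show "T (scaleC a u) = scaleC a (T u)" for a u by (rule cinner_eqI) (simp add: c sc1 cinner_scaleC_left)
    show "norm (T u) \<le> K * norm u" for u
    proof (cases "T u = 0")
      case False
      have "norm (T u) * norm (T u) = norm (cinner (T u) (T u))"
        by (simp add: cinner_self power2_eq_square norm_mult)
      also have "\<dots> \<le> K * norm u * norm (T u)" unfolding c by (rule bd)
      finally show ?thesis using False by simp
    next
      case True
      then show ?thesis
        using order_trans[OF norm_ge_zero bd[of u u]]
        by (cases "u = 0") (auto simp: zero_le_mult_iff)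
    qed
  qed
  then show ?thesis using c by blast
qed

section \<open>Bounded Borel functions represented by operators\<close>

text \<open>Bounded Borel functions are bounded pointwise limits of simple functions.\<close>

lemma bounded_measurable_induct:
  fixes g :: "'a \<Rightarrow> complex"
  assumes g: "g \<in> borel_measurable M" "\<And>z. z \<in> space M \<Longrightarrow> norm (g z) \<le> B" and sp: "space M = UNIV"
    and ind: "\<And>A. A \<in> sets M \<Longrightarrow> P (\<lambda>z. indicator A z)"
    and add: "\<And>f g. P f \<Longrightarrow> P g \<Longrightarrow> P (\<lambda>z. f z + g z)"
    and scale: "\<And>f c. P f \<Longrightarrow> P (\<lambda>z. c * f z)"
    and lim: "\<And>gs g B. (\<And>n. gs n \<in> borel_measurable M) \<Longrightarrow> (\<And>n. P (gs n)) \<Longrightarrow> (\<And>n z. norm (gs n z) \<le> B) \<Longrightarrow>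
      (\<And>z. (\<lambda>n. gs n z) \<longlonglongrightarrow> g z) \<Longrightarrow> g \<in> borel_measurable M \<Longrightarrow> P g"
  shows "P g"
proof -
  have simple: "P f" if f: "simple_function M f" for f
  proof -
    have fin: "finite (range f)" using f sp by (simp add: simple_function_def)
    have "P (\<lambda>z. \<Sum>y\<in>Y. y * indicator (f -` {y}) z)" if "Y \<subseteq> range f" "finite Y" for Y
      using that(2,1)
    proof (induction Y rule: finite_induct)
      case empty
      show ?case using ind[of "{}"] by (simp add: indicator_def)
    next
      case (insert y Y)
      have "f -` {y} \<in> sets M" using f insert.prems sp by (auto simp: simple_function_def)
      then have "P (\<lambda>z. y * indicator (f -` {y}) z + (\<Sum>y\<in>Y. y * indicator (f -` {y}) z))"
        using insert by (intro add scale ind) auto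
      then show ?case by (simp only: sum.insert[OF insert.hyps])
    qed
    from this[OF order_refl fin] have "P (\<lambda>z. \<Sum>y\<in>range f. y * indicator (f -` {y}) z)" .
    also have "(\<lambda>z. \<Sum>y\<in>range f. y * indicator (f -` {y}) z) = f"
    proof
      fix z
      have "(\<Sum>y\<in>range f. y * indicator (f -` {y}) z) = (\<Sum>y\<in>range f. if y = f z then y else 0)"
        by (intro sum.cong) (auto simp: indicator_def)
      also have "\<dots> = f z" using fin by simp
      finally show "(\<Sum>y\<in>range f. y * indicator (f -` {y}) z) = f z" .
    qed
    finally show ?thesis .
  qed
  obtain F where F: "\<And>i. simple_function M (F i)" "\<And>z. (\<lambda>i. F i z) \<longlonglongrightarrow> g z"
      "\<And>i z. norm (F i z) \<le> 2 * norm (g z)"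
    using borel_measurable_implies_sequence_metric[OF g(1), of 0] sp by auto
  show ?thesis
  proof (rule lim)
    show "F n \<in> borel_measurable M" for n using F(1) by (rule borel_measurable_simple_function)
    show "P (F n)" for n using F(1) by (rule simple)
    show "norm (F n z) \<le> 2 * B" for n z using F(3)[of n z] g(2)[of z] sp by simp
  qed (use F g in auto)
qed

text \<open>A family of measures \<open>M u\<close> of mass at most \<open>\<parallel>u\<parallel>\<^sup>2\<close>, concentrated on \<open>S\<close>.  It plays the role of
  the diagonal measures \<open>\<langle>E(\<cdot>)u, u\<rangle>\<close>, both before and after the projections are known.\<close>

locale measure_family =
  fixes M :: "L2 \<Rightarrow> 'a::topological_space measure" and S :: "'a set"
  assumes sets_M [measurable_cong]: "sets (M u) = sets borel"
    and finite_M: "finite_measure (M u)"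
    and mass_M: "measure (M u) UNIV \<le> (norm u)\<^sup>2"
    and supp_M: "AE z in M u. z \<in> S"
begin

lemma space_M [simp]: "space (M u) = UNIV"
  using sets_eq_imp_space_eq[OF sets_M] by simp

text \<open>\<open>T = g(H)\<close> when \<open>M u\<close> is the spectral measure of \<open>H\<close> at \<open>u\<close>.\<close>

definition represents :: "('a \<Rightarrow> complex) \<Rightarrow> (L2 \<Rightarrow> L2) \<Rightarrow> bool" where
  "represents g T \<longleftrightarrow> g \<in> borel_measurable borel \<and> (\<exists>B. \<forall>z\<in>S. norm (g z) \<le> B) \<and>
     bounded_clinear T \<and> (\<forall>u. cinner (T u) u = integral\<^sup>L (M u) g)"

lemma integrable_bounded:
  fixes g :: "'a \<Rightarrow> 'b::{banach,second_countable_topology}"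
  assumes "g \<in> borel_measurable borel" "\<And>z. z \<in> S \<Longrightarrow> norm (g z) \<le> B"
  shows "integrable (M u) g"
proof (rule finite_measure.integrable_const_bound[OF finite_M])
  show "AE z in M u. norm (g z) \<le> B" using supp_M[of u] by eventually_elim (use assms in auto)
  show "g \<in> borel_measurable (M u)" using assms by simp
qed

lemma norm_integral_le:
  fixes g :: "'a \<Rightarrow> 'b::{banach,second_countable_topology}"
  assumes g: "g \<in> borel_measurable borel" "\<And>z. z \<in> S \<Longrightarrow> norm (g z) \<le> B" and B: "B \<ge> 0"
  shows "norm (integral\<^sup>L (M u) g) \<le> B * (norm u)\<^sup>2"
proof -
  interpret finite_measure "M u" by (rule finite_M)
  have "norm (integral\<^sup>L (M u) g) \<le> (\<integral>z. norm (g z) \<partial>M u)" by simp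
  also have "\<dots> \<le> (\<integral>z. B \<partial>M u)"
  proof (rule integral_mono_AE)
    show "integrable (M u) (\<lambda>z. norm (g z))" using integrable_bounded[OF g] by simp
    show "AE z in M u. norm (g z) \<le> B" using supp_M[of u] by eventually_elim (use assms in auto)
  qed simp
  also have "\<dots> = measure (M u) UNIV * B" by simp
  also have "\<dots> \<le> (norm u)\<^sup>2 * B" using mass_M[of u] B by (rule mult_right_mono)
  finally show ?thesis by (simp add: mult.commute)
qed

lemma representsD:
  assumes "represents g T"
  shows "g \<in> borel_measurable borel" "bounded_clinear T" "cinner (T u) u = integral\<^sup>L (M u) g" "integrable (M u) g"
proof -
  show "g \<in> borel_measurable borel" "bounded_clinear T" "cinner (T u) u = integral\<^sup>L (M u) g"
    using assms by (auto simp: represents_def)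
  show "integrable (M u) g" using assms integrable_bounded unfolding represents_def by blast
qed

lemma represents_unique: "represents g T \<Longrightarrow> represents g T' \<Longrightarrow> T = T'"
  by (rule operator_eq_of_form_eq) (auto simp: represents_def)

lemma represents_add:
  assumes "represents f T" "represents g R"
  shows "represents (\<lambda>z. f z + g z) (\<lambda>u. T u + R u)"
proof -
  obtain B C where BC: "\<forall>z\<in>S. norm (f z) \<le> B" "\<forall>z\<in>S. norm (g z) \<le> C"
    using assms by (auto simp: represents_def)
  have "\<forall>z\<in>S. norm (f z + g z) \<le> B + C" using BC by (auto intro!: order_trans[OF norm_triangle_ineq] add_mono)
  then show ?thesis
    using representsD[OF assms(1)] representsD[OF assms(2)]
    by (auto simp: represents_def bounded_clinear_add cinner_add_left)
qed

lemma represents_scale: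
  assumes "represents f T"
  shows "represents (\<lambda>z. c * f z) (\<lambda>u. scaleC c (T u))"
proof -
  obtain B where B: "\<forall>z\<in>S. norm (f z) \<le> B" using assms by (auto simp: represents_def)
  have "\<forall>z\<in>S. norm (c * f z) \<le> norm c * B" using B by (auto simp: norm_mult intro!: mult_left_mono)
  then show ?thesis
    using representsD[OF assms(1)] bounded_clinear_compose[OF bounded_clinear_scaleC]
    by (auto simp: represents_def cinner_scaleC_left)
qed

lemma represents_diff:
  assumes "represents f T" "represents g R"
  shows "represents (\<lambda>z. f z - g z) (\<lambda>u. T u - R u)"
  using represents_add[OF assms(1) represents_scale[OF assms(2), of "-1"]] by (simp add: scaleC_minus1)

lemma represents_cong:
  assumes "represents f T" "g \<in> borel_measurable borel" "\<And>z. z \<in> S \<Longrightarrow> f z = g z"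
  shows "represents g T"
proof -
  have "integral\<^sup>L (M u) f = integral\<^sup>L (M u) g" for u
  proof (rule integral_cong_AE)
    show "AE z in M u. f z = g z" using supp_M[of u] by eventually_elim (rule assms(3))
  qed (use assms representsD[OF assms(1)] in auto)
  then show ?thesis using assms by (auto simp: represents_def)
qed

lemma represents_norm_le:
  assumes "represents g T" "\<And>z. z \<in> S \<Longrightarrow> norm (g z) \<le> B" "B \<ge> 0"
  shows "norm (T u) \<le> 2 * B * norm u"
proof (rule norm_le_of_form_le)
  show "norm (cinner (T u) u) \<le> B * (norm u)\<^sup>2" for u
    unfolding representsD(3)[OF assms(1)] by (rule norm_integral_le) (use assms representsD(1) in auto)
qed (use assms representsD in auto)

text \<open>By polarization the sesquilinear forms of the operators converge whenever the quadratic forms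
  \<open>\<integral> g n dM u\<close> do, and the limit form is again the form of a bounded operator.\<close>

lemma represents_limit:
  assumes T: "\<And>n. represents (g n) (T n)"
    and bd: "\<And>n z. z \<in> S \<Longrightarrow> norm (g n z) \<le> B"
    and lim: "\<And>z. z \<in> S \<Longrightarrow> (\<lambda>n. g n z) \<longlonglongrightarrow> h z" and h: "h \<in> borel_measurable borel"
  shows "\<exists>R. represents h R \<and> (\<forall>u v. (\<lambda>n. cinner (T n u) v) \<longlonglongrightarrow> cinner (R u) v)"
proof -
  \<comment> \<open>\<open>B\<close> may be negative if \<open>S\<close> is empty\<close>
  define B' where "B' = max B 0"
  have bd': "\<And>n z. z \<in> S \<Longrightarrow> norm (g n z) \<le> B'" and B': "B' \<ge> 0" using bd by (auto simp: B'_def le_max_iff_disj)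
  have conv: "(\<lambda>n. integral\<^sup>L (M u) (g n)) \<longlonglongrightarrow> integral\<^sup>L (M u) h" for u
  proof (rule integral_dominated_convergence)
    interpret finite_measure "M u" by (rule finite_M)
    show "integrable (M u) (\<lambda>z. B')" by simp
    show "AE z in M u. (\<lambda>n. g n z) \<longlonglongrightarrow> h z" using supp_M[of u] by eventually_elim (rule lim)
    show "AE z in M u. norm (g n z) \<le> B'" for n using supp_M[of u] by eventually_elim (rule bd')
  qed (use h representsD(1)[OF T] in auto)
  define q where "q u = integral\<^sup>L (M u) h" for u
  \<comment> \<open>the polarization of the limiting quadratic form\<close>
  define b where "b u v = (q (u + v) - q (u - v) + \<i> * q (u + scaleC \<i> v) - \<i> * q (u - scaleC \<i> v)) / 4" for u v
  have lb: "(\<lambda>n. cinner (T n u) v) \<longlonglongrightarrow> b u v" for u v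
  proof -
    have "(\<lambda>n. (cinner (T n (u + v)) (u + v) - cinner (T n (u - v)) (u - v)
       + \<i> * cinner (T n (u + scaleC \<i> v)) (u + scaleC \<i> v)
       - \<i> * cinner (T n (u - scaleC \<i> v)) (u - scaleC \<i> v)) / 4) \<longlonglongrightarrow> b u v"
      unfolding b_def q_def representsD(3)[OF T] by (intro tendsto_intros conv) simp
    then show ?thesis by (simp flip: polarization[OF representsD(2)[OF T]])
  qed
  have "\<exists>R. bounded_clinear R \<and> (\<forall>u v. cinner (R u) v = b u v)"
  proof (rule operator_of_sesquilinear_form[where K="2 * B'"])
    note cl = bounded_clinearD[OF representsD(2)[OF T]]
    fix u v w c
    have "(\<lambda>n. cinner (T n (u + v)) w) \<longlonglongrightarrow> b u w + b v w"
      unfolding cl cinner_add_left by (intro tendsto_add lb)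
    then show "b (u + v) w = b u w + b v w" using lb LIMSEQ_unique by blast
    have "(\<lambda>n. cinner (T n (scaleC c u)) w) \<longlonglongrightarrow> c * b u w"
      unfolding cl cinner_scaleC_left by (intro tendsto_mult_left lb)
    then show "b (scaleC c u) w = c * b u w" using lb LIMSEQ_unique by blast
    have "(\<lambda>n. cinner (T n u) (v + w)) \<longlonglongrightarrow> b u v + b u w"
      unfolding cinner_add_right by (intro tendsto_add lb)
    then show "b u (v + w) = b u v + b u w" using lb LIMSEQ_unique by blast
    have "(\<lambda>n. cinner (T n u) (scaleC c w)) \<longlonglongrightarrow> cnj c * b u w"
      unfolding cinner_scaleC_right by (intro tendsto_mult_left lb)
    then show "b u (scaleC c w) = cnj c * b u w" using lb LIMSEQ_unique by blast
    show "norm (b u v) \<le> 2 * B' * norm u * norm v"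
    proof (rule Lim_bounded[OF tendsto_norm[OF lb]], intro allI impI)
      fix n
      have "norm (cinner (T n u) v) \<le> norm (T n u) * norm v" by (rule norm_cinner_le)
      also have "\<dots> \<le> (2 * B' * norm u) * norm v"
        by (intro mult_right_mono represents_norm_le[OF T bd' B']) auto
      finally show "norm (cinner (T n u) v) \<le> 2 * B' * norm u * norm v" .
    qed
  qed
  then obtain R where R: "bounded_clinear R" "\<And>u v. cinner (R u) v = b u v" by blast
  have "represents h R"
    unfolding represents_def
  proof (intro conjI h R allI)
    show "\<exists>B. \<forall>z\<in>S. norm (h z) \<le> B"
      by (intro exI[of _ B] ballI Lim_bounded[OF tendsto_norm[OF lim]]) (use bd in auto)
    show "cinner (R u) u = integral\<^sup>L (M u) h" for u
      unfolding R using LIMSEQ_unique[OF lb[of u u]] conv[of u] representsD(3)[OF T] by simp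
  qed
  then show ?thesis using lb R(2) by auto
qed

end

section \<open>Projection-valued measures\<close>

locale pvm =
  fixes E :: "real set \<Rightarrow> L2 \<Rightarrow> L2"
  assumes pvm: "projection_valued_measure E"
begin

lemma clinear_E: "A \<in> sets borel \<Longrightarrow> bounded_clinear (E A)"
  and idem_E: "A \<in> sets borel \<Longrightarrow> E A (E A u) = E A u"
  and selfadj_E: "A \<in> sets borel \<Longrightarrow> cinner (E A u) v = cinner u (E A v)"
  and E_UNIV: "E UNIV = id"
  and sums_E: "range F \<subseteq> sets borel \<Longrightarrow> disjoint_family F \<Longrightarrow> (\<lambda>n. E (F n) u) sums E (\<Union>n::nat. F n) u"
  using pvm unfolding projection_valued_measure_def by blast+

lemma E_empty: "E {} u = 0"
proof -
  have "(\<lambda>n::nat. E {} u) sums E {} u" using sums_E[of "\<lambda>_. {}" u] by (simp add: disjoint_family_on_def)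
  then have "(\<lambda>n::nat. E {} u) \<longlonglongrightarrow> 0" by (rule sums_summable[THEN summable_LIMSEQ_zero])
  then show ?thesis by (simp add: LIMSEQ_const_iff)
qed

lemma E_Un: 
  assumes "A \<in> sets borel" "B \<in> sets borel" "A \<inter> B = {}"
  shows "E (A \<union> B) u = E A u + E B u"
proof -
  have "(\<lambda>n. E (binaryset A B n) u) sums E (\<Union>n. binaryset A B n) u"
    by (rule sums_E) (use assms in \<open>auto simp: range_binaryset_eq disjoint_family_on_def binaryset_def\<close>)
  moreover have "(\<lambda>n. E (binaryset A B n) u) sums (E A u + E B u)"
    by (rule binaryset_sums) (rule E_empty)
  ultimately show ?thesis by (simp add: UN_binaryset_eq sums_unique2)
qed

lemma cinner_E_self: "A \<in> sets borel \<Longrightarrow> cinner (E A u) u = of_real ((norm (E A u))\<^sup>2)"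
  by (metis cinner_self idem_E selfadj_E)

lemma norm_E_le: "A \<in> sets borel \<Longrightarrow> norm (E A u) \<le> norm u"
proof (cases "E A u = 0")
  case False
  assume A: "A \<in> sets borel"
  have "norm (E A u) * norm (E A u) = norm (cinner (E A u) u)"
    unfolding cinner_E_self[OF A] norm_of_real by (simp add: power2_eq_square)
  also have "\<dots> \<le> norm (E A u) * norm u" by (rule norm_cinner_le)
  finally show ?thesis using False by simp
qed simp

text \<open>With \<open>w = E B u\<close>, additivity gives \<open>\<parallel>E (A \<union> B) w\<parallel>\<^sup>2 = \<parallel>E A w\<parallel>\<^sup>2 + \<parallel>w\<parallel>\<^sup>2\<close>, while a projection does not increase the norm.
  Multiplicativity is thus a consequence of additivity.\<close>

lemma E_disjoint:
  assumes A: "A \<in> sets borel" and B: "B \<in> sets borel" and AB: "A \<inter> B = {}"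
  shows "E A (E B u) = 0"
proof -
  define w where "w = E B u"
  have w: "E B w = w" unfolding w_def by (rule idem_E[OF B])
  have AUB: "A \<union> B \<in> sets borel" using A B by simp
  have "cinner (E (A \<union> B) w) w = cinner (E A w) w + cinner (E B w) w"
    by (simp only: E_Un[OF A B AB] cinner_add_left)
  then have "(norm (E (A \<union> B) w))\<^sup>2 = (norm (E A w))\<^sup>2 + (norm w)\<^sup>2"
    by (simp only: cinner_E_self[OF A] cinner_self cinner_E_self[OF AUB] w of_real_add[symmetric] of_real_eq_iff)
  moreover have "(norm (E (A \<union> B) w))\<^sup>2 \<le> (norm w)\<^sup>2" using norm_E_le[OF AUB] by (simp add: power_mono)
  ultimately have "(norm (E A w))\<^sup>2 \<le> 0" by linarith
  then show ?thesis by (simp add: w_def)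
qed

lemma E_Int:
  assumes A: "A \<in> sets borel" and B: "B \<in> sets borel"
  shows "E A (E B u) = E (A \<inter> B) u"
proof -
  have m: "A \<inter> B \<in> sets borel" "A - B \<in> sets borel" "B - A \<in> sets borel" using A B by auto
  have eq: "(A \<inter> B) \<union> (B - A) = B" "(A \<inter> B) \<inter> (B - A) = {}" "(A \<inter> B) \<union> (A - B) = A" "(A \<inter> B) \<inter> (A - B) = {}"
    by auto
  have "E A (E B u) = E A (E (A \<inter> B) u + E (B - A) u)"
    using E_Un[of "A \<inter> B" "B - A" u] m by (simp add: eq)
  also have "\<dots> = E A (E (A \<inter> B) u)"
    using E_disjoint[of A "B - A" u] A m by (simp add: bounded_clinearD[OF clinear_E[OF A]])
  also have "\<dots> = E (A \<inter> B) (E (A \<inter> B) u) + E (A - B) (E (A \<inter> B) u)"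
    using E_Un[of "A \<inter> B" "A - B" "E (A \<inter> B) u"] m by (simp add: eq)
  also have "\<dots> = E (A \<inter> B) u" using E_disjoint[of "A - B" "A \<inter> B" u] m eq(4) by (simp add: idem_E Int_commute)
  finally show ?thesis .
qed

abbreviation M :: "L2 \<Rightarrow> real measure" where "M \<equiv> scalar_measure E"

lemma sets_sm [measurable_cong]: "sets (M u) = sets borel"
  unfolding scalar_measure_def using sets.sigma_sets_eq[of "borel :: real measure"]
  by (simp add: sets_measure_of_conv)

lemma emeasure_sm:
  assumes A: "A \<in> sets borel"
  shows "emeasure (M u) A = ennreal ((norm (E A u))\<^sup>2)"
proof -
  let ?\<mu> = "\<lambda>A. ennreal (Re (cinner (E A u) u))"
  have "emeasure (M u) A = ?\<mu> A"
    unfolding scalar_measure_def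
  proof (rule emeasure_measure_of_sigma[OF _ _ _ A])
    show "sigma_algebra UNIV (sets (borel :: real measure))" using sets.sigma_algebra_axioms[of "borel :: real measure"] by simp
    show "positive (sets borel) ?\<mu>" by (simp add: positive_def E_empty)
    show "countably_additive (sets borel) ?\<mu>"
    proof (rule countably_additiveI)
      fix F :: "nat \<Rightarrow> real set" assume F: "range F \<subseteq> sets borel" "disjoint_family F" "\<Union> (range F) \<in> sets borel"
      have "(\<lambda>n. Re (cinner (E (F n) u) u)) sums Re (cinner (E (\<Union>n. F n) u) u)"
        by (intro sums_Re bounded_linear.sums[OF bounded_linear_cinner_left] sums_E F)
      moreover have "Re (cinner (E (F n) u) u) \<ge> 0" for n
        using cinner_E_self[of "F n"] F by (simp add: range_subsetD)
      ultimately show "(\<Sum>n. ?\<mu> (F n)) = ?\<mu> (\<Union> (range F))"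
        by (simp add: suminf_ennreal2 sums_iff)
    qed
  qed
  then show ?thesis by (simp add: cinner_E_self[OF A])
qed

sublocale measure_family M UNIV
proof (rule measure_family.intro)
  show "sets (M u) = sets borel" for u by (rule sets_sm)
  have sp: "space (M u) = UNIV" for u using sets_eq_imp_space_eq[OF sets_sm] by simp
  show "finite_measure (M u)" for u
    by (rule finite_measureI) (simp add: sp emeasure_sm)
  show "measure (M u) UNIV \<le> (norm u)\<^sup>2" for u
    by (simp add: measure_def emeasure_sm E_UNIV)
qed simp

lemma represents_indicator: "A \<in> sets borel \<Longrightarrow> represents (\<lambda>r. indicator A r) (E A)"
proof -
  assume A: "A \<in> sets borel"
  have "integral\<^sup>L (M u) (indicator A) = complex_of_real ((norm (E A u))\<^sup>2)" for u
  proof -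
    have "integral\<^sup>L (M u) (\<lambda>r. complex_of_real (indicator A r)) = of_real (measure (M u) A)"
      using A by simp
    moreover have "(\<lambda>r. complex_of_real (indicator A r)) = indicator A" by (auto simp: indicator_def)
    ultimately show ?thesis using emeasure_sm[OF A, of u] by (simp add: measure_def del: indicator_simps)
  qed
  then show ?thesis
    unfolding represents_def
    by (intro conjI allI clinear_E A exI[of _ 1] ballI) (use A in \<open>auto simp: cinner_E_self[OF A] indicator_def\<close>)
qed

lemma represents_bounded:
  assumes "g \<in> borel_measurable borel" "\<And>r. norm (g r) \<le> B"
  shows "\<exists>T. represents g T"
  using assms
proof (rule bounded_measurable_induct)
  show "\<exists>T. represents (\<lambda>z. indicator A z) T" if "A \<in> sets borel" for A
    using represents_indicator[OF that] by blast
next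
  fix gs :: "nat \<Rightarrow> real \<Rightarrow> complex" and g B
  assume a: "\<And>n. \<exists>T. represents (gs n) T" "\<And>n z. norm (gs n z) \<le> B" "\<And>z. (\<lambda>n. gs n z) \<longlonglongrightarrow> g z"
    "g \<in> borel_measurable borel"
  from a(1) obtain T where "\<And>n. represents (gs n) (T n)" by metis
  from represents_limit[OF this a(2) a(3) a(4)] show "\<exists>T. represents g T" by auto
next
  show "\<exists>T. represents (\<lambda>z. f z + g z) T" if "\<exists>T. represents f T" "\<exists>T. represents g T" for f g
    using that represents_add by blast
  show "\<exists>T. represents (\<lambda>z. c * f z) T" if "\<exists>T. represents f T" for f c
    using that represents_scale by blast
qed simp

lemma sm_E:
  assumes A: "A \<in> sets borel"
  shows "M (E A u) = density (M u) (indicator A)"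
proof (rule measure_eqI)
  fix B assume "B \<in> sets (M (E A u))"
  then have B: "B \<in> sets borel" by (simp add: sets_sm)
  have "emeasure (density (M u) (indicator A)) B = (\<integral>\<^sup>+r. indicator (A \<inter> B) r \<partial>M u)"
    using A B by (subst emeasure_density) (auto simp: indicator_inter_arith[symmetric])
  also have "\<dots> = emeasure (M u) (A \<inter> B)" using A B by (simp add: sets_sm)
  finally show "emeasure (M (E A u)) B = emeasure (density (M u) (indicator A)) B"
    using A B by (simp add: emeasure_sm E_Int Int_commute)
qed (simp add: sets_sm)

text \<open>Compressing an operator to the range of \<open>E A\<close> multiplies its symbol by the indicator of \<open>A\<close>, because it
  restricts the spectral measures to \<open>A\<close>.\<close>

lemma represents_compress:
  assumes g: "represents g T" and A: "A \<in> sets borel"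
  shows "represents (\<lambda>r. indicator A r * g r) (\<lambda>u. E A (T (E A u)))"
  unfolding represents_def
proof (intro conjI allI)
  note [measurable] = representsD(1)[OF g]
  show "(\<lambda>r. indicator A r * g r) \<in> borel_measurable borel" using A by measurable
  obtain B where "\<And>r. norm (g r) \<le> B" using g by (auto simp: represents_def)
  then show "\<exists>B. \<forall>r\<in>UNIV. norm (indicator A r * g r) \<le> B"
    by (intro exI[of _ "max B 0"]) (auto simp: indicator_def le_max_iff_disj)
  show "bounded_clinear (\<lambda>u. E A (T (E A u)))"
    by (rule bounded_clinear_compose[OF clinear_E[OF A] bounded_clinear_compose[OF representsD(2)[OF g] clinear_E[OF A]]])
  fix u
  have "cinner (E A (T (E A u))) u = cinner (T (E A u)) (E A u)" by (rule selfadj_E[OF A])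
  also have "\<dots> = integral\<^sup>L (density (M u) (\<lambda>r. ennreal (indicator A r))) g"
    by (simp add: representsD[OF g] sm_E[OF A] ennreal_indicator)
  also have "\<dots> = integral\<^sup>L (M u) (\<lambda>r. indicator A r *\<^sub>R g r)"
    by (rule integral_density) (use A in auto)
  also have "\<dots> = integral\<^sup>L (M u) (\<lambda>r. indicator A r * g r)"
    by (rule Bochner_Integration.integral_cong) (auto simp: indicator_def)
  finally show "cinner (E A (T (E A u))) u = integral\<^sup>L (M u) (\<lambda>r. indicator A r * g r)" .
qed

text \<open>Splitting the symbol over \<open>A\<close> and its complement shows that \<open>T\<close> is block diagonal for the decomposition into the
  ranges of \<open>E A\<close> and \<open>E (- A)\<close>.\<close>

lemma calculus_commute:
  assumes g: "represents g T" and A: "A \<in> sets borel"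
  shows "T (E A u) = E A (T (E A u))" "E A (T u) = T (E A u)"
proof -
  let ?R = "\<lambda>A u. E A (T (E A u))"
  have A': "- A \<in> sets borel" using A by auto
  have "represents (\<lambda>r. indicator A r * g r + indicator (- A) r * g r) (\<lambda>u. ?R A u + ?R (- A) u)"
    by (intro represents_add represents_compress g A A')
  also have "(\<lambda>r. indicator A r * g r + indicator (- A) r * g r) = g"
    by (auto simp: indicator_def fun_eq_iff)
  finally have "T = (\<lambda>u. ?R A u + ?R (- A) u)" by (rule represents_unique[OF g])
  then have T: "T u = ?R A u + ?R (- A) u" for u by (rule fun_cong)
  have z: "E (- A) (E A u) = 0" "E A (E (- A) u) = 0" for u
    using E_disjoint[OF A A'] E_disjoint[OF A' A] by auto
  show 1: "T (E A u) = E A (T (E A u))" for u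
    using T[of "E A u"] by (simp add: z idem_E[OF A] bounded_clinearD[OF clinear_E[OF A']]
        bounded_clinearD[OF representsD(2)[OF g]])
  show "E A (T u) = T (E A u)"
    using T[of u] 1 by (simp add: z idem_E[OF A] bounded_clinearD[OF clinear_E[OF A]])
qed

lemma calculus_norm_le:
  assumes g: "represents g T" and A: "A \<in> sets borel" and B: "\<And>r. r \<in> A \<Longrightarrow> norm (g r) \<le> B" "B \<ge> 0"
  shows "norm (T (E A u)) \<le> 2 * B * norm (E A u)"
proof -
  have "norm (E A (T (E A (E A u)))) \<le> 2 * B * norm (E A u)"
    by (rule represents_norm_le[OF represents_compress[OF g A]]) (use B in \<open>auto simp: indicator_def\<close>)
  then show ?thesis by (simp add: idem_E[OF A] flip: calculus_commute(1)[OF g A])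
qed

subsection \<open>The absolutely continuous part\<close>

definition ac :: "L2 set" where
  "ac = {u. absolutely_continuous lborel (M u)}"

lemma mem_ac_iff: "u \<in> ac \<longleftrightarrow> (\<forall>N\<in>null_sets lborel. E N u = 0)"
proof -
  have "N \<in> null_sets (M u) \<longleftrightarrow> E N u = 0" if "N \<in> null_sets lborel" for N
    using that by (auto simp: null_sets_def sets_sm emeasure_sm)
  then show ?thesis unfolding ac_def absolutely_continuous_def by blast
qed

lemma null_borel: "N \<in> null_sets lborel \<Longrightarrow> N \<in> sets borel" for N :: "real set"
  by auto

text \<open>The singular part of \<open>u\<close> is \<open>E N u\<close> for a Lebesgue null set \<open>N\<close> of maximal \<open>\<parallel>E N u\<parallel>\<close>; the maximum
  is attained because null sets are closed under countable unions.\<close>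

lemma exists_ac_decomposition:
  "\<exists>p\<in>ac. (\<forall>w\<in>ac. cinner (u - p) w = 0) \<and> norm p \<le> norm u"
proof -
  define s where "s = (SUP N\<in>null_sets lborel. norm (E N u))"
  have bdd: "bdd_above ((\<lambda>N. norm (E N u)) ` null_sets lborel)"
    by (intro bdd_aboveI2[of _ _ "norm u"] norm_E_le null_borel)
  have le_s: "norm (E N u) \<le> s" if "N \<in> null_sets lborel" for N
    unfolding s_def by (rule cSUP_upper[OF that bdd])
  have "\<exists>N\<in>null_sets lborel. norm (E N u) > s - inverse (Suc n)" for n
    using less_cSUP_iff[OF _ bdd, of "s - inverse (Suc n)"] by (auto simp: s_def[symmetric])
  then obtain N where N: "\<And>n. N n \<in> null_sets lborel" "\<And>n. norm (E (N n) u) > s - inverse (Suc n)"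
    by metis
  \<comment> \<open>a null set that attains the supremum\<close>
  define K where "K = (\<Union>n. N n)"
  have K: "K \<in> null_sets lborel" unfolding K_def using N(1) by (intro null_sets_UN)
  have Kb: "K \<in> sets borel" using K by (rule null_borel)
  have "s - inverse (Suc n) \<le> norm (E K u)" for n
  proof -
    have "E (N n) (E K u) = E (N n) u"
      using E_Int[of "N n" K u] N(1) Kb by (simp add: null_borel K_def Int_absorb2 UN_upper)
    then have "norm (E (N n) u) \<le> norm (E K u)" using norm_E_le[OF null_borel[OF N(1)], of n "E K u"] by simp
    then show ?thesis using N(2)[of n] by linarith
  qed
  then have "s - 0 \<le> norm (E K u)"
    by (intro LIMSEQ_le_const2[OF tendsto_diff[OF tendsto_const LIMSEQ_inverse_real_of_nat]]) auto
  then have Ks: "norm (E K u) = s" using le_s[OF K] by simp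
  define p where "p = u - E K u"
  have "E L p = 0" if L: "L \<in> null_sets lborel" for L
  proof -
    have Lb: "L \<in> sets borel" using L by (rule null_borel)
    have LK: "L - K \<in> sets borel" using Lb Kb by auto
    \<comment> \<open>if \<open>L\<close> charged \<open>u\<close> outside \<open>K\<close>, then \<open>K \<union> L\<close> would exceed the supremum\<close>
    have eq: "E (K \<union> L) u = E K u + E (L - K) u"
      using E_Un[of K "L - K" u] Kb LK by simp
    have orth: "cinner (E K u) (E (L - K) u) = 0"
      using E_disjoint[of K "L - K" u] Kb LK by (metis Diff_disjoint cinner_zero_right selfadj_E)
    have "(norm (E (K \<union> L) u))\<^sup>2 = (norm (E K u))\<^sup>2 + (norm (E (L - K) u))\<^sup>2"
      unfolding eq power2_norm_eq_inner
      using arg_cong[OF orth, of Re] by (simp add: inner_add_left inner_add_right inner_commute Re_cinner)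
    moreover have "norm (E (K \<union> L) u) \<le> norm (E K u)" using le_s[of "K \<union> L"] K L Ks by auto
    then have "(norm (E (K \<union> L) u))\<^sup>2 \<le> (norm (E K u))\<^sup>2" by (simp add: power_mono)
    ultimately have "(norm (E (L - K) u))\<^sup>2 \<le> 0" by linarith
    then have z: "E (L - K) u = 0" by simp
    have "E L u = E (L \<inter> K) u + E (L - K) u"
      using E_Un[of "L \<inter> K" "L - K" u] Lb Kb LK by (simp add: Un_Diff_Int Un_commute Int_Diff_disjoint)
    then show ?thesis using z
      by (simp add: p_def bounded_clinearD[OF clinear_E[OF Lb]] E_Int[OF Lb Kb])
  qed
  then have "p \<in> ac" by (simp add: mem_ac_iff)
  moreover have "cinner (u - p) w = 0" if "w \<in> ac" for w
    using that K selfadj_E[OF Kb, of u w] by (simp add: p_def mem_ac_iff)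
  moreover have "norm p \<le> norm u"
  proof -
    have "E (- K) u = p"
      using E_Un[of K "- K" u] Kb by (auto simp: p_def E_UNIV algebra_simps)
    then show ?thesis using norm_E_le[of "- K" u] Kb by auto
  qed
  ultimately show ?thesis by blast
qed

lemma ac_diff: "u \<in> ac \<Longrightarrow> v \<in> ac \<Longrightarrow> u - v \<in> ac"
  by (auto simp: mem_ac_iff bounded_clinearD[OF clinear_E[OF null_borel]])

lemma ac_projection_unique:
  assumes "p \<in> ac" "\<forall>w\<in>ac. cinner (u - p) w = 0" "q \<in> ac" "\<forall>w\<in>ac. cinner (u - q) w = 0"
  shows "p = q"
proof -
  have "p - q \<in> ac" using assms ac_diff by blast
  then have "cinner (u - q) (p - q) - cinner (u - p) (p - q) = 0" using assms by simp
  then have "cinner (p - q) (p - q) = 0" by (simp flip: cinner_diff_left)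
  then show ?thesis by (simp add: cinner_self)
qed

lemma ac_E:
  assumes "u \<in> ac" "A \<in> sets borel"
  shows "E A u \<in> ac"
  unfolding mem_ac_iff
proof
  fix N :: "real set" assume N: "N \<in> null_sets lborel"
  have "E N (E A u) = E A (E N u)"
    using E_Int[OF null_borel[OF N] assms(2)] E_Int[OF assms(2) null_borel[OF N]] by (simp add: Int_commute)
  then show "E N (E A u) = 0"
    using assms N by (simp add: mem_ac_iff bounded_clinearD[OF clinear_E])
qed

text \<open>The characterization has exactly one solution, so that the definite description denotes the projection
  constructed above; it commutes with \<open>E A\<close>, which preserves the absolutely continuous subspace and its complement.\<close>

lemma ac_projection:
  defines "P \<equiv> (THE P. \<forall>u. P u \<in> ac \<and> (\<forall>w\<in>ac. cinner (u - P u) w = 0))"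
  shows "norm (P u) \<le> norm u" "A \<in> sets borel \<Longrightarrow> E A (P u) = P (E A u)"
proof -
  obtain Q where Q: "\<And>u. Q u \<in> ac" "\<And>u w. w \<in> ac \<Longrightarrow> cinner (u - Q u) w = 0" "\<And>u. norm (Q u) \<le> norm u"
    using exists_ac_decomposition by metis
  have "P = Q"
    unfolding P_def
  proof (rule the_equality)
    show "R = Q" if "\<forall>u. R u \<in> ac \<and> (\<forall>w\<in>ac. cinner (u - R u) w = 0)" for R
      using that Q by (intro ext ac_projection_unique) auto
  qed (use Q in auto)
  then show "norm (P u) \<le> norm u" using Q by simp
  assume A: "A \<in> sets borel"
  have "E A (Q u) = Q (E A u)"
  proof (rule ac_projection_unique[of _ "E A u"])
    show "E A (Q u) \<in> ac" by (rule ac_E[OF Q(1) A])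
    show "\<forall>w\<in>ac. cinner (E A u - E A (Q u)) w = 0"
    proof
      fix w assume "w \<in> ac"
      then have "cinner (u - Q u) (E A w) = 0" by (intro Q(2) ac_E A)
      then show "cinner (E A u - E A (Q u)) w = 0"
        by (simp add: selfadj_E[OF A] flip: bounded_clinearD(3)[OF clinear_E[OF A]])
    qed
  qed (use Q in auto)
  then show "E A (P u) = P (E A u)" using \<open>P = Q\<close> by simp
qed

end

section \<open>Unitary operators and their moment measures\<close>

text \<open>Spectral theory is first done for a unitary operator, whose moments \<open>\<langle>U\<^sup>k u, u\<rangle>\<close> are a positive definite sequence and
  therefore the Fourier coefficients of a measure on the circle; the self-adjoint operator is reached later
  through its Cayley transform.\<close>

locale unitary =
  fixes U :: "L2 \<Rightarrow> L2"
  assumes clinear_U: "bounded_clinear U" and isometry: "\<And>u. norm (U u) = norm u" and surj_U: "surj U"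
begin

lemma inner_U: "inner (U u) (U v) = inner u v"
proof -
  have p: "4 * inner x y = (norm (x + y))\<^sup>2 - (norm (x - y))\<^sup>2" for x y :: L2
    unfolding power2_norm_eq_inner
    by (simp add: inner_add_left inner_add_right inner_diff_left inner_diff_right inner_commute)
  show ?thesis
    using p[of "U u" "U v"] p[of u v]
    by (simp add: isometry flip: bounded_clinearD(2,3)[OF clinear_U])
qed

lemma cinner_U: "cinner (U u) (U v) = cinner u v"
  by (simp add: complex_eq_iff Re_cinner Im_cinner inner_U flip: bounded_clinearD(6)[OF clinear_U])

definition V :: "L2 \<Rightarrow> L2" where "V = inv U"

lemma U_V [simp]: "U (V u) = u"
  unfolding V_def by (rule surj_f_inv_f[OF surj_U])

lemma V_U [simp]: "V (U u) = u"
proof -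
  have "norm (U (V (U u)) - U u) = norm (V (U u) - u)"
    by (simp only: isometry bounded_clinearD(3)[OF clinear_U, symmetric])
  then show ?thesis by simp
qed

lemma cinner_V: "cinner (V u) v = cinner u (U v)"
  using cinner_U[of "V u" v] by simp

lemma norm_V: "norm (V u) = norm u"
  using isometry[of "V u"] by simp

lemma clinear_V: "bounded_clinear V"
proof (rule bounded_clinearI[where K=1])
  show "V (u + v) = V u + V v" for u v by (rule cinner_eqI) (simp add: cinner_V cinner_add_left)
  show "V (scaleC c u) = scaleC c (V u)" for c u by (rule cinner_eqI) (simp add: cinner_V cinner_scaleC_left)
qed (simp add: norm_V)

lemma clinear_U_pow: "bounded_clinear (U ^^ n)"
proof (induction n)
  case 0 show ?case using bounded_clinear_id by (simp add: id_def)
next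
  case (Suc n) then show ?case using bounded_clinear_compose[OF clinear_U] by (simp add: comp_def)
qed

lemma cinner_U_pow: "cinner ((U ^^ n) u) ((U ^^ n) v) = cinner u v"
  by (induction n) (auto simp: cinner_U)

end

lemma has_bochner_integral_cis:
  fixes j :: int
  shows "has_bochner_integral lborel (\<lambda>t. indicator {-pi..pi} t *\<^sub>R cis (of_int j * t)) (if j = 0 then 2 * pi else 0)"
proof (cases "j = 0")
  case True
  have "has_bochner_integral lborel (\<lambda>t. indicator {-pi..pi} t *\<^sub>R (1::complex)) (measure lborel {-pi..pi} *\<^sub>R 1)"
    by (rule has_bochner_integral_indicator) auto
  then show ?thesis using True by (simp add: scaleR_conv_of_real)
next
  case False
  define F where "F t = exp (\<i> * of_int j * of_real t) / (\<i> * of_int j)" for t :: real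
  have "has_bochner_integral lborel (\<lambda>t. indicator {-pi..pi} t *\<^sub>R cis (of_int j * t)) (F pi - F (-pi))"
  proof (rule has_bochner_integral_FTC_Icc)
    fix t :: real
    have "((\<lambda>w. exp (\<i> * of_int j * w) / (\<i> * of_int j)) has_field_derivative exp (\<i> * of_int j * of_real t)) (at (of_real t))"
      using False by (auto intro!: derivative_eq_intros)
    from has_vector_derivative_real_field[OF this]
    have "(F has_vector_derivative exp (\<i> * of_int j * of_real t)) (at t)" unfolding F_def .
    also have "exp (\<i> * of_int j * of_real t) = cis (of_int j * t)" by (simp add: cis_conv_exp mult.assoc)
    finally show "(F has_vector_derivative cis (of_int j * t)) (at t within {-pi..pi})"
      by (rule has_vector_derivative_at_within)
  qed (auto intro!: continuous_intros)
  moreover have "F pi = F (- pi)"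
  proof -
    have "exp (\<i> * of_int j * of_real pi) = exp (\<i> * of_int j * of_real (-pi)) * exp (of_int j * (2 * of_real pi * \<i>))"
      by (subst exp_add[symmetric]) (simp add: algebra_simps)
    also have "exp (of_int j * (2 * of_real pi * \<i>)) = 1"
      by (simp add: exp_eq_1)
    finally show ?thesis by (simp add: F_def)
  qed
  ultimately show ?thesis using False by simp
qed

context unitary
begin

text \<open>The Cesaro mean of the Fourier series with coefficients \<open>\<langle>U\<^sup>k u, u\<rangle>\<close>; written as a square, it is manifestly
  nonnegative.\<close>

definition fejer :: "nat \<Rightarrow> L2 \<Rightarrow> real \<Rightarrow> real" where
  "fejer N u t = (norm (\<Sum>n<N. scaleC (cis (- real n * t)) ((U ^^ n) u)))\<^sup>2 / (2 * pi * N)"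

lemma fejer_nonneg: "fejer N u t \<ge> 0"
  by (simp add: fejer_def)

lemma fejer_expand:
  "of_real (fejer N u t) = (\<Sum>n<N. \<Sum>m<N. cis (of_int (int m - int n) * t) * cinner ((U ^^ n) u) ((U ^^ m) u)) / (2 * pi * N)"
proof -
  let ?v = "\<Sum>n<N. scaleC (cis (- real n * t)) ((U ^^ n) u)"
  have "complex_of_real ((norm ?v)\<^sup>2) = cinner ?v ?v" by (rule cinner_self[symmetric])
  also have "\<dots> = (\<Sum>n<N. \<Sum>m<N. cis (- real n * t) * (cnj (cis (- real m * t)) * cinner ((U ^^ n) u) ((U ^^ m) u)))"
    by (simp only: cinner_sum_left) (simp only: cinner_sum_right cinner_scaleC_left cinner_scaleC_right mult_ac)
  also have "\<dots> = (\<Sum>n<N. \<Sum>m<N. cis (of_int (int m - int n) * t) * cinner ((U ^^ n) u) ((U ^^ m) u))"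
    by (intro sum.cong refl) (simp add: cis_cnj cis_mult mult.assoc[symmetric] algebra_simps)
  finally show ?thesis by (simp add: fejer_def)
qed

lemma fejer_coefficients:
  assumes N: "N > 0"
  shows "has_bochner_integral lborel (\<lambda>t. (indicator {-pi..pi} t * fejer N u t) *\<^sub>R cis (real k * t))
    (of_nat (N - k) / of_nat N * cinner ((U ^^ k) u) u)"
proof -
  let ?c = "\<lambda>n m. cinner ((U ^^ n) u) ((U ^^ m) u)"
  have "has_bochner_integral lborel
     (\<lambda>t. (\<Sum>n<N. \<Sum>m<N. (indicator {-pi..pi} t *\<^sub>R cis (of_int (int k + int m - int n) * t)) * ?c n m) / (2 * pi * N))
     ((\<Sum>n<N. \<Sum>m<N. complex_of_real (if int k + int m - int n = 0 then 2 * pi else 0) * ?c n m) / (2 * pi * N))"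
    by (intro has_bochner_integral_divide_zero has_bochner_integral_sum has_bochner_integral_mult_left
        has_bochner_integral_cis)
  also have "(\<lambda>t. (\<Sum>n<N. \<Sum>m<N. (indicator {-pi..pi} t *\<^sub>R cis (of_int (int k + int m - int n) * t)) * ?c n m) / (2 * pi * N))
    = (\<lambda>t. (indicator {-pi..pi} t * fejer N u t) *\<^sub>R cis (real k * t))"
  proof
    fix t
    have "(\<Sum>n<N. \<Sum>m<N. (indicator {-pi..pi} t *\<^sub>R cis (of_int (int k + int m - int n) * t)) * ?c n m)
      = (\<Sum>n<N. \<Sum>m<N. of_real (indicator {-pi..pi} t) * cis (real k * t) * (cis (of_int (int m - int n) * t) * ?c n m))"
      by (intro sum.cong refl)
        (simp add: scaleR_conv_of_real mult.assoc, simp add: cis_mult mult.assoc[symmetric] algebra_simps)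
    also have "\<dots> = of_real (indicator {-pi..pi} t) * cis (real k * t) * (\<Sum>n<N. \<Sum>m<N. cis (of_int (int m - int n) * t) * ?c n m)"
      by (simp add: sum_distrib_left)
    finally show "(\<Sum>n<N. \<Sum>m<N. (indicator {-pi..pi} t *\<^sub>R cis (of_int (int k + int m - int n) * t)) * ?c n m) / (2 * pi * N)
      = (indicator {-pi..pi} t * fejer N u t) *\<^sub>R cis (real k * t)"
      by (simp add: scaleR_conv_of_real fejer_expand mult_ac)
  qed
  also have "(\<Sum>n<N. \<Sum>m<N. complex_of_real (if int k + int m - int n = 0 then 2 * pi else 0) * ?c n m) / (2 * pi * N)
    = of_nat (N - k) / of_nat N * cinner ((U ^^ k) u) u"
  proof -
    have "(\<Sum>n<N. \<Sum>m<N. complex_of_real (if int k + int m - int n = 0 then 2 * pi else 0) * ?c n m)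
      = (\<Sum>m<N. \<Sum>n<N. if n = k + m then 2 * pi * ?c (k + m) m else 0)"
      by (subst sum.swap) (auto intro!: sum.cong)
    also have "\<dots> = (\<Sum>m<N. if k + m < N then 2 * pi * ?c (k + m) m else 0)"
      by (intro sum.cong refl) (simp add: sum.delta)
    also have "\<dots> = (\<Sum>m<N. if k + m < N then 2 * pi * cinner ((U ^^ k) u) u else 0)"
    proof -
      have "?c (k + m) m = cinner ((U ^^ k) u) u" for m
        by (simp add: add.commute[of k m] funpow_add cinner_U_pow)
      then show ?thesis by (simp cong: if_cong)
    qed
    also have "\<dots> = (\<Sum>m\<in>{m. m < N - k}. 2 * pi * cinner ((U ^^ k) u) u)"
      by (rule sum.mono_neutral_cong_right) auto
    finally show ?thesis using N by (simp add: field_simps)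
  qed
  finally show ?thesis .
qed

lemma borel_measurable_fejer [measurable]: "fejer N u \<in> borel_measurable borel"
proof -
  have "continuous_on UNIV (\<lambda>t. complex_of_real (fejer N u t))"
    unfolding fejer_expand divide_inverse by (intro continuous_intros)
  then have "(\<lambda>t. Re (complex_of_real (fejer N u t))) \<in> borel_measurable borel"
    by (intro borel_measurable_continuous_onI continuous_on_Re)
  then show ?thesis by simp
qed

text \<open>Herglotz's theorem: the Fejer densities are probability densities on \<open>[-\<pi>, \<pi>]\<close> whose Fourier
  coefficients tend to \<open>\<langle>U\<^sup>k u, u\<rangle>\<close>, and Helly's selection theorem provides a limit measure.\<close>

lemma moment_measure_unit:
  assumes u: "norm u = 1"
  shows "\<exists>\<nu>::complex measure. prob_space \<nu> \<and> sets \<nu> = sets borel \<and> (AE z in \<nu>. z \<in> sphere 0 1) \<and>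
    (\<forall>k. integral\<^sup>L \<nu> (\<lambda>z. z ^ k) = cinner ((U ^^ k) u) u)"
proof -
  define \<mu> where "\<mu> N = density lborel (\<lambda>t. ennreal (indicator {-pi..pi} t * fejer (Suc N) u t))" for N
  have nn: "indicator {-pi..pi} t * fejer (Suc N) u t \<ge> 0" for N t by (simp add: fejer_nonneg)
  have coeff: "integral\<^sup>L (\<mu> N) (\<lambda>t. cis (real k * t)) = of_nat (Suc N - k) / of_nat (Suc N) * cinner ((U ^^ k) u) u" for N k
  proof -
    have "integral\<^sup>L (\<mu> N) (\<lambda>t. cis (real k * t)) = integral\<^sup>L lborel (\<lambda>t. (indicator {-pi..pi} t * fejer (Suc N) u t) *\<^sub>R cis (real k * t))"
      unfolding \<mu>_def
      by (rule integral_density) (auto intro!: nn borel_measurable_continuous_onI continuous_intros)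
    then show ?thesis using has_bochner_integral_integral_eq[OF fejer_coefficients[of "Suc N" u k]] by simp
  qed
  have mass: "emeasure (\<mu> N) A = 1" if A: "A \<in> sets borel" "{-pi..pi} \<subseteq> A" for A N
  proof -
    have hb: "has_bochner_integral lborel (\<lambda>t. complex_of_real (indicator {-pi..pi} t * fejer (Suc N) u t)) 1"
      using fejer_coefficients[of "Suc N" u 0] u
      by (simp add: cinner_self scaleR_conv_of_real del: of_nat_Suc)
    have "has_bochner_integral lborel (\<lambda>t. indicator {-pi..pi} t * fejer (Suc N) u t) 1"
      using has_bochner_integral_bounded_linear[OF bounded_linear_Re hb] by simp
    then have "(\<integral>\<^sup>+t. ennreal (indicator {-pi..pi} t * fejer (Suc N) u t) \<partial>lborel) = ennreal 1"
      by (subst nn_integral_eq_integral) (auto simp: has_bochner_integral_iff nn)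
    moreover have "emeasure (\<mu> N) A = (\<integral>\<^sup>+t. ennreal (indicator {-pi..pi} t * fejer (Suc N) u t) * indicator A t \<partial>lborel)"
      unfolding \<mu>_def using A by (subst emeasure_density) auto
    moreover have "\<dots> = (\<integral>\<^sup>+t. ennreal (indicator {-pi..pi} t * fejer (Suc N) u t) \<partial>lborel)"
      by (rule nn_integral_cong) (use A in \<open>auto simp: indicator_def\<close>)
    ultimately show ?thesis by simp
  qed
  have sp: "space (\<mu> N) = UNIV" "sets (\<mu> N) = sets borel" for N by (auto simp: \<mu>_def)
  have rd: "real_distribution (\<mu> N)" for N
    unfolding real_distribution_def real_distribution_axioms_def
    by (auto simp: sp mass intro!: prob_spaceI)
  \<comment> \<open>all these measures live on \<open>[-\<pi>, \<pi>]\<close>, so that no mass can escape\<close>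
  have "tight \<mu>"
    unfolding tight_def
  proof (intro conjI allI impI rd)
    fix e :: real assume e: "e > 0"
    have "measure (\<mu> n) {-4<..4} = 1" for n
    proof -
      have "{-pi..pi} \<subseteq> {-4<..4}" using pi_less_4 by auto
      then show ?thesis unfolding measure_def using mass[of "{-4<..4}" n] by simp
    qed
    then show "\<exists>a b. a < b \<and> (\<forall>n. 1 - e < measure (\<mu> n) {a<..b})"
      using e by (intro exI[of _ "-4"] exI[of _ 4]) simp
  qed
  from tight_imp_convergent_subsubsequence[OF this strict_mono_id] obtain r L where
    r: "strict_mono r" and L: "real_distribution L" and w: "weak_conv_m (\<mu> \<circ> r) L" by auto
  interpret L: real_distribution L by (rule L)
  have lim: "integral\<^sup>L L (\<lambda>t. cis (real k * t)) = cinner ((U ^^ k) u) u" for k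
  proof (rule LIMSEQ_unique)
    show "(\<lambda>n. integral\<^sup>L ((\<mu> \<circ> r) n) (\<lambda>t. cis (real k * t))) \<longlonglongrightarrow> integral\<^sup>L L (\<lambda>t. cis (real k * t))"
    proof (rule weak_conv_imp_integral_bdd_continuous_conv[OF _ L w, where B=1])
      show "isCont (\<lambda>t. cis (real k * t)) t" for t
        unfolding cis_conv_exp by (intro continuous_intros)
    qed (auto simp: rd)
    have "(\<lambda>N. complex_of_real (real (Suc N - k) / real (Suc N)) * cinner ((U ^^ k) u) u) \<longlonglongrightarrow> complex_of_real 1 * cinner ((U ^^ k) u) u"
    proof (intro tendsto_intros)
      have "(\<lambda>N. 1 - real k * inverse (real (Suc N))) \<longlonglongrightarrow> 1 - real k * 0"
        by (intro tendsto_intros LIMSEQ_inverse_real_of_nat)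
      then have l: "(\<lambda>N. 1 - real k * inverse (real (Suc N))) \<longlonglongrightarrow> 1" by simp
      have ev: "eventually (\<lambda>N. 1 - real k * inverse (real (Suc N)) = real (Suc N - k) / real (Suc N)) sequentially"
        unfolding eventually_sequentially by (intro exI[of _ k]) (auto simp: field_simps of_nat_diff)
      show "(\<lambda>N. real (Suc N - k) / real (Suc N)) \<longlonglongrightarrow> 1"
        by (rule Lim_transform_eventually[OF l ev])
    qed
    from LIMSEQ_subseq_LIMSEQ[OF this r]
    show "(\<lambda>n. integral\<^sup>L ((\<mu> \<circ> r) n) (\<lambda>t. cis (real k * t))) \<longlonglongrightarrow> cinner ((U ^^ k) u) u"
      by (simp add: coeff comp_def)
  qed
  have cis_m [measurable]: "cis \<in> borel_measurable borel"
    by (intro borel_measurable_continuous_onI continuous_intros)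
  \<comment> \<open>the limit measure on the line is wrapped around the circle\<close>
  show ?thesis
  proof (intro exI[of _ "distr L borel cis"] conjI allI)
    show "prob_space (distr L borel cis)" by (rule L.prob_space_distr) simp
    show "AE z in distr L borel cis. z \<in> sphere 0 1" by (subst AE_distr_iff) auto
    fix k
    have "integral\<^sup>L (distr L borel cis) (\<lambda>z. z ^ k) = integral\<^sup>L L (\<lambda>t. cis t ^ k)"
      by (rule integral_distr) auto
    also have "\<dots> = cinner ((U ^^ k) u) u" using lim[of k] by (simp only: Complex.DeMoivre)
    finally show "integral\<^sup>L (distr L borel cis) (\<lambda>z. z ^ k) = cinner ((U ^^ k) u) u"
      .
  qed simp
qed

lemma moment_measure:
  "\<exists>\<nu>::complex measure. finite_measure \<nu> \<and> sets \<nu> = sets borel \<and> measure \<nu> UNIV \<le> (norm u)\<^sup>2 \<and>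
    (AE z in \<nu>. z \<in> sphere 0 1) \<and> (\<forall>k. integral\<^sup>L \<nu> (\<lambda>z. z ^ k) = cinner ((U ^^ k) u) u)"
proof (cases "u = 0")
  case True
  then show ?thesis
    by (intro exI[of _ "null_measure borel"])
      (auto simp: bounded_clinearD[OF clinear_U_pow] null_sets_def intro: finite_measureI intro!: AE_I'[of UNIV])
next
  case False
  define v where "v = inverse (norm u) *\<^sub>R u"
  have v: "norm v = 1" and u: "u = norm u *\<^sub>R v" using False by (auto simp: v_def)
  obtain \<nu> :: "complex measure" where \<nu>: "prob_space \<nu>" and s: "sets \<nu> = sets borel" and ae: "AE z in \<nu>. z \<in> sphere 0 1"
    and m: "\<And>k. integral\<^sup>L \<nu> (\<lambda>z. z ^ k) = cinner ((U ^^ k) v) v"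
    using moment_measure_unit[OF v] by blast
  note [measurable_cong] = s
  interpret prob_space \<nu> by (rule \<nu>)
  have sp: "space \<nu> = UNIV" using sets_eq_imp_space_eq[OF s] by simp
  define \<rho> where "\<rho> = density \<nu> (\<lambda>_. ennreal ((norm u)\<^sup>2))"
  have e: "emeasure \<rho> UNIV = ennreal ((norm u)\<^sup>2)"
    unfolding \<rho>_def using emeasure_space_1 sp s by (subst emeasure_density) (auto simp: nn_integral_cmult)
  show ?thesis
  proof (intro exI[of _ \<rho>] conjI allI)
    have "space \<rho> = UNIV" by (simp add: \<rho>_def sp)
    then show "finite_measure \<rho>" by (intro finite_measureI) (simp add: e)
    show "sets \<rho> = sets borel" by (simp add: \<rho>_def s)
    show "measure \<rho> UNIV \<le> (norm u)\<^sup>2" by (simp add: measure_def e)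
    show "AE z in \<rho>. z \<in> sphere 0 1" unfolding \<rho>_def using ae by (subst AE_density) auto
    fix k
    have "integral\<^sup>L \<rho> (\<lambda>z. z ^ k) = integral\<^sup>L \<nu> (\<lambda>z. (norm u)\<^sup>2 *\<^sub>R z ^ k)"
      unfolding \<rho>_def by (rule integral_density) auto
    also have "\<dots> = (norm u)\<^sup>2 *\<^sub>R cinner ((U ^^ k) v) v" by (simp add: m)
    also have "\<dots> = cinner ((U ^^ k) (norm u *\<^sub>R v)) (norm u *\<^sub>R v)"
      by (simp only: bounded_clinearD(7)[OF clinear_U_pow] cinner_scaleR_left cinner_scaleR_right)
        (simp add: scaleR_conv_of_real power2_eq_square)
    finally show "integral\<^sup>L \<rho> (\<lambda>z. z ^ k) = cinner ((U ^^ k) u) u" using u by simp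
  qed
qed

end

section \<open>The spectral theorem\<close>

lemma adjoint_exists:
  assumes T: "bounded_clinear T"
  shows "\<exists>T'. bounded_clinear T' \<and> (\<forall>u v. cinner (T' u) v = cinner u (T v))"
proof -
  obtain K where K: "\<And>v. norm (T v) \<le> norm v * K"
    using bounded_linear.bounded[OF bounded_clinearD(1)[OF T]] by blast
  show ?thesis
  proof (rule operator_of_sesquilinear_form[where K=K])
    show "norm (cinner u (T v)) \<le> K * norm u * norm v" for u v
      using order_trans[OF norm_cinner_le mult_left_mono[OF K norm_ge_zero]] by (simp add: mult_ac)
  qed (simp_all add: bounded_clinearD[OF T] cinner_add_left cinner_add_right cinner_scaleC_left cinner_scaleC_right)
qed

context unitary
begin

text \<open>The choice is harmless: on the circle the measure is determined by its moments.\<close>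

definition circ :: "L2 \<Rightarrow> complex measure" where
  "circ u = (SOME \<nu>. finite_measure \<nu> \<and> sets \<nu> = sets borel \<and> measure \<nu> UNIV \<le> (norm u)\<^sup>2 \<and>
    (AE z in \<nu>. z \<in> sphere 0 1) \<and> (\<forall>k. integral\<^sup>L \<nu> (\<lambda>z. z ^ k) = cinner ((U ^^ k) u) u))"

lemma circ: "finite_measure (circ u) \<and> sets (circ u) = sets borel \<and> measure (circ u) UNIV \<le> (norm u)\<^sup>2 \<and>
    (AE z in circ u. z \<in> sphere 0 1) \<and> (\<forall>k. integral\<^sup>L (circ u) (\<lambda>z. z ^ k) = cinner ((U ^^ k) u) u)"
  unfolding circ_def by (rule someI_ex[OF moment_measure])

sublocale measure_family circ "sphere 0 1"
  by (rule measure_family.intro) (use circ in blast)+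

lemma circ_moment: "integral\<^sup>L (circ u) (\<lambda>z. z ^ k) = cinner ((U ^^ k) u) u"
  using circ by blast

text \<open>Laurent polynomials in \<open>z\<close>, paired with the same expression in \<open>U\<close>.\<close>

inductive laurent :: "(complex \<Rightarrow> complex) \<Rightarrow> (L2 \<Rightarrow> L2) \<Rightarrow> bool" where
  one: "laurent (\<lambda>z. 1) (\<lambda>u. u)"
| scale: "laurent g T \<Longrightarrow> laurent (\<lambda>z. c * g z) (\<lambda>u. scaleC c (T u))"
| add: "laurent g T \<Longrightarrow> laurent h R \<Longrightarrow> laurent (\<lambda>z. g z + h z) (\<lambda>u. T u + R u)"
| times_z: "laurent g T \<Longrightarrow> laurent (\<lambda>z. z * g z) (\<lambda>u. U (T u))"
| times_cnj: "laurent g T \<Longrightarrow> laurent (\<lambda>z. cnj z * g z) (\<lambda>u. V (T u))"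

lemma borel_measurable_cnj [measurable]: "cnj \<in> borel_measurable borel"
  by (intro borel_measurable_continuous_onI continuous_intros)

lemma laurent_mult:
  assumes "laurent g T" "laurent h R"
  shows "laurent (\<lambda>z. g z * h z) (\<lambda>u. T (R u))"
  using assms
proof (induction rule: laurent.induct)
  case one then show ?case by simp
next
  case (scale g T c)
  from laurent.scale[OF scale.IH[OF scale.prems], of c] show ?case by (simp add: mult.assoc)
next
  case (add g T g' T')
  from laurent.add[OF add.IH(1)[OF add.prems] add.IH(2)[OF add.prems]] show ?case by (simp add: distrib_right)
next
  case (times_z g T)
  from laurent.times_z[OF times_z.IH[OF times_z.prems]] show ?case by (simp add: mult.assoc)
next
  case (times_cnj g T)
  from laurent.times_cnj[OF times_cnj.IH[OF times_cnj.prems]] show ?case by (simp add: mult.assoc)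
qed

lemma laurent_continuous: "laurent g T \<Longrightarrow> continuous_on UNIV g"
  by (induction rule: laurent.induct) (auto intro!: continuous_intros)

lemma laurent_measurable: "laurent g T \<Longrightarrow> g \<in> borel_measurable borel"
  by (intro borel_measurable_continuous_onI laurent_continuous)

lemma laurent_bounded: "laurent g T \<Longrightarrow> \<exists>B. \<forall>z\<in>sphere 0 1. norm (g z) \<le> B"
  using compact_continuous_image[of "sphere 0 (1::real)" g] laurent_continuous[of g T] continuous_on_subset[of UNIV g "sphere 0 1"]
    compact_imp_bounded[of "g ` sphere 0 1"] by (auto simp: bounded_iff)

lemma laurent_clinear: "laurent g T \<Longrightarrow> bounded_clinear T"
  by (induction rule: laurent.induct)
    (auto intro: bounded_clinear_add bounded_clinear_compose[OF clinear_U] bounded_clinear_compose[OF clinear_V]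
      bounded_clinear_compose[OF bounded_clinear_scaleC] bounded_clinear_id[unfolded id_def])

lemma laurent_integrable: "laurent g T \<Longrightarrow> integrable (circ u) g"
  using laurent_bounded[of g T] integrable_bounded[OF laurent_measurable] by blast

lemma laurent_z_pow: "laurent g T \<Longrightarrow> laurent (\<lambda>z. z ^ n * g z) (\<lambda>u. (U ^^ n) (T u))"
proof (induction n)
  case (Suc n)
  from times_z[OF Suc.IH[OF Suc.prems]] show ?case by (simp add: mult.assoc)
qed simp

lemma laurent_cnj_pow: "laurent g T \<Longrightarrow> laurent (\<lambda>z. cnj z ^ n * g z) (\<lambda>u. (V ^^ n) (T u))"
proof (induction n)
  case (Suc n)
  from times_cnj[OF Suc.IH[OF Suc.prems]] show ?case by (simp add: mult.assoc)
qed simp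

lemma integral_circ_cong:
  assumes "f \<in> borel_measurable borel" "g \<in> borel_measurable borel" "\<And>z. norm z = 1 \<Longrightarrow> f z = (g z :: complex)"
  shows "integral\<^sup>L (circ u) f = integral\<^sup>L (circ u) g"
proof (rule integral_cong_AE)
  show "AE z in circ u. f z = g z" using supp_M[of u] by eventually_elim (use assms in auto)
qed (use assms in auto)

text \<open>The induction carries the products with all powers of \<open>z\<close> and of its conjugate, because
  \<open>z * cnj z = 1\<close> only holds on the circle.\<close>

lemma laurent_moments:
  assumes "laurent g T"
  shows "integral\<^sup>L (circ u) (\<lambda>z. z ^ n * g z) = cinner ((U ^^ n) (T u)) u \<and>
    integral\<^sup>L (circ u) (\<lambda>z. cnj z ^ n * g z) = cinner ((V ^^ n) (T u)) u"
  using assms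
proof (induction arbitrary: n rule: laurent.induct)
  case one
  have "integral\<^sup>L (circ u) (\<lambda>z. cnj (z ^ n)) = cnj (cinner ((U ^^ n) u) u)"
    by (simp only: Bochner_Integration.integral_cnj circ_moment)
  also have "\<dots> = cinner ((V ^^ n) u) u"
  proof -
    have "cinner ((V ^^ n) w) x = cinner w ((U ^^ n) x)" for w x
      by (induction n arbitrary: w x) (simp_all add: cinner_V funpow_swap1)
    then show ?thesis by (simp flip: cinner_commute)
  qed
  finally show ?case by (simp add: circ_moment)
next
  case (scale g T c)
  have "(\<lambda>z. z ^ n * (c * g z)) = (\<lambda>z. c * (z ^ n * g z))" "(\<lambda>z. cnj z ^ n * (c * g z)) = (\<lambda>z. c * (cnj z ^ n * g z))"
    by (auto simp: fun_eq_iff)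
  moreover have "(V ^^ n) (scaleC c w) = scaleC c ((V ^^ n) w)" for w
    by (induction n) (auto simp: bounded_clinearD[OF clinear_V])
  ultimately show ?case
    using scale.IH[of n] by (simp add: bounded_clinearD[OF clinear_U_pow] cinner_scaleC_left)
next
  case (add g T h R)
  have V: "(V ^^ n) (w + w') = (V ^^ n) w + (V ^^ n) w'" for w w'
    by (induction n) (auto simp: bounded_clinearD[OF clinear_V])
  have i: "integrable (circ u) (\<lambda>z. z ^ n * g z)" "integrable (circ u) (\<lambda>z. z ^ n * h z)"
    "integrable (circ u) (\<lambda>z. cnj z ^ n * g z)" "integrable (circ u) (\<lambda>z. cnj z ^ n * h z)"
    using add.hyps by (auto intro: laurent_integrable laurent_z_pow laurent_cnj_pow)
  show ?case
    using add.IH[of n] i by (simp add: distrib_left V bounded_clinearD[OF clinear_U_pow] cinner_add_left)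
next
  case (times_z g T)
  note m [measurable] = laurent_measurable[OF times_z.hyps]
  have 1: "(\<lambda>z. z ^ n * (z * g z)) = (\<lambda>z. z ^ Suc n * g z)" by (auto simp: fun_eq_iff)
  have 2: "integral\<^sup>L (circ u) (\<lambda>z. cnj z ^ n * (z * g z)) = cinner ((V ^^ n) (U (T u))) u"
  proof (cases n)
    case 0 then show ?thesis using times_z.IH[of 1] by simp
  next
    case (Suc k)
    have "integral\<^sup>L (circ u) (\<lambda>z. cnj z ^ n * (z * g z)) = integral\<^sup>L (circ u) (\<lambda>z. cnj z ^ k * g z)"
    proof (rule integral_circ_cong)
      fix z :: complex assume "norm z = 1"
      then have "z * cnj z = 1" by (simp flip: complex_norm_square)
      then have "cnj z ^ k * (z * cnj z) * g z = cnj z ^ k * g z" by simp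
      then show "cnj z ^ n * (z * g z) = cnj z ^ k * g z" by (simp add: Suc mult_ac)
    qed measurable
    also have "\<dots> = cinner ((V ^^ n) (U (T u))) u"
      using times_z.IH[of k] by (simp add: Suc funpow_swap1)
    finally show ?thesis .
  qed
  show ?case using 1 2 times_z.IH[of "Suc n"] by (simp add: funpow_swap1)
next
  case (times_cnj g T)
  note m [measurable] = laurent_measurable[OF times_cnj.hyps]
  have 1: "(\<lambda>z. cnj z ^ n * (cnj z * g z)) = (\<lambda>z. cnj z ^ Suc n * g z)" by (auto simp: fun_eq_iff)
  have 2: "integral\<^sup>L (circ u) (\<lambda>z. z ^ n * (cnj z * g z)) = cinner ((U ^^ n) (V (T u))) u"
  proof (cases n)
    case 0 then show ?thesis using times_cnj.IH[of 1] by simp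
  next
    case (Suc k)
    have "integral\<^sup>L (circ u) (\<lambda>z. z ^ n * (cnj z * g z)) = integral\<^sup>L (circ u) (\<lambda>z. z ^ k * g z)"
    proof (rule integral_circ_cong)
      fix z :: complex assume "norm z = 1"
      then have "z * cnj z = 1" by (simp flip: complex_norm_square)
      then have "z ^ k * (z * cnj z) * g z = z ^ k * g z" by simp
      then show "z ^ n * (cnj z * g z) = z ^ k * g z" by (simp add: Suc mult_ac)
    qed measurable
    also have "\<dots> = cinner ((U ^^ n) (V (T u))) u"
      using times_cnj.IH[of k] by (simp add: Suc funpow_swap1)
    finally show ?thesis .
  qed
  show ?case using 1 2 times_cnj.IH[of "Suc n"] by (simp add: funpow_swap1)
qed

lemma represents_laurent: "laurent g T \<Longrightarrow> represents g T"
  using laurent_moments[of g T _ 0] laurent_measurable laurent_bounded laurent_clinear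
  by (auto simp: represents_def)

lemma laurent_real_polynomial:
  assumes "real_polynomial_function p"
  shows "\<exists>T. laurent (\<lambda>z. complex_of_real (p z)) T"
  using assms
proof (induction rule: real_polynomial_function.induct)
  case (linear f)
  interpret bounded_linear f by fact
  define a where "a = (of_real (f 1) - \<i> * of_real (f \<i>)) / 2"
  have "complex_of_real (f z) = a * (z * 1) + cnj a * (cnj z * 1)" for z
  proof -
    have z: "z = Re z *\<^sub>R 1 + Im z *\<^sub>R \<i>" by (simp add: complex_eq_iff)
    have "f z = f (Re z *\<^sub>R 1 + Im z *\<^sub>R \<i>)" by (rule arg_cong[OF z])
    also have "\<dots> = Re z * f 1 + Im z * f \<i>" by (simp only: add scaleR real_scaleR_def)
    finally show ?thesis by (simp add: a_def complex_eq_iff field_simps)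
  qed
  then show ?case
    using laurent.add[OF laurent.scale[OF times_z[OF one], of a] laurent.scale[OF times_cnj[OF one], of "cnj a"]] by auto
next
  case (const c)
  then show ?case using laurent.scale[OF one, of "of_real c"] by auto
next
  case (add f g) then show ?case using laurent.add by (auto simp: of_real_add) blast
next
  case (mult f g) then show ?case using laurent_mult by (auto simp: of_real_mult) blast
qed

text \<open>Starting from Laurent polynomials, limits that are bounded and pointwise on the circle reach first
  the continuous functions (Stone--Weierstrass), then indicators of open sets, then all bounded
  Borel functions.\<close>

lemma circle_induct:
  assumes g: "g \<in> borel_measurable borel" "\<And>z. norm (g z) \<le> B"
    and laurent: "\<And>g T. laurent g T \<Longrightarrow> P g"
    and add: "\<And>f g. P f \<Longrightarrow> P g \<Longrightarrow> P (\<lambda>z. f z + g z)"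
    and scale: "\<And>f c. P f \<Longrightarrow> P (\<lambda>z. c * f z)"
    and lim: "\<And>gs g B. (\<And>n. P (gs n)) \<Longrightarrow> (\<And>n z. z \<in> sphere 0 1 \<Longrightarrow> norm (gs n z) \<le> B) \<Longrightarrow>
      (\<And>z. z \<in> sphere 0 1 \<Longrightarrow> (\<lambda>n. gs n z) \<longlonglongrightarrow> g z) \<Longrightarrow> g \<in> borel_measurable borel \<Longrightarrow> P g"
  shows "P g"
proof -
  have one: "P (\<lambda>z. 1)" by (rule laurent[OF laurent.one])
  have cont: "P (\<lambda>z. complex_of_real (f z))" if f: "continuous_on UNIV f" for f :: "complex \<Rightarrow> real"
  proof -
    have fS: "continuous_on (sphere 0 1) f" using f continuous_on_subset by blast
    have "\<exists>p. real_polynomial_function p \<and> (\<forall>z\<in>sphere 0 1. \<bar>f z - p z\<bar> < inverse (Suc n))" for n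
    proof -
      have pos: "0 < inverse (real (Suc n))" by simp
      show ?thesis
      proof (rule Stone_Weierstrass_real_polynomial_function[OF compact_sphere fS pos])
        fix g assume "real_polynomial_function g" "\<And>z. z \<in> sphere 0 1 \<Longrightarrow> \<bar>f z - g z\<bar> < inverse (real (Suc n))"
        then show ?thesis by (intro exI[of _ g] conjI ballI)
      qed
    qed
    then have "\<forall>n. \<exists>p. real_polynomial_function p \<and> (\<forall>z\<in>sphere 0 1. \<bar>f z - p z\<bar> < inverse (Suc n))" ..
    from choice[OF this] obtain p where
      p': "\<forall>n. real_polynomial_function (p n) \<and> (\<forall>z\<in>sphere 0 1. \<bar>f z - p n z\<bar> < inverse (Suc n))" ..
    then have p: "real_polynomial_function (p n)" "z \<in> sphere 0 1 \<Longrightarrow> \<bar>f z - p n z\<bar> < inverse (Suc n)" for n z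
      by simp_all
    obtain C where C: "\<And>z. z \<in> sphere 0 1 \<Longrightarrow> norm (f z) \<le> C"
      using compact_imp_bounded[OF compact_continuous_image[OF fS compact_sphere]]
      unfolding bounded_iff by blast
    show ?thesis
    proof (rule lim[where gs="\<lambda>n z. complex_of_real (p n z)" and B="C + 1"])
      show "P (\<lambda>z. complex_of_real (p n z))" for n using laurent_real_polynomial[OF p(1)] laurent by blast
      show "norm (complex_of_real (p n z)) \<le> C + 1" if "z \<in> sphere 0 1" for n z
      proof -
        have "inverse (real (Suc n)) \<le> 1" by (simp add: inverse_le_1_iff)
        then show ?thesis using C[OF that] p(2)[OF that, of n] by simp
      qed
      show "(\<lambda>n. complex_of_real (p n z)) \<longlonglongrightarrow> complex_of_real (f z)" if "z \<in> sphere 0 1" for z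
      proof (intro tendsto_of_real)
        have "(\<lambda>n. p n z - f z) \<longlonglongrightarrow> 0"
          by (rule Lim_null_comparison[OF _ LIMSEQ_inverse_real_of_nat])
            (use p(2)[OF that] in \<open>auto intro!: always_eventually less_imp_le simp: abs_minus_commute\<close>)
        then show "(\<lambda>n. p n z) \<longlonglongrightarrow> f z" by (rule LIM_zero_cancel)
      qed
      show "(\<lambda>z. complex_of_real (f z)) \<in> borel_measurable borel"
        by (intro borel_measurable_continuous_onI continuous_intros f)
    qed
  qed
  have opn: "P (\<lambda>z. indicator A z)" if A: "open A" for A :: "complex set"
  proof (cases "A = UNIV")
    case True then show ?thesis using one by (simp add: indicator_def)
  next
    case False
    define d where "d z = infdist z (- A)" for z
    show ?thesis
    proof (rule lim[where gs="\<lambda>n z. complex_of_real (min 1 (real n * d z))" and B=1])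
      show "P (\<lambda>z. complex_of_real (min 1 (real n * d z)))" for n
        unfolding d_def by (intro cont continuous_intros continuous_on_min)
      show "norm (complex_of_real (min 1 (real n * d z))) \<le> 1" for n z
        by (simp add: d_def infdist_nonneg)
      show "(\<lambda>n. complex_of_real (min 1 (real n * d z))) \<longlonglongrightarrow> indicator A z" for z
      proof (cases "z \<in> A")
        case True
        have "d z \<noteq> 0"
          using in_closed_iff_infdist_zero[of "- A" z] A False True by (auto simp: d_def)
        then have "d z > 0" using infdist_nonneg[of z "- A"] by (simp add: d_def)
        then obtain k where k: "1 < real k * d z" using reals_Archimedean3 by blast
        have "min 1 (real n * d z) = 1" if "n \<ge> k" for n
        proof -
          have "real k * d z \<le> real n * d z" using that \<open>d z > 0\<close> by (intro mult_right_mono) auto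
          then show ?thesis using k by linarith
        qed
        then have "eventually (\<lambda>n. complex_of_real (min 1 (real n * d z)) = indicator A z) sequentially"
          unfolding eventually_sequentially using True by (intro exI[of _ k]) simp
        then show ?thesis by (rule tendsto_eventually)
      qed (simp add: d_def)
      show "indicator A \<in> borel_measurable borel" using A by simp
    qed
  qed
  have borel: "P (\<lambda>z. indicator A z)" if A: "A \<in> sets borel" for A :: "complex set"
  proof -
    have "Int_stable {S :: complex set. open S}" "{S :: complex set. open S} \<subseteq> Pow UNIV"
      by (auto intro: Int_stableI)
    moreover have "A \<in> sigma_sets UNIV {S. open S}" using A by (simp add: borel_def)
    ultimately show ?thesis
    proof (induction rule: sigma_sets_induct_disjoint)
      case (basic A) then show ?case by (simp add: opn)
    next
      case empty show ?case using opn[of "{}"] by simp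
    next
      case (compl A)
      have "(\<lambda>z. 1 + (-1) * indicator A z) = (\<lambda>z. indicator (UNIV - A) z :: complex)"
        by (auto simp: indicator_def)
      then show ?case using add[OF one scale[OF compl(2), of "-1"]] by simp
    next
      case (union F)
      have Fm: "F i \<in> sets borel" for i using union(2) by (auto simp: borel_def)
      have fin: "P (\<lambda>z. \<Sum>i<n. indicator (F i) z)" for n
        by (induction n) (use scale[OF one, of 0] in \<open>simp_all add: add union(3)\<close>)
      have "(\<Sum>i<n. indicator (F i) z) = (indicator (\<Union>i<n. F i) z :: complex)" for n z
        using union(1) by (subst indicator_UN_disjoint) (auto simp: disjoint_family_on_def)
      with fin have fin': "P (\<lambda>z. indicator (\<Union>i<n. F i) z)" for n by simp
      show ?case
      proof (rule lim[where B=1])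
        show "P (\<lambda>z. indicator (\<Union>i<n. F i) z)" for n by (rule fin')
        show "norm (indicator (\<Union>i<n. F i) z :: complex) \<le> 1" for n z by (auto simp: indicator_def)
        show "(\<lambda>n. indicator (\<Union>i<n. F i) z) \<longlonglongrightarrow> (indicator (\<Union> (range F)) z :: complex)" for z
          by (rule LIMSEQ_indicator_UN)
        show "indicator (\<Union> (range F)) \<in> borel_measurable borel" using Fm by simp
      qed
    qed
  qed
  show ?thesis
  proof (rule bounded_measurable_induct[OF g])
    fix gs g B assume "\<And>n. P (gs n)" "\<And>n z. norm (gs n z) \<le> B" "\<And>z. (\<lambda>n. gs n z) \<longlonglongrightarrow> g z" "g \<in> borel_measurable borel"
    then show "P g" by (intro lim[of gs B g]) auto
  qed (use borel add scale in auto)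
qed

lemma represents_exists:
  assumes g: "g \<in> borel_measurable borel" "\<And>z. z \<in> sphere 0 1 \<Longrightarrow> norm (g z) \<le> B"
  shows "\<exists>T. represents g T"
proof -
  let ?g = "\<lambda>z. indicator (sphere 0 1) z * g z"
  note [measurable] = g(1)
  have S: "sphere 0 1 \<in> sets (borel :: complex measure)" by simp
  have "?g \<in> borel_measurable borel" using S by measurable
  moreover have "norm (?g z) \<le> max B 0" for z using g(2)[of z] by (auto simp: indicator_def)
  ultimately have "\<exists>T. represents ?g T"
  proof (rule circle_induct)
    show "\<exists>T. represents (\<lambda>z. f z + g z) T" if "\<exists>T. represents f T" "\<exists>T. represents g T" for f g
      using that represents_add by blast
    show "\<exists>T. represents (\<lambda>z. c * f z) T" if "\<exists>T. represents f T" for f c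
      using that represents_scale by blast
    fix gs :: "nat \<Rightarrow> complex \<Rightarrow> complex" and g B
    assume a: "\<And>n. \<exists>T. represents (gs n) T" "\<And>n z. z \<in> sphere 0 1 \<Longrightarrow> norm (gs n z) \<le> B"
      "\<And>z. z \<in> sphere 0 1 \<Longrightarrow> (\<lambda>n. gs n z) \<longlonglongrightarrow> g z" "g \<in> borel_measurable borel"
    from a(1) obtain T where "\<And>n. represents (gs n) (T n)" by metis
    from represents_limit[OF this a(2) a(3) a(4)] show "\<exists>T. represents g T" by auto
  qed (use represents_laurent in blast)
  then obtain T where "represents ?g T" by blast
  then have "represents g T" by (rule represents_cong) (use g(1) in auto)
  then show ?thesis by blast
qed

lemma represents_adjoint:
  assumes "represents g T" "bounded_clinear T'" "\<And>u v. cinner (T' u) v = cinner u (T v)"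
  shows "represents (\<lambda>z. cnj (g z)) T'"
proof -
  have [measurable]: "g \<in> borel_measurable borel" using assms(1) by (rule representsD)
  have "cinner (T' u) u = cnj (integral\<^sup>L (circ u) g)" for u
    by (simp add: assms(3) cinner_commute[of u "T u"] representsD(3)[OF assms(1)])
  moreover have "(\<lambda>z. cnj (g z)) \<in> borel_measurable borel" by measurable
  ultimately show ?thesis using assms by (auto simp: represents_def)
qed

text \<open>Multiplicativity holds for Laurent polynomials and is transported to bounded Borel functions by two successive
  inductions, one for each factor.\<close>

lemma represents_mult:
  assumes g: "represents g T" and h: "represents h R"
  shows "represents (\<lambda>z. g z * h z) (\<lambda>u. T (R u))"
proof -
  have S: "sphere 0 1 \<in> sets (borel :: complex measure)" by simp
  have trunc: "(\<lambda>z. indicator (sphere 0 1) z * g z) \<in> borel_measurable borel"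
    "\<exists>B. \<forall>z. norm (indicator (sphere 0 1) z * g z) \<le> B" if g: "represents g T" for g :: "complex \<Rightarrow> complex" and T
  proof -
    note [measurable] = representsD(1)[OF g]
    show "(\<lambda>z. indicator (sphere 0 1) z * g z) \<in> borel_measurable borel" using S by measurable
    obtain B where "\<forall>z\<in>sphere 0 1. norm (g z) \<le> B" using g by (auto simp: represents_def)
    then show "\<exists>B. \<forall>z. norm (indicator (sphere 0 1) z * g z) \<le> B"
      by (intro exI[of _ "max B 0"]) (auto simp: indicator_def le_max_iff_disj)
  qed
  let ?P1 = "\<lambda>h R g. \<exists>T. represents g T \<and> represents (\<lambda>z. g z * h z) (\<lambda>u. T (R u))"
  have step1: "represents (\<lambda>z. g z * h z) (\<lambda>u. T (R u))"
    if g: "represents g T" and h: "laurent h R" for g T h R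
  proof -
    obtain B where B: "\<And>z. norm (indicator (sphere 0 1) z * g z) \<le> B" using trunc(2)[OF g] by blast
    have "?P1 h R (\<lambda>z. indicator (sphere 0 1) z * g z)"
    proof (rule circle_induct[OF trunc(1)[OF g] B])
      show "?P1 h R g" if "laurent g T" for g T
        using that h represents_laurent laurent_mult by blast
    next
      fix f g assume "?P1 h R f" "?P1 h R g"
      then obtain T1 T2 where a: "represents f T1" "represents (\<lambda>z. f z * h z) (\<lambda>u. T1 (R u))"
        "represents g T2" "represents (\<lambda>z. g z * h z) (\<lambda>u. T2 (R u))" by blast
      show "?P1 h R (\<lambda>z. f z + g z)"
        using represents_add[OF a(1,3)] represents_add[OF a(2,4)]
        by (intro exI[of _ "\<lambda>u. T1 u + T2 u"]) (simp add: distrib_right)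
    next
      fix f c assume "?P1 h R f"
      then obtain T1 where a: "represents f T1" "represents (\<lambda>z. f z * h z) (\<lambda>u. T1 (R u))" by blast
      show "?P1 h R (\<lambda>z. c * f z)"
        using represents_scale[OF a(1), of c] represents_scale[OF a(2), of c]
        by (intro exI[of _ "\<lambda>u. scaleC c (T1 u)"]) (simp add: mult.assoc)
    next
      fix gs :: "nat \<Rightarrow> complex \<Rightarrow> complex" and g B
      assume a: "\<And>n. ?P1 h R (gs n)" "\<And>n z. z \<in> sphere 0 1 \<Longrightarrow> norm (gs n z) \<le> B"
        "\<And>z. z \<in> sphere 0 1 \<Longrightarrow> (\<lambda>n. gs n z) \<longlonglongrightarrow> g z" "g \<in> borel_measurable borel"
      from a(1) obtain T where T: "\<And>n. represents (gs n) (T n)"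
          "\<And>n. represents (\<lambda>z. gs n z * h z) (\<lambda>u. T n (R u))" by metis
      obtain C where C: "\<And>z. z \<in> sphere 0 1 \<Longrightarrow> norm (h z) \<le> C" using laurent_bounded[OF h] by blast
      note [measurable] = a(4) laurent_measurable[OF h]
      obtain L where L: "represents g L" "\<And>u v. (\<lambda>n. cinner (T n u) v) \<longlonglongrightarrow> cinner (L u) v"
        using represents_limit[OF T(1) a(2) a(3) a(4)] by blast
      have "\<exists>L'. represents (\<lambda>z. g z * h z) L' \<and> (\<forall>u v. (\<lambda>n. cinner (T n (R u)) v) \<longlonglongrightarrow> cinner (L' u) v)"
      proof (rule represents_limit[OF T(2), where B="B * C"])
        show "norm (gs n z * h z) \<le> B * C" if "z \<in> sphere 0 1" for n z
          unfolding norm_mult using a(2)[OF that, of n] C[OF that]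
          by (intro mult_mono) (auto intro: order_trans[OF norm_ge_zero])
        show "(\<lambda>n. gs n z * h z) \<longlonglongrightarrow> g z * h z" if "z \<in> sphere 0 1" for z
          by (intro tendsto_intros a(3) that)
      qed measurable
      then obtain L' where L': "represents (\<lambda>z. g z * h z) L'"
        "\<And>u v. (\<lambda>n. cinner (T n (R u)) v) \<longlonglongrightarrow> cinner (L' u) v" by blast
      have "L' = (\<lambda>u. L (R u))"
        by (intro ext cinner_eqI LIMSEQ_unique[OF L'(2) L(2)])
      then show "?P1 h R g" using L(1) L'(1) by blast
    qed
    then obtain T' where T': "represents (\<lambda>z. indicator (sphere 0 1) z * g z) T'"
      "represents (\<lambda>z. indicator (sphere 0 1) z * g z * h z) (\<lambda>u. T' (R u))" by blast
    note [measurable] = representsD(1)[OF g] laurent_measurable[OF h]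
    have "represents g T'" by (rule represents_cong[OF T'(1)]) auto
    then have "T' = T" using represents_unique[OF g] by blast
    moreover have "represents (\<lambda>z. g z * h z) (\<lambda>u. T' (R u))"
      by (rule represents_cong[OF T'(2)]) auto
    ultimately show ?thesis by simp
  qed
  let ?P2 = "\<lambda>h. \<exists>R. represents h R \<and> represents (\<lambda>z. g z * h z) (\<lambda>u. T (R u))"
  obtain B where B: "\<And>z. norm (indicator (sphere 0 1) z * h z) \<le> B" using trunc(2)[OF h] by blast
  obtain T' where T': "bounded_clinear T'" "\<And>u v. cinner (T' u) v = cinner u (T v)"
    using adjoint_exists[OF representsD(2)[OF g]] by blast
  have T'': "cinner (T u) v = cinner u (T' v)" for u v
    using T'(2)[of v u] by (metis cinner_commute)
  have "?P2 (\<lambda>z. indicator (sphere 0 1) z * h z)"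
  proof (rule circle_induct[OF trunc(1)[OF h] B])
    show "?P2 h" if "laurent h R" for h R
      using that represents_laurent step1[OF g] by blast
  next
    fix f f' assume "?P2 f" "?P2 f'"
    then obtain T1 T2 where a: "represents f T1" "represents (\<lambda>z. g z * f z) (\<lambda>u. T (T1 u))"
      "represents f' T2" "represents (\<lambda>z. g z * f' z) (\<lambda>u. T (T2 u))" by blast
    show "?P2 (\<lambda>z. f z + f' z)"
      using represents_add[OF a(1,3)] represents_add[OF a(2,4)]
      by (intro exI[of _ "\<lambda>u. T1 u + T2 u"]) (simp add: distrib_left bounded_clinearD[OF representsD(2)[OF g]])
  next
    fix f c assume "?P2 f"
    then obtain T1 where a: "represents f T1" "represents (\<lambda>z. g z * f z) (\<lambda>u. T (T1 u))" by blast
    show "?P2 (\<lambda>z. c * f z)"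
      using represents_scale[OF a(1), of c] represents_scale[OF a(2), of c]
      by (intro exI[of _ "\<lambda>u. scaleC c (T1 u)"]) (simp add: mult.left_commute bounded_clinearD[OF representsD(2)[OF g]])
  next
    fix hs :: "nat \<Rightarrow> complex \<Rightarrow> complex" and h B
    assume a: "\<And>n. ?P2 (hs n)" "\<And>n z. z \<in> sphere 0 1 \<Longrightarrow> norm (hs n z) \<le> B"
      "\<And>z. z \<in> sphere 0 1 \<Longrightarrow> (\<lambda>n. hs n z) \<longlonglongrightarrow> h z" "h \<in> borel_measurable borel"
    from a(1) obtain R where R: "\<And>n. represents (hs n) (R n)"
        "\<And>n. represents (\<lambda>z. g z * hs n z) (\<lambda>u. T (R n u))" by metis
    obtain C where C: "\<And>z. z \<in> sphere 0 1 \<Longrightarrow> norm (g z) \<le> C" using g unfolding represents_def by blast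
    note [measurable] = a(4) representsD(1)[OF g]
    obtain L where L: "represents h L" "\<And>u v. (\<lambda>n. cinner (R n u) v) \<longlonglongrightarrow> cinner (L u) v"
      using represents_limit[OF R(1) a(2) a(3) a(4)] by blast
    have "\<exists>L'. represents (\<lambda>z. g z * h z) L' \<and> (\<forall>u v. (\<lambda>n. cinner (T (R n u)) v) \<longlonglongrightarrow> cinner (L' u) v)"
    proof (rule represents_limit[OF R(2), where B="C * B"])
      show "norm (g z * hs n z) \<le> C * B" if "z \<in> sphere 0 1" for n z
        unfolding norm_mult using a(2)[OF that, of n] C[OF that]
        by (intro mult_mono) (auto intro: order_trans[OF norm_ge_zero])
      show "(\<lambda>n. g z * hs n z) \<longlonglongrightarrow> g z * h z" if "z \<in> sphere 0 1" for z
        by (intro tendsto_intros a(3) that)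
    qed measurable
    then obtain L' where L': "represents (\<lambda>z. g z * h z) L'"
      "\<And>u v. (\<lambda>n. cinner (T (R n u)) v) \<longlonglongrightarrow> cinner (L' u) v" by blast
    have "L' = (\<lambda>u. T (L u))"
      by (intro ext cinner_eqI LIMSEQ_unique[OF L'(2)]) (simp add: T'' L(2))
    then show "?P2 h" using L(1) L'(1) by blast
  qed
  then obtain R' where R': "represents (\<lambda>z. indicator (sphere 0 1) z * h z) R'"
    "represents (\<lambda>z. g z * (indicator (sphere 0 1) z * h z)) (\<lambda>u. T (R' u))" by blast
  note [measurable] = representsD(1)[OF g] representsD(1)[OF h]
  have "represents h R'" by (rule represents_cong[OF R'(1)]) auto
  then have "R' = R" using represents_unique[OF h] by blast
  moreover have "represents (\<lambda>z. g z * h z) (\<lambda>u. T (R' u))"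
    by (rule represents_cong[OF R'(2)]) auto
  ultimately show ?thesis by simp
qed

text \<open>The operator \<open>T\<^sup>* T\<close> represents \<open>|g|\<^sup>2\<close>.\<close>

lemma norm_represents_sq:
  assumes g: "represents g T"
  shows "integrable (circ u) (\<lambda>z. (norm (g z))\<^sup>2)" "(norm (T u))\<^sup>2 = (\<integral>z. (norm (g z))\<^sup>2 \<partial>circ u)"
proof -
  obtain T' where T': "bounded_clinear T'" "\<And>u v. cinner (T' u) v = cinner u (T v)"
    using adjoint_exists[OF representsD(2)[OF g]] by blast
  have "represents (\<lambda>z. cnj (g z) * g z) (\<lambda>u. T' (T u))"
    by (rule represents_mult[OF represents_adjoint[OF g T'] g])
  also have "(\<lambda>z. cnj (g z) * g z) = (\<lambda>z. complex_of_real ((norm (g z))\<^sup>2))"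
    by (simp only: complex_norm_square mult.commute)
  finally have r: "represents (\<lambda>z. complex_of_real ((norm (g z))\<^sup>2)) (\<lambda>u. T' (T u))" .
  show "integrable (circ u) (\<lambda>z. (norm (g z))\<^sup>2)"
    using integrable_Re[OF representsD(4)[OF r]] by simp
  have "complex_of_real ((norm (T u))\<^sup>2) = complex_of_real (\<integral>z. (norm (g z))\<^sup>2 \<partial>circ u)"
    using representsD(3)[OF r, of u] by (simp only: T'(2) cinner_self integral_complex_of_real)
  then show "(norm (T u))\<^sup>2 = (\<integral>z. (norm (g z))\<^sup>2 \<partial>circ u)" by (simp only: of_real_eq_iff)
qed

end

context unitary
begin

text \<open>The projection-valued measure of the unitary operator on the Borel sets of the plane, carried by the circle.\<close>

definition F :: "complex set \<Rightarrow> L2 \<Rightarrow> L2" where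
  "F B = (THE T. represents (\<lambda>z. indicator B z) T)"

lemma represents_F:
  assumes B: "B \<in> sets borel"
  shows "represents (\<lambda>z. indicator B z) (F B)"
proof -
  have "\<exists>T. represents (\<lambda>z. indicator B z) T"
    by (rule represents_exists[where B=1]) (use B in \<open>auto simp: indicator_def\<close>)
  then obtain T where T: "represents (\<lambda>z. indicator B z) T" by blast
  have "F B = T" unfolding F_def
    by (rule the_equality[where P="represents (\<lambda>z. indicator B z)", OF T]) (rule represents_unique[OF _ T])
  then show ?thesis using T by simp
qed

lemma F_eqI: "B \<in> sets borel \<Longrightarrow> represents (\<lambda>z. indicator B z) T \<Longrightarrow> F B = T"
  using represents_unique represents_F by blast

lemma cinner_F_self:
  assumes B: "B \<in> sets borel"
  shows "cinner (F B u) u = of_real (measure (circ u) B)"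
proof -
  have "integral\<^sup>L (circ u) (\<lambda>z. complex_of_real (indicator B z)) = of_real (measure (circ u) B)"
    using B by (simp add: sets_M)
  moreover have "(\<lambda>z. complex_of_real (indicator B z)) = indicator B" by (auto simp: indicator_def)
  ultimately show ?thesis using representsD(3)[OF represents_F[OF B], of u] by simp
qed

lemma F_selfadj:
  assumes B: "B \<in> sets borel"
  shows "cinner (F B u) v = cinner u (F B v)"
proof -
  obtain T' where T': "bounded_clinear T'" "\<And>u v. cinner (T' u) v = cinner u (F B v)"
    using adjoint_exists[OF representsD(2)[OF represents_F[OF B]]] by blast
  have "represents (\<lambda>z. cnj (indicator B z)) T'" by (rule represents_adjoint[OF represents_F[OF B] T'])
  also have "(\<lambda>z. cnj (indicator B z)) = (\<lambda>z. indicator B z)" by (auto simp: indicator_def)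
  finally have "F B = T'" by (rule F_eqI[OF B])
  then show ?thesis using T'(2) by simp
qed

lemma F_idem: "B \<in> sets borel \<Longrightarrow> F B (F B u) = F B u"
proof -
  assume B: "B \<in> sets borel"
  have "represents (\<lambda>z. indicator B z * indicator B z) (\<lambda>u. F B (F B u))"
    by (rule represents_mult[OF represents_F[OF B] represents_F[OF B]])
  also have "(\<lambda>z. indicator B z * indicator B z) = (\<lambda>z. indicator B z :: complex)" by (auto simp: indicator_def)
  finally show ?thesis by (metis F_eqI[OF B])
qed

lemma norm_F_sq: "B \<in> sets borel \<Longrightarrow> (norm (F B u))\<^sup>2 = measure (circ u) B"
  by (metis F_idem F_selfadj cinner_F_self cinner_self of_real_eq_iff)

lemma F_UNIV: "F UNIV = id"
  by (rule F_eqI) (use represents_laurent[OF laurent.one] in \<open>simp_all add: id_def indicator_def\<close>)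

lemma F_diff:
  assumes "A \<in> sets borel" "B \<in> sets borel" "A \<subseteq> B"
  shows "F (B - A) u = F B u - F A u"
proof -
  have "represents (\<lambda>z. indicator B z - indicator A z) (\<lambda>u. F B u - F A u)"
    by (intro represents_diff represents_F assms)
  also have "(\<lambda>z. indicator B z - indicator A z) = (\<lambda>z. indicator (B - A) z :: complex)"
    using assms(3) by (auto simp: indicator_def fun_eq_iff)
  finally have "F (B - A) = (\<lambda>u. F B u - F A u)" by (intro F_eqI) (use assms in auto)
  then show ?thesis by simp
qed

lemma F_tendsto:
  assumes B: "\<And>n. B n \<in> sets borel" "incseq B"
  shows "(\<lambda>n. F (B n) u) \<longlonglongrightarrow> F (\<Union>n. B n) u"
proof -
  interpret fm: finite_measure "circ u" by (rule finite_M)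
  have U: "(\<Union>n. B n) \<in> sets borel" using B by auto
  have "(\<lambda>n. measure (circ u) ((\<Union>n. B n) - B n)) \<longlonglongrightarrow> measure (circ u) (\<Inter>n. (\<Union>n. B n) - B n)"
    by (rule fm.finite_Lim_measure_decseq) (use B U in \<open>auto simp: sets_M decseq_def incseq_def\<close>)
  also have "(\<Inter>n. (\<Union>n. B n) - B n) = {}" by auto
  finally have "(\<lambda>n. (norm (F (\<Union>n. B n) u - F (B n) u))\<^sup>2) \<longlonglongrightarrow> 0"
    using B U by (simp add: norm_F_sq UN_upper flip: F_diff)
  then have "(\<lambda>n. sqrt ((norm (F (\<Union>n. B n) u - F (B n) u))\<^sup>2)) \<longlonglongrightarrow> sqrt 0"
    by (rule tendsto_real_sqrt)
  then have "(\<lambda>n. norm (F (B n) u - F (\<Union>n. B n) u)) \<longlonglongrightarrow> 0"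
    by (simp add: norm_minus_commute)
  then show ?thesis using LIM_zero_cancel tendsto_norm_zero_iff by blast
qed

lemma F_sums:
  assumes B: "\<And>n::nat. B n \<in> sets borel" "disjoint_family B"
  shows "(\<lambda>n. F (B n) u) sums F (\<Union>n. B n) u"
proof -
  have m: "(\<Union>i<n. B i) \<in> sets borel" for n using B(1) by (intro sets.countable_UN') auto
  have "(\<Sum>i<n. F (B i) u) = F (\<Union>i<n. B i) u" for n
  proof (induction n)
    case 0
    have "F {} u = 0" using F_diff[of UNIV UNIV u] by simp
    then show ?case by simp
  next
    case (Suc n)
    have sub: "(\<Union>i<n. B i) \<subseteq> (\<Union>i<Suc n. B i)" by (intro UN_mono) auto
    have "(\<Union>i<Suc n. B i) - (\<Union>i<n. B i) = B n"
    proof -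
      have "B i \<inter> B n = {}" if "i < n" for i using B(2) that by (simp add: disjoint_family_on_def)
      then show ?thesis by (auto simp: less_Suc_eq)
    qed
    then have "F (B n) u = F (\<Union>i<Suc n. B i) u - F (\<Union>i<n. B i) u"
      using F_diff[OF m[of n] m[of "Suc n"] sub, of u] by (simp only:)
    then show ?case using Suc by simp
  qed
  moreover have "(\<lambda>n. F (\<Union>i<n. B i) u) \<longlonglongrightarrow> F (\<Union>n. \<Union>i<n. B i) u"
    by (rule F_tendsto[OF m]) (unfold incseq_def, intro allI impI UN_mono, auto)
  moreover have "(\<Union>n. \<Union>i<n. B i) = (\<Union>n. B n)" by auto
  ultimately show ?thesis by (simp add: sums_def)
qed

text \<open>The mass of \<open>B\<close> under \<open>circ (T u)\<close> is \<open>\<parallel>F B (T u)\<parallel>\<^sup>2\<close>, and \<open>F B\<close> composed with \<open>T\<close> represents \<open>g\<close> times the indicator of \<open>B\<close>.\<close>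

lemma circ_represents:
  assumes g: "represents g T"
  shows "circ (T u) = density (circ u) (\<lambda>z. ennreal ((norm (g z))\<^sup>2))"
proof (rule measure_eqI)
  note [measurable] = representsD(1)[OF g]
  show "sets (circ (T u)) = sets (density (circ u) (\<lambda>z. ennreal ((norm (g z))\<^sup>2)))" by (simp add: sets_M)
  fix B assume "B \<in> sets (circ (T u))"
  then have B: "B \<in> sets borel" by (simp add: sets_M)
  then have [measurable]: "B \<in> sets (circ u)" by (simp add: sets_M)
  have r: "represents (\<lambda>z. indicator B z * g z) (\<lambda>u. F B (T u))"
    by (rule represents_mult[OF represents_F[OF B] g])
  have eq: "(norm (indicator B z * g z))\<^sup>2 = (norm (g z))\<^sup>2 * indicator B z" for z by (auto simp: indicator_def)
  interpret T: finite_measure "circ (T u)" by (rule finite_M)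
  have "emeasure (circ (T u)) B = ennreal ((norm (F B (T u)))\<^sup>2)"
    by (simp add: norm_F_sq[OF B] T.emeasure_eq_measure)
  also have "\<dots> = ennreal (\<integral>z. (norm (g z))\<^sup>2 * indicator B z \<partial>circ u)"
    using norm_represents_sq(2)[OF r, of u] unfolding eq by simp
  also have "\<dots> = (\<integral>\<^sup>+z. ennreal ((norm (g z))\<^sup>2 * indicator B z) \<partial>circ u)"
    by (rule nn_integral_eq_integral[symmetric]) (use norm_represents_sq(1)[OF r, of u] in \<open>simp_all add: eq\<close>)
  also have "\<dots> = emeasure (density (circ u) (\<lambda>z. ennreal ((norm (g z))\<^sup>2))) B"
    by (subst emeasure_density) (auto intro!: nn_integral_cong simp: indicator_def)
  finally show "emeasure (circ (T u)) B = emeasure (density (circ u) (\<lambda>z. ennreal ((norm (g z))\<^sup>2))) B" .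
qed

text \<open>The inverse Cayley transform maps the circle without \<open>1\<close> to the real line; the point \<open>1\<close>,
  which carries no mass for the operators of interest, goes to \<open>0\<close>.\<close>

definition cayley_inv :: "complex \<Rightarrow> real" where
  "cayley_inv z = Re (\<i> * (1 + z) / (1 - z))"

lemma cayley_inv_measurable [measurable]: "cayley_inv \<in> borel_measurable borel"
proof -
  have "(\<lambda>z. \<i> * (1 + z) / (1 - z)) \<in> borel_measurable (borel :: complex measure)"
    by (intro borel_measurable_divide borel_measurable_times borel_measurable_add borel_measurable_diff) auto
  then show ?thesis unfolding cayley_inv_def by measurable
qed

definition E :: "real set \<Rightarrow> L2 \<Rightarrow> L2" where
  "E A = F (cayley_inv -` A)"

lemma vimage_cayley: "A \<in> sets borel \<Longrightarrow> cayley_inv -` A \<in> sets borel"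
  using measurable_sets[OF cayley_inv_measurable] by simp

lemma pvm_E: "projection_valued_measure E"
  unfolding projection_valued_measure_def E_def
proof (intro conjI ballI allI impI)
  fix A :: "real set" assume A: "A \<in> sets borel"
  show "bounded_clinear (F (cayley_inv -` A))" using representsD(2)[OF represents_F[OF vimage_cayley[OF A]]] .
  show "F (cayley_inv -` A) (F (cayley_inv -` A) u) = F (cayley_inv -` A) u" for u by (rule F_idem[OF vimage_cayley[OF A]])
  show "cinner (F (cayley_inv -` A) u) v = cinner u (F (cayley_inv -` A) v)" for u v by (rule F_selfadj[OF vimage_cayley[OF A]])
next
  show "F (cayley_inv -` UNIV) = id" by (simp add: F_UNIV)
next
  fix A :: "nat \<Rightarrow> real set" and u assume A: "range A \<subseteq> sets borel" "disjoint_family A"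
  show "(\<lambda>n. F (cayley_inv -` A n) u) sums F (cayley_inv -` (\<Union>n. A n)) u"
    unfolding vimage_UN
    by (rule F_sums) (use A in \<open>auto simp: disjoint_family_on_def intro!: vimage_cayley\<close>)
qed

lemma scalar_measure_E: "scalar_measure E u = distr (circ u) borel cayley_inv"
proof (rule measure_eqI)
  note pvm = pvm.intro[OF pvm_E]
  note sets_sm = pvm.sets_sm[OF pvm]
  interpret fm: finite_measure "circ u" by (rule finite_M)
  show "sets (scalar_measure E u) = sets (distr (circ u) borel cayley_inv)" by (simp add: sets_sm)
  fix A assume "A \<in> sets (scalar_measure E u)"
  then have A: "A \<in> sets borel" by (simp add: sets_sm)
  have "emeasure (scalar_measure E u) A = ennreal (measure (circ u) (cayley_inv -` A))"
    unfolding pvm.emeasure_sm[OF pvm A] unfolding E_def norm_F_sq[OF vimage_cayley[OF A]] ..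
  then show "emeasure (scalar_measure E u) A = emeasure (distr (circ u) borel cayley_inv) A"
    using A by (subst emeasure_distr) (simp_all add: fm.emeasure_eq_measure measurable_cong_sets[OF sets_M refl])
qed

end

text \<open>The graph of a self-adjoint operator, by the range criterion.\<close>

locale selfadjoint_graph =
  fixes H :: L2_operator
  assumes graph_add: "(u, w) \<in> H \<Longrightarrow> (u', w') \<in> H \<Longrightarrow> (u + u', w + w') \<in> H"
    and graph_scale: "(u, w) \<in> H \<Longrightarrow> (scaleC c u, scaleC c w) \<in> H"
    and symmetric: "(u, w) \<in> H \<Longrightarrow> (u', w') \<in> H \<Longrightarrow> cinner w u' = cinner u w'"
    and single_valued: "(0, w) \<in> H \<Longrightarrow> w = 0"
    and range_plus: "\<exists>u w. (u, w) \<in> H \<and> w + scaleC \<i> u = f"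
    and range_minus: "\<exists>u w. (u, w) \<in> H \<and> w - scaleC \<i> u = f"
begin

lemma graph_diff: "(u, w) \<in> H \<Longrightarrow> (u', w') \<in> H \<Longrightarrow> (u - u', w - w') \<in> H"
  using graph_add[OF _ graph_scale[of u' w' "-1"], of u w] by (simp add: scaleC_minus1)

lemma norm_shift:
  assumes "(u, w) \<in> H"
  shows "(norm (w + scaleC \<i> u))\<^sup>2 = (norm w)\<^sup>2 + (norm u)\<^sup>2" "(norm (w - scaleC \<i> u))\<^sup>2 = (norm w)\<^sup>2 + (norm u)\<^sup>2"
proof -
  have "cinner w u = cnj (cinner w u)" using symmetric[OF assms assms] cinner_commute[of w u] by simp
  then have "inner w (scaleC \<i> u) = 0" by (simp add: complex_eq_iff flip: Im_cinner)
  moreover have "norm (scaleC \<i> u) = norm u" by (simp add: norm_scaleC)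
  ultimately show "(norm (w + scaleC \<i> u))\<^sup>2 = (norm w)\<^sup>2 + (norm u)\<^sup>2" "(norm (w - scaleC \<i> u))\<^sup>2 = (norm w)\<^sup>2 + (norm u)\<^sup>2"
    using norm_add_Pythagorean[of w "scaleC \<i> u"] norm_add_Pythagorean[of w "- scaleC \<i> u"]
    by (simp_all add: orthogonal_def)
qed

text \<open>The Cayley transform \<open>(H - i)(H + i)\<^sup>-\<^sup>1\<close>: one range condition makes it everywhere defined, the other one makes it
  surjective, and by symmetry \<open>\<parallel>H u \<plusminus> i u\<parallel>\<^sup>2 = \<parallel>H u\<parallel>\<^sup>2 + \<parallel>u\<parallel>\<^sup>2\<close> for both signs, so that it is isometric.\<close>

lemma cayley_transform:
  "\<exists>U. unitary U \<and> (\<forall>f. (scaleC (1 / (2 * \<i>)) (f - U f), scaleC (1/2) (f + U f)) \<in> H)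
     \<and> (\<forall>u w. (u, w) \<in> H \<longrightarrow> (\<exists>f. u = scaleC (1 / (2 * \<i>)) (f - U f) \<and> w = scaleC (1/2) (f + U f)))"
proof -
  obtain p q where pq: "\<And>f. (p f, q f) \<in> H" "\<And>f. q f + scaleC \<i> (p f) = f" using range_plus by metis
  have uniq: "u = p f \<and> w = q f" if "(u, w) \<in> H" "w + scaleC \<i> u = f" for u w f
  proof -
    have "(norm ((w - q f) + scaleC \<i> (u - p f)))\<^sup>2 = (norm (w - q f))\<^sup>2 + (norm (u - p f))\<^sup>2"
      by (rule norm_shift(1)[OF graph_diff[OF that(1) pq(1)]])
    moreover have "(w - q f) + scaleC \<i> (u - p f) = 0"
      using that(2) pq(2)[of f] by (simp add: scaleC_diff_right algebra_simps)
    ultimately have "(norm (w - q f))\<^sup>2 + (norm (u - p f))\<^sup>2 = 0" by simp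
    then show ?thesis by (simp add: sum_power2_eq_zero_iff)
  qed
  define U where "U f = q f - scaleC \<i> (p f)" for f
  have q: "q f = scaleC (1/2) (f + U f)" and p: "p f = scaleC (1 / (2 * \<i>)) (f - U f)" for f
  proof -
    have "f + U f = q f + q f" using pq(2)[of f] by (simp add: U_def algebra_simps)
    also have "\<dots> = scaleC 2 (q f)" using scaleC_add_left[of 1 1 "q f"] by simp
    finally show "q f = scaleC (1/2) (f + U f)" by simp
    have "f - U f = scaleC \<i> (p f) + scaleC \<i> (p f)" using pq(2)[of f] by (simp add: U_def algebra_simps)
    also have "\<dots> = scaleC (2 * \<i>) (p f)" using scaleC_add_left[of \<i> \<i> "p f"] by simp
    finally show "p f = scaleC (1 / (2 * \<i>)) (f - U f)" by simp
  qed
  have "unitary U"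
  proof
    have norm_U: "norm (U f) = norm f" for f
    proof -
      have "(norm (U f))\<^sup>2 = (norm f)\<^sup>2"
        using norm_shift[OF pq(1)[of f]] unfolding pq(2) U_def by simp
      then show ?thesis by (simp add: power2_eq_iff_nonneg)
    qed
    show "bounded_clinear U"
    proof (rule bounded_clinearI[where K=1])
      fix f g c
      have "p (f + g) = p f + p g \<and> q (f + g) = q f + q g"
        using uniq[OF graph_add[OF pq(1) pq(1)], of f g "f + g"] pq(2)[of f] pq(2)[of g]
        by (simp add: scaleC_add_right algebra_simps)
      then show "U (f + g) = U f + U g" by (simp add: U_def scaleC_add_right)
      have "p (scaleC c f) = scaleC c (p f) \<and> q (scaleC c f) = scaleC c (q f)"
        using uniq[OF graph_scale[OF pq(1)], of c f "scaleC c f"] arg_cong[OF pq(2)[of f], of "scaleC c"]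
        by (simp add: scaleC_add_right mult.commute)
      then show "U (scaleC c f) = scaleC c (U f)" by (simp add: U_def scaleC_diff_right mult.commute)
    qed (simp add: norm_U)
    show "norm (U f) = norm f" for f by (rule norm_U)
    show "surj U"
      unfolding surj_def
    proof
      fix y
      obtain u w where "(u, w) \<in> H" "w - scaleC \<i> u = y" using range_minus by blast
      then have "U (w + scaleC \<i> u) = y" using uniq[of u w "w + scaleC \<i> u"] by (simp add: U_def)
      then show "\<exists>x. y = U x" by blast
    qed
  qed
  moreover have "(scaleC (1 / (2 * \<i>)) (f - U f), scaleC (1/2) (f + U f)) \<in> H" for f
    using pq(1)[of f] by (simp only: p[symmetric] q[symmetric])
  moreover have "\<exists>f. u = scaleC (1 / (2 * \<i>)) (f - U f) \<and> w = scaleC (1/2) (f + U f)" if "(u, w) \<in> H" for u w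
    using uniq[OF that refl] by (intro exI[of _ "w + scaleC \<i> u"]) (simp only: p[symmetric] q[symmetric])
  ultimately show ?thesis by blast
qed

text \<open>The projections are transported from the Cayley transform \<open>U\<close>.  With \<open>u = (f - U f) / (2 \<i>)\<close>, the spectral measure of
  \<open>u\<close> is \<open>|1 - z|\<^sup>2 / 4\<close> times that of \<open>f\<close>, which cancels the singularity of the inverse Cayley transform at \<open>1\<close>; this gives
  the form identity and finite second moments on the domain.  Conversely, a finite second moment makes
  \<open>1 / (1 - z)\<close> square integrable with respect to the measure of \<open>u\<close>, and the limit of its truncations, applied to \<open>u\<close>, is an \<open>f\<close>
  with \<open>f - U f = u\<close>.\<close>

theorem spectral_resolution_exists: "\<exists>E. spectral_resolution H E"
proof -
  obtain U where "unitary U" and H1: "\<And>f. (scaleC (1 / (2 * \<i>)) (f - U f), scaleC (1/2) (f + U f)) \<in> H"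
    and H2: "\<And>u w. (u, w) \<in> H \<Longrightarrow> \<exists>f. u = scaleC (1 / (2 * \<i>)) (f - U f) \<and> w = scaleC (1/2) (f + U f)"
    using cayley_transform by blast
  interpret unitary U by fact
  note [measurable_cong] = sets_M
  define g :: "complex \<Rightarrow> complex" where "g z = 1 / (2 * \<i>) * (1 + (-1) * (z * 1))" for z
  have rg: "represents g (\<lambda>u. scaleC (1 / (2 * \<i>)) (u + scaleC (-1) (U u)))"
    unfolding g_def by (intro represents_laurent laurent.intros)
  then have rg: "represents g (\<lambda>f. scaleC (1 / (2 * \<i>)) (f - U f))" by (simp add: scaleC_minus1)
  have ng: "(norm (g z))\<^sup>2 = (norm (1 - z))\<^sup>2 / 4" for z
    by (simp add: g_def norm_mult norm_divide power_divide)
  let ?c = cayley_inv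
  have [measurable]: "(\<lambda>z. norm (1 - z)) \<in> borel_measurable (borel :: complex measure)"
    by (intro borel_measurable_continuous_onI continuous_intros)
  have c_le: "(?c z)\<^sup>2 * ((norm (1 - z))\<^sup>2 / 4) \<le> 1" if "norm z = 1" for z
  proof (cases "z = 1")
    case False
    have "norm (1 + z) \<le> 2" using norm_triangle_ineq[of 1 z] that by simp
    moreover have "\<bar>?c z\<bar> \<le> norm (1 + z) / norm (1 - z)"
      unfolding cayley_inv_def using abs_Re_le_cmod[of "\<i> * (1 + z) / (1 - z)"] by (simp add: norm_mult norm_divide)
    ultimately have "\<bar>?c z\<bar> * norm (1 - z) \<le> 2" using False by (simp add: field_simps)
    then have "(\<bar>?c z\<bar> * norm (1 - z))\<^sup>2 \<le> 2\<^sup>2" by (intro power_mono) auto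
    then show ?thesis by (simp add: power_mult_distrib)
  qed simp
  have c_eq: "?c z * ((norm (1 - z))\<^sup>2 / 4) = - Im z / 2" if "norm z = 1" for z
  proof (cases "z = 1")
    case False
    have n: "(Re z)\<^sup>2 + (Im z)\<^sup>2 = 1" using that by (simp add: cmod_power2[symmetric])
    have d: "(1 - Re z)\<^sup>2 + (Im z)\<^sup>2 \<noteq> 0" using False by (auto simp: complex_eq_iff sum_power2_eq_zero_iff)
    have "?c z = - 2 * Im z / ((1 - Re z)\<^sup>2 + (Im z)\<^sup>2)"
      unfolding cayley_inv_def by (simp add: Re_divide power2_eq_square algebra_simps)
    moreover have "(norm (1 - z))\<^sup>2 = (1 - Re z)\<^sup>2 + (Im z)\<^sup>2" by (simp add: cmod_power2)
    ultimately show ?thesis using d by (simp add: field_simps)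
  qed (simp)
  have circ_g: "circ (scaleC (1 / (2 * \<i>)) (f - U f)) = density (circ f) (\<lambda>z. ennreal ((norm (1 - z))\<^sup>2 / 4))" for f
    using circ_represents[OF rg, of f] by (simp add: ng)
  have dom1: "(\<integral>\<^sup>+r. ennreal (r\<^sup>2) \<partial>scalar_measure E u) < \<infinity>" if uw: "(u, w) \<in> H" for u w
  proof -
    obtain f where u: "u = scaleC (1 / (2 * \<i>)) (f - U f)" using H2[OF uw] by blast
    interpret fm: finite_measure "circ f" by (rule finite_M)
    have "(\<integral>\<^sup>+r. ennreal (r\<^sup>2) \<partial>scalar_measure E u) = (\<integral>\<^sup>+z. ennreal ((?c z)\<^sup>2) \<partial>circ u)"
      unfolding scalar_measure_E by (subst nn_integral_distr) auto
    also have "\<dots> = (\<integral>\<^sup>+z. ennreal ((norm (1 - z))\<^sup>2 / 4) * ennreal ((?c z)\<^sup>2) \<partial>circ f)"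
      unfolding u circ_g by (rule nn_integral_density) auto
    also have "\<dots> \<le> (\<integral>\<^sup>+z. 1 \<partial>circ f)"
    proof (rule nn_integral_mono_AE)
      show "AE z in circ f. ennreal ((norm (1 - z))\<^sup>2 / 4) * ennreal ((?c z)\<^sup>2) \<le> 1"
        using supp_M[of f]
      proof eventually_elim
        case (elim z)
        then have "(?c z)\<^sup>2 * ((norm (1 - z))\<^sup>2 / 4) \<le> 1" using c_le by simp
        then show ?case by (simp add: ennreal_mult[symmetric] mult.commute)
      qed
    qed
    also have "\<dots> < \<infinity>" by (simp add: fm.emeasure_eq_measure)
    finally show ?thesis .
  qed
  have form: "cinner w u = complex_of_real (integral\<^sup>L (scalar_measure E u) (\<lambda>r. r))" if uw: "(u, w) \<in> H" for u w
  proof -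
    obtain f where u: "u = scaleC (1 / (2 * \<i>)) (f - U f)" and w: "w = scaleC (1/2) (f + U f)" using H2[OF uw] by blast
    have "integral\<^sup>L (scalar_measure E u) (\<lambda>r. r) = (\<integral>z. ?c z \<partial>circ u)"
      unfolding scalar_measure_E by (subst integral_distr) auto
    also have "\<dots> = (\<integral>z. ((norm (1 - z))\<^sup>2 / 4) *\<^sub>R ?c z \<partial>circ f)"
      unfolding u circ_g by (rule integral_density) auto
    also have "\<dots> = (\<integral>z. - Im z / 2 \<partial>circ f)"
    proof (rule integral_cong_AE)
      show "AE z in circ f. ((norm (1 - z))\<^sup>2 / 4) *\<^sub>R ?c z = - Im z / 2"
        using supp_M[of f] by eventually_elim (use c_eq in \<open>simp add: mult.commute\<close>)
    qed (auto intro!: borel_measurable_continuous_onI continuous_intros)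
    also have "\<dots> = - (\<integral>z. Im z \<partial>circ f) / 2" by simp
    also have "(\<integral>z. Im z \<partial>circ f) = Im (cinner (U f) f)"
      using circ_moment[of f 1] laurent_integrable[OF laurent.times_z[OF laurent.one], of f] by simp
    finally have "complex_of_real (integral\<^sup>L (scalar_measure E u) (\<lambda>r. r)) = - of_real (Im (cinner (U f) f)) / 2" by simp
    moreover have "cinner w u = - of_real (Im (cinner (U f) f)) / 2"
    proof -
      have "cinner f (U f) = cnj (cinner (U f) f)" by (rule cinner_commute)
      moreover have "cinner (U f) (U f) = cinner f f" by (rule cinner_U)
      ultimately show ?thesis unfolding u w
        by (simp add: cinner_scaleC_left cinner_scaleC_right cinner_add_left cinner_diff_right complex_eq_iff) (simp add: field_simps)
    qed
    ultimately show ?thesis by simp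
  qed
  have dom2: "u \<in> Domain H" if fin: "(\<integral>\<^sup>+r. ennreal (r\<^sup>2) \<partial>scalar_measure E u) < \<infinity>" for u
  proof -
    interpret fm: finite_measure "circ u" by (rule finite_M)
    have one: "{1::complex} \<in> sets borel" by simp
    \<comment> \<open>the point \<open>1\<close> is not an eigenvalue of \<open>U\<close>, since \<open>U f = f\<close> puts \<open>(0, f)\<close> into the graph\<close>
    have F1: "F {1} u = 0"
    proof -
      define f where "f = F {1} u"
      have "represents (\<lambda>z. z * indicator {1} z) (\<lambda>u. U (F {1} u))"
        using represents_mult[OF represents_laurent[OF laurent.times_z[OF laurent.one]] represents_F[OF one]] by simp
      also have "(\<lambda>z. z * indicator {1} z) = (\<lambda>z. indicator {1} z :: complex)" by (auto simp: indicator_def)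
      finally have "F {1} = (\<lambda>u. U (F {1} u))" by (rule F_eqI[OF one])
      then have "U f = f" unfolding f_def by metis
      then have "(0, scaleC (1/2) (f + f)) \<in> H" using H1[of f] by simp
      then have "scaleC (1/2) (f + f) = 0" by (rule single_valued)
      moreover have "scaleC (1/2) (f + f) = f" by (simp add: scaleC_add_right flip: scaleC_add_left)
      ultimately show ?thesis by (simp add: f_def)
    qed
    define G where "G z = (if z = 1 then 0 else 1 / (1 - z))" for z :: complex
    have [measurable]: "G \<in> borel_measurable borel" unfolding G_def by measurable
    have Gint: "integrable (circ u) (\<lambda>z. (norm (G z))\<^sup>2)"
    proof (rule integrableI_bounded)
      have "(\<integral>\<^sup>+z. ennreal (norm ((norm (G z))\<^sup>2)) \<partial>circ u) \<le> (\<integral>\<^sup>+z. 1 + ennreal ((?c z)\<^sup>2) \<partial>circ u)"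
      proof (rule nn_integral_mono_AE)
        show "AE z in circ u. ennreal (norm ((norm (G z))\<^sup>2)) \<le> 1 + ennreal ((?c z)\<^sup>2)"
          using supp_M[of u]
        proof eventually_elim
          case (elim z)
          then have nz: "norm z = 1" by simp
          have "(norm (G z))\<^sup>2 \<le> 1 + (?c z)\<^sup>2"
          proof (cases "z = 1")
            case False
            have n: "(Re z)\<^sup>2 + (Im z)\<^sup>2 = 1" using nz by (simp add: cmod_power2[symmetric])
            define d where "d = (norm (1 - z))\<^sup>2"
            have d: "d > 0" using False by (simp add: d_def)
            have "d = (1 - Re z)\<^sup>2 + (Im z)\<^sup>2" by (simp add: d_def cmod_power2)
            then have d2: "d = 2 - 2 * Re z"
              using n by (simp add: power2_eq_square algebra_simps)
            have c: "?c z = - 2 * Im z / d" using c_eq[OF nz] d by (simp add: d_def[symmetric] field_simps)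
            have "(2 * Im z)\<^sup>2 = d * (4 - d)"
              using n by (simp add: d2 power2_eq_square algebra_simps)
            then have "1 + (?c z)\<^sup>2 = 4 / d" using d by (simp add: c power_divide field_simps power2_eq_square)
            moreover have "(norm (G z))\<^sup>2 = 1 / d" using False by (simp add: G_def norm_divide power_divide d_def)
            ultimately show ?thesis using d by (simp add: divide_right_mono)
          qed (simp add: G_def)
          then show ?case by (simp flip: ennreal_1 ennreal_plus)
        qed
      qed
      also have "\<dots> = emeasure (circ u) UNIV + (\<integral>\<^sup>+z. ennreal ((?c z)\<^sup>2) \<partial>circ u)"
        by (subst nn_integral_add) auto
      also have "(\<integral>\<^sup>+z. ennreal ((?c z)\<^sup>2) \<partial>circ u) = (\<integral>\<^sup>+r. ennreal (r\<^sup>2) \<partial>scalar_measure E u)"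
        unfolding scalar_measure_E by (subst nn_integral_distr) auto
      finally show "(\<integral>\<^sup>+z. ennreal (norm ((norm (G z))\<^sup>2)) \<partial>circ u) < \<infinity>"
        using fin by (auto simp: fm.emeasure_eq_measure elim!: le_less_trans)
    qed measurable
    \<comment> \<open>truncation away from the singularity of \<open>G\<close>\<close>
    define B where "B n = {z::complex. norm (1 - z) > inverse (Suc n)}" for n
    have B: "B n \<in> sets borel" for n unfolding B_def by measurable
    have "incseq B"
      unfolding B_def by (intro incseq_SucI Collect_mono) (auto intro: le_less_trans[rotated] le_imp_inverse_le)
    moreover have UB: "(\<Union>n. B n) = UNIV - {1}"
    proof (intro set_eqI iffI)
      fix z :: complex assume "z \<in> UNIV - {1}"
      then have "norm (1 - z) > 0" by simp
      then show "z \<in> (\<Union>n. B n)" using reals_Archimedean[of "norm (1 - z)"] by (auto simp: B_def)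
    qed (auto simp: B_def)
    ultimately have FB: "(\<lambda>n. F (B n) u) \<longlonglongrightarrow> u"
      using F_tendsto[of B u] B F_diff[of "{1}" UNIV u] by (simp add: F_UNIV F1)
    define gn where "gn n z = indicator (B n) z * G z" for n z
    have "\<exists>T. represents (gn n) T" for n
    proof (rule represents_exists)
      show "gn n \<in> borel_measurable borel" unfolding gn_def using B[of n] by measurable
      show "norm (gn n z) \<le> real (Suc n)" for z
      proof (cases "z \<in> B n")
        case True
        then have "inverse (norm (1 - z)) \<le> inverse (inverse (real (Suc n)))"
          unfolding B_def by (intro le_imp_inverse_le) auto
        then show ?thesis using True by (auto simp: gn_def G_def norm_divide inverse_eq_divide)
      qed (simp add: gn_def)
    qed
    then obtain T where T: "\<And>n. represents (gn n) (T n)" by metis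
    have [measurable]: "gn n \<in> borel_measurable borel" for n using representsD(1)[OF T] .
    have lim: "(\<lambda>n. \<integral>z. (norm (gn n z - G z))\<^sup>2 \<partial>circ u) \<longlonglongrightarrow> (\<integral>z. 0 \<partial>circ u)"
    proof (rule integral_dominated_convergence[OF _ _ Gint])
      show "AE z in circ u. (\<lambda>n. (norm (gn n z - G z))\<^sup>2) \<longlonglongrightarrow> 0"
      proof (intro always_eventually allI)
        fix z
        show "(\<lambda>n. (norm (gn n z - G z))\<^sup>2) \<longlonglongrightarrow> 0"
        proof (cases "z = 1")
          case False
          then obtain k where k: "z \<in> B k" using UB by blast
          then have "z \<in> B n" if "n \<ge> k" for n using \<open>incseq B\<close> that by (auto simp: incseq_def)
          then have "eventually (\<lambda>n. (norm (gn n z - G z))\<^sup>2 = 0) sequentially"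
            unfolding eventually_sequentially by (intro exI[of _ k]) (simp add: gn_def)
          then show ?thesis by (rule tendsto_eventually)
        qed (simp add: gn_def G_def)
      qed
      show "AE z in circ u. norm ((norm (gn n z - G z))\<^sup>2) \<le> (norm (G z))\<^sup>2" for n
        by (rule always_eventually) (auto simp: gn_def indicator_def)
    qed measurable
    have "Cauchy (\<lambda>n. T n u)"
    proof (rule metric_CauchyI)
      fix e :: real assume e: "e > 0"
      then have "eventually (\<lambda>n. (\<integral>z. (norm (gn n z - G z))\<^sup>2 \<partial>circ u) < e\<^sup>2 / 4) sequentially"
        using order_tendstoD(2)[OF lim, of "e\<^sup>2/4"] by simp
      then obtain N where N: "\<And>n. n \<ge> N \<Longrightarrow> (\<integral>z. (norm (gn n z - G z))\<^sup>2 \<partial>circ u) < e\<^sup>2 / 4"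
        unfolding eventually_sequentially by blast
      have ig: "integrable (circ u) (\<lambda>z. (norm (gn n z - G z))\<^sup>2)" for n
      proof (rule Bochner_Integration.integrable_bound[OF Gint])
        show "AE z in circ u. norm ((norm (gn n z - G z))\<^sup>2) \<le> norm ((norm (G z))\<^sup>2)"
          by (rule always_eventually) (auto simp: gn_def indicator_def)
      qed measurable
      show "\<exists>M. \<forall>m\<ge>M. \<forall>n\<ge>M. dist (T m u) (T n u) < e"
      proof (intro exI[of _ N] allI impI)
        fix m n assume mn: "m \<ge> N" "n \<ge> N"
        note r = represents_diff[OF T[of m] T[of n]]
        have "(norm (T m u - T n u))\<^sup>2 = (\<integral>z. (norm (gn m z - gn n z))\<^sup>2 \<partial>circ u)"
          by (rule norm_represents_sq(2)[OF r])
        also have "\<dots> \<le> (\<integral>z. 2 * (norm (gn m z - G z))\<^sup>2 + 2 * (norm (gn n z - G z))\<^sup>2 \<partial>circ u)"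
        proof (rule integral_mono[OF norm_represents_sq(1)[OF r]])
          fix z
          have "norm (gn m z - gn n z) \<le> norm (gn m z - G z) + norm (gn n z - G z)"
            using norm_triangle_ineq4[of "gn m z - G z" "gn n z - G z"] by simp
          then have "(norm (gn m z - gn n z))\<^sup>2 \<le> (norm (gn m z - G z) + norm (gn n z - G z))\<^sup>2"
            by (rule power_mono) simp
          also have "\<dots> \<le> 2 * (norm (gn m z - G z))\<^sup>2 + 2 * (norm (gn n z - G z))\<^sup>2"
            using sum_squares_bound[of "norm (gn m z - G z)" "norm (gn n z - G z)"] by (simp add: power2_sum)
          finally show "(norm (gn m z - gn n z))\<^sup>2 \<le> 2 * (norm (gn m z - G z))\<^sup>2 + 2 * (norm (gn n z - G z))\<^sup>2" .
        qed (use ig in auto)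
        also have "\<dots> < e\<^sup>2" using N[OF mn(1)] N[OF mn(2)] by (simp add: ig)
        finally show "dist (T m u) (T n u) < e" using e unfolding dist_norm by (simp add: power2_less_imp_less)
      qed
    qed
    then obtain f where f: "(\<lambda>n. T n u) \<longlonglongrightarrow> f" using Cauchy_convergent convergent_def by blast
    \<comment> \<open>the symbols satisfy \<open>(1 - z) G z = 1\<close> on \<open>B n\<close>\<close>
    have "T n u - U (T n u) = F (B n) u" for n
    proof -
      have "represents (\<lambda>z. gn n z - (z * 1) * gn n z) (\<lambda>u. T n u - U (T n u))"
        using represents_diff[OF T[of n] represents_mult[OF represents_laurent[OF laurent.times_z[OF laurent.one]] T[of n]]]
        by simp
      also have "(\<lambda>z. gn n z - (z * 1) * gn n z) = (\<lambda>z. indicator (B n) z)"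
      proof
        fix z show "gn n z - (z * 1) * gn n z = indicator (B n) z"
        proof (cases "z = 1")
          case True then show ?thesis by (simp add: gn_def G_def B_def)
        next
          case False
          then have "1 / (1 - z) - z / (1 - z) = 1" by (simp flip: diff_divide_distrib)
          then show ?thesis using False by (simp add: gn_def G_def indicator_def)
        qed
      qed
      finally have "F (B n) = (\<lambda>u. T n u - U (T n u))" by (rule F_eqI[OF B])
      then show ?thesis by simp
    qed
    moreover have "(\<lambda>n. T n u - U (T n u)) \<longlonglongrightarrow> f - U f"
      by (intro tendsto_diff f bounded_linear.tendsto[OF bounded_clinearD(1)[OF clinear_U]])
    ultimately have "(\<lambda>n. F (B n) u) \<longlonglongrightarrow> f - U f" by simp
    then have "f - U f = u" using FB by (rule LIMSEQ_unique)
    then have "(scaleC (1 / (2 * \<i>)) u, scaleC (1/2) (f + U f)) \<in> H" using H1[of f] by simp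
    from graph_scale[OF this, of "2 * \<i>"] have "(u, scaleC (2 * \<i>) (scaleC (1/2) (f + U f))) \<in> H" by simp
    then show ?thesis by blast
  qed
  have "spectral_resolution H E"
    unfolding spectral_resolution_def using pvm_E dom1 dom2 form by auto
  then show ?thesis by blast
qed

end

section \<open>Convolution on square-integrable fields\<close>

type_synonym R4 = "real^4"

lemma lborel_distr_scaleR:
  assumes "c \<noteq> 0"
  shows "lborel = density (distr lborel borel (\<lambda>x::R4. t + c *\<^sub>R x)) (\<lambda>_. ennreal (\<bar>c\<bar> ^ 4))"
  using lborel_affine[OF assms, of t] by simp

text \<open>The change of variables behind translation invariance, reflection and all scaling arguments below.\<close>

lemma nn_integral_affine:
  assumes [measurable]: "f \<in> borel_measurable borel" and c: "c \<noteq> 0"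
  shows "(\<integral>\<^sup>+x. f x \<partial>lborel) = ennreal (\<bar>c\<bar> ^ 4) * (\<integral>\<^sup>+x. f (t + c *\<^sub>R x) \<partial>(lborel :: R4 measure))"
  by (subst lborel_distr_scaleR[OF c, of t]) (simp add: nn_integral_density nn_integral_distr nn_integral_cmult)

lemma integral_affine:
  fixes f :: "R4 \<Rightarrow> 'a::{banach, second_countable_topology}"
  assumes [measurable]: "f \<in> borel_measurable borel" and c: "c \<noteq> 0"
  shows "(\<integral>x. f x \<partial>lborel) = \<bar>c\<bar> ^ 4 *\<^sub>R (\<integral>x. f (t + c *\<^sub>R x) \<partial>(lborel :: R4 measure))"
  by (subst lborel_distr_scaleR[OF c, of t]) (subst integral_density; simp add: integral_distr)

lemma nn_integral_reflect:
  assumes "f \<in> borel_measurable borel"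
  shows "(\<integral>\<^sup>+y. f (x - y) \<partial>lborel) = (\<integral>\<^sup>+y. f y \<partial>(lborel :: R4 measure))"
  using nn_integral_affine[OF assms, of "-1" x] by simp

lemma nn_integral_translate:
  assumes "f \<in> borel_measurable borel"
  shows "(\<integral>\<^sup>+x. f (x - y) \<partial>lborel) = (\<integral>\<^sup>+x. f x \<partial>(lborel :: R4 measure))"
  using nn_integral_affine[OF assms, of 1 "- y"] by simp

lemma mult_le_sum_squares: "0 \<le> a \<Longrightarrow> 0 \<le> b \<Longrightarrow> a * b \<le> a\<^sup>2 + (b::real)\<^sup>2"
  using sum_squares_bound[of a b] mult_nonneg_nonneg[of a b] by linarith

text \<open>Continuous functions with compact support.\<close>

definition cc :: "(R4 \<Rightarrow> real) \<Rightarrow> bool" where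
  "cc \<phi> \<longleftrightarrow> continuous_on UNIV \<phi> \<and> (\<exists>R. \<forall>x. norm x > R \<longrightarrow> \<phi> x = 0)"

lemma cc_measurable [measurable_dest]: "cc \<phi> \<Longrightarrow> \<phi> \<in> borel_measurable borel"
  unfolding cc_def by (auto intro: borel_measurable_continuous_onI)

lemma cc_bounded:
  assumes "cc \<phi>"
  obtains B R where "\<And>x. \<bar>\<phi> x\<bar> \<le> B" "\<And>x. norm x > R \<Longrightarrow> \<phi> x = 0" "B \<ge> 0" "R \<ge> 0"
proof -
  obtain R where R: "\<And>x. norm x > R \<Longrightarrow> \<phi> x = 0" using assms by (auto simp: cc_def)
  have "compact (\<phi> ` cball 0 R)"
    using assms by (intro compact_continuous_image) (auto simp: cc_def intro: continuous_on_subset)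
  then obtain B where B: "\<And>x. norm x \<le> R \<Longrightarrow> \<bar>\<phi> x\<bar> \<le> B"
    using compact_imp_bounded by (force simp: bounded_iff)
  show ?thesis
  proof (rule that[of "max B 0" "max R 0"])
    show "\<bar>\<phi> x\<bar> \<le> max B 0" for x using R[of x] B[of x] by (cases "norm x \<le> R") (auto simp: le_max_iff_disj)
  qed (use R in auto)
qed

lemma cc_integrable_times:
  fixes h :: "R4 \<Rightarrow> 'a::{banach, second_countable_topology}"
  assumes \<phi>: "cc \<phi>" and h: "h \<in> borel_measurable borel" "\<And>x. norm (h x) \<le> C"
  shows "integrable lborel (\<lambda>x. \<phi> x *\<^sub>R h x)"
proof -
  obtain B R where BR: "\<And>x. \<bar>\<phi> x\<bar> \<le> B" "\<And>x. norm x > R \<Longrightarrow> \<phi> x = 0" "B \<ge> 0" "R \<ge> 0" using cc_bounded[OF \<phi>] by metis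
  have [measurable]: "\<phi> \<in> borel_measurable borel" using \<phi> by measurable
  note [measurable] = h(1)
  have C: "C \<ge> 0" using h(2)[of 0] norm_ge_zero order_trans by blast
  show ?thesis
  proof (rule Bochner_Integration.integrable_bound)
    show "integrable lborel (\<lambda>x. (B * C) *\<^sub>R indicator (cball (0::R4) R) x :: real)"
      by (intro integrable_scaleR_right integrable_real_indicator) (use emeasure_bounded_finite[OF bounded_cball, of "0::R4" R] in auto)
    show "AE x in lborel. norm (\<phi> x *\<^sub>R h x) \<le> norm ((B * C) *\<^sub>R indicator (cball (0::R4) R) x :: real)"
    proof (intro always_eventually allI)
      fix x show "norm (\<phi> x *\<^sub>R h x) \<le> norm ((B * C) *\<^sub>R indicator (cball (0::R4) R) x :: real)"
        using BR h(2)[of x] C by (cases "norm x > R") (auto intro!: mult_mono)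
    qed
  qed measurable
qed

lemma cc_integrable: "cc \<phi> \<Longrightarrow> integrable lborel \<phi>"
  using cc_integrable_times[of \<phi> "\<lambda>_. 1::real" 1] by simp

lemma cc_mult: "cc \<phi> \<Longrightarrow> continuous_on UNIV \<psi> \<Longrightarrow> cc (\<lambda>x. \<phi> x * \<psi> x)"
  unfolding cc_def by (auto intro!: continuous_on_mult)

lemma cc_square_integrable:
  assumes "cc \<phi>" shows "square_integrable (\<lambda>x. \<phi> x *\<^sub>R c)"
proof -
  have [measurable]: "\<phi> \<in> borel_measurable borel" using assms by measurable
  have "integrable lborel (\<lambda>x. \<phi> x * \<phi> x)" using assms cc_def by (intro cc_integrable cc_mult) auto
  then have "integrable lborel (\<lambda>x. (\<phi> x * \<phi> x) * (norm c)\<^sup>2)" by simp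
  then show ?thesis unfolding square_integrable_def by (auto simp: power_mult_distrib power2_eq_square mult_ac)
qed

lemma cc_reflect: "cc \<phi> \<Longrightarrow> cc (\<lambda>y. \<phi> (x - y))"
proof -
  assume \<phi>: "cc \<phi>"
  obtain B R where BR: "\<And>x. \<bar>\<phi> x\<bar> \<le> B" "\<And>x. norm x > R \<Longrightarrow> \<phi> x = 0" using cc_bounded[OF \<phi>] by metis
  have "\<phi> (x - y) = 0" if "norm y > R + norm x" for y
    using that norm_triangle_ineq2[of y x] by (intro BR) (simp add: norm_minus_commute)
  moreover have "continuous_on UNIV (\<lambda>y. \<phi> (x - y))"
    using \<phi> by (auto simp: cc_def intro!: continuous_on_compose2[of UNIV \<phi>] continuous_intros)
  ultimately show ?thesis unfolding cc_def by blast
qed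

lemma cc_uminus: "cc \<phi> \<Longrightarrow> cc (\<lambda>y. \<phi> (- y))"
  using cc_reflect[of \<phi> 0] by simp

lemma cc_neg: "cc \<phi> \<Longrightarrow> cc (\<lambda>y. - \<phi> y)"
  unfolding cc_def by (auto intro: continuous_on_minus)

lemma cc_diff: "cc \<phi> \<Longrightarrow> cc \<psi> \<Longrightarrow> cc (\<lambda>y. \<phi> y - \<psi> y)"
  unfolding cc_def
proof (intro conjI)
  assume a: "continuous_on UNIV \<phi> \<and> (\<exists>R. \<forall>x. norm x > R \<longrightarrow> \<phi> x = 0)" "continuous_on UNIV \<psi> \<and> (\<exists>R. \<forall>x. norm x > R \<longrightarrow> \<psi> x = 0)"
  then obtain R S where "\<forall>x. norm x > R \<longrightarrow> \<phi> x = 0" "\<forall>x. norm x > S \<longrightarrow> \<psi> x = 0" by blast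
  then show "\<exists>R. \<forall>x. norm x > R \<longrightarrow> \<phi> x - \<psi> x = 0" by (intro exI[of _ "max R S"]) auto
qed (auto intro: continuous_on_diff)

lemma cc_integrable_rep:
  assumes \<phi>: "cc \<phi>" shows "integrable lborel (\<lambda>x. \<phi> x *\<^sub>R rep_L2 u x)"
proof (rule Bochner_Integration.integrable_bound)
  have [measurable]: "\<phi> \<in> borel_measurable borel" using \<phi> by measurable
  have "integrable lborel (\<lambda>x. \<phi> x * \<phi> x)" using \<phi> cc_def by (intro cc_integrable cc_mult) auto
  then show "integrable lborel (\<lambda>x. \<phi> x * \<phi> x + (norm (rep_L2 u x))\<^sup>2)"
    by (intro Bochner_Integration.integrable_add integrable_norm_rep_sq)
  show "AE x in lborel. norm (\<phi> x *\<^sub>R rep_L2 u x) \<le> norm (\<phi> x * \<phi> x + (norm (rep_L2 u x))\<^sup>2)"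
  proof (intro always_eventually allI)
    fix x
    show "norm (\<phi> x *\<^sub>R rep_L2 u x) \<le> norm (\<phi> x * \<phi> x + (norm (rep_L2 u x))\<^sup>2)"
      using mult_le_sum_squares[of "\<bar>\<phi> x\<bar>" "norm (rep_L2 u x)"] by (simp add: power2_eq_square)
  qed
  show "(\<lambda>x. \<phi> x *\<^sub>R rep_L2 u x) \<in> borel_measurable lborel" by measurable
qed

definition conv :: "(R4 \<Rightarrow> real) \<Rightarrow> spinor_field \<Rightarrow> spinor_field" where
  "conv \<phi> f x = (\<integral>y. \<phi> (x - y) *\<^sub>R f y \<partial>lborel)"

lemma conv_integrable: "cc \<phi> \<Longrightarrow> integrable lborel (\<lambda>y. \<phi> (x - y) *\<^sub>R rep_L2 u y)"
  by (intro cc_integrable_rep cc_reflect)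

lemma borel_measurable_conv [measurable]:
  assumes [measurable]: "\<phi> \<in> borel_measurable borel" "f \<in> borel_measurable borel"
  shows "conv \<phi> f \<in> borel_measurable borel"
proof -
  have "(\<lambda>x. \<integral>y. \<phi> (x - y) *\<^sub>R f y \<partial>lborel) \<in> borel_measurable borel"
    by (rule lborel.borel_measurable_lebesgue_integral) measurable
  then show ?thesis unfolding conv_def[abs_def] .
qed

text \<open>Convolution on \<open>L\<^sup>2\<close> is controlled by this norm, which stays bounded when the kernels concentrate.\<close>

definition L1n :: "(R4 \<Rightarrow> real) \<Rightarrow> real" where
  "L1n \<phi> = (\<integral>x. \<bar>\<phi> x\<bar> \<partial>lborel)"

lemma L1n_nonneg: "L1n \<phi> \<ge> 0" by (simp add: L1n_def)

lemma nn_integral_L1n: "cc \<phi> \<Longrightarrow> (\<integral>\<^sup>+x. ennreal \<bar>\<phi> x\<bar> \<partial>lborel) = ennreal (L1n \<phi>)"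
  unfolding L1n_def by (rule nn_integral_eq_integral) (auto dest: cc_integrable)

lemma norm_conv_le: "ennreal (norm (conv \<phi> f x)) \<le> (\<integral>\<^sup>+y. ennreal \<bar>\<phi> (x - y)\<bar> * ennreal (norm (f y)) \<partial>lborel)"
proof (cases "integrable lborel (\<lambda>y. \<phi> (x - y) *\<^sub>R f y)")
  case True
  from integral_norm_bound_ennreal[OF this] show ?thesis by (simp add: conv_def ennreal_mult)
qed (simp add: conv_def not_integrable_integral_eq)

text \<open>Young's inequality for an integrable kernel, by the Cauchy--Schwarz inequality for the
  measure \<open>|\<phi>(x - y)| dy\<close> and Tonelli's theorem.\<close>

lemma nn_integral_conv_sq:
  assumes \<phi>: "cc \<phi>" and f[measurable]: "f \<in> borel_measurable borel"
  shows "(\<integral>\<^sup>+x. ennreal ((norm (conv \<phi> f x))\<^sup>2) \<partial>lborel) \<le> ennreal ((L1n \<phi>)\<^sup>2) * (\<integral>\<^sup>+x. ennreal ((norm (f x))\<^sup>2) \<partial>lborel)"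
proof -
  have [measurable]: "\<phi> \<in> borel_measurable borel" using \<phi> by measurable
  have "ennreal ((norm (conv \<phi> f x))\<^sup>2) \<le> ennreal (L1n \<phi>) * (\<integral>\<^sup>+y. ennreal \<bar>\<phi> (x - y)\<bar> * ennreal ((norm (f y))\<^sup>2) \<partial>lborel)" for x
  proof -
    have "ennreal ((norm (conv \<phi> f x))\<^sup>2) = (ennreal (norm (conv \<phi> f x)))\<^sup>2" by (simp add: ennreal_power)
    also have "\<dots> \<le> (\<integral>\<^sup>+y. ennreal \<bar>\<phi> (x - y)\<bar> * ennreal (norm (f y)) \<partial>lborel)\<^sup>2"
      by (intro power_mono norm_conv_le) simp
    also have "(\<lambda>y. ennreal \<bar>\<phi> (x - y)\<bar> * ennreal (norm (f y)))
      = (\<lambda>y. ennreal (sqrt \<bar>\<phi> (x - y)\<bar>) * ennreal (sqrt \<bar>\<phi> (x - y)\<bar> * norm (f y)))"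
      by (auto simp: fun_eq_iff simp flip: ennreal_mult)
    also have "(\<integral>\<^sup>+y. ennreal (sqrt \<bar>\<phi> (x - y)\<bar>) * ennreal (sqrt \<bar>\<phi> (x - y)\<bar> * norm (f y)) \<partial>lborel)\<^sup>2
      \<le> (\<integral>\<^sup>+y. (ennreal (sqrt \<bar>\<phi> (x - y)\<bar>))\<^sup>2 \<partial>lborel) * (\<integral>\<^sup>+y. (ennreal (sqrt \<bar>\<phi> (x - y)\<bar> * norm (f y)))\<^sup>2 \<partial>lborel)"
      by (rule Cauchy_Schwarz_nn_integral) measurable
    also have "\<dots> = (\<integral>\<^sup>+y. ennreal \<bar>\<phi> (x - y)\<bar> \<partial>lborel) * (\<integral>\<^sup>+y. ennreal \<bar>\<phi> (x - y)\<bar> * ennreal ((norm (f y))\<^sup>2) \<partial>lborel)"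
      by (simp add: ennreal_power power_mult_distrib ennreal_mult)
    also have "(\<integral>\<^sup>+y. ennreal \<bar>\<phi> (x - y)\<bar> \<partial>lborel) = ennreal (L1n \<phi>)"
      by (subst nn_integral_reflect[of "\<lambda>y. ennreal \<bar>\<phi> y\<bar>"]) (simp_all add: nn_integral_L1n[OF \<phi>])
    finally show ?thesis .
  qed
  then have "(\<integral>\<^sup>+x. ennreal ((norm (conv \<phi> f x))\<^sup>2) \<partial>lborel)
    \<le> (\<integral>\<^sup>+x. ennreal (L1n \<phi>) * (\<integral>\<^sup>+y. ennreal \<bar>\<phi> (x - y)\<bar> * ennreal ((norm (f y))\<^sup>2) \<partial>lborel) \<partial>lborel)"
    by (intro nn_integral_mono)
  also have "\<dots> = ennreal (L1n \<phi>) * (\<integral>\<^sup>+x. \<integral>\<^sup>+y. ennreal \<bar>\<phi> (x - y)\<bar> * ennreal ((norm (f y))\<^sup>2) \<partial>lborel \<partial>lborel)"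
    by (rule nn_integral_cmult) measurable
  also have "(\<integral>\<^sup>+x. \<integral>\<^sup>+y. ennreal \<bar>\<phi> (x - y)\<bar> * ennreal ((norm (f y))\<^sup>2) \<partial>lborel \<partial>lborel)
    = (\<integral>\<^sup>+y. \<integral>\<^sup>+x. ennreal \<bar>\<phi> (x - y)\<bar> * ennreal ((norm (f y))\<^sup>2) \<partial>lborel \<partial>lborel)"
    by (rule lborel_pair.Fubini'[symmetric]) measurable
  also have "\<dots> = (\<integral>\<^sup>+y. ennreal (L1n \<phi>) * ennreal ((norm (f y))\<^sup>2) \<partial>lborel)"
  proof (intro nn_integral_cong)
    fix y
    have "(\<integral>\<^sup>+x. ennreal \<bar>\<phi> (x - y)\<bar> \<partial>lborel) = ennreal (L1n \<phi>)"
      by (subst nn_integral_translate[of "\<lambda>y. ennreal \<bar>\<phi> y\<bar>"]) (simp_all add: nn_integral_L1n[OF \<phi>])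
    then show "(\<integral>\<^sup>+x. ennreal \<bar>\<phi> (x - y)\<bar> * ennreal ((norm (f y))\<^sup>2) \<partial>lborel) = ennreal (L1n \<phi>) * ennreal ((norm (f y))\<^sup>2)"
      by (subst nn_integral_multc) auto
  qed
  also have "\<dots> = ennreal (L1n \<phi>) * (\<integral>\<^sup>+y. ennreal ((norm (f y))\<^sup>2) \<partial>lborel)"
    by (rule nn_integral_cmult) measurable
  finally show ?thesis by (simp add: power2_eq_square ennreal_mult L1n_nonneg mult.assoc)
qed

lemma square_integrable_conv:
  assumes \<phi>: "cc \<phi>" shows "square_integrable (conv \<phi> (rep_L2 u))"
proof (rule square_integrableI)
  have [measurable]: "\<phi> \<in> borel_measurable borel" using \<phi> by measurable
  show "conv \<phi> (rep_L2 u) \<in> borel_measurable borel" by measurable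
  show "(\<integral>\<^sup>+x. ennreal ((norm (conv \<phi> (rep_L2 u) x))\<^sup>2) \<partial>lborel) < \<infinity>"
    using nn_integral_conv_sq[OF \<phi> borel_measurable_rep[of u]]
    by (rule le_less_trans) (simp add: nn_integral_norm_rep ennreal_mult_less_top)
qed

definition Conv :: "(R4 \<Rightarrow> real) \<Rightarrow> L2 \<Rightarrow> L2" where
  "Conv \<phi> u = mk_L2 (conv \<phi> (rep_L2 u))"

lemma rep_Conv_AE: "cc \<phi> \<Longrightarrow> AE x in lborel. rep_L2 (Conv \<phi> u) x = conv \<phi> (rep_L2 u) x"
  unfolding Conv_def by (rule rep_mk_L2_AE[OF square_integrable_conv])

lemma conv_cong_AE:
  assumes [measurable]: "\<phi> \<in> borel_measurable borel" "f \<in> borel_measurable borel" "g \<in> borel_measurable borel" and "AE y in lborel. f y = g y"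
  shows "conv \<phi> f x = conv \<phi> g x"
  unfolding conv_def by (rule integral_cong_AE) (use assms(4) in \<open>auto elim: eventually_mono\<close>)

lemma norm_Conv_le:
  assumes "cc \<phi>" shows "norm (Conv \<phi> u) \<le> L1n \<phi> * norm u"
proof -
  have "ennreal ((norm (Conv \<phi> u))\<^sup>2) \<le> ennreal ((L1n \<phi>)\<^sup>2) * ennreal ((norm u)\<^sup>2)"
    using nn_integral_conv_sq[OF assms borel_measurable_rep[of u]]
    by (simp add: Conv_def norm_mk_L2[OF square_integrable_conv[OF assms]] nn_integral_norm_rep)
  then have "(norm (Conv \<phi> u))\<^sup>2 \<le> (L1n \<phi> * norm u)\<^sup>2"
    by (simp add: power_mult_distrib flip: ennreal_mult)
  then show ?thesis by (rule power2_le_imp_le) (simp add: L1n_nonneg)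
qed

lemma clinear_Conv:
  assumes \<phi>: "cc \<phi>" shows "bounded_clinear (Conv \<phi>)"
proof (rule bounded_clinearI[where K="L1n \<phi>"])
  have [measurable]: "\<phi> \<in> borel_measurable borel" using \<phi> by measurable
  fix u v c
  have e: "conv \<phi> (rep_L2 (u + v)) x = conv \<phi> (rep_L2 u) x + conv \<phi> (rep_L2 v) x" for x
  proof -
    have e: "conv \<phi> (rep_L2 (u + v)) x = conv \<phi> (\<lambda>y. rep_L2 u y + rep_L2 v y) x"
      by (rule conv_cong_AE[OF _ _ _ rep_add_AE]) measurable
    then show ?thesis by (simp add: conv_def scaleR_add_right conv_integrable[OF \<phi>])
  qed
  have "AE x in lborel. rep_L2 (Conv \<phi> (u + v)) x = rep_L2 (Conv \<phi> u + Conv \<phi> v) x"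
    using rep_Conv_AE[OF \<phi>, of "u + v"] rep_Conv_AE[OF \<phi>, of u] rep_Conv_AE[OF \<phi>, of v] rep_add_AE[of "Conv \<phi> u" "Conv \<phi> v"]
    by eventually_elim (simp add: e)
  then show "Conv \<phi> (u + v) = Conv \<phi> u + Conv \<phi> v" by (rule L2_eqI)
  have bl: "bounded_linear (\<lambda>v::complex^4. c *s v)"
    by (rule bounded_linear_intro[where K="norm c"]) (auto simp: vec_eq_iff algebra_simps norm_vector_smult)
  have e: "conv \<phi> (rep_L2 (scaleC c u)) x = c *s conv \<phi> (rep_L2 u) x" for x
  proof -
    have "conv \<phi> (rep_L2 (scaleC c u)) x = conv \<phi> (\<lambda>y. c *s rep_L2 u y) x"
    proof (rule conv_cong_AE[OF _ _ _ rep_scaleC_AE])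
      show "(\<lambda>y. c *s rep_L2 u y) \<in> borel_measurable borel"
        by (rule measurable_compose[OF borel_measurable_rep borel_measurable_continuous_onI[OF linear_continuous_on[OF bl]]])
    qed measurable
    also have "\<dots> = (\<integral>y. c *s (\<phi> (x - y) *\<^sub>R rep_L2 u y) \<partial>lborel)"
      by (simp add: conv_def linear_cmul[OF bounded_linear.linear[OF bl]])
    also have "\<dots> = c *s conv \<phi> (rep_L2 u) x"
      unfolding conv_def by (rule integral_bounded_linear[OF bl conv_integrable[OF \<phi>]])
    finally show ?thesis .
  qed
  have "AE x in lborel. rep_L2 (Conv \<phi> (scaleC c u)) x = rep_L2 (scaleC c (Conv \<phi> u)) x"
    using rep_Conv_AE[OF \<phi>, of "scaleC c u"] rep_Conv_AE[OF \<phi>, of u] rep_scaleC_AE[of c "Conv \<phi> u"]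
    by eventually_elim (simp add: e)
  then show "Conv \<phi> (scaleC c u) = scaleC c (Conv \<phi> u)" by (rule L2_eqI)
qed (use norm_Conv_le[OF \<phi>] in auto)

lemma hdot_scaleR_left: "hdot (r *\<^sub>R a) b = r *\<^sub>R hdot a b"
proof -
  have "r *\<^sub>R a = of_real r *s a" by (simp add: vec_eq_iff scaleR_conv_of_real[where 'a=complex])
  then show ?thesis by (simp add: hdot_smult_left scaleR_conv_of_real)
qed

lemma bounded_linear_hdot_left: "bounded_linear (\<lambda>a. hdot a b)"
  by (rule bounded_linear_intro[where K="norm b"])
    (auto simp: hdot_add_left hdot_scaleR_left norm_hdot_le_mult)

lemma hdot_scaleR_right: "hdot a (r *\<^sub>R b) = r *\<^sub>R hdot a b"
  by (simp add: hdot_commute[of a] hdot_scaleR_left)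

lemma integral_hdot_left:
  "integrable M f \<Longrightarrow> (\<integral>x. hdot (f x) c \<partial>M) = hdot (\<integral>x. f x \<partial>M) c"
  by (rule integral_bounded_linear[OF bounded_linear_hdot_left])

lemma integral_hdot_right:
  assumes f: "integrable M f"
  shows "(\<integral>x. hdot c (f x) \<partial>M) = hdot c (\<integral>x. f x \<partial>M)"
proof -
  have "(\<integral>x. hdot c (f x) \<partial>M) = cnj (\<integral>x. hdot (f x) c \<partial>M)"
    unfolding Bochner_Integration.integral_cnj[symmetric]
    by (rule Bochner_Integration.integral_cong) (simp_all add: hdot_commute[of c])
  then show ?thesis by (simp add: integral_hdot_left[OF f] hdot_commute[of c])
qed

text \<open>Fubini's theorem; for real kernels the adjoint is convolution with the reflected kernel.\<close>

lemma Conv_adjoint: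
  assumes \<phi>: "cc \<phi>"
  shows "cinner (Conv \<phi> u) v = cinner u (Conv (\<lambda>x. \<phi> (- x)) v)"
proof -
  have [measurable]: "\<phi> \<in> borel_measurable borel" using \<phi> by measurable
  let ?f = "\<lambda>x y. \<phi> (x - y) *\<^sub>R hdot (rep_L2 u y) (rep_L2 v x)"
  have meas [measurable]: "(\<lambda>(x, y). ?f x y) \<in> borel_measurable (lborel \<Otimes>\<^sub>M lborel)"
  proof -
    have "(\<lambda>p. hdot (rep_L2 u (snd p)) (rep_L2 v (fst p))) \<in> borel_measurable (lborel \<Otimes>\<^sub>M lborel :: (R4 \<times> R4) measure)"
      by (intro borel_measurable_hdot) measurable
    then show ?thesis by (simp add: case_prod_beta') 
  qed
  have int: "integrable (lborel \<Otimes>\<^sub>M lborel) (\<lambda>(x, y). ?f x y)"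
  proof (rule integrableI_bounded[OF meas])
    have "(\<integral>\<^sup>+p. ennreal (norm (case p of (x, y) \<Rightarrow> ?f x y)) \<partial>(lborel \<Otimes>\<^sub>M lborel)) = (\<integral>\<^sup>+x. \<integral>\<^sup>+y. ennreal (norm (?f x y)) \<partial>lborel \<partial>lborel)"
      by (subst lborel.nn_integral_fst[symmetric]) measurable
    also have "\<dots> \<le> (\<integral>\<^sup>+x. \<integral>\<^sup>+y. ennreal \<bar>\<phi> (x - y)\<bar> * ennreal ((norm (rep_L2 u y))\<^sup>2) + ennreal \<bar>\<phi> (x - y)\<bar> * ennreal ((norm (rep_L2 v x))\<^sup>2) \<partial>lborel \<partial>lborel)"
    proof (intro nn_integral_mono)
      fix x y
      have "norm (hdot (rep_L2 u y) (rep_L2 v x)) \<le> norm (rep_L2 u y) * norm (rep_L2 v x)" by (rule norm_hdot_le_mult)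
      also have "\<dots> \<le> (norm (rep_L2 u y))\<^sup>2 + (norm (rep_L2 v x))\<^sup>2"
      proof -
        have "0 \<le> norm (rep_L2 u y) * norm (rep_L2 v x)" by simp
        then show ?thesis using sum_squares_bound[of "norm (rep_L2 u y)" "norm (rep_L2 v x)"] by linarith
      qed
      finally have "\<bar>\<phi> (x - y)\<bar> * norm (hdot (rep_L2 u y) (rep_L2 v x)) \<le> \<bar>\<phi> (x - y)\<bar> * ((norm (rep_L2 u y))\<^sup>2 + (norm (rep_L2 v x))\<^sup>2)"
        by (rule mult_left_mono) simp
      then show "ennreal (norm (?f x y)) \<le> ennreal \<bar>\<phi> (x - y)\<bar> * ennreal ((norm (rep_L2 u y))\<^sup>2) + ennreal \<bar>\<phi> (x - y)\<bar> * ennreal ((norm (rep_L2 v x))\<^sup>2)"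
        by (simp add: distrib_left flip: ennreal_mult ennreal_plus)
    qed
    also have "\<dots> = (\<integral>\<^sup>+x. \<integral>\<^sup>+y. ennreal \<bar>\<phi> (x - y)\<bar> * ennreal ((norm (rep_L2 u y))\<^sup>2) \<partial>lborel \<partial>lborel)
        + (\<integral>\<^sup>+x. \<integral>\<^sup>+y. ennreal \<bar>\<phi> (x - y)\<bar> * ennreal ((norm (rep_L2 v x))\<^sup>2) \<partial>lborel \<partial>lborel)"
    proof -
      have "(\<integral>\<^sup>+y. ennreal \<bar>\<phi> (x - y)\<bar> * ennreal ((norm (rep_L2 u y))\<^sup>2) + ennreal \<bar>\<phi> (x - y)\<bar> * ennreal ((norm (rep_L2 v x))\<^sup>2) \<partial>lborel)
       = (\<integral>\<^sup>+y. ennreal \<bar>\<phi> (x - y)\<bar> * ennreal ((norm (rep_L2 u y))\<^sup>2) \<partial>lborel) + (\<integral>\<^sup>+y. ennreal \<bar>\<phi> (x - y)\<bar> * ennreal ((norm (rep_L2 v x))\<^sup>2) \<partial>lborel)" for x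
        by (rule nn_integral_add) measurable
      then show ?thesis by (simp only:) (rule nn_integral_add; measurable)
    qed
    also have "(\<integral>\<^sup>+x. \<integral>\<^sup>+y. ennreal \<bar>\<phi> (x - y)\<bar> * ennreal ((norm (rep_L2 u y))\<^sup>2) \<partial>lborel \<partial>lborel)
       = (\<integral>\<^sup>+y. \<integral>\<^sup>+x. ennreal \<bar>\<phi> (x - y)\<bar> * ennreal ((norm (rep_L2 u y))\<^sup>2) \<partial>lborel \<partial>lborel)"
      by (rule lborel_pair.Fubini'[symmetric]) measurable
    also have "\<dots> = (\<integral>\<^sup>+y. ennreal (L1n \<phi>) * ennreal ((norm (rep_L2 u y))\<^sup>2) \<partial>lborel)"
    proof (intro nn_integral_cong)
      fix y
      have "(\<integral>\<^sup>+x. ennreal \<bar>\<phi> (x - y)\<bar> \<partial>lborel) = ennreal (L1n \<phi>)"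
        by (subst nn_integral_translate[of "\<lambda>y. ennreal \<bar>\<phi> y\<bar>"]) (simp_all add: nn_integral_L1n[OF \<phi>])
      then show "(\<integral>\<^sup>+x. ennreal \<bar>\<phi> (x - y)\<bar> * ennreal ((norm (rep_L2 u y))\<^sup>2) \<partial>lborel) = ennreal (L1n \<phi>) * ennreal ((norm (rep_L2 u y))\<^sup>2)"
        by (subst nn_integral_multc) auto
    qed
    also have "(\<integral>\<^sup>+x. \<integral>\<^sup>+y. ennreal \<bar>\<phi> (x - y)\<bar> * ennreal ((norm (rep_L2 v x))\<^sup>2) \<partial>lborel \<partial>lborel)
        = (\<integral>\<^sup>+x. ennreal (L1n \<phi>) * ennreal ((norm (rep_L2 v x))\<^sup>2) \<partial>lborel)"
    proof (intro nn_integral_cong)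
      fix x
      have "(\<integral>\<^sup>+y. ennreal \<bar>\<phi> (x - y)\<bar> \<partial>lborel) = ennreal (L1n \<phi>)"
        by (subst nn_integral_reflect[of "\<lambda>y. ennreal \<bar>\<phi> y\<bar>"]) (simp_all add: nn_integral_L1n[OF \<phi>])
      then show "(\<integral>\<^sup>+y. ennreal \<bar>\<phi> (x - y)\<bar> * ennreal ((norm (rep_L2 v x))\<^sup>2) \<partial>lborel) = ennreal (L1n \<phi>) * ennreal ((norm (rep_L2 v x))\<^sup>2)"
        by (subst nn_integral_multc) auto
    qed
    also have "(\<integral>\<^sup>+y. ennreal (L1n \<phi>) * ennreal ((norm (rep_L2 u y))\<^sup>2) \<partial>lborel) + (\<integral>\<^sup>+x. ennreal (L1n \<phi>) * ennreal ((norm (rep_L2 v x))\<^sup>2) \<partial>lborel) < \<infinity>"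
      by (simp add: nn_integral_cmult nn_integral_norm_rep ennreal_mult_less_top)
    finally show "(\<integral>\<^sup>+p. ennreal (norm (case p of (x, y) \<Rightarrow> ?f x y)) \<partial>(lborel \<Otimes>\<^sub>M lborel)) < \<infinity>" .
  qed
  have "cinner (Conv \<phi> u) v = (\<integral>x. hdot (conv \<phi> (rep_L2 u) x) (rep_L2 v x) \<partial>lborel)"
    unfolding cinner_rep by (rule integral_cong_AE) (use rep_Conv_AE[OF \<phi>, of u] in \<open>auto elim: eventually_mono\<close>)
  also have "\<dots> = (\<integral>x. \<integral>y. ?f x y \<partial>lborel \<partial>lborel)"
    unfolding conv_def by (simp add: conv_integrable[OF \<phi>] hdot_scaleR_left flip: integral_hdot_left)
  also have "\<dots> = (\<integral>y. \<integral>x. ?f x y \<partial>lborel \<partial>lborel)"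
    by (rule lborel_pair.Fubini_integral[symmetric, OF int])
  also have "\<dots> = (\<integral>y. hdot (rep_L2 u y) (conv (\<lambda>x. \<phi> (- x)) (rep_L2 v) y) \<partial>lborel)"
  proof (rule Bochner_Integration.integral_cong[OF refl])
    fix y
    have "integrable lborel (\<lambda>x. \<phi> (- (y - x)) *\<^sub>R rep_L2 v x)"
      by (rule conv_integrable[OF cc_uminus[OF \<phi>]])
    from integral_hdot_right[OF this, of "rep_L2 u y"]
    show "(\<integral>x. ?f x y \<partial>lborel) = hdot (rep_L2 u y) (conv (\<lambda>x. \<phi> (- x)) (rep_L2 v) y)"
      by (simp add: conv_def hdot_scaleR_right)
  qed
  also have "\<dots> = cinner u (Conv (\<lambda>x. \<phi> (- x)) v)"
    unfolding cinner_rep by (rule integral_cong_AE) (use rep_Conv_AE[OF cc_uminus[OF \<phi>], of v] in \<open>auto elim: eventually_mono\<close>)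
  finally show ?thesis .
qed

section \<open>Smooth test functions and weak derivatives\<close>

text \<open>The smooth functions \<open>t\<^sup>-\<^sup>j exp (-1/t)\<close> on the half line, extended by zero; their span is closed
  under differentiation.\<close>

definition flat :: "nat \<Rightarrow> real \<Rightarrow> real" where
  "flat j t = (if t > 0 then inverse t ^ j * exp (- inverse t) else 0)"

lemma flat_tendsto_0: "(flat j \<longlongrightarrow> 0) (at 0)"
proof -
  have "((\<lambda>x::real. x ^ j / exp x) \<longlongrightarrow> 0) at_top" by (rule tendsto_power_div_exp_0)
  then have "((\<lambda>t::real. inverse t ^ j / exp (inverse t)) \<longlongrightarrow> 0) (at_right 0)"
    by (rule filterlim_compose[OF _ filterlim_inverse_at_top_right])
  moreover have "eventually (\<lambda>t. inverse t ^ j / exp (inverse t) = flat j t) (at_right 0)"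
    by (auto simp: eventually_at_filter flat_def exp_minus field_simps)
  ultimately have r: "(flat j \<longlongrightarrow> 0) (at_right 0)" by (rule Lim_transform_eventually)
  have "eventually (\<lambda>t. 0 = flat j t) (at_left 0)"
    by (auto simp: eventually_at_filter flat_def)
  then have l: "(flat j \<longlongrightarrow> 0) (at_left 0)" by (rule Lim_transform_eventually[OF tendsto_const])
  show ?thesis using l r by (rule filterlim_split_at)
qed

lemma flat_deriv: "(flat j has_real_derivative (flat (j + 2) t - real j * flat (j + 1) t)) (at t)"
proof -
  consider "t > 0" | "t < 0" | "t = 0" by linarith
  then show ?thesis
  proof cases
    case 1
    have "((\<lambda>t. inverse t ^ j * exp (- inverse t)) has_real_derivative (flat (j + 2) t - real j * flat (j + 1) t)) (at t)"
    proof (cases j)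
      case 0
      then show ?thesis using 1
        by (auto intro!: derivative_eq_intros simp: flat_def power2_eq_square)
    next
      case (Suc i)
      show ?thesis using 1 unfolding Suc
        by (auto intro!: derivative_eq_intros simp: flat_def algebra_simps) (cases i, auto)
    qed
    then show ?thesis
      by (rule has_field_derivative_transform_within_open[where S="{0<..}"]) (use 1 in \<open>auto simp: flat_def\<close>)
  next
    case 2
    have "((\<lambda>t. 0) has_real_derivative 0) (at t)" by simp
    then have "(flat j has_real_derivative 0) (at t)"
      by (rule has_field_derivative_transform_within_open[where S="{..<0}"]) (use 2 in \<open>auto simp: flat_def\<close>)
    then show ?thesis using 2 by (simp add: flat_def)
  next
    case 3
    have "((\<lambda>h. (flat j (0 + h) - flat j 0) / h) \<longlongrightarrow> 0) (at 0)"
    proof (rule Lim_transform_eventually[OF flat_tendsto_0[of "Suc j"]])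
      show "eventually (\<lambda>h. flat (Suc j) h = (flat j (0 + h) - flat j 0) / h) (at 0)"
        by (auto simp: eventually_at_filter flat_def divide_inverse)
    qed
    then show ?thesis using 3 by (simp add: DERIV_def flat_def)
  qed
qed

lemma partial_derivI: "(\<phi> has_derivative D) (at x) \<Longrightarrow> partial_deriv k \<phi> x = D (axis k 1)"
  unfolding partial_deriv_def using frechet_derivative_at by metis

lemma partial_deriv_has_real_derivative:
  assumes "\<phi> differentiable (at (x + s *\<^sub>R axis k 1))"
  shows "((\<lambda>s. \<phi> (x + s *\<^sub>R axis k 1)) has_real_derivative partial_deriv k \<phi> (x + s *\<^sub>R axis k 1)) (at s)"
proof -
  obtain D where D: "(\<phi> has_derivative D) (at (x + s *\<^sub>R axis k 1))" using assms by (auto simp: differentiable_def)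
  have "((\<lambda>s. x + s *\<^sub>R axis k 1) has_derivative (\<lambda>h. h *\<^sub>R axis k 1)) (at s)"
    by (auto intro!: derivative_eq_intros)
  from diff_chain_at[OF this D]
  have "((\<lambda>s. \<phi> (x + s *\<^sub>R axis k 1)) has_derivative (\<lambda>h. D (h *\<^sub>R axis k 1))) (at s)" by (simp add: o_def)
  also have "(\<lambda>h. D (h *\<^sub>R axis k 1)) = (\<lambda>h. partial_deriv k \<phi> (x + s *\<^sub>R axis k 1) * h)"
    using linear_cmul[OF has_derivative_linear[OF D]] by (simp add: partial_derivI[OF D] mult.commute)
  finally show ?thesis by (simp add: has_field_derivative_def)
qed

lemma partial_deriv_add:
  assumes "\<phi> differentiable (at x)" "\<psi> differentiable (at x)"
  shows "partial_deriv k (\<lambda>x. \<phi> x + \<psi> x) x = partial_deriv k \<phi> x + partial_deriv k \<psi> x"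
proof -
  obtain D E where D: "(\<phi> has_derivative D) (at x)" "(\<psi> has_derivative E) (at x)" using assms by (auto simp: differentiable_def)
  show ?thesis using partial_derivI[OF has_derivative_add[OF D]] by (simp add: partial_derivI[OF D(1)] partial_derivI[OF D(2)])
qed

lemma partial_deriv_mult:
  assumes "\<phi> differentiable (at x)" "\<psi> differentiable (at x)"
  shows "partial_deriv k (\<lambda>x. \<phi> x * \<psi> x) x = \<phi> x * partial_deriv k \<psi> x + partial_deriv k \<phi> x * \<psi> x"
proof -
  obtain D E where D: "(\<phi> has_derivative D) (at x)" "(\<psi> has_derivative E) (at x)" using assms by (auto simp: differentiable_def)
  show ?thesis using partial_derivI[OF has_derivative_mult[OF D]] by (simp add: partial_derivI[OF D(1)] partial_derivI[OF D(2)])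
qed

lemma partial_deriv_comp:
  assumes "\<phi> differentiable (at x)" "(g has_real_derivative g') (at (\<phi> x))"
  shows "(\<lambda>x. g (\<phi> x)) differentiable (at x)" "partial_deriv k (\<lambda>x. g (\<phi> x)) x = g' * partial_deriv k \<phi> x"
proof -
  obtain D where D: "(\<phi> has_derivative D) (at x)" using assms by (auto simp: differentiable_def)
  have c: "((\<lambda>x. g (\<phi> x)) has_derivative (\<lambda>h. g' * D h)) (at x)"
    using diff_chain_at[OF D assms(2)[unfolded has_field_derivative_def]] by (simp add: o_def)
  show "(\<lambda>x. g (\<phi> x)) differentiable (at x)" using c by (auto simp: differentiable_def)
  show "partial_deriv k (\<lambda>x. g (\<phi> x)) x = g' * partial_deriv k \<phi> x"
    by (simp add: partial_derivI[OF c] partial_derivI[OF D])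
qed

lemma partial_deriv_const: "partial_deriv k (\<lambda>x. c) x = 0"
  by (rule partial_derivI) simp

lemma partial_deriv_coord: "partial_deriv k (\<lambda>x. x $ i) x = (if i = k then 1 else 0)"
proof -
  have "((\<lambda>x::R4. x $ i) has_derivative (\<lambda>h. h $ i)) (at x)"
    by (rule bounded_linear_imp_has_derivative[OF bounded_linear_vec_nth])
  from partial_derivI[OF this] show ?thesis by (simp add: axis_def)
qed

text \<open>An algebra of smooth functions that is closed under differentiation and contains everything
  needed below; membership replaces an explicit discussion of derivatives of all orders.\<close>

inductive smooth_alg :: "(R4 \<Rightarrow> real) \<Rightarrow> bool" where
  const: "smooth_alg (\<lambda>x. c)"
| coord: "smooth_alg (\<lambda>x. x $ i)"
| add: "smooth_alg \<phi> \<Longrightarrow> smooth_alg \<psi> \<Longrightarrow> smooth_alg (\<lambda>x. \<phi> x + \<psi> x)"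
| mult: "smooth_alg \<phi> \<Longrightarrow> smooth_alg \<psi> \<Longrightarrow> smooth_alg (\<lambda>x. \<phi> x * \<psi> x)"
| inv: "smooth_alg \<phi> \<Longrightarrow> (\<And>x. \<phi> x > 0) \<Longrightarrow> smooth_alg (\<lambda>x. inverse (\<phi> x))"
| flat: "smooth_alg \<phi> \<Longrightarrow> smooth_alg (\<lambda>x. flat j (\<phi> x))"

lemma smooth_alg_deriv:
  assumes "smooth_alg \<phi>"
  shows "(\<forall>x. \<phi> differentiable (at x)) \<and> (\<forall>k. smooth_alg (partial_deriv k \<phi>))"
  using assms
proof (induction rule: smooth_alg.induct)
  case (const c)
  have "partial_deriv k (\<lambda>x. c) = (\<lambda>x. 0)" for k by (auto simp: partial_deriv_const)
  then show ?case by (simp add: smooth_alg.const)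
next
  case (coord i)
  have "partial_deriv k (\<lambda>x. x $ i) = (\<lambda>x. if i = k then 1 else 0)" for k by (auto simp: partial_deriv_coord)
  then show ?case
    by (auto intro: bounded_linear_imp_differentiable[OF bounded_linear_vec_nth] smooth_alg.const)
next
  case (add \<phi> \<psi>)
  then have "partial_deriv k (\<lambda>x. \<phi> x + \<psi> x) = (\<lambda>x. partial_deriv k \<phi> x + partial_deriv k \<psi> x)" for k
    by (auto simp: partial_deriv_add)
  then show ?case using add by (auto intro!: smooth_alg.add)
next
  case (mult \<phi> \<psi>)
  then have "partial_deriv k (\<lambda>x. \<phi> x * \<psi> x) = (\<lambda>x. \<phi> x * partial_deriv k \<psi> x + partial_deriv k \<phi> x * \<psi> x)" for k
    by (auto simp: partial_deriv_mult)
  then show ?case using mult by (auto intro!: smooth_alg.add smooth_alg.mult)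
next
  case (inv \<phi>)
  have d: "(inverse has_real_derivative - (inverse (\<phi> x) * inverse (\<phi> x))) (at (\<phi> x))" for x
    using DERIV_inverse[of "\<phi> x"] inv(2)[of x] by (simp add: power2_eq_square)
  have "partial_deriv k (\<lambda>x. inverse (\<phi> x)) = (\<lambda>x. (-1) * (inverse (\<phi> x) * inverse (\<phi> x)) * partial_deriv k \<phi> x)" for k
    using partial_deriv_comp(2)[OF _ d] inv by auto
  moreover have "smooth_alg (\<lambda>x. (-1) * (inverse (\<phi> x) * inverse (\<phi> x)) * partial_deriv k \<phi> x)" for k
    using inv by (intro smooth_alg.mult smooth_alg.const smooth_alg.inv) auto
  ultimately show ?case
    using inv partial_deriv_comp(1)[OF _ d] by auto
next
  case (flat \<phi> j)
  have "partial_deriv k (\<lambda>x. flat j (\<phi> x)) = (\<lambda>x. (flat (j + 2) (\<phi> x) + (- real j) * flat (j + 1) (\<phi> x)) * partial_deriv k \<phi> x)" for k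
    using partial_deriv_comp(2)[OF _ flat_deriv] flat by auto
  moreover have "smooth_alg (\<lambda>x. (flat (j + 2) (\<phi> x) + (- real j) * flat (j + 1) (\<phi> x)) * partial_deriv k \<phi> x)" for k
    using flat by (intro smooth_alg.mult smooth_alg.add smooth_alg.const smooth_alg.flat) auto
  ultimately show ?case
    using flat partial_deriv_comp(1)[OF _ flat_deriv] by auto
qed

lemma smooth_alg_differentiable: "smooth_alg \<phi> \<Longrightarrow> \<phi> differentiable (at x)"
  and smooth_alg_partial: "smooth_alg \<phi> \<Longrightarrow> smooth_alg (partial_deriv k \<phi>)"
  using smooth_alg_deriv by blast+

lemma smooth_alg_continuous: "smooth_alg \<phi> \<Longrightarrow> continuous_on UNIV \<phi>"
  using smooth_alg_differentiable differentiable_imp_continuous_within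
  by (metis continuous_on_eq_continuous_within)

lemma smooth_alg_C_k: "smooth_alg \<phi> \<Longrightarrow> C_k n \<phi>"
  by (induction n arbitrary: \<phi>) (auto simp: smooth_alg_continuous smooth_alg_differentiable smooth_alg_partial)

lemma smooth_alg_diff: "smooth_alg \<phi> \<Longrightarrow> smooth_alg \<psi> \<Longrightarrow> smooth_alg (\<lambda>x. \<phi> x - \<psi> x)"
  using smooth_alg.add[OF _ smooth_alg.mult[OF smooth_alg.const[of "-1"]], of \<phi> \<psi>] by simp

lemma smooth_alg_reflect: "smooth_alg \<phi> \<Longrightarrow> smooth_alg (\<lambda>y. \<phi> (x - y))"
proof (induction rule: smooth_alg.induct)
  case (coord i)
  show ?case using smooth_alg_diff[OF smooth_alg.const smooth_alg.coord] by simp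
qed (auto intro: smooth_alg.intros)

text \<open>Test functions taken from the algebra.  The weak derivatives in the domain of the Dirac operator are tested
  against all smooth compactly supported functions, but only these are ever inserted.\<close>

definition ctest :: "(R4 \<Rightarrow> real) \<Rightarrow> bool" where
  "ctest \<phi> \<longleftrightarrow> smooth_alg \<phi> \<and> (\<exists>R. \<forall>x. norm x > R \<longrightarrow> \<phi> x = 0)"

lemma ctest_cc: "ctest \<phi> \<Longrightarrow> cc \<phi>"
  by (auto simp: ctest_def cc_def smooth_alg_continuous)

lemma compact_support_iff: "compact (closure {x. \<phi> x \<noteq> 0}) \<longleftrightarrow> (\<exists>R. \<forall>x. norm x > R \<longrightarrow> \<phi> x = 0)"
  for \<phi> :: "R4 \<Rightarrow> real"
proof
  assume "compact (closure {x. \<phi> x \<noteq> 0})"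
  then obtain R where "\<forall>x\<in>closure {x. \<phi> x \<noteq> 0}. norm x \<le> R" using compact_imp_bounded bounded_iff by metis
  then show "\<exists>R. \<forall>x. norm x > R \<longrightarrow> \<phi> x = 0" using closure_subset by (intro exI[of _ R]) force
next
  assume "\<exists>R. \<forall>x. norm x > R \<longrightarrow> \<phi> x = 0"
  then have "bounded {x. \<phi> x \<noteq> 0}" by (auto simp: bounded_iff not_le[symmetric])
  then show "compact (closure {x. \<phi> x \<noteq> 0})" by simp
qed

lemma ctest_test_function: "ctest \<phi> \<Longrightarrow> test_function \<phi>"
  unfolding ctest_def test_function_def compact_support_iff using smooth_alg_C_k by blast

lemma partial_deriv_support:
  assumes "\<And>x. norm x > R \<Longrightarrow> \<phi> x = 0" "norm x > R"
  shows "partial_deriv k \<phi> x = 0"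
proof -
  have "((\<lambda>x. 0) has_derivative (\<lambda>h. 0)) (at x)" by simp
  then have "(\<phi> has_derivative (\<lambda>h. 0)) (at x)"
    by (rule has_derivative_transform_within_open[where s="{x. norm x > R}"])
      (use assms in \<open>auto intro!: open_Collect_less continuous_intros\<close>)
  from partial_derivI[OF this] show ?thesis by simp
qed

lemma ctest_partial: "ctest \<phi> \<Longrightarrow> ctest (partial_deriv k \<phi>)"
  unfolding ctest_def using smooth_alg_partial partial_deriv_support by metis

lemma ctest_diff: "ctest \<phi> \<Longrightarrow> ctest \<psi> \<Longrightarrow> ctest (\<lambda>x. \<phi> x - \<psi> x)"
  using cc_diff[OF ctest_cc ctest_cc] by (auto simp: ctest_def cc_def smooth_alg_diff)

lemma ctest_reflect: "ctest \<phi> \<Longrightarrow> ctest (\<lambda>y. \<phi> (x - y))"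
  using cc_reflect[OF ctest_cc, of \<phi> x] by (auto simp: ctest_def cc_def smooth_alg_reflect)

lemma partial_deriv_reflect:
  assumes "\<phi> differentiable (at (x - y))"
  shows "partial_deriv k (\<lambda>y. \<phi> (x - y)) y = - partial_deriv k \<phi> (x - y)"
    "(\<lambda>y. \<phi> (x - y)) differentiable (at y)"
proof -
  obtain D where D: "(\<phi> has_derivative D) (at (x - y))" using assms by (auto simp: differentiable_def)
  have "((\<lambda>y. x - y) has_derivative (\<lambda>h. - h)) (at y)" by (auto intro!: derivative_eq_intros)
  from diff_chain_at[OF this D] have d: "((\<lambda>y. \<phi> (x - y)) has_derivative (\<lambda>h. D (- h))) (at y)" by (simp add: o_def)
  show "partial_deriv k (\<lambda>y. \<phi> (x - y)) y = - partial_deriv k \<phi> (x - y)"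
    using linear_neg[OF has_derivative_linear[OF D]] by (simp add: partial_derivI[OF d] partial_derivI[OF D])
  show "(\<lambda>y. \<phi> (x - y)) differentiable (at y)" using d by (auto simp: differentiable_def)
qed

text \<open>The integral of a partial derivative vanishes: it is the limit of the integrals of difference
  quotients, which vanish by translation invariance.\<close>

lemma integral_partial_deriv:
  assumes diff: "\<And>x. \<psi> differentiable (at x)" and cc: "cc \<psi>" "cc (partial_deriv k \<psi>)"
  shows "(\<integral>x. partial_deriv k \<psi> x \<partial>lborel) = 0"
proof -
  let ?e = "axis k 1 :: R4"
  define h where "h n = inverse (real (Suc n))" for n
  have h: "h n > 0" "h n \<le> 1" for n by (auto simp: h_def inverse_le_1_iff)
  have [measurable]: "\<psi> \<in> borel_measurable borel" using cc by measurable
  obtain B where B: "\<And>x. \<bar>partial_deriv k \<psi> x\<bar> \<le> B" using cc_bounded[OF cc(2)] by metis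
  obtain R where R: "\<And>x. norm x > R \<Longrightarrow> \<psi> x = 0" using cc_bounded[OF cc(1)] by metis
  \<comment> \<open>difference quotients with steps \<open>h n \<le> 1\<close>, supported in a fixed ball and bounded by the mean value theorem\<close>
  define D where "D n x = (\<psi> (x + h n *\<^sub>R ?e) - \<psi> x) / h n" for n x
  have ne: "norm ?e = 1" by simp
  have bound: "\<bar>D n x\<bar> \<le> B * indicator (cball 0 (R + 1)) x" for n x
  proof (cases "norm x > R + 1")
    case True
    have "norm x \<le> norm (x + h n *\<^sub>R ?e) + norm (h n *\<^sub>R ?e)"
      using norm_triangle_ineq4[of "x + h n *\<^sub>R ?e" "h n *\<^sub>R ?e"] by simp
    then have "norm (x + h n *\<^sub>R ?e) > R" using True h[of n] by simp
    then show ?thesis using True R[of x] R[of "x + h n *\<^sub>R ?e"] by (simp add: D_def)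
  next
    case False
    obtain z where z: "0 < z" "z < h n" "\<psi> (x + h n *\<^sub>R ?e) - \<psi> (x + 0 *\<^sub>R ?e) = (h n - 0) * partial_deriv k \<psi> (x + z *\<^sub>R ?e)"
      using MVT2[of 0 "h n" "\<lambda>s. \<psi> (x + s *\<^sub>R ?e)" "\<lambda>s. partial_deriv k \<psi> (x + s *\<^sub>R ?e)"] h[of n]
        partial_deriv_has_real_derivative[OF diff] by blast
    then have "D n x = partial_deriv k \<psi> (x + z *\<^sub>R ?e)" using h[of n] by (simp add: D_def)
    then show ?thesis using B False by (simp add: indicator_def)
  qed
  have "(\<lambda>n. \<integral>x. D n x \<partial>lborel) \<longlonglongrightarrow> (\<integral>x. partial_deriv k \<psi> x \<partial>lborel)"
  proof (rule integral_dominated_convergence)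
    show "integrable lborel (\<lambda>x::R4. B * indicator (cball 0 (R + 1)) x :: real)"
      using emeasure_bounded_finite[OF bounded_cball, of "0::R4" "R + 1"]
      by (intro integrable_mult_right integrable_real_indicator) auto
    show "AE x in lborel. norm (D n x) \<le> B * indicator (cball 0 (R + 1)) x" for n
      using bound by (intro always_eventually allI) simp
    show "AE x in lborel. (\<lambda>n. D n x) \<longlonglongrightarrow> partial_deriv k \<psi> x"
    proof (intro always_eventually allI)
      fix x
      have "((\<lambda>s. (\<psi> (x + (0 + s) *\<^sub>R ?e) - \<psi> (x + 0 *\<^sub>R ?e)) / s) \<longlongrightarrow> partial_deriv k \<psi> (x + 0 *\<^sub>R ?e)) (at 0)"
        using partial_deriv_has_real_derivative[OF diff, where x=x and s=0 and k=k] unfolding DERIV_def .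
      moreover have "filterlim h (at 0) sequentially"
      proof -
        have "h \<longlonglongrightarrow> 0" unfolding h_def by (rule LIMSEQ_inverse_real_of_nat)
        then show ?thesis unfolding filterlim_at using h by (auto intro!: always_eventually simp: less_imp_neq[symmetric])
      qed
      ultimately have "(\<lambda>n. (\<psi> (x + (0 + h n) *\<^sub>R ?e) - \<psi> (x + 0 *\<^sub>R ?e)) / h n) \<longlonglongrightarrow> partial_deriv k \<psi> (x + 0 *\<^sub>R ?e)"
        by (rule filterlim_compose)
      then show "(\<lambda>n. D n x) \<longlonglongrightarrow> partial_deriv k \<psi> x" by (simp add: D_def)
    qed
    show "D n \<in> borel_measurable lborel" for n unfolding D_def by measurable
    show "partial_deriv k \<psi> \<in> borel_measurable lborel" using cc_measurable[OF cc(2)] by simp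
  qed
  moreover have "(\<integral>x. D n x \<partial>lborel) = 0" for n
  proof -
    have t: "(\<integral>x. \<psi> (x + h n *\<^sub>R ?e) \<partial>lborel) = (\<integral>x. \<psi> x \<partial>lborel)"
      using integral_affine[of \<psi> 1 "h n *\<^sub>R ?e"] by (simp add: add.commute)
    have "integrable lborel (\<lambda>x. \<psi> (x + h n *\<^sub>R ?e))"
      using cc_integrable[OF cc_reflect[OF cc_uminus[OF cc(1)], of "- (h n *\<^sub>R ?e)"]] by (simp add: add.commute)
    then show ?thesis unfolding D_def by (simp add: t cc_integrable[OF cc(1)])
  qed
  ultimately show ?thesis using LIMSEQ_unique[OF tendsto_const, of 0] by simp
qed

lemma integral_by_parts:
  assumes \<psi>: "\<And>x. \<psi> differentiable (at x)" "cc \<psi>" "cc (partial_deriv k \<psi>)"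
    and d\<phi>: "\<And>x. \<phi> differentiable (at x)" and co: "continuous_on UNIV \<phi>" "continuous_on UNIV (partial_deriv k \<phi>)"
  shows "(\<integral>x. partial_deriv k \<psi> x * \<phi> x \<partial>lborel) = - (\<integral>x. \<psi> x * partial_deriv k \<phi> x \<partial>lborel)"
proof -
  have c: "cc (\<lambda>x. \<psi> x * \<phi> x)" "cc (\<lambda>x. \<psi> x * partial_deriv k \<phi> x)" "cc (\<lambda>x. partial_deriv k \<psi> x * \<phi> x)"
    by (rule cc_mult \<psi> co)+
  have eq: "partial_deriv k (\<lambda>x. \<psi> x * \<phi> x) = (\<lambda>x. \<psi> x * partial_deriv k \<phi> x + partial_deriv k \<psi> x * \<phi> x)"
    by (auto simp: partial_deriv_mult[OF \<psi>(1) d\<phi>])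
  have "cc (\<lambda>x. \<psi> x * partial_deriv k \<phi> x - (- (partial_deriv k \<psi> x * \<phi> x)))"
    by (intro cc_diff cc_neg c)
  then have "(\<integral>x. partial_deriv k (\<lambda>x. \<psi> x * \<phi> x) x \<partial>lborel) = 0"
    by (intro integral_partial_deriv c) (auto simp: eq intro!: differentiable_mult \<psi> d\<phi>)
  then show ?thesis by (simp add: eq cc_integrable c)
qed

lemma test_functionD:
  assumes "test_function \<psi>"
  shows "\<psi> differentiable (at x)" "cc \<psi>" "cc (partial_deriv k \<psi>)"
proof -
  have 1: "C_k (Suc 0) \<psi>" "C_k 0 \<psi>" using assms unfolding test_function_def by blast+
  then show "\<psi> differentiable (at x)" by simp
  obtain R where R: "\<And>x. norm x > R \<Longrightarrow> \<psi> x = 0" using assms[unfolded test_function_def compact_support_iff] by blast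
  then show "cc \<psi>" using 1 by (auto simp: cc_def)
  have "\<forall>x. norm x > R \<longrightarrow> partial_deriv k \<psi> x = 0" using partial_deriv_support[of R \<psi>] R by blast
  moreover have "continuous_on UNIV (partial_deriv k \<psi>)" using 1 by simp
  ultimately show "cc (partial_deriv k \<psi>)" unfolding cc_def by blast
qed

text \<open>Pairing with the fields \<open>\<psi> c\<close> turns weak derivatives into identities of inner products.\<close>

definition tens :: "(R4 \<Rightarrow> real) \<Rightarrow> complex^4 \<Rightarrow> L2" where
  "tens \<psi> c = mk_L2 (\<lambda>x. \<psi> x *\<^sub>R c)"

lemma rep_tens_AE: "cc \<psi> \<Longrightarrow> AE x in lborel. rep_L2 (tens \<psi> c) x = \<psi> x *\<^sub>R c"
  unfolding tens_def by (rule rep_mk_L2_AE[OF cc_square_integrable])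

lemma cinner_tens:
  assumes \<psi>: "cc \<psi>" shows "cinner u (tens \<psi> c) = hdot (\<integral>x. \<psi> x *\<^sub>R rep_L2 u x \<partial>lborel) c"
proof -
  have [measurable]: "\<psi> \<in> borel_measurable borel" using \<psi> by measurable
  have "cinner u (tens \<psi> c) = (\<integral>x. hdot (\<psi> x *\<^sub>R rep_L2 u x) c \<partial>lborel)"
    unfolding cinner_rep
    by (rule integral_cong_AE)
      (use rep_tens_AE[OF \<psi>, of c] in \<open>auto simp: hdot_scaleR_left hdot_scaleR_right elim: eventually_mono\<close>)
  then show ?thesis by (simp add: integral_hdot_left[OF cc_integrable_rep[OF \<psi>]])
qed

lemma hdot_ext: "(\<And>c. hdot a c = hdot b c) \<Longrightarrow> a = b"
proof -
  assume "\<And>c. hdot a c = hdot b c"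
  moreover have "hdot v (axis i 1) = v $ i" for v i
    by (simp add: hdot_def axis_def if_distrib[of cnj] if_distrib[of "\<lambda>x. _ * x"] cong: if_cong)
  ultimately show ?thesis by (metis vec_eq_iff)
qed

lemma hdot_minus_left: "hdot (- a) b = - hdot a b"
  using hdot_scaleR_left[of "-1" a b] by simp

text \<open>In this form weak derivatives are stable under limits in norm.\<close>

lemma weak_iff:
  "weak_partial_deriv k u g \<longleftrightarrow>
    (\<forall>\<psi> c. test_function \<psi> \<longrightarrow> cinner u (tens (partial_deriv k \<psi>) c) = - cinner g (tens \<psi> c))"
  unfolding weak_partial_deriv_def
  by (auto simp: cinner_tens test_functionD hdot_minus_left intro!: hdot_ext)

lemma weak_limit:
  assumes "\<And>n::nat. weak_partial_deriv k (u n) (g n)" "u \<longlonglongrightarrow> u'" "g \<longlonglongrightarrow> g'"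
  shows "weak_partial_deriv k u' g'"
  unfolding weak_iff
proof (intro allI impI)
  fix \<psi> c assume t: "test_function \<psi>"
  have "(\<lambda>n. cinner (u n) (tens (partial_deriv k \<psi>) c)) \<longlonglongrightarrow> cinner u' (tens (partial_deriv k \<psi>) c)"
    by (intro tendsto_cinner_left assms)
  moreover have "(\<lambda>n. - cinner (g n) (tens \<psi> c)) \<longlonglongrightarrow> - cinner g' (tens \<psi> c)"
    by (intro tendsto_minus tendsto_cinner_left assms)
  ultimately show "cinner u' (tens (partial_deriv k \<psi>) c) = - cinner g' (tens \<psi> c)"
    using assms(1) t by (auto simp: weak_iff intro: LIMSEQ_unique)
qed

lemma weak_add: "weak_partial_deriv k u g \<Longrightarrow> weak_partial_deriv k u' g' \<Longrightarrow> weak_partial_deriv k (u + u') (g + g')"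
  by (simp add: weak_iff cinner_add_left)

lemma weak_scaleC: "weak_partial_deriv k u g \<Longrightarrow> weak_partial_deriv k (scaleC c u) (scaleC c g)"
  by (simp add: weak_iff cinner_scaleC_left)

text \<open>The reflected translates of the kernel are admissible test functions.\<close>

lemma conv_weak:
  assumes w: "weak_partial_deriv k u g" and \<phi>: "ctest \<phi>"
  shows "conv \<phi> (rep_L2 g) x = conv (partial_deriv k \<phi>) (rep_L2 u) x"
proof -
  have d: "\<phi> differentiable (at x)" for x using \<phi> by (auto simp: ctest_def smooth_alg_differentiable)
  have "test_function (\<lambda>y. \<phi> (x - y))" by (intro ctest_test_function ctest_reflect \<phi>)
  then have "(\<integral>y. partial_deriv k (\<lambda>y. \<phi> (x - y)) y *\<^sub>R rep_L2 u y \<partial>lborel) = - (\<integral>y. \<phi> (x - y) *\<^sub>R rep_L2 g y \<partial>lborel)"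
    using w by (auto simp: weak_partial_deriv_def)
  then show ?thesis by (simp add: conv_def partial_deriv_reflect(1)[OF d])
qed

lemma Conv_weak: "weak_partial_deriv k u g \<Longrightarrow> ctest \<phi> \<Longrightarrow> Conv \<phi> g = Conv (partial_deriv k \<phi>) u"
  unfolding Conv_def by (auto intro!: arg_cong[of _ _ mk_L2] conv_weak)

lemma weak_Conv:
  assumes \<phi>: "ctest \<phi>"
  shows "weak_partial_deriv k (Conv \<phi> u) (Conv (partial_deriv k \<phi>) u)"
  unfolding weak_iff
proof (intro allI impI)
  fix \<psi> c assume t: "test_function \<psi>"
  note \<psi> = test_functionD[OF t]
  have c\<phi>: "cc \<phi>" "cc (partial_deriv k \<phi>)" using \<phi> ctest_cc ctest_partial by auto
  have d: "\<phi> differentiable (at x)" for x using \<phi> by (auto simp: ctest_def smooth_alg_differentiable)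
  have conv_tens: "conv (\<lambda>x. \<phi>' (- x)) (rep_L2 (tens \<psi>' c)) y = (\<integral>x. \<psi>' x * \<phi>' (x - y) \<partial>lborel) *\<^sub>R c"
    if "cc \<phi>'" "cc \<psi>'" for \<phi>' \<psi>' y
  proof -
    have [measurable]: "\<phi>' \<in> borel_measurable borel" "\<psi>' \<in> borel_measurable borel" using that by measurable
    have "conv (\<lambda>x. \<phi>' (- x)) (rep_L2 (tens \<psi>' c)) y = conv (\<lambda>x. \<phi>' (- x)) (\<lambda>x. \<psi>' x *\<^sub>R c) y"
      by (rule conv_cong_AE[OF _ _ _ rep_tens_AE[OF that(2)]]) measurable
    also have "\<dots> = (\<integral>x. (\<psi>' x * \<phi>' (x - y)) *\<^sub>R c \<partial>lborel)" by (simp add: conv_def mult.commute)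
    also have "\<dots> = (\<integral>x. \<psi>' x * \<phi>' (x - y) \<partial>lborel) *\<^sub>R c"
      by (rule integral_scaleR_left) 
        (use cc_mult[OF that(2)] cc_reflect[OF cc_uminus[OF that(1)], of y] in \<open>auto intro!: cc_integrable simp: cc_def\<close>)
    finally show ?thesis .
  qed
  have ct: "ctest (\<lambda>x. \<phi> (x - y))" for y
    using ctest_reflect[OF ctest_reflect[OF \<phi>, of 0], of y] by simp
  have "partial_deriv k (\<lambda>x. \<phi> (x - y)) x = partial_deriv k \<phi> (x - y)" for x y
  proof -
    obtain D where D: "(\<phi> has_derivative D) (at (x - y))" using d by (auto simp: differentiable_def)
    have "((\<lambda>x. x - y) has_derivative (\<lambda>h. h)) (at x)" by (auto intro!: derivative_eq_intros)
    from diff_chain_at[OF this D] have "((\<lambda>x. \<phi> (x - y)) has_derivative D) (at x)" by (simp add: o_def)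
    then show ?thesis by (simp add: partial_derivI[OF D] partial_derivI)
  qed
  then have ibp: "(\<integral>x. partial_deriv k \<psi> x * \<phi> (x - y) \<partial>lborel) = - (\<integral>x. \<psi> x * partial_deriv k \<phi> (x - y) \<partial>lborel)" for y
    using integral_by_parts[OF \<psi>, of "\<lambda>x. \<phi> (x - y)"] ctest_cc[OF ct] ctest_cc[OF ctest_partial[OF ct]] ct
    by (simp add: cc_def ctest_def smooth_alg_differentiable)
  have "Conv (\<lambda>x. \<phi> (- x)) (tens (partial_deriv k \<psi>) c) = - Conv (\<lambda>x. partial_deriv k \<phi> (- x)) (tens \<psi> c)"
  proof -
    have e: "conv (\<lambda>x. \<phi> (- x)) (rep_L2 (tens (partial_deriv k \<psi>) c)) y = - conv (\<lambda>x. partial_deriv k \<phi> (- x)) (rep_L2 (tens \<psi> c)) y" for y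
      by (simp add: conv_tens c\<phi> \<psi> ibp)
    have "AE y in lborel. rep_L2 (Conv (\<lambda>x. \<phi> (- x)) (tens (partial_deriv k \<psi>) c)) y = rep_L2 (- Conv (\<lambda>x. partial_deriv k \<phi> (- x)) (tens \<psi> c)) y"
      using rep_Conv_AE[OF cc_uminus[OF c\<phi>(1)], of "tens (partial_deriv k \<psi>) c"] rep_Conv_AE[OF cc_uminus[OF c\<phi>(2)], of "tens \<psi> c"]
        rep_uminus_AE[of "Conv (\<lambda>x. partial_deriv k \<phi> (- x)) (tens \<psi> c)"]
      by eventually_elim (simp add: e)
    then show ?thesis by (rule L2_eqI)
  qed
  then show "cinner (Conv \<phi> u) (tens (partial_deriv k \<psi>) c) = - cinner (Conv (partial_deriv k \<phi>) u) (tens \<psi> c)"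
    by (simp add: Conv_adjoint c\<phi>)
qed

section \<open>An approximate identity\<close>

lemma nn_integral_abs_le:
  fixes f :: "real \<Rightarrow> ennreal"
  assumes [measurable]: "f \<in> borel_measurable borel"
  shows "(\<integral>\<^sup>+t. f \<bar>t\<bar> \<partial>lborel) \<le> 2 * (\<integral>\<^sup>+t. indicator {0..} t * f t \<partial>lborel)"
proof -
  have "(\<integral>\<^sup>+t. f \<bar>t\<bar> \<partial>lborel) \<le> (\<integral>\<^sup>+t. indicator {0..} t * f t + indicator {0..} (- t) * f (- t) \<partial>lborel)"
    by (intro nn_integral_mono) (auto simp: indicator_def abs_if)
  also have "\<dots> = (\<integral>\<^sup>+t. indicator {0..} t * f t \<partial>lborel) + (\<integral>\<^sup>+t. indicator {0..} (- t) * f (- t) \<partial>lborel)"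
    by (rule nn_integral_add) measurable
  also have "(\<integral>\<^sup>+t. indicator {0..} (- t) * f (- t) \<partial>lborel) = (\<integral>\<^sup>+t. indicator {0..} t * f t \<partial>lborel)"
    using nn_integral_real_affine[of "\<lambda>t. indicator {0..} t * f t" "-1" 0] by simp
  finally show ?thesis by (simp add: mult_2)
qed

lemma nn_integral_R4_prod:
  assumes [measurable]: "g \<in> borel_measurable borel"
  shows "(\<integral>\<^sup>+x. (\<Prod>b\<in>Basis. g (x \<bullet> b)) \<partial>(lborel :: R4 measure)) = (\<integral>\<^sup>+t. g t \<partial>(lborel :: real measure)) ^ 4"
  by (subst nn_integral_lborel_prod) auto

text \<open>The bound \<open>|x|\<^sup>-\<^sup>s \<le> \<Prod> |x\<^sub>b|\<^sup>-\<^sup>s\<^sup>/\<^sup>4\<close> over the four coordinates makes integrability a one-dimensional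
  question.\<close>

lemma nn_integral_singular_kernel:
  assumes s: "0 \<le> s" "s < 4" and R: "R > 0"
  shows "(\<integral>\<^sup>+x. ennreal (indicator (cball 0 R) x * norm x powr (- s)) \<partial>(lborel :: R4 measure)) < \<infinity>"
proof -
  define g where "g t = ennreal (indicator {-R..R} t * \<bar>t\<bar> powr (- (s / 4)))" for t :: real
  have [measurable]: "g \<in> borel_measurable borel" unfolding g_def by measurable
  have "AE x in (lborel :: R4 measure). \<forall>b\<in>Basis. x \<bullet> b \<noteq> 0"
    by (rule AE_finite_allI) (auto intro: AE_lborel_inner_neq)
  then have "(\<integral>\<^sup>+x. ennreal (indicator (cball 0 R) x * norm x powr (- s)) \<partial>(lborel :: R4 measure)) \<le> (\<integral>\<^sup>+x. (\<Prod>b\<in>Basis. g (x \<bullet> b)) \<partial>(lborel :: R4 measure))"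
  proof (intro nn_integral_mono_AE, eventually_elim)
    fix x :: R4 assume nz: "\<forall>b\<in>Basis. x \<bullet> b \<noteq> 0"
    show "ennreal (indicator (cball 0 R) x * norm x powr (- s)) \<le> (\<Prod>b\<in>Basis. g (x \<bullet> b))"
    proof (cases "norm x \<le> R")
      case True
      have le: "\<bar>x \<bullet> b\<bar> \<le> norm x" if "b \<in> Basis" for b using that by (rule Basis_le_norm)
      have x0: "x \<noteq> 0" using nz by (auto simp: nonempty_Basis dest: ex_in_conv[THEN iffD2])
      have "norm x powr (- s) = (norm x powr (- (s / 4))) ^ 4"
        using x0 by (simp add: powr_power)
      also have "\<dots> = (\<Prod>b\<in>(Basis :: R4 set). norm x powr (- (s / 4)))" by simp
      also have "\<dots> \<le> (\<Prod>b\<in>Basis. \<bar>x \<bullet> b\<bar> powr (- (s / 4)))"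
      proof (intro prod_mono conjI)
        fix b :: R4 assume b: "b \<in> Basis"
        show "norm x powr (- (s / 4)) \<le> \<bar>x \<bullet> b\<bar> powr (- (s / 4))"
          using powr_mono2'[of "- (s/4)" "\<bar>x \<bullet> b\<bar>" "norm x"] le[OF b] nz b s by simp
      qed simp
      finally have "ennreal (norm x powr (- s)) \<le> ennreal (\<Prod>b\<in>Basis. \<bar>x \<bullet> b\<bar> powr (- (s / 4)))" by (rule ennreal_leI)
      also have "\<dots> = (\<Prod>b\<in>Basis. ennreal (\<bar>x \<bullet> b\<bar> powr (- (s / 4))))" by (rule prod_ennreal[symmetric]) simp
      also have "\<dots> = (\<Prod>b\<in>Basis. g (x \<bullet> b))"
      proof (intro prod.cong refl)
        fix b :: R4 assume "b \<in> Basis"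
        then have "x \<bullet> b \<in> {-R..R}" using le[of b] True by auto
        then show "ennreal (\<bar>x \<bullet> b\<bar> powr (- (s / 4))) = g (x \<bullet> b)" by (simp add: g_def)
      qed
      finally show ?thesis using True by simp
    qed simp
  qed
  also have "\<dots> = (\<integral>\<^sup>+t. g t \<partial>lborel) ^ 4" by (rule nn_integral_R4_prod) measurable
  also have "\<dots> < \<infinity>"
  proof -
    have "(\<integral>\<^sup>+t. g t \<partial>lborel) = (\<integral>\<^sup>+t. (\<lambda>t. ennreal (indicator {0..R} t * t powr (- (s / 4)))) \<bar>t\<bar> \<partial>lborel)"
      by (intro nn_integral_cong) (auto simp: g_def indicator_def)
    also have "\<dots> \<le> 2 * (\<integral>\<^sup>+t. indicator {0..} t * ennreal (indicator {0..R} t * t powr (- (s / 4))) \<partial>lborel)"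
      by (rule nn_integral_abs_le) measurable
    also have "(\<integral>\<^sup>+t. indicator {0..} t * ennreal (indicator {0..R} t * t powr (- (s / 4))) \<partial>lborel) = (\<integral>\<^sup>+t. ennreal (indicator {0..R} t * t powr (- (s / 4))) \<partial>lborel)"
      by (intro nn_integral_cong) (auto simp: indicator_def)
    also have "\<dots> = ennreal (R powr (- (s / 4) + 1) / (- (s / 4) + 1))"
      using nn_integral_has_integral_lebesgue[OF _ has_integral_powr_from_0[of "- (s / 4)" R]] s R
      by (simp add: nn_integral_completion)
    finally have "(\<integral>\<^sup>+t. g t \<partial>lborel) < \<infinity>" by (rule le_less_trans) (simp add: ennreal_mult_less_top)
    then show ?thesis by (simp add: power_less_top_ennreal)
  qed
  finally show ?thesis .
qed

text \<open>This is the divergence of \<open>z / (1 + |z|\<^sup>2)\<^sup>2\<close>, a regularization of the fundamental solution \<open>z / |z|\<^sup>4\<close>.  With this choice of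
  the mollifier, the representation of a field through its Dirac derivative becomes an algebraic identity.\<close>

definition eta :: "R4 \<Rightarrow> real" where
  "eta z = 4 * inverse ((1 + z \<bullet> z) ^ 3)"

lemma eta_pos: "eta z > 0"
  by (simp add: eta_def add_pos_nonneg)

lemma borel_measurable_eta [measurable]: "eta \<in> borel_measurable borel"
  unfolding eta_def by measurable

lemma integrable_eta: "integrable lborel eta"
proof (rule integrableI_nonneg)
  define g where "g t = ennreal ((1 + t\<^sup>2) powr (- (3/4)))" for t :: real
  have [measurable]: "g \<in> borel_measurable borel" unfolding g_def by measurable
  have "(\<integral>\<^sup>+z. ennreal (eta z) \<partial>lborel) \<le> (\<integral>\<^sup>+z. 4 * (\<Prod>b\<in>Basis. g (z \<bullet> b)) \<partial>(lborel :: R4 measure))"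
  proof (intro nn_integral_mono)
    fix z :: R4
    have p: "1 + z \<bullet> z > 0" by (simp add: add_pos_nonneg)
    have "inverse ((1 + z \<bullet> z) ^ 3) = (1 + z \<bullet> z) powr (- 3)"
      using p by (simp add: powr_minus powr_numeral)
    also have "\<dots> = ((1 + z \<bullet> z) powr (- (3/4))) ^ 4" using p by (simp add: powr_power)
    also have "\<dots> = (\<Prod>b\<in>(Basis :: R4 set). (1 + z \<bullet> z) powr (- (3/4)))" by simp
    also have "\<dots> \<le> (\<Prod>b\<in>Basis. (1 + (z \<bullet> b)\<^sup>2) powr (- (3/4)))"
    proof (intro prod_mono conjI)
      fix b :: R4 assume b: "b \<in> Basis"
      have "(z \<bullet> b)\<^sup>2 \<le> (norm z)\<^sup>2" using Basis_le_norm[OF b, of z] by (metis abs_le_square_iff abs_norm_cancel)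
      then have "(z \<bullet> b)\<^sup>2 \<le> z \<bullet> z" by (simp add: power2_norm_eq_inner)
      then show "(1 + z \<bullet> z) powr (- (3/4)) \<le> (1 + (z \<bullet> b)\<^sup>2) powr (- (3/4))"
        by (intro powr_mono2') (auto simp: add_pos_nonneg)
    qed simp
    finally have "ennreal (inverse ((1 + z \<bullet> z) ^ 3)) \<le> ennreal (\<Prod>b\<in>Basis. (1 + (z \<bullet> b)\<^sup>2) powr (- (3/4)))" by (rule ennreal_leI)
    also have "\<dots> = (\<Prod>b\<in>Basis. g (z \<bullet> b))" unfolding g_def by (rule prod_ennreal[symmetric]) simp
    finally have "4 * ennreal (inverse ((1 + z \<bullet> z) ^ 3)) \<le> 4 * (\<Prod>b\<in>Basis. g (z \<bullet> b))" by (rule mult_left_mono) simp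
    then show "ennreal (eta z) \<le> 4 * (\<Prod>b\<in>Basis. g (z \<bullet> b))"
      unfolding eta_def by (subst ennreal_mult) (use p in auto)
  qed
  also have "\<dots> = 4 * (\<integral>\<^sup>+t. g t \<partial>lborel) ^ 4"
    by (subst nn_integral_cmult, measurable) (simp add: nn_integral_R4_prod)
  also have "\<dots> < \<infinity>"
  proof -
    have "(\<integral>\<^sup>+t. g t \<partial>lborel) = (\<integral>\<^sup>+t. g \<bar>t\<bar> \<partial>lborel)" by (simp add: g_def)
    also have "\<dots> \<le> 2 * (\<integral>\<^sup>+t. indicator {0..} t * g t \<partial>lborel)"
      by (rule nn_integral_abs_le) measurable
    also have "\<dots> \<le> 2 * (\<integral>\<^sup>+t. indicator {0..1} t + ennreal (indicator {1..} t * t powr (- (3/2))) \<partial>lborel)"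
    proof (intro mult_left_mono nn_integral_mono)
      fix t :: real
      have 1: "g t \<le> 1"
        unfolding g_def using powr_mono2'[of "- (3/4)" 1 "1 + t\<^sup>2"] by simp
      have 2: "g t \<le> ennreal (t powr (- (3/2)))" if "t \<ge> 1"
      proof -
        have "(1 + t\<^sup>2) powr (- (3/4)) \<le> (t\<^sup>2) powr (- (3/4))" by (rule powr_mono2') (use that in auto)
        also have "(t\<^sup>2) powr (- (3/4)) = t powr (- (3/2))"
          using that by (simp add: powr_powr flip: powr_numeral)
        finally show ?thesis unfolding g_def by (rule ennreal_leI)
      qed
      show "indicator {0..} t * g t \<le> indicator {0..1} t + ennreal (indicator {1..} t * t powr (- (3/2)))"
        using 1 2 add_increasing2[of 1 "g t" 1] by (auto simp: indicator_def)
    qed simp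
    also have "(\<integral>\<^sup>+t. indicator {0..1} t + ennreal (indicator {1..} t * t powr (- (3/2))) \<partial>lborel)
      = 1 + (\<integral>\<^sup>+t. ennreal (indicator {1..} t * t powr (- (3/2))) \<partial>lborel)"
      by (subst nn_integral_add) auto
    also have "(\<integral>\<^sup>+t. ennreal (indicator {1..} t * t powr (- (3/2))) \<partial>lborel) = ennreal 2"
      using nn_integral_has_integral_lebesgue[OF _ has_integral_powr_to_inf[of "- (3/2)" 1]]
      by (simp add: nn_integral_completion)
    finally have "(\<integral>\<^sup>+t. g t \<partial>lborel) \<le> 2 * (1 + ennreal 2)" .
    then have "(\<integral>\<^sup>+t. g t \<partial>lborel) < \<infinity>" by (rule le_less_trans) (simp add: ennreal_mult_less_top)
    then show ?thesis by (simp add: power_less_top_ennreal ennreal_mult_less_top)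
  qed
  finally show "(\<integral>\<^sup>+z. ennreal (eta z) \<partial>lborel) < \<infinity>" .
qed (auto intro: less_imp_le[OF eta_pos])

definition cut :: "real \<Rightarrow> R4 \<Rightarrow> real" where
  "cut L x = flat 0 (1 - L\<^sup>2 * (x \<bullet> x))"

text \<open>Concentration at scale \<open>1 / (n + 1)\<close>, with a smooth cutoff to the ball of radius \<open>1 / L\<close>.  The kernels tend to
  \<open>moll_const\<close> times the Dirac mass at the origin; only positivity of this constant matters.\<close>

definition moll :: "real \<Rightarrow> nat \<Rightarrow> R4 \<Rightarrow> real" where
  "moll L n x = cut L x * (4 * real (Suc n) ^ 4 * inverse ((1 + (real (Suc n))\<^sup>2 * (x \<bullet> x)) ^ 3))"

definition moll_const :: real where
  "moll_const = flat 0 1 * (\<integral>z. eta z \<partial>lborel)"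

lemma flat0_bounds: "0 \<le> flat 0 t" "flat 0 t \<le> 1"
  by (auto simp: flat_def)

lemma cut_bounds: "0 \<le> cut L x" "cut L x \<le> 1"
  using flat0_bounds by (auto simp: cut_def)

lemma cut_support:
  assumes "L > 0" "norm x \<ge> 1 / L" shows "cut L x = 0"
proof -
  have "1 \<le> L * norm x" using assms by (simp add: field_simps)
  then have "1 \<le> (L * norm x)\<^sup>2" by (simp add: one_le_power)
  then have "1 \<le> L\<^sup>2 * (x \<bullet> x)" by (simp add: power_mult_distrib power2_norm_eq_inner)
  then show ?thesis by (simp add: cut_def flat_def)
qed

lemma smooth_alg_sum: "finite I \<Longrightarrow> (\<And>i. i \<in> I \<Longrightarrow> smooth_alg (f i)) \<Longrightarrow> smooth_alg (\<lambda>x. \<Sum>i\<in>I. f i x)"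
  by (induction I rule: finite_induct) (auto intro: smooth_alg.intros)

lemma smooth_alg_inner: "smooth_alg (\<lambda>x. x \<bullet> x)"
  unfolding inner_vec_def inner_real_def by (intro smooth_alg_sum smooth_alg.mult smooth_alg.coord) auto

lemma smooth_alg_cut: "smooth_alg (cut L)"
  unfolding cut_def[abs_def] by (intro smooth_alg.flat smooth_alg_diff smooth_alg.const smooth_alg.mult smooth_alg_inner)

lemma smooth_alg_inverse_quadratic: "smooth_alg (\<lambda>x. inverse ((1 + a\<^sup>2 * (x \<bullet> x)) ^ j))"
proof (induction j)
  case 0 then show ?case by (simp add: smooth_alg.const)
next
  case (Suc j)
  have "smooth_alg (\<lambda>x. inverse (1 + a\<^sup>2 * (x \<bullet> x)))"
    by (intro smooth_alg.inv smooth_alg.add smooth_alg.const smooth_alg.mult smooth_alg_inner) (simp add: add_pos_nonneg)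
  from smooth_alg.mult[OF this Suc] show ?case by (simp add: mult.commute)
qed

lemma ctest_moll: assumes "L > 0" shows "ctest (moll L n)"
proof -
  have "smooth_alg (moll L n)"
    unfolding moll_def[abs_def]
    by (intro smooth_alg.mult smooth_alg_cut smooth_alg.const smooth_alg_inverse_quadratic)
  moreover have "moll L n x = 0" if "norm x > 1 / L" for x
    using cut_support[OF assms, of x] that by (simp add: moll_def)
  ultimately show ?thesis unfolding ctest_def by blast
qed

lemmas cc_moll = ctest_cc[OF ctest_moll]

lemma moll_even: "moll L n (- x) = moll L n x"
  by (simp add: moll_def cut_def)

lemma moll_nonneg: "moll L n x \<ge> 0"
  by (simp add: moll_def cut_bounds add_nonneg_nonneg)

lemma moll_rescale: "moll L n (inverse (real (Suc n)) *\<^sub>R z) = real (Suc n) ^ 4 * (cut L (inverse (real (Suc n)) *\<^sub>R z) * eta z)"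
proof -
  have "(real (Suc n))\<^sup>2 * ((inverse (real (Suc n)) *\<^sub>R z) \<bullet> (inverse (real (Suc n)) *\<^sub>R z)) = z \<bullet> z"
    by (simp add: power2_eq_square field_simps del: of_nat_Suc)
  then show ?thesis by (simp only: moll_def eta_def) simp
qed

lemma L1n_moll_le: "L1n (moll L n) \<le> (\<integral>z. eta z \<partial>lborel)"
proof -
  have [measurable]: "cut L \<in> borel_measurable borel"
    using smooth_alg_continuous[OF smooth_alg_cut] by (rule borel_measurable_continuous_onI)
  have [measurable]: "moll L n \<in> borel_measurable borel" unfolding moll_def[abs_def] by measurable
  have "L1n (moll L n) = (\<integral>x. moll L n x \<partial>lborel)" by (simp add: L1n_def moll_nonneg)
  also have "\<dots> = inverse (real (Suc n)) ^ 4 * (\<integral>z. moll L n (0 + inverse (real (Suc n)) *\<^sub>R z) \<partial>lborel)"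
    using integral_affine[of "moll L n" "inverse (real (Suc n))" 0] by simp
  also have "\<dots> = (\<integral>z. cut L (inverse (real (Suc n)) *\<^sub>R z) * eta z \<partial>lborel)"
  proof -
    have "inverse (real (Suc n)) ^ 4 * (real (Suc n) ^ 4 * r) = r" for r
      by (simp add: power_inverse del: of_nat_Suc)
    then show ?thesis by (simp only: add_0 moll_rescale integral_mult_right_zero)
  qed
  also have "\<dots> \<le> (\<integral>z. eta z \<partial>lborel)"
  proof (rule integral_mono[OF _ integrable_eta])
    show "integrable lborel (\<lambda>z. cut L (inverse (real (Suc n)) *\<^sub>R z) * eta z)"
      by (rule Bochner_Integration.integrable_bound[OF integrable_eta])
        (auto simp: abs_mult cut_bounds less_imp_le[OF eta_pos] intro!: always_eventually mult_left_le_one_le)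
    show "cut L (inverse (real (Suc n)) *\<^sub>R z) * eta z \<le> eta z" for z
      using cut_bounds less_imp_le[OF eta_pos] by (intro mult_left_le_one_le) auto
  qed
  finally show ?thesis .
qed

lemma moll_const_pos: "moll_const > 0"
proof -
  have "(\<integral>z. eta z \<partial>lborel) \<noteq> 0"
  proof
    assume "(\<integral>z. eta z \<partial>lborel) = 0"
    then have "AE z in lborel. eta z = 0"
      using integral_nonneg_eq_0_iff_AE[OF integrable_eta] less_imp_le[OF eta_pos] by auto
    then have "AE z in (lborel :: R4 measure). False"
      by eventually_elim (use eta_pos in \<open>simp add: less_le\<close>)
    then show False using ae_filter_eq_bot_iff[of "lborel :: R4 measure"] by (simp add: trivial_limit_def)
  qed
  moreover have "(\<integral>z. eta z \<partial>lborel) \<ge> 0" using less_imp_le[OF eta_pos] by simp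
  ultimately show ?thesis by (simp add: moll_const_def flat_def)
qed

text \<open>After rescaling, the integrand is \<open>eta z f (x - z / (n + 1))\<close> up to the cutoff, and dominated convergence applies.\<close>

lemma conv_moll_pointwise:
  assumes f[measurable]: "f \<in> borel_measurable borel" and B: "\<And>x. norm (f x) \<le> B" and c: "isCont f x"
  shows "(\<lambda>n. conv (moll L n) f x) \<longlonglongrightarrow> moll_const *\<^sub>R f x"
proof -
  have cutm [measurable]: "cut L \<in> borel_measurable borel"
    using smooth_alg_continuous[OF smooth_alg_cut] by (rule borel_measurable_continuous_onI)
  have [measurable]: "moll L n \<in> borel_measurable borel" for n unfolding moll_def[abs_def] by measurable
  let ?h = "\<lambda>n. inverse (real (Suc n))"
  have eq: "conv (moll L n) f x = (\<integral>z. (cut L (?h n *\<^sub>R z) * eta z) *\<^sub>R f (x - ?h n *\<^sub>R z) \<partial>lborel)" for n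
  proof -
    have "conv (moll L n) f x = ?h n ^ 4 *\<^sub>R (\<integral>z. moll L n (x - (x + (- ?h n) *\<^sub>R z)) *\<^sub>R f (x + (- ?h n) *\<^sub>R z) \<partial>lborel)"
      unfolding conv_def using integral_affine[of "\<lambda>y. moll L n (x - y) *\<^sub>R f y" "- ?h n" x] by simp
    also have "(\<integral>z. moll L n (x - (x + (- ?h n) *\<^sub>R z)) *\<^sub>R f (x + (- ?h n) *\<^sub>R z) \<partial>lborel)
       = (\<integral>z. real (Suc n) ^ 4 *\<^sub>R ((cut L (?h n *\<^sub>R z) * eta z) *\<^sub>R f (x - ?h n *\<^sub>R z)) \<partial>lborel)"
    proof (rule Bochner_Integration.integral_cong[OF refl])
      fix z
      have "x - (x + (- ?h n) *\<^sub>R z) = ?h n *\<^sub>R z" "x + (- ?h n) *\<^sub>R z = x - ?h n *\<^sub>R z" by simp_all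
      then show "moll L n (x - (x + (- ?h n) *\<^sub>R z)) *\<^sub>R f (x + (- ?h n) *\<^sub>R z)
        = real (Suc n) ^ 4 *\<^sub>R ((cut L (?h n *\<^sub>R z) * eta z) *\<^sub>R f (x - ?h n *\<^sub>R z))"
        by (simp only: moll_rescale scaleR_scaleR)
    qed
    also have "\<dots> = real (Suc n) ^ 4 *\<^sub>R (\<integral>z. (cut L (?h n *\<^sub>R z) * eta z) *\<^sub>R f (x - ?h n *\<^sub>R z) \<partial>lborel)"
      by (rule integral_scaleR_right) 
    finally show ?thesis by (simp add: field_simps)
  qed
  have h0: "?h \<longlonglongrightarrow> 0" by (rule LIMSEQ_inverse_real_of_nat)
  have "(\<lambda>n. \<integral>z. (cut L (?h n *\<^sub>R z) * eta z) *\<^sub>R f (x - ?h n *\<^sub>R z) \<partial>lborel) \<longlonglongrightarrow> (\<integral>z. (flat 0 1 * eta z) *\<^sub>R f x \<partial>lborel)"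
  proof (rule integral_dominated_convergence)
    show "integrable lborel (\<lambda>z. eta z * B)" using integrable_eta by simp
    show "AE z in lborel. norm ((cut L (?h n *\<^sub>R z) * eta z) *\<^sub>R f (x - ?h n *\<^sub>R z)) \<le> eta z * B" for n
    proof (intro always_eventually allI)
      fix z
      have "\<bar>cut L (?h n *\<^sub>R z)\<bar> * eta z * norm (f (x - ?h n *\<^sub>R z)) \<le> 1 * eta z * B"
        using cut_bounds[of L "?h n *\<^sub>R z"] less_imp_le[OF eta_pos[of z]] by (intro mult_mono B) auto
      then show "norm ((cut L (?h n *\<^sub>R z) * eta z) *\<^sub>R f (x - ?h n *\<^sub>R z)) \<le> eta z * B"
        using less_imp_le[OF eta_pos[of z]] by (simp add: abs_mult)
    qed
    show "AE z in lborel. (\<lambda>n. (cut L (?h n *\<^sub>R z) * eta z) *\<^sub>R f (x - ?h n *\<^sub>R z)) \<longlonglongrightarrow> (flat 0 1 * eta z) *\<^sub>R f x"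
    proof (intro always_eventually allI)
      fix z :: R4
      have "isCont (cut L) 0"
        using smooth_alg_continuous[OF smooth_alg_cut] by (simp add: continuous_on_eq_continuous_at)
      moreover have "(\<lambda>n. ?h n *\<^sub>R z) \<longlonglongrightarrow> 0" using tendsto_scaleR[OF h0 tendsto_const, of z] by simp
      ultimately have "(\<lambda>n. cut L (?h n *\<^sub>R z)) \<longlonglongrightarrow> cut L 0" by (rule isCont_tendsto_compose)
      then have 1: "(\<lambda>n. cut L (?h n *\<^sub>R z)) \<longlonglongrightarrow> flat 0 1" by (simp add: cut_def)
      have "(\<lambda>n. x - ?h n *\<^sub>R z) \<longlonglongrightarrow> x - 0 *\<^sub>R z" by (intro tendsto_intros h0)
      then have "(\<lambda>n. f (x - ?h n *\<^sub>R z)) \<longlonglongrightarrow> f x" using isCont_tendsto_compose[OF c] by simp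
      then show "(\<lambda>n. (cut L (?h n *\<^sub>R z) * eta z) *\<^sub>R f (x - ?h n *\<^sub>R z)) \<longlonglongrightarrow> (flat 0 1 * eta z) *\<^sub>R f x"
        by (intro tendsto_intros 1)
    qed
  qed measurable
  also have "(\<integral>z. (flat 0 1 * eta z) *\<^sub>R f x \<partial>lborel) = moll_const *\<^sub>R f x"
    using integrable_eta by (subst integral_scaleR_left) (simp_all add: moll_const_def)
  finally show ?thesis by (simp only: eq)
qed

lemma norm_conv_moll_le:
  assumes f[measurable]: "f \<in> borel_measurable borel" and B: "\<And>x. norm (f x) \<le> B" and L: "L > 0"
  shows "norm (conv (moll L n) f x) \<le> (\<integral>z. eta z \<partial>lborel) * B"
proof -
  have B0: "B \<ge> 0" using B[of 0] norm_ge_zero order_trans by blast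
  have [measurable]: "moll L n \<in> borel_measurable borel" using cc_moll[OF L] by measurable
  have "ennreal (norm (conv (moll L n) f x)) \<le> (\<integral>\<^sup>+y. ennreal \<bar>moll L n (x - y)\<bar> * ennreal (norm (f y)) \<partial>lborel)"
    by (rule norm_conv_le)
  also have "\<dots> \<le> (\<integral>\<^sup>+y. ennreal \<bar>moll L n (x - y)\<bar> * ennreal B \<partial>lborel)"
    by (intro nn_integral_mono mult_left_mono ennreal_leI B) simp
  also have "\<dots> = ennreal (L1n (moll L n)) * ennreal B"
    by (subst nn_integral_multc) (simp_all add: nn_integral_reflect[of "\<lambda>y. ennreal \<bar>moll L n y\<bar>"] nn_integral_L1n[OF cc_moll[OF L]])
  finally have "norm (conv (moll L n) f x) \<le> L1n (moll L n) * B"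
    using B0 by (simp add: L1n_nonneg flip: ennreal_mult)
  also have "\<dots> \<le> (\<integral>z. eta z \<partial>lborel) * B" by (intro mult_right_mono L1n_moll_le B0)
  finally show ?thesis .
qed

lemma square_integrable_box: "square_integrable (\<lambda>x. indicator (box a b) x *\<^sub>R v)"
proof -
  have "(\<lambda>x. (norm (indicator (box a b) x *\<^sub>R v))\<^sup>2) = (\<lambda>x. indicator (box a b) x * (norm v)\<^sup>2)"
    by (auto simp: indicator_def)
  moreover have "integrable lborel (\<lambda>x::R4. indicator (box a b) x * (norm v)\<^sup>2)"
    using emeasure_bounded_finite[OF bounded_box, of a b]
    by (intro integrable_mult_left integrable_real_indicator) auto
  ultimately show ?thesis by (simp add: square_integrable_def)
qed

text \<open>The indicator function is continuous off the boundary of the box, and all convolutions vanish outside one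
  common ball.\<close>

lemma Conv_moll_box:
  assumes L: "L > 0"
  shows "(\<lambda>n. Conv (moll L n) (mk_L2 (\<lambda>x. indicator (box a b) x *\<^sub>R v))) \<longlonglongrightarrow> moll_const *\<^sub>R mk_L2 (\<lambda>x. indicator (box a b) x *\<^sub>R v)"
proof -
  define f :: spinor_field where "f x = indicator (box a b) x *\<^sub>R v" for x
  define u where "u = mk_L2 f"
  define C where "C = (\<integral>z. eta z \<partial>lborel)"
  have C0: "C \<ge> 0" unfolding C_def using less_imp_le[OF eta_pos] by simp
  have [measurable]: "f \<in> borel_measurable borel" unfolding f_def by measurable
  have [measurable]: "moll L n \<in> borel_measurable borel" for n using cc_moll[OF L] by measurable
  have fB: "norm (f x) \<le> norm v" for x by (simp add: f_def indicator_def)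
  have rep: "AE x in lborel. rep_L2 u x = f x" unfolding u_def f_def by (rule rep_mk_L2_AE[OF square_integrable_box])
  obtain R where R: "\<And>x. norm x > R \<Longrightarrow> f x = 0"
  proof -
    obtain R where "\<And>x. x \<in> box a b \<Longrightarrow> norm x \<le> R" using bounded_box[of a b] by (auto simp: bounded_iff)
    then show thesis by (intro that[of R]) (auto simp: f_def indicator_def not_le[symmetric])
  qed
  have supp: "conv (moll L n) f x = 0" if "norm x > R + 1 / L" for n x
  proof -
    have "moll L n (x - y) *\<^sub>R f y = 0" for y
    proof (cases "norm y > R")
      case False
      then have "norm (x - y) \<ge> 1 / L" using that norm_triangle_ineq2[of x y] by linarith
      then show ?thesis using cut_support[OF L] by (simp add: moll_def)
    qed (simp add: R)
    then have "(\<lambda>y. moll L n (x - y) *\<^sub>R f y) = (\<lambda>y. 0)" by (rule ext)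
    then show ?thesis by (simp add: conv_def)
  qed
  have bd: "(norm (conv (moll L n) f x - moll_const *\<^sub>R f x))\<^sup>2 \<le> ((C + moll_const) * norm v)\<^sup>2 * indicator (cball 0 (R + 1 / L)) x" for n x
  proof (cases "norm x > R + 1 / L")
    case True
    moreover have "1 / L > 0" using L by simp
    ultimately have "norm x > R" by linarith
    then show ?thesis using True supp[OF True] R by simp
  next
    case False
    have "norm (conv (moll L n) f x - moll_const *\<^sub>R f x) \<le> norm (conv (moll L n) f x) + norm (moll_const *\<^sub>R f x)"
      by (rule norm_triangle_ineq4)
    also have "\<dots> \<le> C * norm v + moll_const * norm v"
      using norm_conv_moll_le[of f "norm v" L n x] fB L moll_const_pos by (intro add_mono) (auto simp: C_def intro: mult_left_mono)
    finally have "(norm (conv (moll L n) f x - moll_const *\<^sub>R f x))\<^sup>2 \<le> ((C + moll_const) * norm v)\<^sup>2"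
      by (intro power_mono) (auto simp: distrib_right)
    then show ?thesis using False by simp
  qed
  have "(\<lambda>n. \<integral>x. (norm (conv (moll L n) f x - moll_const *\<^sub>R f x))\<^sup>2 \<partial>lborel) \<longlonglongrightarrow> (\<integral>x. 0 \<partial>(lborel :: R4 measure))"
  proof (rule integral_dominated_convergence)
    show "integrable lborel (\<lambda>x::R4. ((C + moll_const) * norm v)\<^sup>2 * indicator (cball 0 (R + 1 / L)) x :: real)"
      using emeasure_bounded_finite[OF bounded_cball, of "0::R4" "R + 1 / L"]
      by (intro integrable_mult_right integrable_real_indicator) auto
    show "AE x in lborel. norm ((norm (conv (moll L n) f x - moll_const *\<^sub>R f x))\<^sup>2) \<le> ((C + moll_const) * norm v)\<^sup>2 * indicator (cball 0 (R + 1 / L)) x" for n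
      using bd by (intro always_eventually allI) simp
    have "emeasure lborel (cbox a b - box a b) = 0"
      by (subst emeasure_Diff) (auto simp: box_subset_cbox emeasure_lborel_cbox_eq emeasure_lborel_box_eq)
    then have "AE x in lborel. x \<notin> cbox a b - box a b" by (intro AE_not_in) (auto simp: null_sets_def)
    then show "AE x in lborel. (\<lambda>n. (norm (conv (moll L n) f x - moll_const *\<^sub>R f x))\<^sup>2) \<longlonglongrightarrow> 0"
    proof eventually_elim
      case (elim x)
      then have "x \<notin> frontier (box a b)" by (simp add: frontier_box split: if_splits)
      then have "isCont (\<lambda>x. indicator (box a b) x :: real) x" by (simp add: isCont_indicator)
      then have "isCont f x" unfolding f_def by (intro continuous_intros)
      from conv_moll_pointwise[OF _ fB this, of L]
      have "(\<lambda>n. conv (moll L n) f x) \<longlonglongrightarrow> moll_const *\<^sub>R f x" by simp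
      then have "(\<lambda>n. (norm (conv (moll L n) f x - moll_const *\<^sub>R f x))\<^sup>2) \<longlonglongrightarrow> (norm (moll_const *\<^sub>R f x - moll_const *\<^sub>R f x))\<^sup>2"
        by (intro tendsto_intros)
      then show ?case by simp
    qed
  qed measurable
  moreover have "(\<integral>x. (norm (conv (moll L n) f x - moll_const *\<^sub>R f x))\<^sup>2 \<partial>lborel) = (norm (Conv (moll L n) u - moll_const *\<^sub>R u))\<^sup>2" for n
    unfolding norm_L2_sq
  proof (rule integral_cong_AE)
    have e: "conv (moll L n) (rep_L2 u) x = conv (moll L n) f x" for x
      by (rule conv_cong_AE[OF _ _ _ rep]) measurable
    show "AE x in lborel. (norm (conv (moll L n) f x - moll_const *\<^sub>R f x))\<^sup>2 = (norm (rep_L2 (Conv (moll L n) u - moll_const *\<^sub>R u) x))\<^sup>2"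
      using rep_diff_AE[of "Conv (moll L n) u" "moll_const *\<^sub>R u"] rep_Conv_AE[OF cc_moll[OF L], of n u] rep_scaleR_AE[of moll_const u] rep
      by eventually_elim (simp add: e)
  qed measurable
  ultimately have "(\<lambda>n. (norm (Conv (moll L n) u - moll_const *\<^sub>R u))\<^sup>2) \<longlonglongrightarrow> 0" by simp
  then have "(\<lambda>n. sqrt ((norm (Conv (moll L n) u - moll_const *\<^sub>R u))\<^sup>2)) \<longlonglongrightarrow> sqrt 0" by (rule tendsto_real_sqrt)
  then have "(\<lambda>n. norm (Conv (moll L n) u - moll_const *\<^sub>R u)) \<longlonglongrightarrow> 0" by simp
  then show ?thesis unfolding u_def f_def using LIM_zero_cancel tendsto_norm_zero_iff by blast
qed

text \<open>A field orthogonal to all indicator functions of boxes vanishes, by a Dynkin argument.\<close>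

lemma orthogonal_boxes_imp_zero:
  assumes w: "\<And>a b v. inner w (mk_L2 (\<lambda>x. indicator (box a b) x *\<^sub>R v)) = 0"
  shows "w = 0"
proof -
  have box0: "(\<integral>x. indicator (box a b) x * inner (rep_L2 w x) v \<partial>lborel) = 0" for a b v
  proof -
    have i: "integrable lborel (\<lambda>x. hdot (rep_L2 w x) (indicator (box a b) x *\<^sub>R v))"
      by (rule integrable_hdot[OF square_integrable_rep square_integrable_box])
    have "0 = Re (cinner w (mk_L2 (\<lambda>x. indicator (box a b) x *\<^sub>R v)))" using w by (simp add: Re_cinner)
    also have "cinner w (mk_L2 (\<lambda>x. indicator (box a b) x *\<^sub>R v)) = (\<integral>x. hdot (rep_L2 w x) (indicator (box a b) x *\<^sub>R v) \<partial>lborel)"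
      unfolding cinner_rep by (rule integral_cong_AE) (use rep_mk_L2_AE[OF square_integrable_box[of a b v]] in \<open>auto elim: eventually_mono\<close>)
    also have "Re \<dots> = (\<integral>x. Re (hdot (rep_L2 w x) (indicator (box a b) x *\<^sub>R v)) \<partial>lborel)" by (rule integral_Re[OF i, symmetric])
    finally show ?thesis by (simp add: Re_hdot)
  qed
  have "AE x in lborel. inner (rep_L2 w x) v = 0" for v
  proof -
    define Q where "Q N = box (- real (Suc N) *\<^sub>R One) (real (Suc N) *\<^sub>R One :: R4)" for N
    define g where "g N x = indicator (Q N) x * inner (rep_L2 w x) v" for N x
    have gm [measurable]: "g N \<in> borel_measurable borel" for N unfolding g_def Q_def by measurable
    have gi: "integrable lborel (g N)" for N
    proof (rule Bochner_Integration.integrable_bound)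
      show "integrable lborel (\<lambda>x. (norm (rep_L2 w x))\<^sup>2 + indicator (Q N) x * (norm v)\<^sup>2)"
        unfolding Q_def by (intro Bochner_Integration.integrable_add integrable_norm_rep_sq integrable_mult_left integrable_real_indicator) auto
      show "AE x in lborel. norm (g N x) \<le> norm ((norm (rep_L2 w x))\<^sup>2 + indicator (Q N) x * (norm v)\<^sup>2)"
      proof (intro always_eventually allI)
        fix x
        have "\<bar>inner (rep_L2 w x) v\<bar> \<le> (norm (rep_L2 w x))\<^sup>2 + (norm v)\<^sup>2"
          by (rule order_trans[OF Cauchy_Schwarz_ineq2 mult_le_sum_squares]) auto
        then show "norm (g N x) \<le> norm ((norm (rep_L2 w x))\<^sup>2 + indicator (Q N) x * (norm v)\<^sup>2)"
          by (auto simp: g_def indicator_def)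
      qed
    qed measurable
    have setint: "set_lebesgue_integral lborel A (g N) = 0" if "A \<in> sets lborel" for A N
    proof -
      have bx: "set_lebesgue_integral lborel (box a b) (g N) = 0" for a b
      proof -
        obtain c d where "box a b \<inter> Q N = box c d" unfolding Q_def box_Int_box by blast
        then have "indicator (box a b) x *\<^sub>R g N x = indicator (box c d) x * inner (rep_L2 w x) v" for x
          by (auto simp: g_def indicator_def)
        then show ?thesis using box0[of c d v] by (simp add: set_lebesgue_integral_def)
      qed
      have U: "set_lebesgue_integral lborel UNIV (g N) = 0"
      proof -
        have "set_lebesgue_integral lborel UNIV (g N) = set_lebesgue_integral lborel (Q N) (g N)"
          unfolding set_lebesgue_integral_def by (rule Bochner_Integration.integral_cong) (auto simp: g_def indicator_def)
        then show ?thesis using bx unfolding Q_def by simp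
      qed
      have si: "set_integrable lborel A (g N)" if "A \<in> sets borel" for A
        unfolding set_integrable_def using gi[of N] that by (intro integrable_mult_indicator) auto
      have "Int_stable (range (\<lambda>(a, b). box a b :: R4 set))"
        by (auto simp: Int_stable_def box_Int_box)
      moreover have "range (\<lambda>(a, b). box a b :: R4 set) \<subseteq> Pow UNIV" by simp
      moreover have "A \<in> sigma_sets UNIV (range (\<lambda>(a, b). box a b :: R4 set))"
        using that by (simp add: borel_eq_box)
      ultimately show ?thesis
      proof (induction rule: sigma_sets_induct_disjoint)
        case (basic A) then show ?case using bx by auto
      next
        case empty show ?case by (simp add: set_lebesgue_integral_def)
      next
        case (compl A)
        then have A: "A \<in> sets borel" by (simp add: borel_eq_box)
        have "set_lebesgue_integral lborel (A \<union> (UNIV - A)) (g N) = set_lebesgue_integral lborel A (g N) + set_lebesgue_integral lborel (UNIV - A) (g N)"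
          by (rule set_integral_Un) (use A in \<open>auto intro: si\<close>)
        then show ?case using compl U by simp
      next
        case (union F)
        then have F: "F i \<in> sets borel" for i by (auto simp: borel_eq_box)
        have "set_lebesgue_integral lborel (\<Union>i. F i) (g N) = (\<Sum>i. set_lebesgue_integral lborel (F i) (g N))"
          by (rule lebesgue_integral_countable_add) (use F union(1) in \<open>auto intro!: si simp: disjoint_family_on_def\<close>)
        then show ?case using union by simp
      qed
    qed
    have "AE x in lborel. g N x = 0" for N by (rule sigma_finite_measure.density_zero[OF sigma_finite_lborel gi setint])
    then have "AE x in lborel. \<forall>N. g N x = 0" by (simp add: AE_all_countable)
    then show ?thesis
    proof eventually_elim
      case (elim x)
      obtain N where N: "norm x < real N" using reals_Archimedean2 by blast
      have "x \<in> Q N"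
        unfolding Q_def mem_box
      proof
        fix i :: R4 assume i: "i \<in> Basis"
        have "\<bar>x \<bullet> i\<bar> < real (Suc N)" using Basis_le_norm[OF i, of x] N by linarith
        then show "- real (Suc N) *\<^sub>R One \<bullet> i < x \<bullet> i \<and> x \<bullet> i < real (Suc N) *\<^sub>R One \<bullet> i"
          using i by (auto simp: inner_sum_left_Basis abs_less_iff)
      qed
      then show ?case using elim[rule_format, of N] by (simp add: g_def)
    qed
  qed
  then have "AE x in lborel. \<forall>v\<in>Basis. inner (rep_L2 w x) v = 0"
    by (intro AE_finite_allI) auto
  then have "AE x in lborel. rep_L2 w x = rep_L2 0 x"
    using rep_zero_AE by eventually_elim (simp add: euclidean_all_zero_iff)
  then show ?thesis by (rule L2_eqI)
qed

text \<open>By uniform boundedness of the convolution operators, the fields for which the limit holds form a closed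
  subspace.  It contains the indicators of boxes, so that its orthogonal complement is trivial.\<close>

theorem Conv_moll_tendsto:
  assumes L: "L > 0"
  shows "(\<lambda>n. Conv (moll L n) u) \<longlonglongrightarrow> moll_const *\<^sub>R u"
proof -
  define D where "D = {u. (\<lambda>n. Conv (moll L n) u) \<longlonglongrightarrow> moll_const *\<^sub>R u}"
  define C where "C = (\<integral>z. eta z \<partial>lborel) + moll_const"
  have C: "C > 0" unfolding C_def using less_imp_le[OF eta_pos] moll_const_pos by (simp add: add_nonneg_pos)
  note cl = bounded_clinearD[OF clinear_Conv[OF cc_moll[OF L]]]
  have bd: "norm (Conv (moll L n) u - moll_const *\<^sub>R u) \<le> C * norm u" for n u
  proof -
    have "norm (Conv (moll L n) u - moll_const *\<^sub>R u) \<le> norm (Conv (moll L n) u) + norm (moll_const *\<^sub>R u)" by (rule norm_triangle_ineq4)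
    also have "\<dots> \<le> (\<integral>z. eta z \<partial>lborel) * norm u + moll_const * norm u"
      using order_trans[OF norm_Conv_le[OF cc_moll[OF L]] mult_right_mono[OF L1n_moll_le norm_ge_zero]] moll_const_pos
      by (intro add_mono) auto
    finally show ?thesis by (simp add: C_def distrib_right)
  qed
  have "subspace D"
    unfolding subspace_def
  proof (intro conjI ballI allI)
    show "0 \<in> D" by (simp add: D_def cl)
    show "x + y \<in> D" if "x \<in> D" "y \<in> D" for x y
      using that by (auto simp: D_def cl scaleR_add_right intro: tendsto_add)
    show "c *\<^sub>R x \<in> D" if "x \<in> D" for c x
      using that tendsto_scaleR[OF tendsto_const, of _ "moll_const *\<^sub>R x" sequentially c]
      by (auto simp: D_def cl mult.commute)
  qed
  moreover have "closed D"
    unfolding closed_sequential_limits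
  proof (intro allI impI, elim conjE)
    fix x l assume x: "\<forall>n. x n \<in> D" "x \<longlonglongrightarrow> l"
    have "(\<lambda>n. Conv (moll L n) l - moll_const *\<^sub>R l) \<longlonglongrightarrow> 0"
    proof (rule LIMSEQ_I)
      fix r :: real assume r: "r > 0"
      then obtain k where k: "norm (x k - l) < r / 2 / C"
        using LIMSEQ_D[OF x(2), of "r / 2 / C"] C by (metis divide_pos_pos half_gt_zero order_refl)
      have "(\<lambda>n. Conv (moll L n) (x k) - moll_const *\<^sub>R x k) \<longlonglongrightarrow> 0"
        using x(1) by (simp add: D_def LIM_zero)
      from LIMSEQ_D[OF this, of "r / 2"] r obtain n0 where n0: "\<And>n. n \<ge> n0 \<Longrightarrow> norm (Conv (moll L n) (x k) - moll_const *\<^sub>R x k) < r / 2" by auto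
      show "\<exists>n0. \<forall>n\<ge>n0. norm (Conv (moll L n) l - moll_const *\<^sub>R l - 0) < r"
      proof (intro exI[of _ n0] allI impI)
        fix n assume n: "n \<ge> n0"
        have "Conv (moll L n) l - moll_const *\<^sub>R l = (Conv (moll L n) (x k) - moll_const *\<^sub>R x k) - (Conv (moll L n) (x k - l) - moll_const *\<^sub>R (x k - l))"
          by (simp add: cl algebra_simps)
        then have "norm (Conv (moll L n) l - moll_const *\<^sub>R l) \<le> norm (Conv (moll L n) (x k) - moll_const *\<^sub>R x k) + norm (Conv (moll L n) (x k - l) - moll_const *\<^sub>R (x k - l))"
          by (metis norm_triangle_ineq4)
        also have "\<dots> < r / 2 + C * (r / 2 / C)"
          using n0[OF n] order_le_less_trans[OF bd mult_strict_left_mono[OF k C]] by (rule add_strict_mono)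
        finally show "norm (Conv (moll L n) l - moll_const *\<^sub>R l - 0) < r" using C by simp
      qed
    qed
    then show "l \<in> D" unfolding D_def by (simp add: LIM_zero_cancel)
  qed
  ultimately obtain p where p: "p \<in> D" "\<And>s. s \<in> D \<Longrightarrow> inner (u - p) s = 0"
    using orthogonal_projection_exists[of D u] by blast
  have "u - p = 0"
    by (rule orthogonal_boxes_imp_zero) (use p(2) Conv_moll_box[OF L] in \<open>auto simp: D_def\<close>)
  then show ?thesis using p(1) by (simp add: D_def)
qed

section \<open>Multiplication by matrices\<close>

text \<open>The entrywise bound is the one inherited from the decay assumption on the potential.\<close>

definition bmat :: "(R4 \<Rightarrow> complex^4^4) \<Rightarrow> real \<Rightarrow> bool" where
  "bmat A K \<longleftrightarrow> (\<forall>i j. (\<lambda>x. A x $ i $ j) \<in> borel_measurable borel) \<and> (\<forall>x i j. norm (A x $ i $ j) \<le> K)"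

lemma bmat_const: "\<exists>K. bmat (\<lambda>x. A) K"
proof -
  have "norm (A $ i $ j) \<le> (\<Sum>i\<in>UNIV. \<Sum>j\<in>UNIV. norm (A $ i $ j))" for i j
    by (rule order_trans[OF member_le_sum[of j UNIV "\<lambda>j. norm (A $ i $ j)"] member_le_sum[of i UNIV "\<lambda>i. \<Sum>j\<in>UNIV. norm (A $ i $ j)"]])
      (auto intro: sum_nonneg)
  then show ?thesis by (auto simp: bmat_def)
qed

lemma norm_matrix_vector_le:
  fixes A :: "complex^4^4"
  assumes "\<And>i j. norm (A $ i $ j) \<le> K"
  shows "norm (A *v a) \<le> 16 * K * norm a"
proof -
  have K: "K \<ge> 0" using assms[of 1 1] norm_ge_zero order_trans by blast
  have "norm ((A *v a) $ i) \<le> 4 * (K * norm a)" for i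
  proof -
    have "norm ((A *v a) $ i) \<le> (\<Sum>j\<in>UNIV. norm (A $ i $ j * a $ j))"
      unfolding matrix_vector_mult_def by (simp add: norm_sum)
    also have "\<dots> \<le> (\<Sum>j\<in>(UNIV :: 4 set). K * norm a)"
      by (intro sum_mono) (auto simp: norm_mult intro!: mult_mono assms K Finite_Cartesian_Product.norm_nth_le)
    finally show ?thesis by simp
  qed
  then have "(\<Sum>i\<in>UNIV. norm ((A *v a) $ i)) \<le> (\<Sum>i\<in>(UNIV :: 4 set). 4 * (K * norm a))" by (intro sum_mono)
  moreover have "norm (A *v a) \<le> (\<Sum>i\<in>UNIV. norm ((A *v a) $ i))"
    unfolding norm_vec_def by (intro L2_set_le_sum) simp
  ultimately show ?thesis by simp
qed

lemma borel_measurable_vecI: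
  fixes f :: "'a \<Rightarrow> complex^4"
  assumes [measurable]: "\<And>i. (\<lambda>x. f x $ i) \<in> borel_measurable M"
  shows "f \<in> borel_measurable M"
proof -
  have ax [measurable]: "(\<lambda>c. axis i c :: complex^4) \<in> borel_measurable borel" for i
    unfolding axis_def
  proof (intro borel_measurable_continuous_onI continuous_on_vec_lambda)
    show "continuous_on UNIV (\<lambda>c::complex. if j = i then c else 0)" for j by (cases "j = i") auto
  qed
  have "f = (\<lambda>x. \<Sum>i\<in>UNIV. axis i (f x $ i))"
    by (auto simp: fun_eq_iff vec_eq_iff axis_def)
  also have "\<dots> \<in> borel_measurable M" by measurable
  finally show ?thesis .
qed

lemma square_integrable_mult:
  assumes A: "bmat A K"
  shows "square_integrable (\<lambda>x. A x *v rep_L2 u x)"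
proof (rule square_integrableI)
  have [measurable]: "(\<lambda>x. A x $ i $ j) \<in> borel_measurable borel" for i j using A by (simp add: bmat_def)
  have "(\<lambda>x. (A x *v rep_L2 u x) $ i) \<in> borel_measurable borel" for i
    unfolding matrix_vector_mult_def by simp
  then show m [measurable]: "(\<lambda>x. A x *v rep_L2 u x) \<in> borel_measurable borel" by (rule borel_measurable_vecI)
  have "(\<integral>\<^sup>+x. ennreal ((norm (A x *v rep_L2 u x))\<^sup>2) \<partial>lborel) \<le> (\<integral>\<^sup>+x. ennreal ((16 * K)\<^sup>2) * ennreal ((norm (rep_L2 u x))\<^sup>2) \<partial>lborel)"
  proof (intro nn_integral_mono)
    fix x
    have "(norm (A x *v rep_L2 u x))\<^sup>2 \<le> (16 * K * norm (rep_L2 u x))\<^sup>2"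
      by (intro power_mono norm_matrix_vector_le) (use A in \<open>auto simp: bmat_def\<close>)
    then show "ennreal ((norm (A x *v rep_L2 u x))\<^sup>2) \<le> ennreal ((16 * K)\<^sup>2) * ennreal ((norm (rep_L2 u x))\<^sup>2)"
      by (simp add: power_mult_distrib flip: ennreal_mult)
  qed
  also have "\<dots> < \<infinity>" by (simp add: nn_integral_cmult nn_integral_norm_rep ennreal_mult_less_top)
  finally show "(\<integral>\<^sup>+x. ennreal ((norm (A x *v rep_L2 u x))\<^sup>2) \<partial>lborel) < \<infinity>" .
qed

lemma rep_mult_AE: "bmat A K \<Longrightarrow> AE x in lborel. rep_L2 (mult_L2 A u) x = A x *v rep_L2 u x"
  unfolding mult_L2_def by (rule rep_mk_L2_AE[OF square_integrable_mult])

lemma norm_mult_L2_le: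
  assumes A: "bmat A K" shows "norm (mult_L2 A u) \<le> 16 * K * norm u"
proof -
  have K: "K \<ge> 0" using A norm_ge_zero[of "A 0 $ 1 $ 1"] order_trans unfolding bmat_def by blast
  have "ennreal ((norm (mult_L2 A u))\<^sup>2) = (\<integral>\<^sup>+x. ennreal ((norm (A x *v rep_L2 u x))\<^sup>2) \<partial>lborel)"
    unfolding mult_L2_def by (rule norm_mk_L2[OF square_integrable_mult[OF A]])
  also have "\<dots> \<le> (\<integral>\<^sup>+x. ennreal ((16 * K)\<^sup>2) * ennreal ((norm (rep_L2 u x))\<^sup>2) \<partial>lborel)"
  proof (intro nn_integral_mono)
    fix x
    have "(norm (A x *v rep_L2 u x))\<^sup>2 \<le> (16 * K * norm (rep_L2 u x))\<^sup>2"
      by (intro power_mono norm_matrix_vector_le) (use A in \<open>auto simp: bmat_def\<close>)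
    then show "ennreal ((norm (A x *v rep_L2 u x))\<^sup>2) \<le> ennreal ((16 * K)\<^sup>2) * ennreal ((norm (rep_L2 u x))\<^sup>2)"
      by (simp add: power_mult_distrib flip: ennreal_mult)
  qed
  also have "\<dots> = ennreal ((16 * K)\<^sup>2) * ennreal ((norm u)\<^sup>2)"
    by (subst nn_integral_cmult) (simp_all add: nn_integral_norm_rep)
  also have "\<dots> = ennreal ((16 * K * norm u)\<^sup>2)"
    by (simp add: power_mult_distrib flip: ennreal_mult)
  finally have "(norm (mult_L2 A u))\<^sup>2 \<le> (16 * K * norm u)\<^sup>2" by (simp add: ennreal_le_iff)
  then show ?thesis by (rule power2_le_imp_le) (simp add: K)
qed

lemma matrix_vector_smult: "(A :: complex^4^4) *v (c *s a) = c *s (A *v a)"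
  by (simp add: matrix_vector_mult_def vec_eq_iff sum_distrib_left mult_ac)

lemma scaleR_smult: "r *\<^sub>R (a :: complex^4) = of_real r *s a"
  by (simp add: vec_eq_iff scaleR_conv_of_real[where 'a=complex])

lemma matrix_vector_scaleR: "(A :: complex^4^4) *v (r *\<^sub>R a) = r *\<^sub>R (A *v a)"
  by (simp add: scaleR_smult matrix_vector_smult)

lemma clinear_mult_L2:
  assumes A: "bmat A K" shows "bounded_clinear (mult_L2 A)"
proof (rule bounded_clinearI[where K="16 * K"])
  show "mult_L2 A (u + v) = mult_L2 A u + mult_L2 A v" for u v
  proof (rule L2_eqI)
    show "AE x in lborel. rep_L2 (mult_L2 A (u + v)) x = rep_L2 (mult_L2 A u + mult_L2 A v) x"
      using rep_mult_AE[OF A, of "u + v"] rep_mult_AE[OF A, of u] rep_mult_AE[OF A, of v] rep_add_AE[of u v]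
        rep_add_AE[of "mult_L2 A u" "mult_L2 A v"]
      by eventually_elim (simp add: matrix_vector_right_distrib)
  qed
  show "mult_L2 A (scaleC c u) = scaleC c (mult_L2 A u)" for c u
  proof (rule L2_eqI)
    show "AE x in lborel. rep_L2 (mult_L2 A (scaleC c u)) x = rep_L2 (scaleC c (mult_L2 A u)) x"
      using rep_mult_AE[OF A, of "scaleC c u"] rep_mult_AE[OF A, of u] rep_scaleC_AE[of c u] rep_scaleC_AE[of c "mult_L2 A u"]
      by eventually_elim (simp add: matrix_vector_smult)
  qed
qed (use norm_mult_L2_le[OF A] in auto)

lemma hdot_matrix: "hdot (A *v a) b = hdot a (adjoint_matrix A *v b)"
proof -
  have "hdot (A *v a) b = (\<Sum>i\<in>UNIV. \<Sum>j\<in>UNIV. A $ i $ j * a $ j * cnj (b $ i))"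
    by (simp add: hdot_def matrix_vector_mult_def sum_distrib_right)
  also have "\<dots> = (\<Sum>j\<in>UNIV. \<Sum>i\<in>UNIV. A $ i $ j * a $ j * cnj (b $ i))" by (rule sum.swap)
  also have "\<dots> = hdot a (adjoint_matrix A *v b)"
    by (simp add: hdot_def matrix_vector_mult_def adjoint_matrix_def sum_distrib_left mult_ac)
  finally show ?thesis .
qed

lemma bmat_adjoint: "bmat A K \<Longrightarrow> bmat (\<lambda>x. adjoint_matrix (A x)) K"
proof -
  assume A: "bmat A K"
  then have [measurable]: "(\<lambda>x. A x $ i $ j) \<in> borel_measurable borel" for i j by (simp add: bmat_def)
  have "(\<lambda>x. cnj (A x $ j $ i)) \<in> borel_measurable borel" for i j
    by (rule measurable_compose[OF _ borel_measurable_continuous_onI]) (auto intro!: continuous_intros)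
  then show ?thesis using A by (auto simp: bmat_def adjoint_matrix_def)
qed

lemma cinner_mult_L2:
  assumes A: "bmat A K"
  shows "cinner (mult_L2 A u) v = cinner u (mult_L2 (\<lambda>x. adjoint_matrix (A x)) v)"
proof -
  have "AE x in lborel. hdot (rep_L2 (mult_L2 A u) x) (rep_L2 v x) = hdot (rep_L2 u x) (rep_L2 (mult_L2 (\<lambda>x. adjoint_matrix (A x)) v) x)"
    using rep_mult_AE[OF A, of u] rep_mult_AE[OF bmat_adjoint[OF A], of v] by eventually_elim (simp add: hdot_matrix)
  then show ?thesis unfolding cinner_rep by (intro integral_cong_AE) auto
qed

abbreviation Mat :: "complex^4^4 \<Rightarrow> L2 \<Rightarrow> L2" where
  "Mat A \<equiv> mult_L2 (\<lambda>x. A)"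

lemma clinear_Mat: "bounded_clinear (Mat A)"
  using bmat_const clinear_mult_L2 by blast

lemma rep_Mat_AE: "AE x in lborel. rep_L2 (Mat A u) x = A *v rep_L2 u x"
  using bmat_const rep_mult_AE by blast

lemma cinner_Mat: "cinner (Mat A u) v = cinner u (Mat (adjoint_matrix A) v)"
  using bmat_const cinner_mult_L2 by blast

lemma Mat_Mat: "Mat A (Mat B u) = Mat (A ** B) u"
proof (rule L2_eqI)
  show "AE x in lborel. rep_L2 (Mat A (Mat B u)) x = rep_L2 (Mat (A ** B) u) x"
    using rep_Mat_AE[of A "Mat B u"] rep_Mat_AE[of B u] rep_Mat_AE[of "A ** B" u]
    by eventually_elim (simp add: matrix_vector_mul_assoc)
qed

lemma Mat_add: "Mat (A + B) u = Mat A u + Mat B u"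
proof (rule L2_eqI)
  show "AE x in lborel. rep_L2 (Mat (A + B) u) x = rep_L2 (Mat A u + Mat B u) x"
    using rep_Mat_AE[of "A + B" u] rep_Mat_AE[of B u] rep_Mat_AE[of A u] rep_add_AE[of "Mat A u" "Mat B u"]
    by eventually_elim (simp add: matrix_vector_mult_add_rdistrib)
qed

lemma Mat_zero: "Mat 0 u = 0"
  using Mat_add[of 0 0 u] by simp

lemma Mat_one: "Mat (mat 1) u = u"
proof (rule L2_eqI)
  show "AE x in lborel. rep_L2 (Mat (mat 1) u) x = rep_L2 u x"
    using rep_Mat_AE[of "mat 1" u] by eventually_elim simp
qed

lemma conv_Mat:
  assumes \<phi>: "cc \<phi>" shows "conv \<phi> (rep_L2 (Mat A u)) x = A *v conv \<phi> (rep_L2 u) x"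
proof -
  have [measurable]: "\<phi> \<in> borel_measurable borel" using \<phi> by measurable
  have bl: "bounded_linear ((*v) A)"
    by (rule bounded_linear_intro[where K="16 * (SOME K. \<forall>i j. norm (A $ i $ j) \<le> K)"])
      (use norm_matrix_vector_le[OF someI_ex[OF bmat_const[of A, unfolded bmat_def, simplified], rule_format], of _]
        in \<open>auto simp: matrix_vector_right_distrib matrix_vector_scaleR mult.commute\<close>)
  have "conv \<phi> (rep_L2 (Mat A u)) x = conv \<phi> (\<lambda>y. A *v rep_L2 u y) x"
  proof (rule conv_cong_AE[OF _ _ _ rep_Mat_AE])
    show "(\<lambda>y. A *v rep_L2 u y) \<in> borel_measurable borel"
      by (rule measurable_compose[OF borel_measurable_rep borel_measurable_continuous_onI[OF linear_continuous_on[OF bl]]])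
  qed measurable
  also have "\<dots> = (\<integral>y. A *v (\<phi> (x - y) *\<^sub>R rep_L2 u y) \<partial>lborel)"
    by (simp add: conv_def linear_cmul[OF bounded_linear.linear[OF bl]])
  also have "\<dots> = A *v conv \<phi> (rep_L2 u) x"
    unfolding conv_def by (rule integral_bounded_linear[OF bl conv_integrable[OF \<phi>]])
  finally show ?thesis .
qed

lemma weak_Mat:
  assumes "weak_partial_deriv k u g" shows "weak_partial_deriv k (Mat A u) (Mat A g)"
  unfolding weak_iff
proof (intro allI impI)
  fix \<psi> c assume t: "test_function \<psi>"
  have "Mat B (tens \<phi> c) = tens \<phi> (B *v c)" if "cc \<phi>" for \<phi> B
  proof (rule L2_eqI)
    show "AE x in lborel. rep_L2 (Mat B (tens \<phi> c)) x = rep_L2 (tens \<phi> (B *v c)) x"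
      using rep_Mat_AE[of B "tens \<phi> c"] rep_tens_AE[OF that, of c] rep_tens_AE[OF that, of "B *v c"]
      by eventually_elim (simp add: matrix_vector_scaleR)
  qed
  then show "cinner (Mat A u) (tens (partial_deriv k \<psi>) c) = - cinner (Mat A g) (tens \<psi> c)"
    using assms t by (simp add: cinner_Mat weak_iff test_functionD)
qed

section \<open>Elliptic regularity for the Dirac operator\<close>

lemma vector_4: "(vector [a,b,c,d] :: 'a::zero^4) $ 1 = a" "(vector [a,b,c,d] :: 'a::zero^4) $ 2 = b"
  "(vector [a,b,c,d] :: 'a::zero^4) $ 3 = c" "(vector [a,b,c,d] :: 'a::zero^4) $ 4 = d"
  unfolding vector_def by simp_all

lemma dirac_alpha_explicit:
  "dirac_alpha 1 = vector [vector [0, 0, 0, - \<i>], vector [0, 0, \<i>, 0], vector [0, - \<i>, 0, 0], vector [\<i>, 0, 0, 0]]"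
  "dirac_alpha 2 = vector [vector [0, 0, 0, 1], vector [0, 0, 1, 0], vector [0, 1, 0, 0], vector [1, 0, 0, 0]]"
  "dirac_alpha 3 = vector [vector [0, 0, 1, 0], vector [0, 0, 0, - 1], vector [1, 0, 0, 0], vector [0, - 1, 0, 0]]"
  "dirac_alpha 4 = vector [vector [0, 0, \<i>, 0], vector [0, 0, 0, \<i>], vector [- \<i>, 0, 0, 0], vector [0, - \<i>, 0, 0]]"
  by (simp_all add: dirac_alpha_def block_matrix_def pauli_def mat_def)

lemma alpha_selfadjoint: "adjoint_matrix (dirac_alpha j) = dirac_alpha j"
proof -
  have "\<forall>j. adjoint_matrix (dirac_alpha j) = dirac_alpha j"
    unfolding forall_4
    by (simp add: adjoint_matrix_def dirac_alpha_def block_matrix_def pauli_def vec_eq_iff forall_4 vector_4 mat_def)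
  then show ?thesis by blast
qed

lemma beta_selfadjoint: "adjoint_matrix dirac_beta = dirac_beta"
  by (simp add: adjoint_matrix_def dirac_beta_def block_matrix_def vec_eq_iff forall_4 vector_4 mat_def)

text \<open>The Clifford relations.  Together with self-adjointness they yield both the norm identity for the gradient and the
  representation of a field through its Dirac derivative.\<close>

lemma alpha_anticommute:
  "dirac_alpha j ** dirac_alpha k + dirac_alpha k ** dirac_alpha j = (if j = k then mat 1 + mat 1 else 0)"
proof -
  have "\<forall>j k. dirac_alpha j ** dirac_alpha k + dirac_alpha k ** dirac_alpha j = (if j = k then mat 1 + mat 1 else 0)"
    unfolding forall_4
    by (intro conjI; simp only: dirac_alpha_explicit vec_eq_iff forall_4 matrix_matrix_mult_def sum_4 vector_add_component vec_lambda_beta vector_4;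
        simp add: mat_def)
  then show ?thesis by blast
qed

lemma Mat_alpha_anticommute:
  "Mat (dirac_alpha j) (Mat (dirac_alpha k) u) + Mat (dirac_alpha k) (Mat (dirac_alpha j) u) = (if j = k then u + u else 0)"
  unfolding Mat_Mat Mat_add[symmetric] alpha_anticommute
  by (cases "j = k") (simp_all only: if_True if_False simp_thms Mat_add Mat_one Mat_zero)

lemma partial_deriv_even:
  assumes "\<And>x. \<phi> (- x) = \<phi> x" "\<And>x. \<phi> differentiable (at x)"
  shows "partial_deriv k \<phi> (- x) = - partial_deriv k \<phi> x"
  using partial_deriv_reflect(1)[where x=0 and y=x and \<phi>=\<phi> and k=k] assms by simp

lemma Conv_neg_kernel:
  assumes \<phi>: "cc \<phi>" shows "Conv (\<lambda>x. - \<phi> x) u = - Conv \<phi> u"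
proof (rule L2_eqI)
  have "conv (\<lambda>x. - \<phi> x) (rep_L2 u) x = - conv \<phi> (rep_L2 u) x" for x by (simp add: conv_def)
  then show "AE x in lborel. rep_L2 (Conv (\<lambda>x. - \<phi> x) u) x = rep_L2 (- Conv \<phi> u) x"
    using rep_Conv_AE[OF \<phi>, of u] rep_Conv_AE[OF cc_neg[OF \<phi>], of u] rep_uminus_AE[of "Conv \<phi> u"]
    by (auto elim: eventually_elim2) 
qed

lemma Conv_diff_kernel:
  assumes \<phi>: "cc \<phi>" "cc \<psi>" shows "Conv (\<lambda>x. \<phi> x - \<psi> x) u = Conv \<phi> u - Conv \<psi> u"
proof (rule L2_eqI)
  have e: "conv (\<lambda>x. \<phi> x - \<psi> x) (rep_L2 u) x = conv \<phi> (rep_L2 u) x - conv \<psi> (rep_L2 u) x" for x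
    using conv_integrable[OF \<phi>(1), of x u] conv_integrable[OF \<phi>(2), of x u] by (simp add: conv_def scaleR_diff_left)
  show "AE x in lborel. rep_L2 (Conv (\<lambda>x. \<phi> x - \<psi> x) u) x = rep_L2 (Conv \<phi> u - Conv \<psi> u) x"
    using rep_Conv_AE[OF \<phi>(1), of u] rep_Conv_AE[OF \<phi>(2), of u] rep_Conv_AE[OF cc_diff[OF \<phi>], of u] rep_diff_AE[of "Conv \<phi> u" "Conv \<psi> u"]
    by eventually_elim (simp add: e)
qed

text \<open>Weak derivatives are skew-symmetric: after smoothing one factor, the even kernel moves to the
  other factor at the price of one sign.\<close>

lemma weak_by_parts:
  assumes u: "weak_partial_deriv k u u'" and v: "weak_partial_deriv k v v'"
  shows "cinner u' v = - cinner u v'"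
proof (rule LIMSEQ_unique)
  let ?m = "moll 1"
  have ct: "ctest (?m n)" for n by (rule ctest_moll) simp
  note cp = ctest_cc[OF ctest_partial[OF ct]]
  have eq: "cinner (Conv (?m n) u') v = - cinner u (Conv (?m n) v')" for n
  proof -
    have odd: "(\<lambda>x. partial_deriv k (?m n) (- x)) = (\<lambda>x. - partial_deriv k (?m n) x)"
      using ct[of n] by (intro ext partial_deriv_even) (auto simp: moll_even ctest_def smooth_alg_differentiable)
    show ?thesis
      unfolding Conv_weak[OF u ct] Conv_adjoint[OF cp] odd Conv_neg_kernel[OF cp] Conv_weak[OF v ct] by simp
  qed
  have "(\<lambda>n. inverse moll_const * cinner (Conv (?m n) u') v) \<longlonglongrightarrow> inverse moll_const * cinner (moll_const *\<^sub>R u') v"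
    by (intro tendsto_intros tendsto_cinner_left Conv_moll_tendsto) simp
  then show "(\<lambda>n. inverse moll_const * cinner (Conv (?m n) u') v) \<longlonglongrightarrow> cinner u' v"
    using moll_const_pos by (simp add: cinner_scaleR_left mult.assoc[symmetric] flip: of_real_mult)
  have "(\<lambda>n. inverse moll_const * - cinner u (Conv (?m n) v')) \<longlonglongrightarrow> inverse moll_const * - cinner u (moll_const *\<^sub>R v')"
    by (intro tendsto_intros tendsto_cinner_right Conv_moll_tendsto) simp
  then show "(\<lambda>n. inverse moll_const * cinner (Conv (?m n) u') v) \<longlonglongrightarrow> - cinner u v'"
    unfolding eq using moll_const_pos by (simp add: cinner_scaleR_right mult.assoc[symmetric] flip: of_real_mult)
qed

text \<open>Weak derivatives are unique.\<close>

lemma weak_zero: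
  assumes "weak_partial_deriv k 0 g" shows "g = 0"
proof -
  have "Conv (moll 1 n) g = 0" for n
    using Conv_weak[OF assms ctest_moll, of 1 n] bounded_clinearD(4)[OF clinear_Conv[OF ctest_cc[OF ctest_partial[OF ctest_moll]]], of 1 k n] by simp
  then have "moll_const *\<^sub>R g = 0" using Conv_moll_tendsto[of 1 g] by (simp add: LIMSEQ_const_iff)
  then show ?thesis using moll_const_pos by simp
qed

lemma weak_tens:
  assumes "test_function \<psi>" shows "weak_partial_deriv k (tens \<psi> c) (tens (partial_deriv k \<psi>) c)"
  unfolding weak_iff
proof (intro allI impI)
  fix \<phi> d assume t: "test_function \<phi>"
  have i: "(\<integral>x. \<xi>' x *\<^sub>R rep_L2 (tens \<xi> c) x \<partial>lborel) = (\<integral>x. \<xi>' x * \<xi> x \<partial>lborel) *\<^sub>R c" if "cc \<xi>" "cc \<xi>'" for \<xi> \<xi>'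
  proof -
    have [measurable]: "\<xi> \<in> borel_measurable borel" "\<xi>' \<in> borel_measurable borel" using that by measurable
    have "(\<integral>x. \<xi>' x *\<^sub>R rep_L2 (tens \<xi> c) x \<partial>lborel) = (\<integral>x. (\<xi>' x * \<xi> x) *\<^sub>R c \<partial>lborel)"
      by (rule integral_cong_AE) (use rep_tens_AE[OF that(1), of c] in \<open>auto elim: eventually_mono\<close>)
    also have "\<dots> = (\<integral>x. \<xi>' x * \<xi> x \<partial>lborel) *\<^sub>R c"
      by (rule integral_scaleR_left, rule cc_integrable[OF cc_mult[OF that(2)]]) (use that(1) in \<open>simp add: cc_def\<close>)
    finally show ?thesis .
  qed
  note p = test_functionD[OF assms] and q = test_functionD[OF t]
  have "(\<integral>x. partial_deriv k \<phi> x * \<psi> x \<partial>lborel) = - (\<integral>x. \<phi> x * partial_deriv k \<psi> x \<partial>lborel)"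
    by (rule integral_by_parts) (use p q in \<open>auto simp: cc_def\<close>)
  then show "cinner (tens \<psi> c) (tens (partial_deriv k \<phi>) d) = - cinner (tens (partial_deriv k \<psi>) c) (tens \<phi> d)"
    using p q by (simp add: cinner_tens i hdot_minus_left)
qed

text \<open>Symmetry of second derivatives, by induction over the generation of the algebra.\<close>

lemma smooth_alg_partial_commute:
  assumes "smooth_alg \<phi>"
  shows "partial_deriv j (partial_deriv k \<phi>) x = partial_deriv k (partial_deriv j \<phi>) x"
  using assms
proof (induction arbitrary: x rule: smooth_alg.induct)
  case (const c)
  have "partial_deriv k (\<lambda>x. c) = (\<lambda>x. 0)" for k by (auto simp: partial_deriv_const)
  then show ?case by (simp add: partial_deriv_const)
next
  case (coord i)
  have "partial_deriv k (\<lambda>x. x $ i) = (\<lambda>x. if i = k then 1 else 0)" for k by (auto simp: partial_deriv_coord)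
  then show ?case by (simp add: partial_deriv_const)
next
  case (add \<phi> \<psi>)
  have "partial_deriv k (\<lambda>x. \<phi> x + \<psi> x) = (\<lambda>x. partial_deriv k \<phi> x + partial_deriv k \<psi> x)" for k
    using add by (auto simp: partial_deriv_add smooth_alg_differentiable)
  then show ?case using add by (simp add: partial_deriv_add smooth_alg_differentiable smooth_alg_partial)
next
  case (mult \<phi> \<psi>)
  have "partial_deriv k (\<lambda>x. \<phi> x * \<psi> x) = (\<lambda>x. \<phi> x * partial_deriv k \<psi> x + partial_deriv k \<phi> x * \<psi> x)" for k
    using mult by (auto simp: partial_deriv_mult smooth_alg_differentiable)
  then show ?case using mult
    by (simp add: partial_deriv_add partial_deriv_mult smooth_alg_differentiable smooth_alg_partial smooth_alg.mult)
next
  case (inv \<phi>)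
  have d: "(inverse has_real_derivative - (inverse (\<phi> x) * inverse (\<phi> x))) (at (\<phi> x))" for x
    using DERIV_inverse[of "\<phi> x"] inv(2)[of x] by (simp add: power2_eq_square)
  have p: "partial_deriv k (\<lambda>x. inverse (\<phi> x)) = (\<lambda>x. (- (inverse (\<phi> x) * inverse (\<phi> x))) * partial_deriv k \<phi> x)" for k
    using partial_deriv_comp(2)[OF _ d] inv by (auto simp: smooth_alg_differentiable)
  have s: "smooth_alg (\<lambda>x. inverse (\<phi> x))" using inv by (intro smooth_alg.inv)
  have n: "partial_deriv k (\<lambda>x. - (\<psi> x)) x = - partial_deriv k \<psi> x" if "smooth_alg \<psi>" for \<psi> k x
    using partial_deriv_mult[of "\<lambda>x. -1" x \<psi> k] that by (simp add: smooth_alg_differentiable partial_deriv_const)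
  have sm: "smooth_alg (\<lambda>x. - (inverse (\<phi> x) * inverse (\<phi> x)))"
    using smooth_alg.mult[OF smooth_alg.const[of "-1"] smooth_alg.mult[OF s s]] by simp
  show ?case using inv s sm
    by (simp add: p partial_deriv_mult n smooth_alg_differentiable smooth_alg_partial smooth_alg.mult algebra_simps)
next
  case (flat \<phi> j')
  have p: "partial_deriv k (\<lambda>x. flat i (\<phi> x)) = (\<lambda>x. (flat (i + 2) (\<phi> x) - real i * flat (i + 1) (\<phi> x)) * partial_deriv k \<phi> x)" for k i
    using partial_deriv_comp(2)[OF _ flat_deriv] flat by (auto simp: smooth_alg_differentiable)
  have d: "((\<lambda>t. flat (i + 2) t - real i * flat (i + 1) t) has_real_derivative
      ((flat (i + 2 + 2) t - real (i + 2) * flat (i + 2 + 1) t) - real i * (flat (i + 1 + 2) t - real (i + 1) * flat (i + 1 + 1) t))) (at t)" for i t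
    by (intro DERIV_diff DERIV_cmult flat_deriv)
  note c = partial_deriv_comp[OF smooth_alg_differentiable[OF flat.hyps] d[of j']]
  show ?case using flat c
    unfolding p by (subst (1 2) partial_deriv_mult) (auto simp: smooth_alg_differentiable smooth_alg_partial)
qed

text \<open>The identity \<open>\<parallel>\<Sum> \<alpha>\<^sub>k \<partial>\<^sub>k h\<parallel>\<^sup>2 = \<Sum> \<parallel>\<partial>\<^sub>k h\<parallel>\<^sup>2\<close>, which expresses that the square of the massless
  Dirac operator is the Laplacian.\<close>

lemma norm_dirac_Conv:
  assumes \<theta>: "ctest \<theta>"
  shows "(norm (\<Sum>k\<in>UNIV. Mat (dirac_alpha k) (Conv (partial_deriv k \<theta>) f)))\<^sup>2 = (\<Sum>k\<in>UNIV. (norm (Conv (partial_deriv k \<theta>) f))\<^sup>2)"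
proof -
  let ?h = "\<lambda>k. Conv (partial_deriv k \<theta>) f"
  let ?a = "\<lambda>j k. cinner (Mat (dirac_alpha j) (?h j)) (Mat (dirac_alpha k) (?h k))"
  have w: "weak_partial_deriv j (Conv \<theta> f) (?h j)" for j by (rule weak_Conv[OF \<theta>])
  have w2: "weak_partial_deriv j (?h k) (Conv (partial_deriv j (partial_deriv k \<theta>)) f)" for j k by (rule weak_Conv[OF ctest_partial[OF \<theta>]])
  \<comment> \<open>both derivatives are moved to the second factor, where they commute\<close>
  have a: "?a j k = - cinner (Conv \<theta> f) (Mat (dirac_alpha j) (Mat (dirac_alpha k) (Conv (partial_deriv j (partial_deriv k \<theta>)) f)))" for j k
    using weak_by_parts[OF w weak_Mat[OF weak_Mat[OF w2[of j k], of "dirac_alpha k"], of "dirac_alpha j"]]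
    by (simp add: cinner_Mat alpha_selfadjoint)
  have comm: "partial_deriv j (partial_deriv k \<theta>) = partial_deriv k (partial_deriv j \<theta>)" for j k
    using \<theta> by (intro ext smooth_alg_partial_commute) (simp add: ctest_def)
  have sym: "?a j k + ?a k j = (if j = k then 2 * of_real ((norm (?h k))\<^sup>2) else 0)" for j k
  proof (cases "j = k")
    case True
    have "Mat (dirac_alpha k) (Mat (dirac_alpha k) (?h k)) + Mat (dirac_alpha k) (Mat (dirac_alpha k) (?h k)) = ?h k + ?h k"
      using Mat_alpha_anticommute[of k k "?h k"] by simp
    then have "2 *\<^sub>R Mat (dirac_alpha k) (Mat (dirac_alpha k) (?h k)) = 2 *\<^sub>R ?h k" by (simp add: scaleR_2)
    then have "?a k k = cinner (?h k) (?h k)" by (simp add: cinner_Mat alpha_selfadjoint)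
    then show ?thesis using True by (simp add: cinner_self)
  next
    case False
    have "?a j k + ?a k j = - cinner (Conv \<theta> f) (Mat (dirac_alpha j) (Mat (dirac_alpha k) (Conv (partial_deriv j (partial_deriv k \<theta>)) f))
       + Mat (dirac_alpha k) (Mat (dirac_alpha j) (Conv (partial_deriv j (partial_deriv k \<theta>)) f)))"
      unfolding a comm[of k j] by (simp add: cinner_add_right)
    then show ?thesis using False by (simp add: Mat_alpha_anticommute)
  qed
  let ?D = "\<Sum>k\<in>UNIV. Mat (dirac_alpha k) (?h k)"
  have "2 * cinner ?D ?D = (\<Sum>j\<in>UNIV. \<Sum>k\<in>UNIV. ?a j k) + (\<Sum>j\<in>UNIV. \<Sum>k\<in>UNIV. ?a k j)"
    unfolding sum.swap[of "\<lambda>j k. ?a k j"] by (simp only: cinner_sum_left) (simp only: cinner_sum_right mult_2)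
  also have "\<dots> = (\<Sum>j\<in>UNIV. \<Sum>k\<in>UNIV. if j = k then 2 * of_real ((norm (?h k))\<^sup>2) else 0)"
    unfolding sum.distrib[symmetric] sym ..
  also have "\<dots> = 2 * of_real (\<Sum>k\<in>UNIV. (norm (?h k))\<^sup>2)" by (simp add: sum_distrib_left)
  finally have "complex_of_real ((norm ?D)\<^sup>2) = of_real (\<Sum>k\<in>UNIV. (norm (?h k))\<^sup>2)" by (simp only: cinner_self) simp
  then show ?thesis by (simp only: of_real_eq_iff)
qed

text \<open>\<open>\<Sum> \<alpha>\<^sub>k \<partial>\<^sub>k f = G\<close> in the sense of distributions.\<close>

definition distributional_dirac :: "L2 \<Rightarrow> L2 \<Rightarrow> bool" where
  "distributional_dirac f G \<longleftrightarrow> (\<forall>\<psi> c. test_function \<psi> \<longrightarrow>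
     (\<Sum>k\<in>UNIV. cinner f (Mat (dirac_alpha k) (tens (partial_deriv k \<psi>) c))) = - cinner G (tens \<psi> c))"

lemma distributional_dirac_weak:
  assumes "\<And>k. weak_partial_deriv k f (g k)"
  shows "distributional_dirac f (\<Sum>k\<in>UNIV. Mat (dirac_alpha k) (g k))"
  unfolding distributional_dirac_def
proof (intro allI impI)
  fix \<psi> c assume t: "test_function \<psi>"
  have "cinner f (Mat (dirac_alpha k) (tens (partial_deriv k \<psi>) c)) = - cinner (Mat (dirac_alpha k) (g k)) (tens \<psi> c)" for k
    using weak_Mat[OF assms, of k "dirac_alpha k"] t cinner_Mat[of "dirac_alpha k" f] by (simp add: weak_iff alpha_selfadjoint)
  then show "(\<Sum>k\<in>UNIV. cinner f (Mat (dirac_alpha k) (tens (partial_deriv k \<psi>) c))) = - cinner (\<Sum>k\<in>UNIV. Mat (dirac_alpha k) (g k)) (tens \<psi> c)"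
    by (simp add: cinner_sum_left sum_negf)
qed

text \<open>The test functions are reflected translates of \<open>\<phi>\<close>, each tensored with a constant spinor.\<close>

lemma distributional_dirac_conv:
  assumes f: "distributional_dirac f G" and \<phi>: "ctest \<phi>"
  shows "conv \<phi> (rep_L2 G) x = (\<Sum>k\<in>UNIV. dirac_alpha k *v conv (partial_deriv k \<phi>) (rep_L2 f) x)"
proof (rule hdot_ext)
  fix c
  have d: "\<phi> differentiable (at x)" for x using \<phi> by (auto simp: ctest_def smooth_alg_differentiable)
  have r: "ctest (\<lambda>y. \<phi> (x - y))" by (rule ctest_reflect[OF \<phi>])
  have p: "partial_deriv k (\<lambda>y. \<phi> (x - y)) = (\<lambda>y. - partial_deriv k \<phi> (x - y))" for k
    by (intro ext partial_deriv_reflect d)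
  have cp: "cc (\<lambda>y. - partial_deriv k \<phi> (x - y))" for k
    by (intro cc_neg cc_reflect ctest_cc[OF ctest_partial[OF \<phi>]])
  have "cinner G (tens (\<lambda>y. \<phi> (x - y)) c) = hdot (conv \<phi> (rep_L2 G) x) c"
    by (simp add: cinner_tens ctest_cc[OF r] conv_def)
  moreover have "cinner f (Mat (dirac_alpha k) (tens (partial_deriv k (\<lambda>y. \<phi> (x - y))) c)) = - hdot (dirac_alpha k *v conv (partial_deriv k \<phi>) (rep_L2 f) x) c" for k
  proof -
    have "cinner f (Mat (dirac_alpha k) (tens (partial_deriv k (\<lambda>y. \<phi> (x - y))) c)) = cinner (Mat (dirac_alpha k) f) (tens (\<lambda>y. - partial_deriv k \<phi> (x - y)) c)"
      by (simp add: cinner_Mat alpha_selfadjoint p)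
    also have "\<dots> = - hdot (conv (partial_deriv k \<phi>) (rep_L2 (Mat (dirac_alpha k) f)) x) c"
      by (simp add: cinner_tens[OF cp] conv_def hdot_minus_left)
    also have "\<dots> = - hdot (dirac_alpha k *v conv (partial_deriv k \<phi>) (rep_L2 f) x) c"
      by (simp add: conv_Mat[OF ctest_cc[OF ctest_partial[OF \<phi>]]])
    finally show ?thesis .
  qed
  ultimately have "- hdot (conv \<phi> (rep_L2 G) x) c = (\<Sum>k\<in>UNIV. - hdot (dirac_alpha k *v conv (partial_deriv k \<phi>) (rep_L2 f) x) c)"
    using f[unfolded distributional_dirac_def, rule_format, OF ctest_test_function[OF r], of c] by simp
  then show "hdot (conv \<phi> (rep_L2 G) x) c = hdot (\<Sum>k\<in>UNIV. dirac_alpha k *v conv (partial_deriv k \<phi>) (rep_L2 f) x) c"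
    by (simp add: sum_negf linear_sum[OF bounded_linear.linear[OF bounded_linear_hdot_left]])
qed

lemma distributional_dirac_Conv:
  assumes f: "distributional_dirac f G" and \<phi>: "ctest \<phi>"
  shows "Conv \<phi> G = (\<Sum>k\<in>UNIV. Mat (dirac_alpha k) (Conv (partial_deriv k \<phi>) f))"
proof (rule L2_eqI)
  have "AE x in lborel. \<forall>k\<in>UNIV. rep_L2 (Mat (dirac_alpha k) (Conv (partial_deriv k \<phi>) f)) x = dirac_alpha k *v conv (partial_deriv k \<phi>) (rep_L2 f) x"
  proof (rule AE_finite_allI)
    fix k
    show "AE x in lborel. rep_L2 (Mat (dirac_alpha k) (Conv (partial_deriv k \<phi>) f)) x = dirac_alpha k *v conv (partial_deriv k \<phi>) (rep_L2 f) x"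
      using rep_Mat_AE[of "dirac_alpha k" "Conv (partial_deriv k \<phi>) f"] rep_Conv_AE[OF ctest_cc[OF ctest_partial[OF \<phi>]], of k f]
      by eventually_elim simp
  qed simp
  then show "AE x in lborel. rep_L2 (Conv \<phi> G) x = rep_L2 (\<Sum>k\<in>UNIV. Mat (dirac_alpha k) (Conv (partial_deriv k \<phi>) f)) x"
    using rep_Conv_AE[OF ctest_cc[OF \<phi>], of G] rep_sum_AE[of UNIV "\<lambda>k. Mat (dirac_alpha k) (Conv (partial_deriv k \<phi>) f)", OF finite]
    by eventually_elim (simp add: distributional_dirac_conv[OF f \<phi>])
qed

text \<open>Elliptic regularity: the mollified gradients are Cauchy because the norm identity bounds them by
  the mollified right-hand sides.\<close>

theorem dirac_elliptic_regularity:
  assumes f: "distributional_dirac f G"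
  obtains g where "\<And>k. weak_partial_deriv k f (g k)" "(\<Sum>k\<in>UNIV. Mat (dirac_alpha k) (g k)) = G"
proof -
  let ?m = "moll 1"
  have ct: "ctest (?m n)" for n by (rule ctest_moll) simp
  have le: "norm (Conv (partial_deriv k (?m n)) f - Conv (partial_deriv k (?m p)) f) \<le> norm (Conv (?m n) G - Conv (?m p) G)" for k n p
  proof -
    define \<theta> where "\<theta> = (\<lambda>x. ?m n x - ?m p x)"
    have \<theta>: "ctest \<theta>" unfolding \<theta>_def by (rule ctest_diff[OF ct ct])
    have d: "?m n differentiable (at x)" for n x using ct[of n] by (simp add: ctest_def smooth_alg_differentiable)
    have "partial_deriv k \<theta> x = partial_deriv k (?m n) x - partial_deriv k (?m p) x" for x
    proof -
      obtain D where D: "(?m n has_derivative D) (at x)" using d[of n x] unfolding differentiable_def by blast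
      obtain E where E: "(?m p has_derivative E) (at x)" using d[of p x] unfolding differentiable_def by blast
      show ?thesis unfolding \<theta>_def using partial_derivI[OF has_derivative_diff[OF D E]] by (simp add: partial_derivI[OF D] partial_derivI[OF E])
    qed
    then have p: "partial_deriv k \<theta> = (\<lambda>x. partial_deriv k (?m n) x - partial_deriv k (?m p) x)" by (rule ext)
    have "(norm (Conv (partial_deriv k \<theta>) f))\<^sup>2 \<le> (\<Sum>k\<in>UNIV. (norm (Conv (partial_deriv k \<theta>) f))\<^sup>2)"
      by (rule member_le_sum) auto
    also have "\<dots> = (norm (Conv \<theta> G))\<^sup>2"
      by (simp only: norm_dirac_Conv[OF \<theta>, symmetric] distributional_dirac_Conv[OF f \<theta>])
    finally have "norm (Conv (partial_deriv k \<theta>) f) \<le> norm (Conv \<theta> G)" by (rule power2_le_imp_le) simp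
    then show ?thesis
      unfolding p by (simp add: Conv_diff_kernel ctest_cc[OF ctest_partial[OF ct]] ctest_cc[OF ct] \<theta>_def)
  qed
  have CG: "Cauchy (\<lambda>n. Conv (?m n) G)" using Conv_moll_tendsto[of 1 G] by (intro LIMSEQ_imp_Cauchy) auto
  have "Cauchy (\<lambda>n. Conv (partial_deriv k (?m n)) f)" for k
  proof (rule metric_CauchyI)
    fix e :: real assume "e > 0"
    then obtain N where "\<And>m n. m \<ge> N \<Longrightarrow> n \<ge> N \<Longrightarrow> dist (Conv (?m m) G) (Conv (?m n) G) < e" using metric_CauchyD[OF CG] by blast
    then show "\<exists>M. \<forall>m\<ge>M. \<forall>n\<ge>M. dist (Conv (partial_deriv k (?m m)) f) (Conv (partial_deriv k (?m n)) f) < e"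
      by (intro exI[of _ N]) (auto simp: dist_norm intro: le_less_trans[OF le])
  qed
  then have "\<exists>g. (\<lambda>n. Conv (partial_deriv k (?m n)) f) \<longlonglongrightarrow> g" for k using Cauchy_convergent convergent_def by blast
  then obtain g where g: "\<And>k. (\<lambda>n. Conv (partial_deriv k (?m n)) f) \<longlonglongrightarrow> g k" by metis
  have "weak_partial_deriv k (moll_const *\<^sub>R f) (g k)" for k
    by (rule weak_limit[OF weak_Conv[OF ct] _ g]) (rule Conv_moll_tendsto, simp)
  then have w: "weak_partial_deriv k (inverse moll_const *\<^sub>R moll_const *\<^sub>R f) (inverse moll_const *\<^sub>R g k)" for k
    unfolding scaleR_scaleC[of "inverse moll_const"] by (rule weak_scaleC)
  have "(\<lambda>n. \<Sum>k\<in>UNIV. Mat (dirac_alpha k) (Conv (partial_deriv k (?m n)) f)) \<longlonglongrightarrow> (\<Sum>k\<in>UNIV. Mat (dirac_alpha k) (g k))"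
    by (intro tendsto_sum bounded_linear.tendsto[OF bounded_clinearD(1)[OF clinear_Mat]] g)
  then have "(\<lambda>n. Conv (?m n) G) \<longlonglongrightarrow> (\<Sum>k\<in>UNIV. Mat (dirac_alpha k) (g k))" by (simp only: distributional_dirac_Conv[OF f ct])
  then have "(\<Sum>k\<in>UNIV. Mat (dirac_alpha k) (g k)) = moll_const *\<^sub>R G" using Conv_moll_tendsto[of 1 G] LIMSEQ_unique by auto
  then have "(\<Sum>k\<in>UNIV. Mat (dirac_alpha k) (inverse moll_const *\<^sub>R g k)) = G"
    using moll_const_pos by (simp add: bounded_clinearD[OF clinear_Mat] flip: scaleR_sum_right)
  then show thesis using that[of "\<lambda>k. inverse moll_const *\<^sub>R g k"] w moll_const_pos by simp
qed

section \<open>Self-adjointness of the perturbed Dirac operator\<close>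

locale dirac_potential =
  fixes m :: real and V :: "R4 \<Rightarrow> complex^4^4" and K :: real
  assumes bounded_V: "bmat V K" and hermitian_V: "\<And>x. adjoint_matrix (V x) = V x"
begin

abbreviation H :: L2_operator where "H \<equiv> perturbed_dirac m V"

definition pot :: "L2 \<Rightarrow> L2" where
  "pot u = scaleC (of_real m) (Mat dirac_beta u) + mult_L2 V u"

definition dslash :: "(4 \<Rightarrow> L2) \<Rightarrow> L2" where
  "dslash g = (\<Sum>k\<in>UNIV. Mat (dirac_alpha k) (g k))"

lemma H_iff: "(u, w) \<in> H \<longleftrightarrow> (\<exists>g. (\<forall>k. weak_partial_deriv k u (g k)) \<and> w = scaleC (- \<i>) (dslash g) + pot u)"
  unfolding perturbed_dirac_def free_dirac_def dslash_def pot_def by (auto simp: add.assoc) blast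

lemma clinear_pot: "bounded_clinear pot"
  unfolding pot_def[abs_def]
  by (rule bounded_clinear_add[OF bounded_clinear_compose[OF bounded_clinear_scaleC clinear_Mat] clinear_mult_L2[OF bounded_V]])

lemma cinner_pot: "cinner (pot u) v = cinner u (pot v)"
  by (simp add: pot_def cinner_add_left cinner_add_right cinner_scaleC_left cinner_scaleC_right cinner_Mat beta_selfadjoint
      cinner_mult_L2[OF bounded_V] hermitian_V)

lemma dslash_add: "dslash (\<lambda>k. g k + h k) = dslash g + dslash h"
  by (simp add: dslash_def bounded_clinearD[OF clinear_Mat] sum.distrib)

lemma dslash_scaleC: "dslash (\<lambda>k. scaleC c (g k)) = scaleC c (dslash g)"
  by (simp add: dslash_def bounded_clinearD[OF clinear_Mat] scaleC_sum)

lemma H_add: "(u, w) \<in> H \<Longrightarrow> (u', w') \<in> H \<Longrightarrow> (u + u', w + w') \<in> H"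
proof -
  assume "(u, w) \<in> H" "(u', w') \<in> H"
  then obtain g g' where "\<And>k. weak_partial_deriv k u (g k)" "w = scaleC (- \<i>) (dslash g) + pot u"
    "\<And>k. weak_partial_deriv k u' (g' k)" "w' = scaleC (- \<i>) (dslash g') + pot u'" by (auto simp: H_iff)
  then show ?thesis unfolding H_iff
    by (intro exI[of _ "\<lambda>k. g k + g' k"]) (auto intro: weak_add simp: dslash_add scaleC_add_right bounded_clinearD[OF clinear_pot])
qed

lemma H_scale: "(u, w) \<in> H \<Longrightarrow> (scaleC c u, scaleC c w) \<in> H"
proof -
  assume "(u, w) \<in> H"
  then obtain g where "\<And>k. weak_partial_deriv k u (g k)" "w = scaleC (- \<i>) (dslash g) + pot u" by (auto simp: H_iff)
  then show ?thesis unfolding H_iff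
    by (intro exI[of _ "\<lambda>k. scaleC c (g k)"])
      (auto intro: weak_scaleC simp: dslash_scaleC scaleC_add_right bounded_clinearD[OF clinear_pot] mult.commute)
qed

lemma H_symmetric:
  assumes "(u, w) \<in> H" "(u', w') \<in> H" shows "cinner w u' = cinner u w'"
proof -
  obtain g g' where g: "\<And>k. weak_partial_deriv k u (g k)" "w = scaleC (- \<i>) (dslash g) + pot u"
    "\<And>k. weak_partial_deriv k u' (g' k)" "w' = scaleC (- \<i>) (dslash g') + pot u'" using assms by (auto simp: H_iff)
  have "cinner (Mat (dirac_alpha k) (g k)) u' = - cinner u (Mat (dirac_alpha k) (g' k))" for k
    using weak_by_parts[OF g(1) weak_Mat[OF g(3)], of k "dirac_alpha k"] by (simp add: cinner_Mat alpha_selfadjoint)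
  then have "cinner (dslash g) u' = - cinner u (dslash g')"
    by (simp add: dslash_def cinner_sum_left cinner_sum_right sum_negf)
  then show ?thesis
    by (simp add: g cinner_add_left cinner_add_right cinner_scaleC_left cinner_scaleC_right cinner_pot)
qed

lemma H_single_valued: "(0, w) \<in> H \<Longrightarrow> w = 0"
proof -
  assume "(0, w) \<in> H"
  then obtain g where g: "\<And>k. weak_partial_deriv k 0 (g k)" "w = scaleC (- \<i>) (dslash g) + pot 0" by (auto simp: H_iff)
  have "g k = 0" for k by (rule weak_zero[OF g(1)])
  then show ?thesis using g(2) by (simp add: dslash_def bounded_clinearD[OF clinear_pot] bounded_clinearD[OF clinear_Mat])
qed

text \<open>By elliptic regularity the Sobolev domain is the maximal domain on which the equation makes sense as an
  identity of distributions.\<close>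

lemma H_of_distributional:
  assumes "distributional_dirac u (scaleC \<i> (w - pot u))"
  shows "(u, w) \<in> H"
proof -
  obtain g where g: "\<And>k. weak_partial_deriv k u (g k)" "(\<Sum>k\<in>UNIV. Mat (dirac_alpha k) (g k)) = scaleC \<i> (w - pot u)"
    using dirac_elliptic_regularity[OF assms] by blast
  then have "scaleC (- \<i>) (dslash g) = w - pot u" by (simp add: dslash_def)
  then show ?thesis using g(1) unfolding H_iff by (intro exI[of _ g]) simp
qed

lemma distributional_of_H:
  assumes "(u, w) \<in> H" shows "distributional_dirac u (scaleC \<i> (w - pot u))"
proof -
  obtain g where g: "\<And>k. weak_partial_deriv k u (g k)" "w = scaleC (- \<i>) (dslash g) + pot u" using assms by (auto simp: H_iff)
  have "scaleC \<i> (w - pot u) = dslash g" by (simp add: g(2))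
  then show ?thesis using distributional_dirac_weak[OF g(1)] by (simp add: dslash_def)
qed

text \<open>Identities of distributions survive limits in norm.\<close>

lemma H_closed:
  assumes "\<And>n::nat. (u n, w n) \<in> H" "u \<longlonglongrightarrow> u'" "w \<longlonglongrightarrow> w'"
  shows "(u', w') \<in> H"
proof (rule H_of_distributional, unfold distributional_dirac_def, intro allI impI, rule LIMSEQ_unique)
  fix \<psi> c assume t: "test_function \<psi>"
  show "(\<lambda>n. \<Sum>k\<in>UNIV. cinner (u n) (Mat (dirac_alpha k) (tens (partial_deriv k \<psi>) c))) \<longlonglongrightarrow>
      (\<Sum>k\<in>UNIV. cinner u' (Mat (dirac_alpha k) (tens (partial_deriv k \<psi>) c)))"
    by (intro tendsto_sum tendsto_cinner_left assms)
  have "(\<lambda>n. - cinner (scaleC \<i> (w n - pot (u n))) (tens \<psi> c)) \<longlonglongrightarrow> - cinner (scaleC \<i> (w' - pot u')) (tens \<psi> c)"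
    by (intro tendsto_minus tendsto_cinner_left bounded_linear.tendsto[OF bounded_clinearD(1)[OF bounded_clinear_scaleC]] tendsto_diff
        bounded_linear.tendsto[OF bounded_clinearD(1)[OF clinear_pot]] assms)
  also have "(\<lambda>n. - cinner (scaleC \<i> (w n - pot (u n))) (tens \<psi> c)) = (\<lambda>n. \<Sum>k\<in>UNIV. cinner (u n) (Mat (dirac_alpha k) (tens (partial_deriv k \<psi>) c)))"
    using distributional_of_H[OF assms(1)] t by (auto simp: distributional_dirac_def)
  finally show "(\<lambda>n. \<Sum>k\<in>UNIV. cinner (u n) (Mat (dirac_alpha k) (tens (partial_deriv k \<psi>) c))) \<longlonglongrightarrow> - cinner (scaleC \<i> (w' - pot u')) (tens \<psi> c)" .
qed

text \<open>The range of \<open>H + \<sigma>\<close> is closed because \<open>H\<close> is closed and \<open>\<parallel>(H + \<sigma>) u\<parallel> \<ge> \<parallel>u\<parallel>\<close>; a field orthogonal to it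
  solves the adjoint equation in the sense of distributions, hence lies in the domain by elliptic
  regularity, and vanishes by symmetry.\<close>

lemma H_range:
  assumes \<sigma>: "\<sigma> = \<i> \<or> \<sigma> = - \<i>"
  shows "\<exists>u w. (u, w) \<in> H \<and> w + scaleC \<sigma> u = f"
proof -
  have \<sigma>': "norm \<sigma> = 1" "cnj \<sigma> = - \<sigma>" using \<sigma> by auto
  have shift: "(norm (w + scaleC \<sigma> u))\<^sup>2 = (norm w)\<^sup>2 + (norm u)\<^sup>2" if "(u, w) \<in> H" for u w
  proof -
    have "cinner w u = cnj (cinner w u)" using H_symmetric[OF that that] cinner_commute[of w u] by simp
    then have "Im (cinner w u) = 0" by (simp add: complex_eq_iff)
    then have "inner w (scaleC \<sigma> u) = 0" using \<sigma> by (auto simp: cinner_scaleC_right simp flip: Re_cinner)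
    then show ?thesis using norm_add_Pythagorean[of w "scaleC \<sigma> u"] \<sigma>' by (simp add: orthogonal_def norm_scaleC)
  qed
  define S where "S = {w + scaleC \<sigma> u | u w. (u, w) \<in> H}"
  have H0: "(0, 0) \<in> H"
    using H_of_distributional[of 0 0] by (simp add: distributional_dirac_def bounded_clinearD[OF clinear_pot])
  have S_scale: "scaleC c f \<in> S" if "f \<in> S" for c f
  proof -
    obtain u w where "(u, w) \<in> H" "f = w + scaleC \<sigma> u" using \<open>f \<in> S\<close> by (auto simp: S_def)
    then have "(scaleC c u, scaleC c w) \<in> H" "scaleC c f = scaleC c w + scaleC \<sigma> (scaleC c u)"
      by (auto simp: H_scale scaleC_add_right mult.commute)
    then show ?thesis unfolding S_def by blast
  qed
  have "subspace S"
    unfolding subspace_def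
  proof (intro conjI ballI allI)
    show "0 \<in> S" unfolding S_def using H0 by force
    fix x y assume "x \<in> S" "y \<in> S"
    then obtain u w u' w' where "(u, w) \<in> H" "x = w + scaleC \<sigma> u" "(u', w') \<in> H" "y = w' + scaleC \<sigma> u'" by (auto simp: S_def)
    then have "(u + u', w + w') \<in> H" "x + y = (w + w') + scaleC \<sigma> (u + u')" by (auto simp: H_add scaleC_add_right algebra_simps)
    then show "x + y \<in> S" unfolding S_def by blast
  qed (simp add: scaleR_scaleC S_scale)
  moreover have "closed S"
    unfolding closed_sequential_limits
  proof (intro allI impI, elim conjE)
    fix x l assume x: "\<forall>n. x n \<in> S" "x \<longlonglongrightarrow> l"
    then have "\<forall>n. \<exists>u w. (u, w) \<in> H \<and> x n = w + scaleC \<sigma> u"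
      unfolding S_def mem_Collect_eq by blast
    then obtain u w where uw: "\<And>n. (u n, w n) \<in> H" "\<And>n. x n = w n + scaleC \<sigma> (u n)" by metis
    have d: "(norm (x m - x n))\<^sup>2 = (norm (w m - w n))\<^sup>2 + (norm (u m - u n))\<^sup>2" for m n
    proof -
      have "(u m + scaleC (-1) (u n), w m + scaleC (-1) (w n)) \<in> H" by (intro H_add H_scale uw)
      from shift[OF this] show ?thesis by (simp add: uw(2) scaleC_minus1 scaleC_diff_right algebra_simps)
    qed
    have le: "norm (u m - u n) \<le> norm (x m - x n)" "norm (w m - w n) \<le> norm (x m - x n)" for m n
      by (rule power2_le_imp_le; simp add: d)+
    have Cx: "Cauchy x" using x(2) by (rule LIMSEQ_imp_Cauchy)
    have "Cauchy u" "Cauchy w"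
    proof -
      have "Cauchy y" if y: "\<And>m n. norm (y m - y n) \<le> norm (x m - x n)" for y :: "nat \<Rightarrow> L2"
      proof (rule metric_CauchyI)
        fix e :: real assume "e > 0"
        then obtain N where "\<And>m n. m \<ge> N \<Longrightarrow> n \<ge> N \<Longrightarrow> dist (x m) (x n) < e" using metric_CauchyD[OF Cx] by blast
        then show "\<exists>M. \<forall>m\<ge>M. \<forall>n\<ge>M. dist (y m) (y n) < e"
          by (intro exI[of _ N]) (auto simp: dist_norm intro: le_less_trans[OF y])
      qed
      then show "Cauchy u" "Cauchy w" using le by blast+
    qed
    then obtain u' w' where l: "u \<longlonglongrightarrow> u'" "w \<longlonglongrightarrow> w'" using Cauchy_convergent convergent_def by blast
    have "(u', w') \<in> H" by (rule H_closed[OF uw(1) l])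
    moreover have "(\<lambda>n. w n + scaleC \<sigma> (u n)) \<longlonglongrightarrow> w' + scaleC \<sigma> u'"
      by (intro tendsto_add l bounded_linear.tendsto[OF bounded_clinearD(1)[OF bounded_clinear_scaleC]])
    then have "l = w' + scaleC \<sigma> u'" using x(2) LIMSEQ_unique by (simp flip: uw(2))
    ultimately show "l \<in> S" unfolding S_def by blast
  qed
  ultimately obtain p where p: "p \<in> S" "\<And>s. s \<in> S \<Longrightarrow> inner (f - p) s = 0"
    using orthogonal_projection_exists[of S f] by blast
  define h where "h = f - p"
  have h: "cinner h s = 0" if "s \<in> S" for s
    using p(2)[OF that] p(2)[OF S_scale[OF that, of \<i>]] by (simp add: complex_eq_iff Re_cinner Im_cinner h_def)
  have "distributional_dirac h (scaleC \<i> (scaleC \<sigma> h - pot h))"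
    unfolding distributional_dirac_def
  proof (intro allI impI)
    fix \<psi> c assume t: "test_function \<psi>"
    let ?t = "tens \<psi> c" and ?g = "\<lambda>k. tens (partial_deriv k \<psi>) c"
    have "(?t, scaleC (- \<i>) (dslash ?g) + pot ?t) \<in> H"
      unfolding H_iff using weak_tens[OF t] by (intro exI[of _ ?g]) simp
    then have "cinner h (scaleC (- \<i>) (dslash ?g) + pot ?t + scaleC \<sigma> ?t) = 0" by (intro h) (auto simp: S_def)
    then have "\<i> * cinner h (dslash ?g) + cinner (pot h) ?t - \<sigma> * cinner h ?t = 0"
      by (simp add: cinner_add_right cinner_scaleC_right cinner_pot \<sigma>')
    then have "\<i> * cinner h (dslash ?g) = \<sigma> * cinner h ?t - cinner (pot h) ?t" by (simp add: algebra_simps)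
    then have "\<i> * (\<i> * cinner h (dslash ?g)) = \<i> * (\<sigma> * cinner h ?t - cinner (pot h) ?t)" by simp
    then have "- cinner h (dslash ?g) = cinner (scaleC \<i> (scaleC \<sigma> h - pot h)) ?t"
      by (simp add: cinner_scaleC_left cinner_diff_left)
    from this[symmetric] have "cinner h (dslash ?g) = - cinner (scaleC \<i> (scaleC \<sigma> h - pot h)) ?t" by simp
    then show "(\<Sum>k\<in>UNIV. cinner h (Mat (dirac_alpha k) (tens (partial_deriv k \<psi>) c))) = - cinner (scaleC \<i> (scaleC \<sigma> h - pot h)) ?t"
      by (simp add: dslash_def cinner_sum_right)
  qed
  then have "(h, scaleC \<sigma> h) \<in> H" by (rule H_of_distributional)
  from H_symmetric[OF this this] have "\<sigma> * cinner h h = - \<sigma> * cinner h h" by (simp add: cinner_scaleC_left cinner_scaleC_right \<sigma>')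
  moreover have "x = 0" if "x = - x" for x :: complex using that by (simp add: complex_eq_iff)
  ultimately have "\<sigma> * cinner h h = 0" by simp
  then have "cinner h h = 0" using \<sigma>' by auto
  then have "f = p" by (simp add: cinner_self h_def)
  then show ?thesis using p(1) by (auto simp: S_def)
qed

sublocale selfadjoint_graph H
proof
  show "\<exists>u w. (u, w) \<in> H \<and> w + scaleC \<i> u = f" for f by (rule H_range) simp
  show "\<exists>u w. (u, w) \<in> H \<and> w - scaleC \<i> u = f" for f
    using H_range[of "- \<i>" f] by (simp add: scaleC_minus_left)
qed (fact H_add H_scale H_symmetric H_single_valued)+

end

section \<open>Pointwise bounds for spectrally localized fields\<close>

text \<open>The square integral of the excess \<open>(|u'| - b)\<^sup>+\<close> is at most \<open>\<parallel>u' - u n\<parallel>\<^sup>2\<close> for every \<open>n\<close>.  This replaces the passage to an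
  almost everywhere convergent subsequence.\<close>

lemma AE_bound_limit:
  fixes b :: "R4 \<Rightarrow> ennreal"
  assumes u: "u \<longlonglongrightarrow> u'" and b [measurable]: "b \<in> borel_measurable borel"
    and bd: "\<And>n. AE x in lborel. ennreal (norm (rep_L2 (u n) x)) \<le> b x"
  shows "AE x in lborel. ennreal (norm (rep_L2 u' x)) \<le> b x"
proof -
  have "(\<integral>\<^sup>+x. (ennreal (norm (rep_L2 u' x)) - b x)\<^sup>2 \<partial>lborel) \<le> ennreal ((norm (u' - u n))\<^sup>2)" for n
    unfolding nn_integral_norm_diff[symmetric]
  proof (rule nn_integral_mono_AE)
    show "AE x in lborel. (ennreal (norm (rep_L2 u' x)) - b x)\<^sup>2 \<le> ennreal ((norm (rep_L2 u' x - rep_L2 (u n) x))\<^sup>2)"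
      using bd[of n]
    proof eventually_elim
      case (elim x)
      have "ennreal (norm (rep_L2 u' x)) \<le> ennreal (norm (rep_L2 u' x - rep_L2 (u n) x)) + ennreal (norm (rep_L2 (u n) x))"
        using norm_triangle_ineq[of "rep_L2 u' x - rep_L2 (u n) x" "rep_L2 (u n) x"] by (simp add: ennreal_leI flip: ennreal_plus)
      also have "\<dots> \<le> ennreal (norm (rep_L2 u' x - rep_L2 (u n) x)) + b x" using elim by (rule add_left_mono)
      finally have "ennreal (norm (rep_L2 u' x)) - b x \<le> ennreal (norm (rep_L2 u' x - rep_L2 (u n) x))"
        by (simp add: ennreal_minus_le_iff add.commute)
      then have "(ennreal (norm (rep_L2 u' x)) - b x)\<^sup>2 \<le> (ennreal (norm (rep_L2 u' x - rep_L2 (u n) x)))\<^sup>2" by (intro power_mono) auto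
      then show ?case by (simp add: ennreal_power)
    qed
  qed
  moreover have "(\<lambda>n. ennreal ((norm (u' - u n))\<^sup>2)) \<longlonglongrightarrow> ennreal ((norm (u' - u'))\<^sup>2)"
    by (intro tendsto_ennrealI tendsto_intros u)
  ultimately have "(\<integral>\<^sup>+x. (ennreal (norm (rep_L2 u' x)) - b x)\<^sup>2 \<partial>lborel) \<le> 0"
    by (intro LIMSEQ_le_const) auto
  then have "AE x in lborel. (ennreal (norm (rep_L2 u' x)) - b x)\<^sup>2 = 0"
    by (subst nn_integral_0_iff_AE[symmetric]) auto
  then show ?thesis
    by eventually_elim (auto simp: diff_eq_0_iff_ennreal)
qed

definition nconv :: "(R4 \<Rightarrow> ennreal) \<Rightarrow> (R4 \<Rightarrow> ennreal) \<Rightarrow> R4 \<Rightarrow> ennreal" where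
  "nconv a b x = (\<integral>\<^sup>+y. a (x - y) * b y \<partial>lborel)"

lemma borel_measurable_nconv [measurable]:
  assumes [measurable]: "a \<in> borel_measurable borel" "b \<in> borel_measurable borel"
  shows "nconv a b \<in> borel_measurable borel"
  unfolding nconv_def[abs_def] by measurable

lemma nconv_mono_AE:
  assumes "AE y in lborel. b y \<le> c y" shows "nconv a b x \<le> nconv a c x"
  unfolding nconv_def by (rule nn_integral_mono_AE) (use assms in \<open>auto elim!: eventually_mono intro: mult_left_mono\<close>)

lemma nconv_cmult:
  assumes [measurable]: "a \<in> borel_measurable borel" "b \<in> borel_measurable borel"
  shows "nconv a (\<lambda>y. c * b y) x = c * nconv a b x"
proof -
  have "nconv a (\<lambda>y. c * b y) x = (\<integral>\<^sup>+y. c * (a (x - y) * b y) \<partial>lborel)" by (simp add: nconv_def mult_ac)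
  then show ?thesis by (simp add: nconv_def nn_integral_cmult)
qed

lemma nconv_assoc:
  assumes [measurable]: "a \<in> borel_measurable borel" "b \<in> borel_measurable borel" "c \<in> borel_measurable borel"
  shows "nconv a (nconv b c) x = nconv (nconv a b) c x"
proof -
  have "nconv a (nconv b c) x = (\<integral>\<^sup>+y. \<integral>\<^sup>+z. a (x - y) * (b (y - z) * c z) \<partial>lborel \<partial>lborel)"
    unfolding nconv_def by (intro nn_integral_cong nn_integral_cmult[symmetric]) measurable
  also have "\<dots> = (\<integral>\<^sup>+z. \<integral>\<^sup>+y. a (x - y) * (b (y - z) * c z) \<partial>lborel \<partial>lborel)"
    by (rule lborel_pair.Fubini'[symmetric]) measurable
  also have "\<dots> = (\<integral>\<^sup>+z. nconv a b (x - z) * c z \<partial>lborel)"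
  proof (intro nn_integral_cong)
    fix z
    have "(\<integral>\<^sup>+y. a (x - y) * (b (y - z) * c z) \<partial>lborel) = (\<integral>\<^sup>+y. a (x - y) * b (y - z) \<partial>lborel) * c z"
      by (subst nn_integral_multc[symmetric]) (auto simp: mult.assoc)
    also have "(\<integral>\<^sup>+y. a (x - y) * b (y - z) \<partial>lborel) = (\<integral>\<^sup>+y. a (x - z - y) * b y \<partial>lborel)"
      using nn_integral_translate[of "\<lambda>y. a (x - z - y) * b y" z] by (simp add: algebra_simps)
    finally show "(\<integral>\<^sup>+y. a (x - y) * (b (y - z) * c z) \<partial>lborel) = nconv a b (x - z) * c z" by (simp add: nconv_def)
  qed
  finally show ?thesis by (simp add: nconv_def)
qed

text \<open>Truncated powers \<open>|y|\<^sup>-\<^sup>s\<close>; convolution lowers the singularity.\<close>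

definition riesz :: "real \<Rightarrow> real \<Rightarrow> R4 \<Rightarrow> ennreal" where
  "riesz s R y = ennreal (indicator (cball 0 R) y * norm y powr (- s))"

lemma borel_measurable_riesz [measurable]: "riesz s R \<in> borel_measurable borel"
proof -
  have [measurable]: "cball (0::R4) R \<in> sets borel" by simp
  have [measurable]: "(\<lambda>y::R4. norm y powr (- s)) \<in> borel_measurable borel" by (intro powr_real_measurable) auto
  show ?thesis unfolding riesz_def by measurable
qed

text \<open>Of the two factors \<open>|x - y|\<^sup>-\<^sup>s\<close> and \<open>|y|\<^sup>-\<^sup>t\<close>, the one with the larger base gives up the power
  \<open>\<tau>\<close>, which is comparable to \<open>|x|\<^sup>-\<^sup>\<tau>\<close>; what remains is dominated by a single integrable power.\<close>

lemma nconv_riesz: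
  assumes \<tau>: "0 \<le> \<tau>" "\<tau> \<le> s" "\<tau> \<le> t" "s + t - \<tau> < 4" and R: "R > 0" "R' > 0"
  shows "\<exists>C. \<forall>x. x \<noteq> 0 \<longrightarrow> nconv (riesz s R) (riesz t R') x \<le> ennreal C * riesz \<tau> (R + R') x"
proof -
  define \<sigma> where "\<sigma> = s + t - \<tau>"
  have \<sigma>: "0 \<le> \<sigma>" "\<sigma> < 4" using \<tau> by (auto simp: \<sigma>_def)
  have fin: "(\<integral>\<^sup>+y. riesz \<sigma> r y \<partial>lborel) < \<infinity>" if "r > 0" for r
    unfolding riesz_def by (rule nn_integral_singular_kernel[OF \<sigma> that])
  define I where "I = (\<integral>\<^sup>+y. riesz \<sigma> R y \<partial>lborel) + (\<integral>\<^sup>+y. riesz \<sigma> R' y \<partial>lborel)"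
  have I: "I < \<infinity>" unfolding I_def using fin R by simp
  have pw: "riesz s R z * riesz t R' y \<le> ennreal (2 powr \<tau>) * riesz \<tau> (R + R') (z + y) * (riesz \<sigma> R z + riesz \<sigma> R' y)"
    if zy: "z + y \<noteq> 0" for z y
  proof (cases "norm z \<le> R \<and> norm y \<le> R' \<and> z \<noteq> 0 \<and> y \<noteq> 0")
    case False
    then have "riesz s R z * riesz t R' y = 0" by (auto simp: riesz_def)
    then show ?thesis by (simp only: zero_le)
  next
    case True
    have tri: "norm (z + y) \<le> norm z + norm y" by (rule norm_triangle_ineq)
    then have in_ball: "norm (z + y) \<le> R + R'" using True by linarith
    have main: "norm p powr (- a) * norm q powr (- b) \<le> 2 powr \<tau> * norm (z + y) powr (- \<tau>) * norm p powr (- \<sigma>)"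
      if pq: "norm p \<le> norm q" "norm (z + y) \<le> norm p + norm q" "p \<noteq> 0" and ab: "\<tau> \<le> b" "a + b - \<tau> = \<sigma>" for p q :: R4 and a b
    proof -
      have q: "norm q > 0" "norm p > 0" using pq by auto
      have "norm q powr (- b) = norm q powr (- \<tau>) * norm q powr (- (b - \<tau>))" by (simp flip: powr_add)
      also have "\<dots> \<le> (norm (z + y) / 2) powr (- \<tau>) * norm p powr (- (b - \<tau>))"
        using pq ab \<tau> zy q by (intro mult_mono powr_mono2') auto
      also have "(norm (z + y) / 2) powr (- \<tau>) = 2 powr \<tau> * norm (z + y) powr (- \<tau>)"
        by (simp add: powr_divide powr_minus field_simps)
      finally have "norm p powr (- a) * norm q powr (- b) \<le> norm p powr (- a) * (2 powr \<tau> * norm (z + y) powr (- \<tau>) * norm p powr (- (b - \<tau>)))"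
        by (rule mult_left_mono) simp
      also have "\<dots> = 2 powr \<tau> * norm (z + y) powr (- \<tau>) * (norm p powr (- a) * norm p powr (- (b - \<tau>)))" by (simp add: mult_ac)
      also have "norm p powr (- a) * norm p powr (- (b - \<tau>)) = norm p powr (- \<sigma>)"
        using ab by (simp flip: powr_add add: algebra_simps)
      finally show ?thesis .
    qed
    have "norm z powr (- s) * norm y powr (- t) \<le> 2 powr \<tau> * norm (z + y) powr (- \<tau>) * (norm z powr (- \<sigma>) + norm y powr (- \<sigma>))"
    proof (cases "norm z \<le> norm y")
      case le: True
      have "norm z powr (- s) * norm y powr (- t) \<le> 2 powr \<tau> * norm (z + y) powr (- \<tau>) * norm z powr (- \<sigma>)"
        by (rule main) (use le tri True \<tau> in \<open>auto simp: \<sigma>_def\<close>)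
      also have "\<dots> \<le> 2 powr \<tau> * norm (z + y) powr (- \<tau>) * (norm z powr (- \<sigma>) + norm y powr (- \<sigma>))" by (intro mult_left_mono) auto
      finally show ?thesis .
    next
      case le: False
      have "norm y powr (- t) * norm z powr (- s) \<le> 2 powr \<tau> * norm (z + y) powr (- \<tau>) * norm y powr (- \<sigma>)"
        by (rule main) (use le tri True \<tau> in \<open>auto simp: \<sigma>_def\<close>)
      also have "\<dots> \<le> 2 powr \<tau> * norm (z + y) powr (- \<tau>) * (norm z powr (- \<sigma>) + norm y powr (- \<sigma>))" by (intro mult_left_mono) auto
      finally show ?thesis by (simp add: mult.commute)
    qed
    then show ?thesis using True in_ball by (simp add: riesz_def ennreal_leI flip: ennreal_mult ennreal_plus)
  qed
  have "nconv (riesz s R) (riesz t R') x \<le> ennreal (2 powr \<tau> * enn2real I) * riesz \<tau> (R + R') x" if x: "x \<noteq> 0" for x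
  proof -
    have "nconv (riesz s R) (riesz t R') x \<le> (\<integral>\<^sup>+y. ennreal (2 powr \<tau>) * riesz \<tau> (R + R') x * (riesz \<sigma> R (x - y) + riesz \<sigma> R' y) \<partial>lborel)"
      unfolding nconv_def
    proof (rule nn_integral_mono)
      fix y show "riesz s R (x - y) * riesz t R' y \<le> ennreal (2 powr \<tau>) * riesz \<tau> (R + R') x * (riesz \<sigma> R (x - y) + riesz \<sigma> R' y)"
        using pw[of "x - y" y] x by simp
    qed
    also have "\<dots> = ennreal (2 powr \<tau>) * riesz \<tau> (R + R') x * (\<integral>\<^sup>+y. riesz \<sigma> R (x - y) + riesz \<sigma> R' y \<partial>lborel)"
      by (rule nn_integral_cmult) measurable
    also have "(\<integral>\<^sup>+y. riesz \<sigma> R (x - y) + riesz \<sigma> R' y \<partial>lborel) = I"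
      unfolding I_def by (subst nn_integral_add) (simp_all add: nn_integral_reflect)
    also have "I = ennreal (enn2real I)" using I by simp
    finally show ?thesis by (simp add: ennreal_mult mult_ac)
  qed
  then show ?thesis by blast
qed

text \<open>The kernel \<open>|x|\<^sup>-\<^sup>3\<close> of the inverse Dirac operator is not square integrable in dimension four.  Convolving it twice
  with itself improves the exponent to \<open>5/2\<close> and then to \<open>7/4\<close> (up to an arbitrarily small loss, the exponents \<open>2\<close> and \<open>1\<close> would
  be available), and \<open>7/2 < 4\<close> makes the square integrable; the Cauchy--Schwarz inequality does the rest.\<close>

lemma triple_riesz_bound:
  "\<exists>C. \<forall>h x. h \<in> borel_measurable borel \<longrightarrow>
    (nconv (riesz 3 1) (nconv (riesz 3 1) (nconv (riesz 3 1) h)) x)\<^sup>2 \<le> ennreal C * (\<integral>\<^sup>+y. (h y)\<^sup>2 \<partial>lborel)"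
proof -
  let ?a = "riesz 3 1"
  obtain C1 where C1: "\<And>x. x \<noteq> 0 \<Longrightarrow> nconv ?a ?a x \<le> ennreal C1 * riesz (5/2) 2 x"
    using nconv_riesz[of "5/2" 3 3 1 1] by auto
  obtain C2 where C2: "\<And>x. x \<noteq> 0 \<Longrightarrow> nconv ?a (riesz (5/2) 2) x \<le> ennreal C2 * riesz (7/4) 3 x"
    using nconv_riesz[of "7/4" 3 "5/2" 1 2] by auto
  let ?b = "nconv ?a (nconv ?a ?a)"
  have nz: "AE x in lborel. x \<noteq> (0::R4)" by (rule AE_lborel_singleton)
  have b: "?b x \<le> ennreal C1 * (ennreal C2 * riesz (7/4) 3 x)" if "x \<noteq> 0" for x
  proof -
    have "?b x \<le> nconv ?a (\<lambda>y. ennreal C1 * riesz (5/2) 2 y) x"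
      by (rule nconv_mono_AE) (use nz C1 in \<open>auto elim: eventually_mono\<close>)
    also have "\<dots> = ennreal C1 * nconv ?a (riesz (5/2) 2) x" by (rule nconv_cmult) measurable
    also have "\<dots> \<le> ennreal C1 * (ennreal C2 * riesz (7/4) 3 x)" by (intro mult_left_mono C2 that) simp
    finally show ?thesis .
  qed
  have bfin: "(\<integral>\<^sup>+x. (?b x)\<^sup>2 \<partial>lborel) < \<infinity>"
  proof -
    have "(\<integral>\<^sup>+x. (?b x)\<^sup>2 \<partial>lborel) \<le> (\<integral>\<^sup>+x. (ennreal C1 * ennreal C2)\<^sup>2 * riesz (7/2) 3 x \<partial>lborel)"
    proof (rule nn_integral_mono_AE)
      show "AE x in lborel. (?b x)\<^sup>2 \<le> (ennreal C1 * ennreal C2)\<^sup>2 * riesz (7/2) 3 x"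
        using nz
      proof eventually_elim
        case (elim x)
        have "(?b x)\<^sup>2 \<le> (ennreal C1 * (ennreal C2 * riesz (7/4) 3 x))\<^sup>2" by (intro power_mono b elim) simp
        also have "\<dots> = (ennreal C1 * ennreal C2)\<^sup>2 * (riesz (7/4) 3 x)\<^sup>2" by (simp add: power_mult_distrib mult.assoc)
        also have "(riesz (7/4) 3 x)\<^sup>2 = riesz (7/2) 3 x"
        proof -
          have "(norm x powr (- (7/4)))\<^sup>2 = norm x powr (- (7/2))" by (simp add: power2_eq_square flip: powr_add)
          then show ?thesis by (auto simp: riesz_def ennreal_power indicator_def)
        qed
        finally show ?case .
      qed
    qed
    also have "\<dots> = (ennreal C1 * ennreal C2)\<^sup>2 * (\<integral>\<^sup>+x. riesz (7/2) 3 x \<partial>lborel)" by (rule nn_integral_cmult) measurable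
    also have "\<dots> < \<infinity>"
      using nn_integral_singular_kernel[of "7/2" 3] by (simp add: riesz_def ennreal_mult_less_top power_less_top_ennreal)
    finally show ?thesis .
  qed
  show ?thesis
  proof (intro exI[of _ "enn2real (\<integral>\<^sup>+x. (?b x)\<^sup>2 \<partial>lborel)"] allI impI)
    fix h :: "R4 \<Rightarrow> ennreal" and x assume [measurable]: "h \<in> borel_measurable borel"
    have aa: "nconv ?a (nconv ?a h) = nconv (nconv ?a ?a) h" by (rule ext, rule nconv_assoc) measurable
    have "nconv ?a (nconv ?a (nconv ?a h)) x = nconv ?b h x"
      unfolding aa by (rule nconv_assoc) measurable
    then have "(nconv ?a (nconv ?a (nconv ?a h)) x)\<^sup>2 = (\<integral>\<^sup>+y. ?b (x - y) * h y \<partial>lborel)\<^sup>2" by (simp add: nconv_def)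
    also have "\<dots> \<le> (\<integral>\<^sup>+y. (?b (x - y))\<^sup>2 \<partial>lborel) * (\<integral>\<^sup>+y. (h y)\<^sup>2 \<partial>lborel)" by (rule Cauchy_Schwarz_nn_integral) measurable
    also have "(\<integral>\<^sup>+y. (?b (x - y))\<^sup>2 \<partial>lborel) = (\<integral>\<^sup>+x. (?b x)\<^sup>2 \<partial>lborel)" by (rule nn_integral_reflect) measurable
    also have "\<dots> = ennreal (enn2real (\<integral>\<^sup>+x. (?b x)\<^sup>2 \<partial>lborel))" using bfin by simp
    finally show "(nconv ?a (nconv ?a (nconv ?a h)) x)\<^sup>2 \<le> ennreal (enn2real (\<integral>\<^sup>+x. (?b x)\<^sup>2 \<partial>lborel)) * (\<integral>\<^sup>+y. (h y)\<^sup>2 \<partial>lborel)" .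
  qed
qed

text \<open>The kernel truncated at the length \<open>1 / L\<close> that corresponds to spectral parameters of size \<open>L\<close>.  The prefactor turns it
  into the \<open>L\<^sup>1\<close>-invariant rescaling of \<open>riesz 3 1\<close>.\<close>

definition rieszL :: "real \<Rightarrow> R4 \<Rightarrow> ennreal" where
  "rieszL L y = ennreal L * riesz 3 (1 / L) y"

lemma borel_measurable_rieszL [measurable]: "rieszL L \<in> borel_measurable borel"
  unfolding rieszL_def by measurable

lemma rieszL_scale:
  assumes L: "L > 0" shows "rieszL L (inverse L *\<^sub>R v) = ennreal (L ^ 4) * riesz 3 1 v"
proof -
  have "norm (inverse L *\<^sub>R v) powr (- 3) = L ^ 3 * norm v powr (- 3)"
    using L by (simp add: powr_mult powr_minus powr_numeral power_inverse divide_inverse)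
  moreover have "(inverse L *\<^sub>R v \<in> cball 0 (1 / L)) \<longleftrightarrow> v \<in> cball 0 1" using L by (simp add: field_simps)
  ultimately show ?thesis
    using L by (auto simp: rieszL_def riesz_def indicator_def power_numeral_reduce mult_ac simp flip: ennreal_mult)
qed

lemma nconv_rieszL_scale:
  assumes L: "L > 0" and [measurable]: "h \<in> borel_measurable borel"
  shows "nconv (rieszL L) h (inverse L *\<^sub>R x) = nconv (riesz 3 1) (\<lambda>z. h (inverse L *\<^sub>R z)) x"
proof -
  have "nconv (rieszL L) h (inverse L *\<^sub>R x) = ennreal (\<bar>inverse L\<bar> ^ 4) * (\<integral>\<^sup>+z. rieszL L (inverse L *\<^sub>R x - (0 + inverse L *\<^sub>R z)) * h (0 + inverse L *\<^sub>R z) \<partial>lborel)"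
    unfolding nconv_def by (rule nn_integral_affine) (use L in auto)
  also have "(\<integral>\<^sup>+z. rieszL L (inverse L *\<^sub>R x - (0 + inverse L *\<^sub>R z)) * h (0 + inverse L *\<^sub>R z) \<partial>lborel)
     = (\<integral>\<^sup>+z. ennreal (L ^ 4) * (riesz 3 1 (x - z) * h (inverse L *\<^sub>R z)) \<partial>lborel)"
    by (simp add: rieszL_scale[OF L] mult.assoc flip: scaleR_diff_right)
  also have "\<dots> = ennreal (L ^ 4) * nconv (riesz 3 1) (\<lambda>z. h (inverse L *\<^sub>R z)) x"
    unfolding nconv_def by (rule nn_integral_cmult) measurable
  also have "ennreal (\<bar>inverse L\<bar> ^ 4) * (ennreal (L ^ 4) * y) = y" for y
    using L by (simp add: mult.assoc[symmetric] power_inverse flip: ennreal_mult)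
  finally show ?thesis .
qed

text \<open>Scaling: the square of the \<open>L\<^sup>2\<close> norm of the iterated kernel acquires the factor \<open>L\<^sup>4\<close>.\<close>

lemma triple_rieszL_bound:
  "\<exists>C. \<forall>L h x. L > 0 \<longrightarrow> h \<in> borel_measurable borel \<longrightarrow>
    (nconv (rieszL L) (nconv (rieszL L) (nconv (rieszL L) h)) x)\<^sup>2 \<le> ennreal (C * L ^ 4) * (\<integral>\<^sup>+y. (h y)\<^sup>2 \<partial>lborel)"
proof -
  obtain C where C: "\<And>h x. h \<in> borel_measurable borel \<Longrightarrow>
    (nconv (riesz 3 1) (nconv (riesz 3 1) (nconv (riesz 3 1) h)) x)\<^sup>2 \<le> ennreal C * (\<integral>\<^sup>+y. (h y)\<^sup>2 \<partial>lborel)"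
    using triple_riesz_bound by blast
  show ?thesis
  proof (intro exI[of _ C] allI impI)
    fix L :: real and h :: "R4 \<Rightarrow> ennreal" and x assume L: "L > 0" and [measurable]: "h \<in> borel_measurable borel"
    let ?S = "\<lambda>h z. h (inverse L *\<^sub>R z) :: ennreal"
    have S: "?S (nconv (rieszL L) k) = nconv (riesz 3 1) (?S k)" if "k \<in> borel_measurable borel" for k
      by (rule ext) (rule nconv_rieszL_scale[OF L that])
    have "nconv (rieszL L) (nconv (rieszL L) (nconv (rieszL L) h)) x = ?S (nconv (rieszL L) (nconv (rieszL L) (nconv (rieszL L) h))) (L *\<^sub>R x)"
      using L by simp
    also have "\<dots> = nconv (riesz 3 1) (nconv (riesz 3 1) (nconv (riesz 3 1) (?S h))) (L *\<^sub>R x)"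
    proof -
      have "nconv (rieszL L) h \<in> borel_measurable borel" "nconv (rieszL L) (nconv (rieszL L) h) \<in> borel_measurable borel" by measurable
      then have "?S (nconv (rieszL L) (nconv (rieszL L) (nconv (rieszL L) h))) = nconv (riesz 3 1) (nconv (riesz 3 1) (nconv (riesz 3 1) (?S h)))"
        using S[of h] S[of "nconv (rieszL L) h"] S[of "nconv (rieszL L) (nconv (rieszL L) h)"] by simp
      from fun_cong[OF this, of "L *\<^sub>R x"] show ?thesis .
    qed
    finally have "(nconv (rieszL L) (nconv (rieszL L) (nconv (rieszL L) h)) x)\<^sup>2 \<le> ennreal C * (\<integral>\<^sup>+y. (?S h y)\<^sup>2 \<partial>lborel)"
      using C[of "?S h" "L *\<^sub>R x"] by simp
    also have "(\<integral>\<^sup>+y. (?S h y)\<^sup>2 \<partial>lborel) = ennreal (L ^ 4) * (\<integral>\<^sup>+y. (h y)\<^sup>2 \<partial>lborel)"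
      using nn_integral_affine[of "\<lambda>y. (?S h y)\<^sup>2" L 0] L by simp
    finally show "(nconv (rieszL L) (nconv (rieszL L) (nconv (rieszL L) h)) x)\<^sup>2 \<le> ennreal (C * L ^ 4) * (\<integral>\<^sup>+y. (h y)\<^sup>2 \<partial>lborel)"
      using L by (simp add: ennreal_mult'' mult.assoc)
  qed
qed

text \<open>With \<open>N = n + 1\<close>, this is the regularized fundamental solution \<open>x\<^sub>j / (|x|\<^sup>2 + N\<^sup>-\<^sup>2)\<^sup>2\<close> of the massless Dirac operator, cut
  off at distance \<open>1 / L\<close>.\<close>

definition gam :: "real \<Rightarrow> nat \<Rightarrow> 4 \<Rightarrow> R4 \<Rightarrow> real" where
  "gam L n j x = cut L x * (x $ j * (real (Suc n) ^ 4 * inverse ((1 + (real (Suc n))\<^sup>2 * (x \<bullet> x)) ^ 2)))"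

text \<open>The part of the divergence of \<open>gam\<close> in which the derivative falls on the cutoff.\<close>

definition gam_rem :: "real \<Rightarrow> nat \<Rightarrow> R4 \<Rightarrow> real" where
  "gam_rem L n x = 2 * L\<^sup>2 * (x \<bullet> x) * flat 2 (1 - L\<^sup>2 * (x \<bullet> x)) * (real (Suc n) ^ 4 * inverse ((1 + (real (Suc n))\<^sup>2 * (x \<bullet> x)) ^ 2))"

lemma ctest_gam: assumes "L > 0" shows "ctest (gam L n j)"
proof -
  have "smooth_alg (gam L n j)"
    unfolding gam_def[abs_def]
    by (intro smooth_alg.mult smooth_alg_cut smooth_alg.const smooth_alg.coord smooth_alg_inverse_quadratic)
  moreover have "gam L n j x = 0" if "norm x > 1 / L" for x
    using cut_support[OF assms, of x] that by (simp add: gam_def)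
  ultimately show ?thesis unfolding ctest_def by blast
qed

lemma flat_cut_support:
  fixes x :: R4
  assumes "L > 0" "norm x \<ge> 1 / L" shows "flat j (1 - L\<^sup>2 * (x \<bullet> x)) = 0"
  using cut_support[OF assms] by (auto simp: cut_def flat_def split: if_splits)

lemma cc_gam_rem: assumes "L > 0" shows "cc (gam_rem L n)"
proof -
  have "smooth_alg (gam_rem L n)"
    unfolding gam_rem_def[abs_def]
    by (intro smooth_alg.mult smooth_alg.const smooth_alg_inner smooth_alg.flat smooth_alg_diff smooth_alg_inverse_quadratic)
  moreover have "gam_rem L n x = 0" if "norm x > 1 / L" for x
    using flat_cut_support[OF assms, of x 2] that by (simp add: gam_rem_def)
  ultimately have "ctest (gam_rem L n)" unfolding ctest_def by blast
  then show ?thesis by (rule ctest_cc)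
qed

lemma partial_deriv_radial:
  assumes "(g has_real_derivative g') (at (x \<bullet> x))"
  shows "partial_deriv k (\<lambda>x. g (x \<bullet> x)) x = 2 * x $ k * g'"
proof -
  have d: "((\<lambda>x::R4. x \<bullet> x) has_derivative (\<lambda>h. x \<bullet> h + h \<bullet> x)) (at x)"
    by (auto intro!: derivative_eq_intros)
  then have diff: "(\<lambda>x::R4. x \<bullet> x) differentiable (at x)" by (auto simp: differentiable_def)
  have "partial_deriv k (\<lambda>x. x \<bullet> x) x = 2 * x $ k"
    using partial_derivI[OF d, of k] by (simp add: inner_axis inner_commute)
  then show ?thesis using partial_deriv_comp(2)[OF diff assms, of k] by simp
qed

lemma partial_deriv_gam:
  fixes L n x
  defines "N \<equiv> real (Suc n)" and "s \<equiv> x \<bullet> x"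
  shows "partial_deriv k (gam L n j) x = (if j = k then cut L x * (N ^ 4 * inverse ((1 + N\<^sup>2 * s) ^ 2)) else 0)
    + x $ j * x $ k * (- 2 * L\<^sup>2 * flat 2 (1 - L\<^sup>2 * s) * (N ^ 4 * inverse ((1 + N\<^sup>2 * s) ^ 2))
       + cut L x * (- 4 * N ^ 6 * inverse ((1 + N\<^sup>2 * s) ^ 3)))"
proof -
  let ?q = "\<lambda>x::R4. N ^ 4 * inverse ((1 + N\<^sup>2 * (x \<bullet> x)) ^ 2)"
  have p: "1 + N\<^sup>2 * s > 0" unfolding s_def by (simp add: add_pos_nonneg)
  have sq: "smooth_alg ?q" by (intro smooth_alg.mult smooth_alg.const smooth_alg_inverse_quadratic)
  have sx: "smooth_alg (\<lambda>x. x $ j * ?q x)" by (intro smooth_alg.mult smooth_alg.coord sq)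
  have d1: "((\<lambda>s. 1 - L\<^sup>2 * s) has_real_derivative - L\<^sup>2) (at s)" by (auto intro!: derivative_eq_intros)
  have "((\<lambda>s. flat 0 (1 - L\<^sup>2 * s)) has_real_derivative (- L\<^sup>2) * flat 2 (1 - L\<^sup>2 * s)) (at s)"
    using DERIV_chain2[where f="flat 0" and g="\<lambda>s. 1 - L\<^sup>2 * s", OF flat_deriv d1]
    by (simp add: mult.commute numeral_2_eq_2 del: power_Suc)
  from partial_deriv_radial[OF this[unfolded s_def], of k]
  have dcut: "partial_deriv k (cut L) x = 2 * x $ k * (- L\<^sup>2 * flat 2 (1 - L\<^sup>2 * s))"
    by (simp add: cut_def[abs_def] s_def)
  have "((\<lambda>s. N ^ 4 * inverse ((1 + N\<^sup>2 * s) ^ 2)) has_real_derivative - 2 * N ^ 6 * inverse ((1 + N\<^sup>2 * s) ^ 3)) (at s)"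
  proof -
    define D where "D = 1 + N\<^sup>2 * s"
    have D: "D \<noteq> 0" "D ^ 2 \<noteq> 0" using p unfolding D_def by auto
    have d2: "((\<lambda>s. 1 + N\<^sup>2 * s) has_real_derivative N\<^sup>2) (at s)" by (auto intro!: derivative_eq_intros)
    have "((\<lambda>s. N ^ 4 * inverse ((1 + N\<^sup>2 * s) ^ 2)) has_real_derivative
        N ^ 4 * - (inverse (D ^ 2) * (real 2 * (N\<^sup>2 * D ^ (2 - Suc 0))) * inverse (D ^ 2))) (at s)"
      unfolding D_def by (intro DERIV_cmult DERIV_inverse' DERIV_power d2) (use D in \<open>simp add: D_def\<close>)
    moreover have "N ^ 4 * - (inverse (D ^ 2) * (real 2 * (N\<^sup>2 * D ^ (2 - Suc 0))) * inverse (D ^ 2)) = - 2 * N ^ 6 * inverse (D ^ 3)"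
      using D(1) by (simp add: field_simps power_numeral_reduce)
    ultimately show ?thesis unfolding D_def by (rule DERIV_cong)
  qed
  from partial_deriv_radial[OF this[unfolded s_def], of k]
  have dq: "partial_deriv k ?q x = 2 * x $ k * (- 2 * N ^ 6 * inverse ((1 + N\<^sup>2 * s) ^ 3))" by (simp add: s_def)
  have "gam L n j = (\<lambda>x. cut L x * (x $ j * ?q x))" by (simp add: gam_def[abs_def] N_def)
  then have "partial_deriv k (gam L n j) x = partial_deriv k (cut L) x * (x $ j * ?q x)
      + cut L x * (partial_deriv k (\<lambda>x. x $ j) x * ?q x + x $ j * partial_deriv k ?q x)"
    by (simp only: partial_deriv_mult[OF smooth_alg_differentiable[OF smooth_alg_cut] smooth_alg_differentiable[OF sx]]
        partial_deriv_mult[OF smooth_alg_differentiable[OF smooth_alg.coord] smooth_alg_differentiable[OF sq]] add.commute)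
  then show ?thesis unfolding dcut dq partial_deriv_coord
    by (cases "j = k") (simp_all add: s_def algebra_simps)
qed

lemma partial_deriv_gam_sym: "partial_deriv k (gam L n j) = partial_deriv j (gam L n k)"
  by (rule ext) (simp add: partial_deriv_gam mult.commute)

lemma gam_divergence: "(\<Sum>k\<in>UNIV. partial_deriv k (gam L n k) x) = moll L n x - gam_rem L n x"
proof -
  define N where "N = real (Suc n)"
  define s where "s = x \<bullet> x"
  define D where "D = 1 + N\<^sup>2 * s"
  have D: "D > 0" unfolding D_def s_def by (simp add: add_pos_nonneg)
  have s4: "(\<Sum>k\<in>UNIV. x $ k * x $ k) = s" by (simp add: s_def inner_vec_def)
  have "(\<Sum>k\<in>UNIV. partial_deriv k (gam L n k) x) = 4 * (cut L x * (N ^ 4 * inverse (D ^ 2)))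
     + s * (- 2 * L\<^sup>2 * flat 2 (1 - L\<^sup>2 * s) * (N ^ 4 * inverse (D ^ 2)) + cut L x * (- 4 * N ^ 6 * inverse (D ^ 3)))"
    unfolding partial_deriv_gam sum.distrib if_P[OF refl] N_def[symmetric] s_def[symmetric] D_def[symmetric] sum_distrib_right[symmetric] s4 by simp
  also have "4 * (cut L x * (N ^ 4 * inverse (D ^ 2))) = cut L x * (4 * N ^ 4 * inverse (D ^ 3)) * D"
    using D by (simp add: field_simps power_numeral_reduce)
  also have "cut L x * (4 * N ^ 4 * inverse (D ^ 3)) * D + s * (- 2 * L\<^sup>2 * flat 2 (1 - L\<^sup>2 * s) * (N ^ 4 * inverse (D ^ 2)) + cut L x * (- 4 * N ^ 6 * inverse (D ^ 3)))
     = cut L x * (4 * N ^ 4 * inverse (D ^ 3)) - 2 * L\<^sup>2 * s * flat 2 (1 - L\<^sup>2 * s) * (N ^ 4 * inverse (D ^ 2))"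
  proof -
    have "cut L x * (4 * N ^ 4 * inverse (D ^ 3)) * D = cut L x * (4 * N ^ 4 * inverse (D ^ 3)) + s * cut L x * (4 * N ^ 6 * inverse (D ^ 3))"
      unfolding D_def[of] by (simp add: algebra_simps power_numeral_reduce)
    then show ?thesis by (simp add: algebra_simps)
  qed
  finally show ?thesis by (simp add: moll_def gam_rem_def N_def s_def D_def)
qed

lemma inverse_quadratic_le:
  assumes "x \<noteq> 0"
  shows "real (Suc n) ^ 4 * inverse ((1 + (real (Suc n))\<^sup>2 * (x \<bullet> x)) ^ 2) \<le> norm x powr (- 4)"
proof -
  define N where "N = real (Suc n)"
  have N: "N > 0" by (simp add: N_def)
  have x: "norm x > 0" using assms by simp
  have "(N\<^sup>2 * (norm x)\<^sup>2) ^ 2 \<le> (1 + N\<^sup>2 * (x \<bullet> x)) ^ 2"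
    by (intro power_mono) (auto simp: power2_norm_eq_inner)
  then have "inverse ((1 + N\<^sup>2 * (x \<bullet> x)) ^ 2) \<le> inverse ((N\<^sup>2 * (norm x)\<^sup>2) ^ 2)"
    using N x by (intro le_imp_inverse_le) auto
  then have "N ^ 4 * inverse ((1 + N\<^sup>2 * (x \<bullet> x)) ^ 2) \<le> N ^ 4 * inverse ((N\<^sup>2 * (norm x)\<^sup>2) ^ 2)"
    using N by (intro mult_left_mono) auto
  also have "\<dots> = inverse (norm x ^ 4)" using N x by (simp add: power_mult_distrib field_simps flip: power_mult)
  also have "\<dots> = norm x powr (- 4)" using x by (simp add: powr_minus powr_numeral)
  finally show ?thesis by (simp add: N_def)
qed

lemma flat2_le: "flat 2 t \<le> 2"
proof (cases "t > 0")
  case True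
  define s where "s = inverse t"
  have "s > 0" using True by (simp add: s_def)
  then have "1 + s + s\<^sup>2 / 2 \<le> exp s" by (intro exp_lower_Taylor_quadratic) simp
  then have "s\<^sup>2 \<le> 2 * exp s" using \<open>s > 0\<close> by simp
  then have "s\<^sup>2 * exp (- s) \<le> 2 * exp s * exp (- s)" by (intro mult_right_mono) auto
  then show ?thesis using True by (simp add: flat_def s_def exp_minus mult.assoc)
qed (simp add: flat_def)

lemma flat_nonneg: "0 \<le> flat j t"
  by (simp add: flat_def)

lemma gam_le:
  assumes L: "L > 0" shows "ennreal \<bar>gam L n j x\<bar> \<le> ennreal (1 / L) * rieszL L x"
proof (cases "x = 0 \<or> norm x \<ge> 1 / L")
  case True
  then have "gam L n j x = 0" using cut_support[OF L, of x] by (auto simp: gam_def)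
  then show ?thesis by simp
next
  case False
  let ?q = "real (Suc n) ^ 4 * inverse ((1 + (real (Suc n))\<^sup>2 * (x \<bullet> x)) ^ 2)"
  have q: "0 \<le> ?q" by (simp add: add_nonneg_nonneg)
  have "\<bar>gam L n j x\<bar> = cut L x * (\<bar>x $ j\<bar> * ?q)"
    unfolding gam_def abs_mult using cut_bounds(1)[of L x] q by (simp add: abs_mult)
  also have "\<dots> \<le> 1 * (norm x * norm x powr (- 4))"
    using False cut_bounds[of L x] q by (intro mult_mono inverse_quadratic_le component_le_norm_cart mult_nonneg_nonneg) auto
  also have "\<dots> = norm x powr (- 3)"
    using False powr_add[of "norm x" 1 "- 4"] by simp
  finally have "ennreal \<bar>gam L n j x\<bar> \<le> ennreal (norm x powr (- 3))" by (rule ennreal_leI)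
  also have "\<dots> = ennreal (1 / L) * rieszL L x"
    using False L by (simp add: rieszL_def riesz_def mult.assoc[symmetric] flip: ennreal_mult)
  finally show ?thesis .
qed

text \<open>The derivative of the cutoff costs a factor \<open>L\<close>, which is affordable because the kernel is supported where
  \<open>L |x| \<le> 1\<close>.\<close>

lemma gam_rem_le:
  assumes L: "L > 0" shows "ennreal \<bar>gam_rem L n x\<bar> \<le> 4 * rieszL L x"
proof (cases "x = 0 \<or> norm x \<ge> 1 / L")
  case True
  then have "gam_rem L n x = 0" using flat_cut_support[OF L, of x 2] by (auto simp: gam_rem_def)
  then show ?thesis by simp
next
  case False
  let ?q = "real (Suc n) ^ 4 * inverse ((1 + (real (Suc n))\<^sup>2 * (x \<bullet> x)) ^ 2)"
  have x: "norm x > 0" using False by simp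
  have Lx: "L * norm x \<le> 1" using False L by (simp add: field_simps)
  have q: "0 \<le> ?q" by (simp add: add_nonneg_nonneg)
  have "\<bar>gam_rem L n x\<bar> = 2 * L\<^sup>2 * (x \<bullet> x) * flat 2 (1 - L\<^sup>2 * (x \<bullet> x)) * ?q"
    unfolding gam_rem_def using q flat_nonneg[of 2 "1 - L\<^sup>2 * (x \<bullet> x)"] by (intro abs_of_nonneg mult_nonneg_nonneg) auto
  also have "\<dots> \<le> 2 * L\<^sup>2 * (x \<bullet> x) * 2 * norm x powr (- 4)"
    using False q flat_nonneg[of 2 "1 - L\<^sup>2 * (x \<bullet> x)"] by (intro mult_mono flat2_le inverse_quadratic_le) auto
  also have "\<dots> = 4 * (L * (L * norm x) * norm x powr (- 3))"
  proof -
    have "norm x * norm x powr (- 4) = norm x powr (- 3)" using x powr_add[of "norm x" 1 "- 4"] by simp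
    moreover have "x \<bullet> x = norm x * norm x" by (simp add: power2_eq_square flip: power2_norm_eq_inner)
    ultimately show ?thesis by (simp add: power2_eq_square mult_ac)
  qed
  also have "\<dots> \<le> 4 * (L * 1 * norm x powr (- 3))"
    using L Lx by (intro mult_left_mono mult_right_mono) auto
  finally have "ennreal \<bar>gam_rem L n x\<bar> \<le> ennreal (4 * (L * norm x powr (- 3)))" by (simp add: ennreal_leI)
  also have "\<dots> = 4 * rieszL L x"
    using False L by (simp add: rieszL_def riesz_def ennreal_mult)
  finally show ?thesis .
qed

lemma conv_kernel_sum:
  assumes "finite I" "\<And>i. i \<in> I \<Longrightarrow> cc (\<phi> i)"
  shows "conv (\<lambda>x. \<Sum>i\<in>I. \<phi> i x) (rep_L2 u) x = (\<Sum>i\<in>I. conv (\<phi> i) (rep_L2 u) x)"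
  unfolding conv_def scaleR_sum_left
  by (rule Bochner_Integration.integral_sum) (rule conv_integrable[OF assms(2)])

text \<open>Representation of \<open>u\<close> through \<open>G = \<Sum> \<alpha>\<^sub>k \<partial>\<^sub>k u\<close>: the matrices \<open>\<partial>\<^sub>k \<Gamma>\<^sub>j\<close> are symmetric, so that the
  anticommutation relations leave only the divergence of \<open>\<Gamma>\<close>, an approximate identity up to the cutoff error.\<close>

lemma dirac_representation:
  assumes G: "distributional_dirac u G" and L: "L > 0"
  shows "conv (moll L n) (rep_L2 u) x = (\<Sum>j\<in>UNIV. dirac_alpha j *v conv (gam L n j) (rep_L2 G) x) + conv (gam_rem L n) (rep_L2 u) x"
proof -
  let ?D = "\<lambda>j k. conv (partial_deriv k (gam L n j)) (rep_L2 u) x"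
  have cp: "cc (partial_deriv k (gam L n j))" for j k by (intro ctest_cc ctest_partial ctest_gam L)
  let ?A = "\<lambda>j k. dirac_alpha j *v (dirac_alpha k *v ?D j k)"
  let ?S = "\<Sum>j\<in>UNIV. dirac_alpha j *v conv (gam L n j) (rep_L2 G) x"
  have sumv: "A *v (\<Sum>k\<in>UNIV. f k) = (\<Sum>k\<in>UNIV. A *v f k)" for A :: "complex^4^4" and f :: "4 \<Rightarrow> complex^4"
    by (simp add: sum_4 matrix_vector_right_distrib)
  have S: "?S = (\<Sum>j\<in>UNIV. \<Sum>k\<in>UNIV. ?A j k)"
    by (simp add: distributional_dirac_conv[OF G ctest_gam[OF L]] sumv)
  have anti: "?A j k + ?A k j = (if j = k then 2 *\<^sub>R ?D k k else 0)" for j k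
  proof -
    have "?A j k + ?A k j = (dirac_alpha j ** dirac_alpha k + dirac_alpha k ** dirac_alpha j) *v ?D j k"
      by (simp add: partial_deriv_gam_sym[of j L n k] matrix_vector_mul_assoc matrix_vector_mult_add_rdistrib)
    also have "\<dots> = (if j = k then 2 *\<^sub>R ?D k k else 0)"
      unfolding alpha_anticommute
      by (cases "j = k") (simp_all only: if_True if_False matrix_vector_mult_add_rdistrib matrix_vector_mul_lid matrix_vector_mult_0 scaleR_2 simp_thms)
    finally show ?thesis .
  qed
  have "2 *\<^sub>R ?S = (\<Sum>j\<in>UNIV. \<Sum>k\<in>UNIV. ?A j k) + (\<Sum>j\<in>UNIV. \<Sum>k\<in>UNIV. ?A k j)"
    unfolding S sum.swap[of "\<lambda>j k. ?A k j"] by (rule scaleR_2)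
  also have "\<dots> = (\<Sum>j\<in>UNIV. \<Sum>k\<in>UNIV. if j = k then 2 *\<^sub>R ?D k k else 0)"
    by (simp only: sum.distrib[symmetric] anti)
  also have "\<dots> = 2 *\<^sub>R (\<Sum>k\<in>UNIV. ?D k k)" by (simp add: scaleR_sum_right)
  finally have "?S = (\<Sum>k\<in>UNIV. ?D k k)" by simp
  also have "\<dots> = conv (\<lambda>x. \<Sum>k\<in>UNIV. partial_deriv k (gam L n k) x) (rep_L2 u) x"
    by (rule conv_kernel_sum[symmetric]) (simp_all add: cp)
  also have "\<dots> = conv (moll L n) (rep_L2 u) x - conv (gam_rem L n) (rep_L2 u) x"
    using conv_integrable[OF cc_moll[OF L], where x=x and u=u] conv_integrable[OF cc_gam_rem[OF L], where x=x and u=u]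
    by (simp add: gam_divergence conv_def scaleR_diff_left)
  finally show ?thesis by simp
qed

lemma norm_alpha_mult_le: "norm (dirac_alpha j *v a) \<le> 16 * norm a"
proof -
  have "\<forall>j i k. norm (dirac_alpha j $ i $ k) \<le> 1"
    unfolding forall_4 by (simp add: dirac_alpha_explicit vector_4)
  then show ?thesis using norm_matrix_vector_le[of "dirac_alpha j" 1 a] by simp
qed

text \<open>The bound is uniform in the regularization and hence passes to the limit of the approximate identity.\<close>

lemma dirac_pointwise_bound:
  assumes G: "distributional_dirac u G" and L: "L > 0"
  shows "AE x in lborel. ennreal (norm (moll_const *\<^sub>R rep_L2 u x)) \<le>
    nconv (rieszL L) (\<lambda>y. ennreal (64 * norm (rep_L2 G y) / L + 4 * norm (rep_L2 u y))) x"
proof -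
  let ?b = "nconv (rieszL L) (\<lambda>y. ennreal (64 * norm (rep_L2 G y) / L + 4 * norm (rep_L2 u y)))"
  have pw: "ennreal (norm (conv (moll L n) (rep_L2 u) x)) \<le> ?b x" for n x
  proof -
    have [measurable]: "gam L n j \<in> borel_measurable borel" "gam_rem L n \<in> borel_measurable borel" for j
      using ctest_cc[OF ctest_gam[OF L]] cc_gam_rem[OF L] by (auto intro: cc_measurable)
    let ?I = "\<integral>\<^sup>+y. rieszL L (x - y) * ennreal (norm (rep_L2 G y) / L) \<partial>lborel"
    let ?J = "\<integral>\<^sup>+y. rieszL L (x - y) * ennreal (4 * norm (rep_L2 u y)) \<partial>lborel"
    have 1: "ennreal (norm (conv (gam L n j) (rep_L2 G) x)) \<le> ?I" for j
    proof (rule order_trans[OF norm_conv_le nn_integral_mono])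
      fix y
      have "ennreal \<bar>gam L n j (x - y)\<bar> * ennreal (norm (rep_L2 G y)) \<le> (ennreal (1 / L) * rieszL L (x - y)) * ennreal (norm (rep_L2 G y))"
        by (intro mult_right_mono gam_le L) simp
      also have "\<dots> = rieszL L (x - y) * (ennreal (1 / L) * ennreal (norm (rep_L2 G y)))" by (simp add: mult_ac)
      also have "ennreal (1 / L) * ennreal (norm (rep_L2 G y)) = ennreal (norm (rep_L2 G y) / L)" using L by (simp flip: ennreal_mult)
      finally show "ennreal \<bar>gam L n j (x - y)\<bar> * ennreal (norm (rep_L2 G y)) \<le> rieszL L (x - y) * ennreal (norm (rep_L2 G y) / L)" .
    qed
    have 2: "ennreal (norm (conv (gam_rem L n) (rep_L2 u) x)) \<le> ?J"
    proof (rule order_trans[OF norm_conv_le nn_integral_mono])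
      fix y
      have "ennreal \<bar>gam_rem L n (x - y)\<bar> * ennreal (norm (rep_L2 u y)) \<le> (4 * rieszL L (x - y)) * ennreal (norm (rep_L2 u y))"
        by (intro mult_right_mono gam_rem_le L) simp
      also have "\<dots> = rieszL L (x - y) * ennreal (4 * norm (rep_L2 u y))" by (simp add: mult_ac ennreal_mult)
      finally show "ennreal \<bar>gam_rem L n (x - y)\<bar> * ennreal (norm (rep_L2 u y)) \<le> rieszL L (x - y) * ennreal (4 * norm (rep_L2 u y))" .
    qed
    let ?c = "\<lambda>j. conv (gam L n j) (rep_L2 G) x"
    have "norm (conv (moll L n) (rep_L2 u) x) \<le> norm (\<Sum>j\<in>UNIV. dirac_alpha j *v ?c j) + norm (conv (gam_rem L n) (rep_L2 u) x)"
      unfolding dirac_representation[OF G L] by (rule norm_triangle_ineq)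
    also have "\<dots> \<le> (\<Sum>j\<in>UNIV. 16 * norm (?c j)) + norm (conv (gam_rem L n) (rep_L2 u) x)"
      by (intro add_right_mono sum_norm_le norm_alpha_mult_le)
    finally have "ennreal (norm (conv (moll L n) (rep_L2 u) x)) \<le> ennreal ((\<Sum>j\<in>UNIV. 16 * norm (?c j)) + norm (conv (gam_rem L n) (rep_L2 u) x))"
      by (rule ennreal_leI)
    also have "\<dots> = (\<Sum>j\<in>UNIV. 16 * ennreal (norm (?c j))) + ennreal (norm (conv (gam_rem L n) (rep_L2 u) x))"
      by (simp add: sum_nonneg ennreal_mult flip: sum_ennreal)
    also have "\<dots> \<le> (\<Sum>j\<in>(UNIV::4 set). 16 * ?I) + ?J"
      by (intro add_mono sum_mono mult_left_mono 1 2) simp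
    also have "\<dots> = 64 * ?I + ?J" by (simp add: mult.assoc[symmetric])
    also have "64 * ?I = (\<integral>\<^sup>+y. 64 * (rieszL L (x - y) * ennreal (norm (rep_L2 G y) / L)) \<partial>lborel)"
      by (rule nn_integral_cmult[symmetric]) measurable
    also have "\<dots> + ?J = (\<integral>\<^sup>+y. 64 * (rieszL L (x - y) * ennreal (norm (rep_L2 G y) / L)) + rieszL L (x - y) * ennreal (4 * norm (rep_L2 u y)) \<partial>lborel)"
      by (rule nn_integral_add[symmetric]) measurable
    also have "\<dots> = ?b x"
      unfolding nconv_def
    proof (intro nn_integral_cong)
      fix y
      have "ennreal (64 * norm (rep_L2 G y) / L + 4 * norm (rep_L2 u y)) = 64 * ennreal (norm (rep_L2 G y) / L) + ennreal (4 * norm (rep_L2 u y))"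
        using L ennreal_mult[of 64 "norm (rep_L2 G y) / L"] by simp
      then show "64 * (rieszL L (x - y) * ennreal (norm (rep_L2 G y) / L)) + rieszL L (x - y) * ennreal (4 * norm (rep_L2 u y))
        = rieszL L (x - y) * ennreal (64 * norm (rep_L2 G y) / L + 4 * norm (rep_L2 u y))"
        by (simp add: distrib_left mult_ac)
    qed
    finally show ?thesis .
  qed
  have "AE x in lborel. ennreal (norm (rep_L2 (moll_const *\<^sub>R u) x)) \<le> ?b x"
  proof (rule AE_bound_limit[OF Conv_moll_tendsto[OF L]])
    show "?b \<in> borel_measurable borel" by measurable
    show "AE x in lborel. ennreal (norm (rep_L2 (Conv (moll L n) u) x)) \<le> ?b x" for n
      using rep_Conv_AE[OF cc_moll[OF L], of n u] by eventually_elim (simp add: pw)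
  qed
  then show ?thesis using rep_scaleR_AE[of moll_const u] by eventually_elim simp
qed

context dirac_potential
begin

text \<open>The lower order terms of \<open>H\<close> are bounded operators and are absorbed into the term without the factor \<open>1 / L\<close>; here
  \<open>L \<ge> 1\<close> is used.\<close>

lemma H_pointwise_bound:
  "\<exists>C>0. \<forall>L\<ge>1. \<forall>u w. (u, w) \<in> H \<longrightarrow>
    (AE x in lborel. ennreal (norm (rep_L2 u x)) \<le> nconv (rieszL L) (\<lambda>y. ennreal (C * (norm (rep_L2 w y) / L + norm (rep_L2 u y)))) x)"
proof -
  define A where "A = 16 * \<bar>m\<bar> + 16 * \<bar>K\<bar>"
  define C where "C = (64 + 64 * A + 4) / moll_const"
  have A0: "A \<ge> 0" by (simp add: A_def)
  have C: "C > 0" unfolding C_def using A0 moll_const_pos by simp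
  show ?thesis
  proof (intro exI[of _ C] conjI C allI impI)
    fix L u w assume L: "L \<ge> (1::real)" and uw: "(u, w) \<in> H"
    then have L0: "L > 0" by simp
    let ?G = "scaleC \<i> (w - pot u)"
    have beta: "bmat (\<lambda>x. dirac_beta) 1"
      by (simp add: bmat_def dirac_beta_def block_matrix_def forall_4 vector_4 mat_def)
    have Gb: "AE y in lborel. norm (rep_L2 ?G y) \<le> norm (rep_L2 w y) + A * norm (rep_L2 u y)"
      using rep_scaleC_AE[of \<i> "w - pot u"] rep_diff_AE[of w "pot u"]
        rep_add_AE[of "scaleC (of_real m) (Mat dirac_beta u)" "mult_L2 V u"]
        rep_scaleC_AE[of "of_real m" "Mat dirac_beta u"] rep_mult_AE[OF beta, of u] rep_mult_AE[OF bounded_V, of u]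
    proof eventually_elim
      case (elim y)
      have "norm (rep_L2 (pot u) y) \<le> norm (of_real m *s (dirac_beta *v rep_L2 u y)) + norm (V y *v rep_L2 u y)"
        unfolding pot_def elim(3) elim(4) elim(5) elim(6) by (rule norm_triangle_ineq)
      also have "\<dots> \<le> \<bar>m\<bar> * (16 * 1 * norm (rep_L2 u y)) + 16 * \<bar>K\<bar> * norm (rep_L2 u y)"
      proof (rule add_mono)
        show "norm (of_real m *s (dirac_beta *v rep_L2 u y)) \<le> \<bar>m\<bar> * (16 * 1 * norm (rep_L2 u y))"
          unfolding norm_vector_smult norm_of_real
          by (intro mult_left_mono norm_matrix_vector_le) (use beta in \<open>auto simp: bmat_def\<close>)
        show "norm (V y *v rep_L2 u y) \<le> 16 * \<bar>K\<bar> * norm (rep_L2 u y)"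
          by (rule norm_matrix_vector_le) (use bounded_V in \<open>auto simp: bmat_def intro: order_trans[OF _ abs_ge_self]\<close>)
      qed
      also have "\<dots> = A * norm (rep_L2 u y)" by (simp add: A_def algebra_simps)
      finally have "norm (rep_L2 w y - rep_L2 (pot u) y) \<le> norm (rep_L2 w y) + A * norm (rep_L2 u y)"
        using norm_triangle_ineq4[of "rep_L2 w y" "rep_L2 (pot u) y"] by linarith
      then show ?case unfolding elim(1) elim(2) norm_vector_smult by simp
    qed
    have le: "AE y in lborel. ennreal (64 * norm (rep_L2 ?G y) / L + 4 * norm (rep_L2 u y)) \<le> ennreal moll_const * ennreal (C * (norm (rep_L2 w y) / L + norm (rep_L2 u y)))"
      using Gb
    proof eventually_elim
      case (elim y)
      have "norm (rep_L2 ?G y) / L \<le> (norm (rep_L2 w y) + A * norm (rep_L2 u y)) / L"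
        using elim L0 by (intro divide_right_mono) auto
      also have "\<dots> = norm (rep_L2 w y) / L + A * (norm (rep_L2 u y) / L)" by (simp add: add_divide_distrib)
      also have "\<dots> \<le> norm (rep_L2 w y) / L + A * norm (rep_L2 u y)"
      proof -
        have "norm (rep_L2 u y) / L \<le> norm (rep_L2 u y)" using L by (simp add: divide_le_eq mult_le_cancel_left1 not_less)
        then show ?thesis using A0 by (intro add_left_mono mult_left_mono)
      qed
      finally have g: "norm (rep_L2 ?G y) / L \<le> norm (rep_L2 w y) / L + A * norm (rep_L2 u y)" .
      have "64 * norm (rep_L2 ?G y) / L + 4 * norm (rep_L2 u y) \<le> 64 * (norm (rep_L2 w y) / L) + (64 * A + 4) * norm (rep_L2 u y)"
      proof -
        have "64 * norm (rep_L2 ?G y) / L = 64 * (norm (rep_L2 ?G y) / L)" by simp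
        moreover have "(64 * A + 4) * norm (rep_L2 u y) = 64 * (A * norm (rep_L2 u y)) + 4 * norm (rep_L2 u y)" by (simp add: algebra_simps)
        ultimately show ?thesis using g by linarith
      qed
      also have "\<dots> \<le> (64 + 64 * A + 4) * (norm (rep_L2 w y) / L + norm (rep_L2 u y))"
      proof -
        let ?w = "norm (rep_L2 w y) / L" and ?u = "norm (rep_L2 u y)"
        have "0 \<le> (64 * A + 4) * ?w + 64 * ?u" using A0 L0 by simp
        moreover have "(64 + 64 * A + 4) * (?w + ?u) = 64 * ?w + (64 * A + 4) * ?u + ((64 * A + 4) * ?w + 64 * ?u)" by algebra
        ultimately show ?thesis by linarith
      qed
      also have "\<dots> = moll_const * (C * (norm (rep_L2 w y) / L + norm (rep_L2 u y)))"
        using moll_const_pos by (simp add: C_def)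
      finally have "ennreal (64 * norm (rep_L2 ?G y) / L + 4 * norm (rep_L2 u y)) \<le> ennreal (moll_const * (C * (norm (rep_L2 w y) / L + norm (rep_L2 u y))))"
        by (rule ennreal_leI)
      also have "\<dots> = ennreal moll_const * ennreal (C * (norm (rep_L2 w y) / L + norm (rep_L2 u y)))"
        using C L0 moll_const_pos by (intro ennreal_mult) auto
      finally show ?case .
    qed
    have "AE x in lborel. ennreal (norm (moll_const *\<^sub>R rep_L2 u x)) \<le> nconv (rieszL L) (\<lambda>y. ennreal (64 * norm (rep_L2 ?G y) / L + 4 * norm (rep_L2 u y))) x"
      by (rule dirac_pointwise_bound[OF distributional_of_H[OF uw] L0])
    then show "AE x in lborel. ennreal (norm (rep_L2 u x)) \<le> nconv (rieszL L) (\<lambda>y. ennreal (C * (norm (rep_L2 w y) / L + norm (rep_L2 u y)))) x"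
    proof eventually_elim
      case (elim x)
      have "ennreal moll_const * ennreal (norm (rep_L2 u x)) = ennreal (norm (moll_const *\<^sub>R rep_L2 u x))"
        using moll_const_pos by (simp flip: ennreal_mult)
      also note elim
      also have "nconv (rieszL L) (\<lambda>y. ennreal (64 * norm (rep_L2 ?G y) / L + 4 * norm (rep_L2 u y))) x
        \<le> nconv (rieszL L) (\<lambda>y. ennreal moll_const * ennreal (C * (norm (rep_L2 w y) / L + norm (rep_L2 u y)))) x"
        by (rule nconv_mono_AE[OF le])
      also have "\<dots> = ennreal moll_const * nconv (rieszL L) (\<lambda>y. ennreal (C * (norm (rep_L2 w y) / L + norm (rep_L2 u y)))) x"
        by (rule nconv_cmult) measurable
      finally show ?case using moll_const_pos by (simp add: ennreal_mult_le_mult_iff)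
    qed
  qed
qed

text \<open>A Bernstein inequality: fields on which the powers of \<open>H\<close> up to the third act like a quantity of
  size \<open>L\<close> are bounded by \<open>L\<^sup>2\<close> times their norm, the exponent being half the dimension.  Three
  applications of the pointwise bound are enough for the iterated kernel to be square integrable.\<close>

lemma bernstein:
  "\<exists>C>0. \<forall>L\<ge>1. \<forall>B\<ge>0. \<forall>u. (\<forall>i<3. (u i, u (Suc i)) \<in> H) \<longrightarrow> (\<forall>i<4. norm (u i) \<le> L ^ i * B) \<longrightarrow>
    (AE x in lborel. norm (rep_L2 (u 0) x) \<le> C * L\<^sup>2 * B)"
proof -
  obtain c where c: "c > 0" and pb: "\<And>L u w. L \<ge> 1 \<Longrightarrow> (u, w) \<in> H \<Longrightarrow>
      AE x in lborel. ennreal (norm (rep_L2 u x)) \<le> nconv (rieszL L) (\<lambda>y. ennreal (c * (norm (rep_L2 w y) / L + norm (rep_L2 u y)))) x"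
    using H_pointwise_bound by blast
  obtain C0 where C0: "\<And>L h x. L > 0 \<Longrightarrow> h \<in> borel_measurable borel \<Longrightarrow>
    (nconv (rieszL L) (nconv (rieszL L) (nconv (rieszL L) h)) x)\<^sup>2 \<le> ennreal (C0 * L ^ 4) * (\<integral>\<^sup>+y. (h y)\<^sup>2 \<partial>lborel)"
    using triple_rieszL_bound by blast
  define C where "C = 6 * c ^ 3 * sqrt (16 * \<bar>C0\<bar> + 1)"
  have C: "C > 0" using c by (simp add: C_def add_nonneg_pos)
  show ?thesis
  proof (intro exI[of _ C] conjI C allI impI)
    fix L B :: real and u :: "nat \<Rightarrow> L2"
    assume L: "L \<ge> 1" and B: "B \<ge> 0" and uH: "\<forall>i<3. (u i, u (Suc i)) \<in> H" and un: "\<forall>i<4. norm (u i) \<le> L ^ i * B"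
    have L0: "L > 0" using L by simp
    \<comment> \<open>the weights \<open>L\<^sup>-\<^sup>i\<close> put all four fields on the same scale\<close>
    define f where "f i y = ennreal (norm (rep_L2 (u i) y) / L ^ i)" for i y
    have [measurable]: "f i \<in> borel_measurable borel" for i unfolding f_def by measurable
    \<comment> \<open>each application of the pointwise bound admits one more field: \<open>M k\<close> is controlled by \<open>M (k + 1)\<close>\<close>
    define M where "M k y = (\<Sum>i<Suc k. f i y)" for k y
    have [measurable]: "M k \<in> borel_measurable borel" for k unfolding M_def[abs_def] by measurable
    have fM: "f i y + f (Suc i) y \<le> M (Suc k) y" if "i \<le> k" for i k y
    proof -
      have "f i y + f (Suc i) y = sum (\<lambda>i. f i y) {i, Suc i}" by simp
      also have "\<dots> \<le> M (Suc k) y" unfolding M_def by (rule sum_mono2) (use that in auto)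
      finally show ?thesis .
    qed
    have step: "AE x in lborel. f i x \<le> ennreal c * nconv (rieszL L) (M (Suc k)) x" if i: "i \<le> k" "k < 3" for i k
    proof -
      have "(u i, u (Suc i)) \<in> H" using uH that by auto
      from pb[OF L this] show ?thesis
      proof eventually_elim
        case (elim x)
        have "f i x = ennreal (1 / L ^ i) * ennreal (norm (rep_L2 (u i) x))" using L0 by (simp add: f_def flip: ennreal_mult)
        also have "\<dots> \<le> ennreal (1 / L ^ i) * nconv (rieszL L) (\<lambda>y. ennreal (c * (norm (rep_L2 (u (Suc i)) y) / L + norm (rep_L2 (u i) y)))) x"
          by (intro mult_left_mono elim) simp
        also have "\<dots> = nconv (rieszL L) (\<lambda>y. ennreal (1 / L ^ i) * ennreal (c * (norm (rep_L2 (u (Suc i)) y) / L + norm (rep_L2 (u i) y)))) x"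
          by (rule nconv_cmult[symmetric]) measurable
        also have "\<dots> \<le> nconv (rieszL L) (\<lambda>y. ennreal c * M (Suc k) y) x"
        proof (rule nconv_mono_AE, intro always_eventually allI)
          fix y
          have "ennreal (1 / L ^ i) * ennreal (c * (norm (rep_L2 (u (Suc i)) y) / L + norm (rep_L2 (u i) y)))
            = ennreal (1 / L ^ i * (c * (norm (rep_L2 (u (Suc i)) y) / L + norm (rep_L2 (u i) y))))"
            using L0 c by (intro ennreal_mult[symmetric]) auto
          also have "1 / L ^ i * (c * (norm (rep_L2 (u (Suc i)) y) / L + norm (rep_L2 (u i) y)))
            = c * (norm (rep_L2 (u i) y) / L ^ i + norm (rep_L2 (u (Suc i)) y) / L ^ Suc i)"
            using L0 by (simp add: field_simps)
          also have "ennreal \<dots> = ennreal c * (f i y + f (Suc i) y)"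
            using L0 c unfolding f_def by (subst ennreal_mult) auto
          also have "\<dots> \<le> ennreal c * M (Suc k) y" by (intro mult_left_mono fM i) simp
          finally show "ennreal (1 / L ^ i) * ennreal (c * (norm (rep_L2 (u (Suc i)) y) / L + norm (rep_L2 (u i) y))) \<le> ennreal c * M (Suc k) y" .
        qed
        also have "\<dots> = ennreal c * nconv (rieszL L) (M (Suc k)) x" by (rule nconv_cmult) measurable
        finally show ?case .
      qed
    qed
    have Mstep: "AE x in lborel. M k x \<le> of_nat (Suc k) * ennreal c * nconv (rieszL L) (M (Suc k)) x" if k: "k < 3" for k
    proof -
      have "AE x in lborel. \<forall>i\<in>{..<Suc k}. f i x \<le> ennreal c * nconv (rieszL L) (M (Suc k)) x"
        by (rule AE_finite_allI) (use step k in auto)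
      then show ?thesis
      proof eventually_elim
        case (elim x)
        have "M k x \<le> (\<Sum>i<Suc k. ennreal c * nconv (rieszL L) (M (Suc k)) x)"
          unfolding M_def[of k] by (intro sum_mono) (use elim in blast)
        then show ?case by (simp add: mult.assoc)
      qed
    qed
    let ?T = "nconv (rieszL L)"
    have T1: "?T (M 1) x \<le> 2 * ennreal c * ?T (?T (M 2)) x" for x
    proof -
      have "?T (M 1) x \<le> ?T (\<lambda>y. 2 * ennreal c * ?T (M 2) y) x"
        by (rule nconv_mono_AE) (use Mstep[of 1] in \<open>simp add: numeral_2_eq_2\<close>)
      also have "\<dots> = 2 * ennreal c * ?T (?T (M 2)) x" by (rule nconv_cmult) measurable
      finally show ?thesis .
    qed
    have T2: "?T (?T (M 2)) x \<le> 3 * ennreal c * ?T (?T (?T (M 3))) x" for x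
    proof -
      have in1: "?T (M 2) y \<le> 3 * ennreal c * ?T (?T (M 3)) y" for y
      proof -
        have "?T (M 2) y \<le> ?T (\<lambda>y. 3 * ennreal c * ?T (M 3) y) y"
          by (rule nconv_mono_AE) (use Mstep[of 2] in \<open>simp add: numeral_3_eq_3 numeral_2_eq_2\<close>)
        also have "\<dots> = 3 * ennreal c * ?T (?T (M 3)) y" by (rule nconv_cmult) measurable
        finally show ?thesis .
      qed
      have "?T (?T (M 2)) x \<le> ?T (\<lambda>y. 3 * ennreal c * ?T (?T (M 3)) y) x"
        by (rule nconv_mono_AE) (use in1 in auto)
      also have "\<dots> = 3 * ennreal c * ?T (?T (?T (M 3))) x" by (rule nconv_cmult) measurable
      finally show ?thesis .
    qed
    have MM: "(\<integral>\<^sup>+y. (M 3 y)\<^sup>2 \<partial>lborel) \<le> ennreal (16 * B\<^sup>2)"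
    proof -
      have "(M 3 y)\<^sup>2 \<le> 4 * (\<Sum>i<4. (f i y)\<^sup>2)" for y
      proof -
        have e: "(\<Sum>i<Suc 3. f i y) = ennreal (\<Sum>i<4. norm (rep_L2 (u i) y) / L ^ i)"
          unfolding f_def using L0 by (subst sum_ennreal) auto
        have "(\<Sum>i<4. norm (rep_L2 (u i) y) / L ^ i)\<^sup>2 \<le> (\<Sum>i<4. (norm (rep_L2 (u i) y) / L ^ i)\<^sup>2) * real (card {..<4::nat})"
          by (rule sum_squared_le_sum_of_squares)
        then have "(\<Sum>i<4. norm (rep_L2 (u i) y) / L ^ i)\<^sup>2 \<le> 4 * (\<Sum>i<4. (norm (rep_L2 (u i) y) / L ^ i)\<^sup>2)" by simp
        then have "ennreal ((\<Sum>i<4. norm (rep_L2 (u i) y) / L ^ i)\<^sup>2) \<le> ennreal (4 * (\<Sum>i<4. (norm (rep_L2 (u i) y) / L ^ i)\<^sup>2))" by (rule ennreal_leI)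
        also have "\<dots> = 4 * (\<Sum>i<4. (f i y)\<^sup>2)"
          unfolding f_def using L0 by (simp add: ennreal_mult sum_nonneg ennreal_power flip: sum_ennreal)
        finally show ?thesis
          unfolding M_def e using L0 by (subst ennreal_power) (auto intro!: sum_nonneg)
      qed
      then have "(\<integral>\<^sup>+y. (M 3 y)\<^sup>2 \<partial>lborel) \<le> (\<integral>\<^sup>+y. 4 * (\<Sum>i<4. (f i y)\<^sup>2) \<partial>lborel)" by (intro nn_integral_mono)
      also have "\<dots> = 4 * (\<Sum>i<4. \<integral>\<^sup>+y. (f i y)\<^sup>2 \<partial>lborel)"
        by (subst nn_integral_cmult, measurable, subst nn_integral_sum) auto
      also have "\<dots> \<le> 4 * (\<Sum>i<4::nat. ennreal (B\<^sup>2))"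
      proof (intro mult_left_mono sum_mono)
        fix i :: nat assume i: "i \<in> {..<4}"
        have "(\<integral>\<^sup>+y. (f i y)\<^sup>2 \<partial>lborel) = (\<integral>\<^sup>+y. ennreal ((1 / L ^ i)\<^sup>2) * ennreal ((norm (rep_L2 (u i) y))\<^sup>2) \<partial>lborel)"
          unfolding f_def using L0 by (intro nn_integral_cong) (simp add: ennreal_power power_divide flip: ennreal_mult)
        also have "\<dots> = ennreal ((1 / L ^ i)\<^sup>2) * ennreal ((norm (u i))\<^sup>2)"
          by (subst nn_integral_cmult) (simp_all add: nn_integral_norm_rep)
        also have "\<dots> = ennreal ((norm (u i) / L ^ i)\<^sup>2)" by (simp add: power_divide flip: ennreal_mult)
        also have "\<dots> \<le> ennreal (B\<^sup>2)"
          using un i L0 by (intro ennreal_leI power_mono) (auto simp: divide_le_eq mult.commute)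
        finally show "(\<integral>\<^sup>+y. (f i y)\<^sup>2 \<partial>lborel) \<le> ennreal (B\<^sup>2)" .
      qed simp
      also have "\<dots> = ennreal (16 * B\<^sup>2)" by (simp add: ennreal_mult mult.assoc[symmetric])
      finally show ?thesis .
    qed
    have T3: "?T (?T (?T (M 3))) x \<le> ennreal (sqrt (16 * \<bar>C0\<bar> + 1) * L\<^sup>2 * B)" for x
    proof -
      have "(?T (?T (?T (M 3))) x)\<^sup>2 \<le> ennreal (C0 * L ^ 4) * (\<integral>\<^sup>+y. (M 3 y)\<^sup>2 \<partial>lborel)" by (rule C0[OF L0]) measurable
      also have "\<dots> \<le> ennreal (\<bar>C0\<bar> * L ^ 4) * ennreal (16 * B\<^sup>2)"
        using L0 by (intro mult_mono MM ennreal_leI mult_right_mono) auto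
      also have "\<dots> = ennreal ((16 * \<bar>C0\<bar>) * (L\<^sup>2 * B)\<^sup>2)" using L0 by (simp add: power_mult_distrib mult_ac flip: ennreal_mult power_mult)
      also have "\<dots> \<le> ennreal ((16 * \<bar>C0\<bar> + 1) * (L\<^sup>2 * B)\<^sup>2)" by (intro ennreal_leI mult_right_mono) auto
      also have "\<dots> = (ennreal (sqrt (16 * \<bar>C0\<bar> + 1) * L\<^sup>2 * B))\<^sup>2"
        using B by (simp add: ennreal_power power_mult_distrib mult.assoc)
      finally have sq: "(?T (?T (?T (M 3))) x)\<^sup>2 \<le> (ennreal (sqrt (16 * \<bar>C0\<bar> + 1) * L\<^sup>2 * B))\<^sup>2" .
      have nn: "0 \<le> sqrt (16 * \<bar>C0\<bar> + 1) * L\<^sup>2 * B" using B by simp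
      show ?thesis
      proof (cases "?T (?T (?T (M 3))) x")
        case (real r)
        then have "r\<^sup>2 \<le> (sqrt (16 * \<bar>C0\<bar> + 1) * L\<^sup>2 * B)\<^sup>2"
          using sq nn by (simp add: ennreal_power)
        then have "r \<le> sqrt (16 * \<bar>C0\<bar> + 1) * L\<^sup>2 * B" using nn by (rule power2_le_imp_le)
        then show ?thesis using real by (simp add: ennreal_leI)
      next
        case top
        then show ?thesis using sq nn by (simp add: ennreal_power power2_eq_square ennreal_mult_eq_top_iff top_unique ennreal_top_mult)
      qed
    qed
    show "AE x in lborel. norm (rep_L2 (u 0) x) \<le> C * L\<^sup>2 * B"
      using Mstep[of 0, simplified]
    proof eventually_elim
      case (elim x)
      have "ennreal (norm (rep_L2 (u 0) x)) = M 0 x" by (simp add: M_def f_def)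
      also have "\<dots> \<le> ennreal c * ?T (M 1) x" using elim by simp
      also have "\<dots> \<le> ennreal c * (2 * ennreal c * (3 * ennreal c * ennreal (sqrt (16 * \<bar>C0\<bar> + 1) * L\<^sup>2 * B)))"
        by (intro mult_left_mono order_trans[OF T1] order_trans[OF T2] T3) auto
      also have "\<dots> = ennreal (C * L\<^sup>2 * B)"
      proof -
        have "ennreal c * (2 * ennreal c * (3 * ennreal c * ennreal r)) = ennreal (6 * c ^ 3 * r)" if "r \<ge> 0" for r
        proof -
          have "ennreal (6 * c ^ 3 * r) = ennreal (c * (2 * (c * (3 * (c * r)))))" by (simp add: power3_eq_cube mult_ac)
          also have "\<dots> = ennreal c * (2 * (ennreal c * (3 * (ennreal c * ennreal r))))" using c that by (simp only: ennreal_mult ennreal_numeral zero_le_numeral mult_nonneg_nonneg less_imp_le)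
          finally show ?thesis by (simp only: mult.assoc)
        qed
        from this[of "sqrt (16 * \<bar>C0\<bar> + 1) * L\<^sup>2 * B"] B show ?thesis by (simp add: C_def mult.assoc)
      qed
      finally show ?case using C B L0 by (subst (asm) ennreal_le_iff) auto
    qed
  qed
qed

end

section \<open>Dyadic spectral shells\<close>

text \<open>From here on only the spectral resolution and the Bernstein inequality enter, no longer the form of the
  operator.\<close>

locale bernstein_resolution = selfadjoint_graph H + pvm E for H E +
  fixes C :: real
  assumes resolution: "spectral_resolution H E" and C_pos: "C > 0"
    and bernstein_H: "\<And>L B u. L \<ge> 1 \<Longrightarrow> B \<ge> 0 \<Longrightarrow> \<forall>i<3::nat. (u i, u (Suc i)) \<in> H \<Longrightarrow> \<forall>i<4. norm (u i) \<le> L ^ i * B \<Longrightarrow>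
      AE x in lborel. norm (rep_L2 (u 0) x) \<le> C * L\<^sup>2 * B"
begin

abbreviation window :: "nat \<Rightarrow> real set" where
  "window n \<equiv> {- real n..real n}"

text \<open>Bounded approximations of the identity function; the corresponding operators converge to \<open>H\<close> as forms on its
  domain.\<close>

definition trunc :: "nat \<Rightarrow> real \<Rightarrow> complex" where
  "trunc n r = indicator (window n) r * complex_of_real r"

lemma trunc_measurable [measurable]: "trunc n \<in> borel_measurable borel"
  unfolding trunc_def[abs_def] by measurable

lemma trunc_le: "norm (trunc n r) \<le> real n" "norm (trunc n r) \<le> \<bar>r\<bar>"
  by (auto simp: trunc_def indicator_def)

lemma Domain_iff: "u \<in> Domain H \<longleftrightarrow> (\<integral>\<^sup>+r. ennreal (r\<^sup>2) \<partial>M u) < \<infinity>"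
  using resolution unfolding spectral_resolution_def by auto

lemma window_in_Domain: "E (window n) u \<in> Domain H"
proof -
  have w: "window n \<in> sets borel" by simp
  have "(\<integral>\<^sup>+r. ennreal (r\<^sup>2) \<partial>M (E (window n) u)) = (\<integral>\<^sup>+r. indicator (window n) r * ennreal (r\<^sup>2) \<partial>M u)"
    unfolding sm_E[OF w] by (rule nn_integral_density) (simp_all add: measurable_cong_sets[OF sets_M refl])
  also have "\<dots> \<le> (\<integral>\<^sup>+r. ennreal ((real n)\<^sup>2) \<partial>M u)"
    by (intro nn_integral_mono) (auto simp: indicator_def abs_le_square_iff[symmetric] intro!: ennreal_leI)
  also have "\<dots> = ennreal ((real n)\<^sup>2) * emeasure (M u) UNIV" by simp
  also have "\<dots> < \<infinity>"
    using finite_measure.emeasure_finite[OF finite_M, of u UNIV] by (simp add: ennreal_mult_less_top less_top)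
  finally show ?thesis by (simp add: Domain_iff)
qed

text \<open>Elements of the domain have finite second moments, so that \<open>1 + r\<^sup>2\<close> dominates.\<close>

lemma form_limit:
  assumes uw: "(u, w) \<in> H" and T: "\<And>n. represents (trunc n) (T n)"
  shows "(\<lambda>n. cinner (T n u) u) \<longlonglongrightarrow> cinner w u"
proof -
  interpret finite_measure "M u" by (rule finite_M)
  have fin: "(\<integral>\<^sup>+r. ennreal (r\<^sup>2) \<partial>M u) < \<infinity>" using uw Domain_iff[of u] by auto
  have sq: "integrable (M u) (\<lambda>r. r\<^sup>2)"
    by (rule integrableI_bounded) (use fin in \<open>simp_all add: measurable_cong_sets[OF sets_M refl]\<close>)
  have bd: "integrable (M u) (\<lambda>r. 1 + r\<^sup>2)" using sq by (intro Bochner_Integration.integrable_add) simp_all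
  have le: "\<bar>r\<bar> \<le> 1 + r\<^sup>2" for r :: real
    using sum_squares_bound[of "\<bar>r\<bar>" 1] by (simp add: power2_eq_square)
  have "(\<lambda>n. integral\<^sup>L (M u) (trunc n)) \<longlonglongrightarrow> integral\<^sup>L (M u) (\<lambda>r. complex_of_real r)"
  proof (rule integral_dominated_convergence[OF _ _ bd])
    show "(\<lambda>r. complex_of_real r) \<in> borel_measurable (M u)" "trunc n \<in> borel_measurable (M u)" for n
      by (simp_all add: measurable_cong_sets[OF sets_M refl])
    show "AE r in M u. (\<lambda>n. trunc n r) \<longlonglongrightarrow> complex_of_real r"
    proof (intro always_eventually allI)
      fix r :: real
      obtain N where N: "\<bar>r\<bar> \<le> real N" using real_arch_simple by blast
      have "\<forall>\<^sub>F n in sequentially. trunc n r = complex_of_real r"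
        by (rule eventually_sequentiallyI[of N]) (use N in \<open>auto simp: trunc_def indicator_def\<close>)
      then show "(\<lambda>n. trunc n r) \<longlonglongrightarrow> complex_of_real r" by (rule tendsto_eventually)
    qed
    show "AE r in M u. norm (trunc n r) \<le> 1 + r\<^sup>2" for n
      by (intro always_eventually allI order_trans[OF trunc_le(2) le])
  qed
  moreover have "cinner w u = integral\<^sup>L (M u) (\<lambda>r. complex_of_real r)"
    using resolution uw unfolding spectral_resolution_def by (auto simp: integral_complex_of_real)
  ultimately show ?thesis by (simp add: representsD(3)[OF T])
qed

lemma polarized_limit:
  assumes uw: "(u, w) \<in> H" and vw: "(v, w') \<in> H" and T: "\<And>n. represents (trunc n) (T n)"
  shows "(\<lambda>n. cinner (T n u) v) \<longlonglongrightarrow> cinner w v"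
proof -
  note i = graph_scale[OF vw, of \<i>]
  have "(\<lambda>n. cinner (T n (u + v)) (u + v) - cinner (T n (u - v)) (u - v)
     + \<i> * cinner (T n (u + scaleC \<i> v)) (u + scaleC \<i> v)
     - \<i> * cinner (T n (u - scaleC \<i> v)) (u - scaleC \<i> v)) \<longlonglongrightarrow>
     cinner (w + w') (u + v) - cinner (w - w') (u - v)
     + \<i> * cinner (w + scaleC \<i> w') (u + scaleC \<i> v) - \<i> * cinner (w - scaleC \<i> w') (u - scaleC \<i> v)"
    by (intro tendsto_intros form_limit[OF _ T] graph_add graph_diff uw vw i)
  also have "cinner (w + w') (u + v) - cinner (w - w') (u - v)
     + \<i> * cinner (w + scaleC \<i> w') (u + scaleC \<i> v) - \<i> * cinner (w - scaleC \<i> w') (u - scaleC \<i> v) = 4 * cinner w v"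
    by (simp add: cinner_add_left cinner_add_right cinner_diff_left cinner_diff_right cinner_scaleC_left cinner_scaleC_right algebra_simps)
  finally have "(\<lambda>n. 4 * cinner (T n u) v) \<longlonglongrightarrow> 4 * cinner w v"
    by (simp add: polarization[OF representsD(2)[OF T]])
  from tendsto_mult_left[OF this, of "1/4"] show ?thesis by simp
qed

text \<open>The bracket, and not \<open>|r|\<close>, is used for the dyadic decomposition: it is at least \<open>1\<close>, so that indices start at \<open>0\<close>, and
  the weight of the theorem is a function of it.\<close>

definition shell :: "nat \<Rightarrow> real set" where
  "shell k = {r. 2 ^ k \<le> japanese_bracket r \<and> japanese_bracket r < 2 ^ Suc k}"

lemma bracket_measurable [measurable]: "(japanese_bracket :: real \<Rightarrow> real) \<in> borel_measurable borel"
  unfolding japanese_bracket_def[abs_def] by measurable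

lemma shell_borel [measurable]: "shell k \<in> sets borel"
  unfolding shell_def by measurable

lemma shell_subset: "shell k \<subseteq> window (2 ^ Suc k)"
proof
  fix r assume "r \<in> shell k"
  moreover have "\<bar>r\<bar> \<le> japanese_bracket r" unfolding japanese_bracket_def by (rule real_le_rsqrt) simp
  ultimately show "r \<in> window (2 ^ Suc k)" unfolding shell_def by auto
qed

lemma shell_disjoint: "disjoint_family shell"
proof -
  have "k \<le> l" if "r \<in> shell k" "r \<in> shell l" for k l r
  proof (rule ccontr)
    assume "\<not> k \<le> l"
    then have "(2::real) ^ Suc l \<le> 2 ^ k" by (intro power_increasing) auto
    then show False using that by (simp add: shell_def)
  qed
  then show ?thesis unfolding disjoint_family_on_def by (blast intro: antisym)
qed

lemma shell_cover: "(\<Union>k. shell k) = UNIV"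
proof -
  have "\<exists>k. r \<in> shell k" for r
  proof -
    let ?P = "\<lambda>n. japanese_bracket r < 2 ^ n"
    obtain n where n: "?P n" using real_arch_pow[of 2 "japanese_bracket r"] by auto
    have ge1: "japanese_bracket r \<ge> 1" by (simp add: japanese_bracket_def)
    have l: "?P (LEAST n. ?P n)" using n by (rule LeastI)
    then have "(LEAST n. ?P n) \<noteq> 0" using ge1 by (cases "LEAST n. ?P n") auto
    then obtain k where k: "(LEAST n. ?P n) = Suc k" using not0_implies_Suc by blast
    have "\<not> ?P k" by (rule not_less_Least) (simp add: k)
    then show ?thesis using l unfolding k by (auto simp: shell_def not_less)
  qed
  then show ?thesis by auto
qed

lemma shell_sums: "(\<lambda>k. E (shell k) u) sums u"
  using sums_E[OF _ shell_disjoint, of u] shell_borel by (simp add: shell_cover E_UNIV image_subset_iff)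

text \<open>On the range of the spectral projection of a bounded interval, \<open>H\<close> is the bounded operator
  obtained by integrating the truncated identity.\<close>

lemma window_action:
  assumes u: "E (window N) u = u"
  shows "\<exists>w. (u, w) \<in> H \<and> E (window N) w = w \<and> norm w \<le> 2 * real N * norm u"
proof -
  have "\<exists>T. represents (trunc n) T" for n
    by (rule represents_bounded) (simp, rule trunc_le(1))
  then obtain T where T: "\<And>n. represents (trunc n) (T n)" by metis
  have J: "window n \<in> sets borel" for n by simp
  obtain w where uw: "(u, w) \<in> H" using window_in_Domain[of N u] u by auto
  have eq: "T n u = T N u" if n: "n \<ge> N" for n
  proof -
    have "(\<lambda>r. indicator (window N) r * trunc n r) = (\<lambda>r. indicator (window N) r * trunc N r)"
      using n by (auto simp: trunc_def indicator_def fun_eq_iff)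
    then have "(\<lambda>u. E (window N) (T n (E (window N) u))) = (\<lambda>u. E (window N) (T N (E (window N) u)))"
      using represents_unique[OF _ represents_compress[OF T[of N] J[of N]]] represents_compress[OF T[of n] J[of N]] by simp
    then have "E (window N) (T n (E (window N) u)) = E (window N) (T N (E (window N) u))" by meson
    then show ?thesis
      using calculus_commute(1)[OF T[of n] J[of N], of u] calculus_commute(1)[OF T[of N] J[of N], of u] unfolding u by simp
  qed
  \<comment> \<open>on \<open>u\<close> the truncations stabilize at \<open>n = N\<close>, so that their limit form is that of \<open>T N\<close>\<close>
  have orth: "cinner (w - T N u) v = 0" if v: "v \<in> Domain H" for v
  proof -
    obtain w' where "(v, w') \<in> H" using v by auto
    then have "(\<lambda>n. cinner (T n u) v) \<longlonglongrightarrow> cinner w v" by (rule polarized_limit[OF uw _ T])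
    moreover have "(\<lambda>n. cinner (T n u) v) \<longlonglongrightarrow> cinner (T N u) v"
      by (rule tendsto_eventually, rule eventually_sequentiallyI[of N]) (rule arg_cong[where f="\<lambda>x. cinner x v"], rule eq)
    ultimately have "cinner w v = cinner (T N u) v" by (rule LIMSEQ_unique)
    then show ?thesis by (simp add: cinner_diff_left)
  qed
  let ?z = "w - T N u"
  \<comment> \<open>the ranges of the projections of bounded intervals lie in the domain\<close>
  have z: "E (window n) ?z = 0" for n
  proof -
    have "cinner (E (window n) ?z) ?z = cinner ?z (E (window n) ?z)" by (rule selfadj_E) simp
    also have "\<dots> = 0" by (rule orth[OF window_in_Domain])
    finally show ?thesis using cinner_E_self[OF J[of n], of ?z] by simp
  qed
  have "E (shell k) ?z = 0" for k
  proof -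
    have "E (shell k) ?z = E (shell k) (E (window (2 ^ Suc k)) ?z)"
      using shell_subset[of k] by (simp only: E_Int[OF shell_borel J] Int_absorb2)
    then show ?thesis by (simp only: z bounded_clinearD(4)[OF clinear_E[OF shell_borel]])
  qed
  then have "?z = 0" using shell_sums[of ?z] sums_unique2[of "\<lambda>k. 0::L2" ?z 0] by simp
  then have w: "w = T N u" by simp
  have "E (window N) w = w" unfolding w using calculus_commute(1)[OF T J[of N], of N u] u by simp
  moreover have "norm w \<le> 2 * real N * norm u"
    unfolding w using calculus_norm_le[OF T J[of N] trunc_le(1), of N u] u by simp
  ultimately show ?thesis using uw by blast
qed

lemma window_bernstein:
  assumes u: "E (window N) u = u" and N: "N \<ge> 1"
  shows "AE x in lborel. norm (rep_L2 u x) \<le> C * (2 * real N)\<^sup>2 * norm u"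
proof -
  obtain S where S: "\<And>u. E (window N) u = u \<Longrightarrow> (u, S u) \<in> H \<and> E (window N) (S u) = S u \<and> norm (S u) \<le> 2 * real N * norm u"
    using window_action by metis
  \<comment> \<open>the orbit \<open>u, H u, H\<^sup>2 u, \<dots>\<close> stays in the range of the projection\<close>
  define f where "f i = (S ^^ i) u" for i
  have f: "E (window N) (f i) = f i \<and> norm (f i) \<le> (2 * real N) ^ i * norm u" for i
  proof (induction i)
    case 0 then show ?case using u by (simp add: f_def)
  next
    case (Suc i)
    have "norm (f (Suc i)) \<le> 2 * real N * norm (f i)" using S[of "f i"] Suc by (simp add: f_def)
    also have "\<dots> \<le> 2 * real N * ((2 * real N) ^ i * norm u)" using Suc by (intro mult_left_mono) auto
    finally show ?case using S[of "f i"] Suc by (simp add: f_def mult.assoc)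
  qed
  have "AE x in lborel. norm (rep_L2 (f 0) x) \<le> C * (2 * real N)\<^sup>2 * norm u"
  proof (rule bernstein_H)
    show "\<forall>i<3. (f i, f (Suc i)) \<in> H" using S f by (simp add: f_def)
  qed (use f N in auto)
  then show ?thesis by (simp add: f_def)
qed

lemma shell_bernstein:
  "AE x in lborel. norm (rep_L2 (E (shell k) u) x) \<le> 16 * C * 4 ^ k * norm (E (shell k) u)"
proof -
  have "E (window (2 ^ Suc k)) (E (shell k) u) = E (shell k) u"
    using shell_subset[of k] by (simp only: E_Int[OF _ shell_borel] Int_absorb1 borel_closed closed_atLeastAtMost)
  from window_bernstein[OF this] show ?thesis
    by (simp add: power_mult_distrib power_even_eq[symmetric] mult_ac power2_eq_square flip: power_mult_distrib)
qed

text \<open>The dual form of the Bernstein inequality: \<open>\<parallel>E u\<parallel>\<^sup>2 = \<langle>E u, u\<rangle>\<close> is at most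
  \<open>\<parallel>E u\<parallel>\<^sub>\<infinity> \<parallel>u\<parallel>\<^sub>1\<close>.\<close>

lemma shell_dual_bernstein:
  assumes u: "L1_norm u \<le> 1"
  shows "norm (E (shell k) u) \<le> 16 * C * 4 ^ k"
proof -
  let ?e = "E (shell k) u"
  let ?a = "16 * C * 4 ^ k * norm ?e"
  have a: "?a \<ge> 0" using C_pos by simp
  have "ennreal ((norm ?e)\<^sup>2) = ennreal (norm (cinner ?e u))"
    by (simp add: cinner_E_self norm_power)
  also have "\<dots> \<le> (\<integral>\<^sup>+x. ennreal (norm (hdot (rep_L2 ?e x) (rep_L2 u x))) \<partial>lborel)"
    unfolding cinner_rep by (intro integral_norm_bound_ennreal integrable_hdot) simp_all
  also have "\<dots> \<le> (\<integral>\<^sup>+x. ennreal ?a * ennreal (norm (rep_L2 u x)) \<partial>lborel)"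
  proof (rule nn_integral_mono_AE)
    show "AE x in lborel. ennreal (norm (hdot (rep_L2 ?e x) (rep_L2 u x))) \<le> ennreal ?a * ennreal (norm (rep_L2 u x))"
      using shell_bernstein[of k u]
    proof eventually_elim
      case (elim x)
      have "norm (hdot (rep_L2 ?e x) (rep_L2 u x)) \<le> norm (rep_L2 ?e x) * norm (rep_L2 u x)" by (rule norm_hdot_le_mult)
      also have "\<dots> \<le> ?a * norm (rep_L2 u x)" by (intro mult_right_mono elim) simp
      finally show ?case using a by (simp add: ennreal_leI flip: ennreal_mult)
    qed
  qed
  also have "\<dots> = ennreal ?a * L1_norm u" unfolding L1_norm_def by (rule nn_integral_cmult) simp
  also have "\<dots> \<le> ennreal ?a * 1" using u by (intro mult_left_mono) simp_all
  finally have "(norm ?e)\<^sup>2 \<le> ?a" using a by (simp add: ennreal_le_iff)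
  then have "norm ?e * norm ?e \<le> 16 * C * 4 ^ k * norm ?e" by (simp add: power2_eq_square)
  then show ?thesis using C_pos by (cases "norm ?e = 0") (auto simp: mult_le_cancel_right)
qed

text \<open>Summation over the dyadic shells: the two Bernstein inequalities lose \<open>4\<^sup>k\<close> each, the weight gains
  \<open>16\<^sup>-\<^sup>k\<close> times a summable factor.\<close>

lemma weighted_bound:
  assumes f: "represents f T" "\<And>r. norm (f r) \<le> 1"
    and P: "\<And>u. norm (P u) \<le> norm u" "\<And>A u. A \<in> sets borel \<Longrightarrow> E A (P u) = P (E A u)"
    and W: "represents (\<lambda>r. complex_of_real (japanese_bracket r powr (- 4 - \<epsilon>))) W" and \<epsilon>: "\<epsilon> > 0"
    and u: "L1_norm u \<le> 1"
  shows "AE x in lborel. ennreal (norm (rep_L2 (T (P (W u))) x)) \<le> ennreal (4 * (16 * C)\<^sup>2 / (1 - 2 powr (- \<epsilon>)))"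
proof -
  define q where "q = 2 powr (- \<epsilon>)"
  have q: "0 < q" "q < 1" using \<epsilon> powr_less_mono[of "-\<epsilon>" 0 2] by (simp_all add: q_def)
  let ?v = "T (P (W u))"
  have nk: "norm (E (shell k) ?v) \<le> 4 * (16 * C) * 4 ^ k * ((2 ^ k) powr (- 4 - \<epsilon>))" for k
  proof -
    have com: "E (shell k) ?v = T (P (W (E (shell k) u)))"
      by (simp only: calculus_commute(2)[OF f(1) shell_borel] calculus_commute(2)[OF W shell_borel] P(2)[OF shell_borel])
    have "norm (E (shell k) ?v) \<le> 2 * 1 * norm (P (W (E (shell k) u)))"
      unfolding com by (rule represents_norm_le[OF f(1)]) (simp_all add: f(2))
    also have "\<dots> \<le> 2 * 1 * norm (W (E (shell k) u))" using P(1) by simp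
    also have "norm (W (E (shell k) u)) \<le> 2 * (2 ^ k) powr (- 4 - \<epsilon>) * norm (E (shell k) u)"
    proof (rule calculus_norm_le[OF W shell_borel])
      fix r assume "r \<in> shell k"
      then show "norm (complex_of_real (japanese_bracket r powr (- 4 - \<epsilon>))) \<le> (2 ^ k) powr (- 4 - \<epsilon>)"
        using \<epsilon> by (auto simp: shell_def intro!: powr_mono2')
    qed simp
    also have "\<dots> \<le> 2 * (2 ^ k) powr (- 4 - \<epsilon>) * (16 * C * 4 ^ k)"
      by (intro mult_left_mono shell_dual_bernstein u) simp
    finally show ?thesis by (simp add: mult_ac)
  qed
  have bk: "AE x in lborel. norm (rep_L2 (E (shell k) ?v) x) \<le> 4 * (16 * C)\<^sup>2 * q ^ k" for k
    using shell_bernstein[of k ?v]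
  proof eventually_elim
    case (elim x)
    have pw: "(2 ^ k) powr (- 4 - \<epsilon>) = q ^ k / 16 ^ k" for k :: nat
    proof -
      have "((2::real) ^ k) powr (- 4 - \<epsilon>) = (2 powr (- 4 - \<epsilon>)) ^ k"
        by (simp add: powr_powr powr_realpow[symmetric] mult.commute)
      also have "2 powr (- 4 - \<epsilon>) = q / 16" by (simp add: q_def powr_diff powr_minus field_simps)
      finally show ?thesis by (simp add: power_divide)
    qed
    have "norm (rep_L2 (E (shell k) ?v) x) \<le> 16 * C * 4 ^ k * (4 * (16 * C) * 4 ^ k * ((2 ^ k) powr (- 4 - \<epsilon>)))"
      using C_pos by (intro order_trans[OF elim] mult_left_mono nk) simp
    also have "\<dots> = 4 * (16 * C)\<^sup>2 * ((4 ^ k * 4 ^ k) * (q ^ k / 16 ^ k))" unfolding pw by (simp add: power2_eq_square mult_ac)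
    also have "(4::real) ^ k * 4 ^ k = 16 ^ k" by (simp flip: power_mult_distrib)
    finally show ?case by simp
  qed
  \<comment> \<open>the expansion converges in \<open>L\<^sup>2\<close>, and the uniform bound on its partial sums survives\<close>
  have lim: "(\<lambda>n. \<Sum>k<n. E (shell k) ?v) \<longlonglongrightarrow> ?v" using shell_sums[of ?v] by (simp add: sums_def)
  have "AE x in lborel. ennreal (norm (rep_L2 ?v x)) \<le> (\<lambda>x. ennreal (4 * (16 * C)\<^sup>2 / (1 - q))) x"
  proof (rule AE_bound_limit[OF lim])
    fix n
    have "AE x in lborel. \<forall>k\<in>{..<n}. norm (rep_L2 (E (shell k) ?v) x) \<le> 4 * (16 * C)\<^sup>2 * q ^ k"
      by (rule AE_finite_allI) (use bk in auto)
    then show "AE x in lborel. ennreal (norm (rep_L2 (\<Sum>k<n. E (shell k) ?v) x)) \<le> ennreal (4 * (16 * C)\<^sup>2 / (1 - q))"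
      using rep_sum_AE[of "{..<n}" "\<lambda>k. E (shell k) ?v", OF finite_lessThan]
    proof eventually_elim
      case (elim x)
      have "norm (rep_L2 (\<Sum>k<n. E (shell k) ?v) x) \<le> (\<Sum>k<n. 4 * (16 * C)\<^sup>2 * q ^ k)"
        unfolding elim(2) by (intro sum_norm_le) (use elim(1) in blast)
      also have "\<dots> = 4 * (16 * C)\<^sup>2 * (\<Sum>k<n. q ^ k)" by (simp add: sum_distrib_left)
      also have "\<dots> \<le> 4 * (16 * C)\<^sup>2 * (1 / (1 - q))"
      proof (rule mult_left_mono)
        have "(\<Sum>k<n. q ^ k) \<le> (\<Sum>k. q ^ k)" using q by (intro sum_le_suminf summable_geometric) auto
        then show "(\<Sum>k<n. q ^ k) \<le> 1 / (1 - q)" using q by (simp add: suminf_geometric)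
      qed simp
      finally show ?case by (simp add: ennreal_leI)
    qed
  qed simp
  then show ?thesis by (simp add: q_def)
qed

lemma functional_calculus_eq:
  assumes "E = spectral_family H" "represents g T"
  shows "functional_calculus g H = T"
  unfolding functional_calculus_def
proof (rule the_equality)
  show "bounded_clinear T \<and> (\<forall>u. cinner (T u) u = integral\<^sup>L (spectral_measure_at H u) g)"
    using representsD[OF assms(2)] assms(1) by auto
  fix T' assume "bounded_clinear T' \<and> (\<forall>u. cinner (T' u) u = integral\<^sup>L (spectral_measure_at H u) g)"
  then show "T' = T" using representsD[OF assms(2)] assms(1) by (intro operator_eq_of_form_eq) auto
qed

end

theorem theorem1p3:
  fixes m \<delta> \<epsilon> :: real and V :: "real^4 \<Rightarrow> complex^4^4"
  assumes "m > 0"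
    and "\<And>x. adjoint_matrix (V x) = V x"
    and "\<And>i j. continuous_on UNIV (\<lambda>x. V x $ i $ j)"
    and "\<delta> > 5/2"
    and "\<exists>C. \<forall>x i j. norm (V x $ i $ j) \<le> C * japanese_bracket x powr (- \<delta>)"
    and "regular_threshold m V 1"
    and "regular_threshold m V (- 1)"
    and "\<epsilon> > 0"
  shows "\<exists>C::real. \<forall>t::real.
    L1_Linf_opnorm
      (functional_calculus (\<lambda>r. exp (- \<i> * complex_of_real t * complex_of_real r)) (perturbed_dirac m V)
       \<circ> P_ac (perturbed_dirac m V)
       \<circ> functional_calculus (\<lambda>r. complex_of_real (japanese_bracket r powr (- 4 - \<epsilon>))) (perturbed_dirac m V))
    \<le> ennreal C"
proof -
  obtain c where c: "\<And>x i j. norm (V x $ i $ j) \<le> c * japanese_bracket x powr (- \<delta>)" using assms(5) by blast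
  have bound: "norm (V x $ i $ j) \<le> \<bar>c\<bar>" for x i j
  proof -
    have b1: "1 \<le> japanese_bracket x" by (simp add: japanese_bracket_def)
    have "japanese_bracket x powr (- \<delta>) \<le> japanese_bracket x powr 0" using b1 assms(4) by (intro powr_mono) auto
    then have le1: "japanese_bracket x powr (- \<delta>) \<le> 1" using b1 by simp
    have "c * japanese_bracket x powr (- \<delta>) \<le> \<bar>c\<bar> * 1" using le1 by (intro mult_mono) auto
    then show ?thesis using c[of x i j] by simp
  qed
  have meas: "(\<lambda>x. V x $ i $ j) \<in> borel_measurable borel" for i j
    by (rule borel_measurable_continuous_onI[OF assms(3)])
  interpret dirac_potential m V "\<bar>c\<bar>"
    by unfold_locales (simp_all add: bmat_def meas bound assms(2))
  let ?E = "spectral_family H"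
  have res: "spectral_resolution H ?E" unfolding spectral_family_def by (rule someI_ex[OF spectral_resolution_exists])
  obtain C where C: "C > 0" and bern: "\<forall>L\<ge>1. \<forall>B\<ge>0. \<forall>u. (\<forall>i<3. (u i, u (Suc i)) \<in> H) \<longrightarrow> (\<forall>i<4. norm (u i) \<le> L ^ i * B) \<longrightarrow>
    (AE x in lborel. norm (rep_L2 (u 0) x) \<le> C * L\<^sup>2 * B)"
    using bernstein by blast
  interpret R: bernstein_resolution H ?E C
    by unfold_locales (use res bern C in \<open>auto simp: spectral_resolution_def\<close>)
  have "\<exists>W. R.represents (\<lambda>r. complex_of_real (japanese_bracket r powr (- 4 - \<epsilon>))) W"
  proof (rule R.represents_bounded)
    show "norm (complex_of_real (japanese_bracket r powr (- 4 - \<epsilon>))) \<le> 1" for r :: real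
    proof -
      have "1 \<le> japanese_bracket r" by (simp add: japanese_bracket_def)
      then show ?thesis using powr_mono[of "- 4 - \<epsilon>" 0 "japanese_bracket r"] assms(8) by auto
    qed
  qed measurable
  then obtain W where W: "R.represents (\<lambda>r. complex_of_real (japanese_bracket r powr (- 4 - \<epsilon>))) W" ..
  show ?thesis
  proof (intro exI allI)
    fix t :: real
    let ?f = "\<lambda>r. exp (- \<i> * complex_of_real t * complex_of_real r)"
    have f1: "norm (?f r) \<le> 1" for r by (simp add: norm_exp_eq_Re)
    have "\<exists>T. R.represents ?f T"
      by (rule R.represents_bounded[OF _ f1]) (intro borel_measurable_continuous_onI continuous_intros)
    then obtain T where T: "R.represents ?f T" ..
    have Pac: "P_ac H = (THE P. \<forall>u. P u \<in> R.ac \<and> (\<forall>w\<in>R.ac. cinner (u - P u) w = 0))"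
      by (simp add: P_ac_def ac_subspace_def R.ac_def)
    have P: "norm (P_ac H u) \<le> norm u" "A \<in> sets borel \<Longrightarrow> ?E A (P_ac H u) = P_ac H (?E A u)" for u A
      unfolding Pac by (rule R.ac_projection, assumption?)+
    have "Linf_norm (T (P_ac H (W u))) \<le> ennreal (4 * (16 * C)\<^sup>2 / (1 - 2 powr (- \<epsilon>)))" if "L1_norm u \<le> 1" for u
      unfolding Linf_norm_def
      by (rule esssup_I) (simp, rule R.weighted_bound[OF T f1 P W assms(8) that])
    then show "L1_Linf_opnorm (functional_calculus ?f H \<circ> P_ac H \<circ>
        functional_calculus (\<lambda>r. complex_of_real (japanese_bracket r powr (- 4 - \<epsilon>))) H)
      \<le> ennreal (4 * (16 * C)\<^sup>2 / (1 - 2 powr (- \<epsilon>)))"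
      unfolding L1_Linf_opnorm_def R.functional_calculus_eq[OF refl T] R.functional_calculus_eq[OF refl W]
      by (intro SUP_least) simp
  qed
qed

end
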